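(* Let $Q_1=\sum_{\varepsilon\in\mathbb F_2^3}x_\varepsilon^4\in W'$, let $H(F_1)=\chi_{18}\big/\prod_{m''\in\mathbb F_2^3}\theta\left[\begin{smallmatrix}0\\ m''\end{smallmatrix}\right]\in W$, and set $R=H(F_1)\,Q_1$ (that is, $R(\tau,z)=H(F_1)(\tau)\,Q_1(\tau,z)$, regarded as the element $H(F_1)\otimes Q_1$ of $W\otimes W'$). Then, up to a nonzero constant factor, the Coble quartic is equal to $$\sum_{\gamma\in \Gamma_{3,0}(2)\backslash \mathrm{Sp}(6,\mathbb Z)}\gamma(R(\tau,z))=\sum_{\gamma\in \Gamma_{3,0}(2)\backslash \mathrm{Sp}(6,\mathbb Z)}\det(C\tau+D)^{-16}\,e^{-8\pi i\, z^t(C\tau+D)^{-1}Cz}\,R\big(\gamma\tau,(C\tau+D)^{-t}z\big),\qquad \gamma=\begin{pmatrix}A&B\\ C&D\end{pmatrix},$$ where the sum is understood as an element of $W\otimes W'$, i.e. as a quartic polynomial in the coordinates $x_\varepsilon$ with coefficients in $W$.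
   Context: $\mathbb H_3$ is the Siegel upper half-space of complex symmetric $3\times3$ matrices $\tau$ with positive definite imaginary part; $\gamma=\begin{pmatrix}A&B\\ C&D\end{pmatrix}\in\mathrm{Sp}(6,\mathbb Z)$ acts by $\gamma\tau=(A\tau+B)(C\tau+D)^{-1}$. $\Gamma_3(2)$ is the kernel of $\mathrm{Sp}(6,\mathbb Z)\to\mathrm{Sp}(6,\mathbb F_2)$, and $\Gamma_{3,0}(2)=\{\gamma\in\mathrm{Sp}(6,\mathbb Z): C\equiv0 \bmod 2\}$, a subgroup of index 135. $(C\tau+D)^{-t}$ is the inverse transpose. Theta functions: for $m=\left[\begin{smallmatrix}m'\\ m''\end{smallmatrix}\right]$, $m',m''\in\mathbb F_2^3$ (entries taken in $\{0,1\}$), and $z\in\mathbb C^3$, $$\theta_m(\tau,z)=\theta\left[\begin{smallmatrix}m'\\ m''\end{smallmatrix}\right](\tau,z)=\sum_{p\in\mathbb Z^3}\exp\pi i\Big[\big(p+\tfrac{m'}2\big)^t\big(\tau(p+\tfrac{m'}2)+2(z+\tfrac{m''}2)\big)\Big],$$ and $\theta_m=\theta_m(\tau,0)$ is the theta constant. The characteristic $m$ is even if $m'\cdot m''$ is even; there are 36 even ones. $\chi_{18}=\prod_{m\text{ even}}\theta_m(\tau,0)$. Second order theta functions: $x_\varepsilon=\Theta[\varepsilon](\tau,z)=\theta\left[\begin{smallmatrix}\varepsilon\\ 0\end{smallmatrix}\right](2\tau,2z)$, $\varepsilon\in\mathbb F_2^3$; these are also the coordinates on the $\mathbb P^7$ that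 is the target of the Kummer map $z\mapsto[\Theta[\varepsilon](\tau,z)]_\varepsilon$ of the abelian variety $X_\tau=\mathbb C^3/(\mathbb Z^3+\tau\mathbb Z^3)$. $W$: A Fano configuration is a Lagrangian subspace $F$ of $\mathbb F_2^6$ (for the form $m'\cdot n''-m''\cdot n'$) all of whose 8 elements are even characteristics (there are 30 of them). For such $F$ put $H(F)=\chi_{18}/\prod_{n\in F}\theta_n$, a modular form of weight 14 for $\Gamma_3(2)$. $W$ is the 15-dimensional $\mathbb C$-vector space spanned by all $H(F)$, on which $\mathrm{Sp}(6,\mathbb F_2)=\mathrm{Sp}(6,\mathbb Z)/\Gamma_3(2)$ acts by $(\gamma h)(\tau)=\det(C\tau+D)^{-14}h(\gamma\tau)$. $W'$: the 15-dimensional $\mathbb C$-vector space of quartics in the $x_\varepsilon$ spanned by $$Q_{000}=Q_1=\sum_\varepsilon x_\varepsilon^4,\qquad Q_\alpha=\tfrac12\sum_\varepsilon x_\varepsilon^2x_{\varepsilon+\alpha}^2,\qquad Q'_\alpha=\tfrac14\sum_\varepsilon\prod_{\mu\in\alpha^\perp}x_{\varepsilon+\mu}\qquad(\alpha\in\mathbb F_2^3\setminus\{0\}),$$ where $\varepsilon$ runs over $\mathbb F_2^3$ and $\alpha^\perp$ is the two-dimensional subspace orthogonal to $\alpha$ for the standard scalar product. These are $\mathbb C$-linearly independent, both as polynomials in the $x_\varepsilon$ and as functions of $(\tau,z)$, and $\mathrm{Sp}(6,\mathbb F_2)$ acts on $W'$ by $(\gamma q)(\tau,z)=\det(C\tau+D)^{-2}e^{-8\pi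 i z^t(C\tau+D)^{-1}Cz}q(\gamma\tau,(C\tau+D)^{-t}z)$. The action on $W\otimes W'$ is the tensor product action. The Coble quartic is the nonzero element of $W\otimes W'$, unique up to a constant factor, that is invariant under $\mathrm{Sp}(6,\mathbb F_2)$; viewed as a quartic polynomial in the $x_\varepsilon$ depending on $\tau$, its eight partial derivatives with respect to the $x_\varepsilon$ are the eight cubics defining the Kummer threefold $X_\tau/\pm1\subset\mathbb P^7$ when $X_\tau$ is the Jacobian of a non-hyperelliptic genus 3 curve. *)

theory Defs
  imports "HOL-Analysis.Analysis" "HOL-Library.Z2" "HOL-Library.Function_Algebras"
begin

instance bit :: finite
proof
  have "(UNIV :: bit set) \<subseteq> {0, 1}"
    by (auto intro: bit.exhaust)
  then show "finite (UNIV :: bit set)"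
    by (rule finite_subset) simp
qed


section \<open>The symplectic group and the Siegel upper half-space\<close>

text \<open>
  Matrices of size 6 and characteristics in \<open>F\<^sub>2\<^sup>6\<close> are indexed by the sum type
  \<open>3 + 3\<close>, so that \<^term>\<open>Inl\<close> and \<^term>\<open>Inr\<close> select the two halves.
\<close>

definition blockA :: "'a^(3 + 3)^(3 + 3) \<Rightarrow> 'a^3^3"
  where "blockA \<gamma> = (\<chi> i j. \<gamma> $ Inl i $ Inl j)"

definition blockB :: "'a^(3 + 3)^(3 + 3) \<Rightarrow> 'a^3^3"
  where "blockB \<gamma> = (\<chi> i j. \<gamma> $ Inl i $ Inr j)"

definition blockC :: "'a^(3 + 3)^(3 + 3) \<Rightarrow> 'a^3^3"
  where "blockC \<gamma> = (\<chi> i j. \<gamma> $ Inr i $ Inl j)"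

definition blockD :: "'a^(3 + 3)^(3 + 3) \<Rightarrow> 'a^3^3"
  where "blockD \<gamma> = (\<chi> i j. \<gamma> $ Inr i $ Inr j)"

definition sympJ :: "int^(3 + 3)^(3 + 3)"
  where "sympJ = (\<chi> k l. case (k, l) of
           (Inl i, Inr j) \<Rightarrow> of_bool (i = j)
         | (Inr i, Inl j) \<Rightarrow> - of_bool (i = j)
         | _ \<Rightarrow> 0)"

definition Sp6 :: "(int^(3 + 3)^(3 + 3)) set"
  where "Sp6 = {\<gamma>. transpose \<gamma> ** sympJ ** \<gamma> = sympJ}"

definition Gamma30_2 :: "(int^(3 + 3)^(3 + 3)) set"
  where "Gamma30_2 = {\<gamma> \<in> Sp6. \<forall>i j. even (blockC \<gamma> $ i $ j)}"

text \<open>\<open>T\<close> is a complete set of representatives for the cosets \<open>G \<gamma>\<close>, \<open>\<gamma> \<in> K\<close>.\<close>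

definition right_transversal ::
  "(int^(3 + 3)^(3 + 3)) set \<Rightarrow> (int^(3 + 3)^(3 + 3)) set \<Rightarrow> (int^(3 + 3)^(3 + 3)) set \<Rightarrow> bool"
  where "right_transversal G K T \<longleftrightarrow>
    T \<subseteq> K \<and> (\<forall>\<gamma>\<in>K. \<exists>!t. t \<in> T \<and> (\<exists>\<delta>\<in>G. \<gamma> = \<delta> ** t))"

definition siegel3 :: "(complex^3^3) set"
  where "siegel3 = {\<tau>. transpose \<tau> = \<tau> \<and>
           (\<forall>v::real^3. v \<noteq> 0 \<longrightarrow> 0 < v \<bullet> (map_matrix Im \<tau> *v v))}"

definition cocycle :: "int^(3 + 3)^(3 + 3) \<Rightarrow> complex^3^3 \<Rightarrow> complex^3^3"
  where "cocycle \<gamma> \<tau> = map_matrix of_int (blockC \<gamma>) ** \<tau> + map_matrix of_int (blockD \<gamma>)"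

definition siegel_act :: "int^(3 + 3)^(3 + 3) \<Rightarrow> complex^3^3 \<Rightarrow> complex^3^3"
  where "siegel_act \<gamma> \<tau> =
    (map_matrix of_int (blockA \<gamma>) ** \<tau> + map_matrix of_int (blockB \<gamma>)) ** matrix_inv (cocycle \<gamma> \<tau>)"

definition transform_z :: "int^(3 + 3)^(3 + 3) \<Rightarrow> complex^3^3 \<Rightarrow> complex^3 \<Rightarrow> complex^3"
  where "transform_z \<gamma> \<tau> z = transpose (matrix_inv (cocycle \<gamma> \<tau>)) *v z"

definition theta_exp_factor :: "int^(3 + 3)^(3 + 3) \<Rightarrow> complex^3^3 \<Rightarrow> complex^3 \<Rightarrow> complex"
  where "theta_exp_factor \<gamma> \<tau> z =
    exp (- 8 * of_real pi * \<i> *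
      scalar_product z (matrix_inv (cocycle \<gamma> \<tau>) *v (map_matrix of_int (blockC \<gamma>) *v z)))"


section \<open>Theta functions\<close>

definition upper :: "'a^(3 + 3) \<Rightarrow> 'a^3"
  where "upper m = (\<chi> i. m $ Inl i)"

definition lower :: "'a^(3 + 3) \<Rightarrow> 'a^3"
  where "lower m = (\<chi> i. m $ Inr i)"

definition half_char :: "bit^3 \<Rightarrow> complex^3"
  where "half_char a = (\<chi> i. of_bit (a $ i) / 2)"

definition theta :: "bit^3 \<Rightarrow> bit^3 \<Rightarrow> complex^3^3 \<Rightarrow> complex^3 \<Rightarrow> complex"
  where "theta a b \<tau> z =
    (\<Sum>\<^sub>\<infinity>p\<in>(UNIV :: (int^3) set).
       let q = (\<chi> i. of_int (p $ i)) + half_char a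
       in exp (of_real pi * \<i> * scalar_product q (\<tau> *v q + 2 *\<^sub>R (z + half_char b))))"

definition theta_const :: "bit^(3 + 3) \<Rightarrow> complex^3^3 \<Rightarrow> complex"
  where "theta_const m \<tau> = theta (upper m) (lower m) \<tau> 0"

definition even_char :: "bit^(3 + 3) \<Rightarrow> bool"
  where "even_char m \<longleftrightarrow> scalar_product (upper m) (lower m) = 0"

text \<open>The point \<open>(\<Theta>[\<epsilon>](\<tau>, z))\<^sub>\<epsilon>\<close> of \<open>C\<^sup>8\<close>, whose coordinates are indexed by \<open>F\<^sub>2\<^sup>3\<close>.\<close>

definition Theta2 :: "complex^3^3 \<Rightarrow> complex^3 \<Rightarrow> complex^(bit^3)"
  where "Theta2 \<tau> z = (\<chi> \<epsilon>. theta \<epsilon> 0 (2 *\<^sub>R \<tau>) (2 *\<^sub>R z))"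


section \<open>Complex vector spaces of functions\<close>

definition cscale :: "complex \<Rightarrow> ('a \<Rightarrow> complex) \<Rightarrow> 'a \<Rightarrow> complex"
  where "cscale c f = (\<lambda>x. c * f x)"

interpretation cfun: vector_space cscale
  by unfold_locales (auto simp: cscale_def fun_eq_iff algebra_simps)


section \<open>The space of modular forms of weight 14\<close>

definition fano :: "(bit^(3 + 3)) set \<Rightarrow> bool"
  where "fano F \<longleftrightarrow>
    vec.subspace F \<and> vec.dim F = 3 \<and>
    (\<forall>m\<in>F. \<forall>n\<in>F.
       scalar_product (upper m) (lower n) - scalar_product (lower m) (upper n) = 0) \<and>
    (\<forall>m\<in>F. even_char m)"

text \<open>
  The quotient of \<open>\<chi>\<^sub>1\<^sub>8\<close> by the product of the theta constants in \<open>F\<close> is the product of the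
  remaining even theta constants; a pointwise division would give the value 0 wherever a theta
  constant in \<open>F\<close> vanishes.  Functions on the Siegel space are represented by functions which
  vanish outside of it, so that equality of functions is equality on the Siegel space.
\<close>

definition formH :: "(bit^(3 + 3)) set \<Rightarrow> complex^3^3 \<Rightarrow> complex"
  where "formH F \<tau> = (if \<tau> \<in> siegel3 then \<Prod>m\<in>{m. even_char m} - F. theta_const m \<tau> else 0)"

definition spaceW :: "(complex^3^3 \<Rightarrow> complex) set"
  where "spaceW = cfun.span (formH ` {F. fano F})"


section \<open>The space of quartics\<close>

text \<open>Polynomials in the coordinates \<open>x\<^sub>\<epsilon>\<close> are represented by polynomial functions on \<open>C\<^sup>8\<close>.\<close>

definition Q_one :: "complex^(bit^3) \<Rightarrow> complex"
  where "Q_one x = (\<Sum>\<epsilon>\<in>UNIV. (x $ \<epsilon>) ^ 4)"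

definition Q_sq :: "bit^3 \<Rightarrow> complex^(bit^3) \<Rightarrow> complex"
  where "Q_sq \<alpha> x = 1 / 2 * (\<Sum>\<epsilon>\<in>UNIV. (x $ \<epsilon>)\<^sup>2 * (x $ (\<epsilon> + \<alpha>))\<^sup>2)"

definition Q_perp :: "bit^3 \<Rightarrow> complex^(bit^3) \<Rightarrow> complex"
  where "Q_perp \<alpha> x =
    1 / 4 * (\<Sum>\<epsilon>\<in>UNIV. \<Prod>\<mu>\<in>{\<mu>. scalar_product \<alpha> \<mu> = 0}. x $ (\<epsilon> + \<mu>))"

definition spaceW' :: "(complex^(bit^3) \<Rightarrow> complex) set"
  where "spaceW' = cfun.span ({Q_one} \<union> Q_sq ` {\<alpha>. \<alpha> \<noteq> 0} \<union> Q_perp ` {\<alpha>. \<alpha> \<noteq> 0})"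

text \<open>
  The action on quartics is given by a formula for functions of \<open>(\<tau>, z)\<close>; the resulting function
  is written as a quartic in the \<open>\<Theta>[\<epsilon>](\<tau>, z)\<close>, which is unique since the spanning quartics are
  linearly independent as functions of \<open>(\<tau>, z)\<close>.
\<close>

definition quartic_act ::
  "int^(3 + 3)^(3 + 3) \<Rightarrow> (complex^(bit^3) \<Rightarrow> complex) \<Rightarrow> complex^(bit^3) \<Rightarrow> complex"
  where "quartic_act \<gamma> q = (THE q'. q' \<in> spaceW' \<and>
    (\<forall>\<tau>\<in>siegel3. \<forall>z. q' (Theta2 \<tau> z) =
       det (cocycle \<gamma> \<tau>) powi (-2) * theta_exp_factor \<gamma> \<tau> z *
       q (Theta2 (siegel_act \<gamma> \<tau>) (transform_z \<gamma> \<tau> z))))"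


section \<open>The tensor product and the Coble quartic\<close>

text \<open>
  Elements of the tensor product are functions of \<open>(\<tau>, x)\<close>, that is, quartics in \<open>x\<close> whose
  coefficients are functions of \<open>\<tau>\<close>.  Here \<open>x\<close> is independent of \<open>\<tau>\<close>: the restriction to
  \<open>x = \<Theta>(\<tau>, z)\<close> is not injective on the tensor product, as the Coble quartic vanishes
  on the Kummer variety.
\<close>

definition tensor ::
  "(complex^3^3 \<Rightarrow> complex) \<Rightarrow> (complex^(bit^3) \<Rightarrow> complex) \<Rightarrow>
   (complex^3^3) \<times> (complex^(bit^3)) \<Rightarrow> complex"
  where "tensor h q = (\<lambda>(\<tau>, x). h \<tau> * q x)"

definition spaceWW' :: "((complex^3^3) \<times> (complex^(bit^3)) \<Rightarrow> complex) set"
  where "spaceWW' = cfun.span {tensor h q | h q. h \<in> spaceW \<and> q \<in> spaceW'}"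

text \<open>
  By linearity of \<^term>\<open>quartic_act \<gamma>\<close> on \<^term>\<open>spaceW'\<close>, this maps \<open>h \<otimes> q\<close> to
  \<open>(\<gamma> h) \<otimes> (\<gamma> q)\<close>, where \<open>\<gamma> h\<close> is \<open>\<tau> \<mapsto> det (C \<tau> + D)\<^sup>-\<^sup>1\<^sup>4 h(\<gamma> \<tau>)\<close>.
\<close>

definition tensor_act ::
  "int^(3 + 3)^(3 + 3) \<Rightarrow> ((complex^3^3) \<times> (complex^(bit^3)) \<Rightarrow> complex) \<Rightarrow>
   (complex^3^3) \<times> (complex^(bit^3)) \<Rightarrow> complex"
  where "tensor_act \<gamma> P = (\<lambda>(\<tau>, x).
    if \<tau> \<in> siegel3
    then det (cocycle \<gamma> \<tau>) powi (-14) * quartic_act \<gamma> (\<lambda>y. P (siegel_act \<gamma> \<tau>, y)) x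
    else 0)"

text \<open>
  Invariance under \<open>Sp(6, F\<^sub>2)\<close> is invariance under \<open>Sp(6, Z)\<close>, through which the action is defined.
\<close>

definition is_coble_quartic :: "((complex^3^3) \<times> (complex^(bit^3)) \<Rightarrow> complex) \<Rightarrow> bool"
  where "is_coble_quartic P \<longleftrightarrow>
    P \<in> spaceWW' \<and> P \<noteq> 0 \<and> (\<forall>\<gamma>\<in>Sp6. tensor_act \<gamma> P = P)"

definition fano1 :: "(bit^(3 + 3)) set"
  where "fano1 = {m. upper m = 0}"

definition coble_R :: "(complex^3^3) \<times> (complex^(bit^3)) \<Rightarrow> complex"
  where "coble_R = tensor (formH fano1) Q_one"

end

theory Submission
  imports Defs "HOL-Complex_Analysis.Conformal_Mappings" "HOL-Probability.Characteristic_Functions"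
begin

text \<open>
  Translations \<open>t\<^sub>S\<close>, unimodular substitutions and the inversions \<open>J\<^sub>j\<close> in a single coordinate generate
  \<open>Sp(6, Z)\<close>, and theta functions transform explicitly under them.  Write \<open>e = H(F\<^sub>1)\<close>.  Both \<open>e\<close> and
  \<open>Q\<^sub>1\<close> are invariant under generators of \<open>\<Gamma>\<^sub>3\<^sub>,\<^sub>0(2)\<close>, and both satisfy
  \<open>f = - (f|J\<^sub>j + f|J\<^sub>j t\<^sub>j\<^sub>j)\<close>, for \<open>e\<close> by Riemann's quartic relation.  Clearing the columns of \<open>C\<close> modulo 2
  one at a time writes \<open>\<gamma>\<close> as an element of \<open>\<Gamma>\<^sub>3\<^sub>,\<^sub>0(2)\<close> times a product of at most three blocks
  \<open>J\<^sub>j t\<^sub>S u\<close>.  Each block contributes a factor \<open>-1/2\<close>: up to translates \<open>h|t\<^sub>S - h\<close> one has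
  \<open>e|\<gamma> = \<lambda> e\<close>, and \<open>Q\<^sub>1|\<gamma>\<close> has the value \<open>\<lambda>\<close> at the unit vector \<open>x\<^sub>0\<close> of the zero characteristic, the
  limit of \<open>\<Theta>(i t, 0)\<close>.  Averaging the value of the coset sum at \<open>x\<^sub>0\<close> over translations therefore
  gives \<open>(\<Sum>\<lambda>\<^sup>2) e\<close>, which is not 0.  All \<open>H(F)\<close> lie on the orbit of \<open>e\<close> up to constants, so the value at
  \<open>x\<^sub>0\<close> of any invariant tensor is a multiple of \<open>e\<close>.  An invariant tensor whose value at \<open>x\<^sub>0\<close> vanishes
  also vanishes at the images of \<open>x\<^sub>0\<close> under the generators, and these separate the quartics in \<open>W'\<close>.
\<close>

text \<open>The action on quartics is specified only on theta vectors, and there the Coble quartic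
  vanishes, so identities in the tensor product cannot be tested at \<open>x = Theta2 tau z\<close>.
  The vector \<open>ind {0}\<close> avoids this obstacle: it does not depend on tau, it is fixed by
  translations and unimodular substitutions, and it is still a limit of theta vectors. Evaluating an
  invariant tensor there gives a translation invariant element of \<open>W\<close>, and averaging
  shows that such elements form the line spanned by \<open>e\<close>. This yields uniqueness with no
  character theory and no decomposition of \<open>W\<close> or \<open>W'\<close>. For existence only
  the coset sum being nonzero is at stake. The factor -1/2 of a block has the same source on both
  sides: modulo translates \<open>e|w|J_j\<close> and \<open>e|w|J_j t_jj\<close> agree and add up
  to \<open>-e|w\<close>, and the corresponding two values of quartics at the fixed vector agree as
  well. Each coset thus contributes the square of one real number, the trivial coset contributes 1,
  and nothing can cancel.\<close>

section \<open>Block calculus for integral symplectic matrices\<close>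

lemma UNIV_sum33: "(UNIV :: (3 + 3) set) = range Inl \<union> range Inr"
  by (metis UNIV_sum)

lemma sum_sum33:
  fixes f :: "3 + 3 \<Rightarrow> 'a::comm_monoid_add"
  shows "(\<Sum>k\<in>UNIV. f k) = (\<Sum>i\<in>UNIV. f (Inl i)) + (\<Sum>i\<in>UNIV. f (Inr i))"
proof -
  have "sum f UNIV = sum f (range Inl \<union> range Inr)" by (simp only: UNIV_sum33)
  also have "\<dots> = sum f (range Inl) + sum f (range Inr)" by (rule sum.union_disjoint) auto
  finally show ?thesis by (simp add: sum.reindex)
qed

definition mk :: "'a^3^3 \<Rightarrow> 'a^3^3 \<Rightarrow> 'a^3^3 \<Rightarrow> 'a^3^3 \<Rightarrow> 'a^(3 + 3)^(3 + 3)"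
  where "mk A B C D = (\<chi> k l. case k of
      Inl i \<Rightarrow> (case l of Inl j \<Rightarrow> A $ i $ j | Inr j \<Rightarrow> B $ i $ j)
    | Inr i \<Rightarrow> (case l of Inl j \<Rightarrow> C $ i $ j | Inr j \<Rightarrow> D $ i $ j))"

lemma block_mk [simp]:
  "blockA (mk A B C D) = A" "blockB (mk A B C D) = B"
  "blockC (mk A B C D) = C" "blockD (mk A B C D) = D"
  by (simp_all add: blockA_def blockB_def blockC_def blockD_def mk_def vec_eq_iff)

lemma all33: "(\<forall>k::3 + 3. P k) \<longleftrightarrow> (\<forall>i. P (Inl i)) \<and> (\<forall>i. P (Inr i))"
  by (metis old.sum.exhaust)

lemma mk_blocks: "mk (blockA \<gamma>) (blockB \<gamma>) (blockC \<gamma>) (blockD \<gamma>) = \<gamma>"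
  by (simp add: blockA_def blockB_def blockC_def blockD_def mk_def vec_eq_iff all33)

lemma mk_eq_iff: "mk A B C D = mk A' B' C' D' \<longleftrightarrow> A = A' \<and> B = B' \<and> C = C' \<and> D = D'"
  by (metis block_mk)

lemma mk_cases: obtains A B C D where "\<gamma> = mk A B C D"
  by (metis mk_blocks)

lemma mk_mult:
  "mk A B C D ** mk A' B' C' D' =
   mk (A ** A' + B ** C') (A ** B' + B ** D') (C ** A' + D ** C') (C ** B' + D ** D')"
  by (simp add: mk_def vec_eq_iff all33 matrix_matrix_mult_def sum_sum33)

lemma transpose_mk:
  "transpose (mk A B C D) = mk (transpose A) (transpose C) (transpose B) (transpose D)"
  by (simp add: mk_def vec_eq_iff all33 transpose_def)

lemma sympJ_mk: "sympJ = mk 0 (mat 1) (- mat 1) 0"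
  by (simp add: mk_def sympJ_def vec_eq_iff all33 mat_def)

lemma mat_mk: "mat 1 = mk (mat 1) 0 0 (mat 1)"
  by (simp add: mk_def vec_eq_iff all33 mat_def)

lemma matrix_mul_minus_left: "(- A) ** B = - (A ** (B :: 'a::ring_1^'n^'m))"
  by (simp add: matrix_matrix_mult_def vec_eq_iff sum_negf)

lemma matrix_mul_minus_right: "A ** (- B) = - (A ** (B :: 'a::ring_1^'n^'m))"
  by (simp add: matrix_matrix_mult_def vec_eq_iff sum_negf)

lemma matrix_add_rdistrib': "(A + B) ** C = A ** C + B ** (C :: 'a::semiring_1^'n^'m)"
  by (simp add: matrix_matrix_mult_def vec_eq_iff sum.distrib distrib_right)

lemma matrix_diff_ldistrib: "A ** (B - C) = A ** B - A ** (C :: 'a::ring_1^'n^'m)"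
  using matrix_add_ldistrib[of A B "-C"] by (simp add: matrix_mul_minus_right)

lemma matrix_diff_rdistrib: "(A - B) ** C = A ** C - B ** (C :: 'a::ring_1^'n^'m)"
  using matrix_add_rdistrib'[of A "-B" C] by (simp add: matrix_mul_minus_left)

lemma matrix_mul_zero [simp]: "0 ** A = 0" "A ** 0 = (0 :: 'a::semiring_1^'n^'m)"
  by (simp_all add: matrix_matrix_mult_def vec_eq_iff)

lemmas mat_distribs = matrix_mul_minus_left matrix_mul_minus_right matrix_add_rdistrib'
  matrix_add_ldistrib matrix_diff_ldistrib matrix_diff_rdistrib

lemma transpose_add: "transpose (A + B) = transpose A + transpose B"
  and transpose_minus: "transpose (- C) = - transpose (C :: 'b::ab_group_add^'n^'m)"
  and transpose_zero [simp]: "transpose 0 = (0 :: 'c::zero^'n^'m)"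
  by (simp_all add: transpose_def vec_eq_iff)

lemma Sp6_mk:
  "mk A B C D \<in> Sp6 \<longleftrightarrow>
    transpose A ** C = transpose C ** A \<and> transpose B ** D = transpose D ** B \<and>
    transpose A ** D - transpose C ** B = mat 1"
  (is "_ \<longleftrightarrow> ?R")
proof -
  have *: "transpose D ** A - transpose B ** C = transpose (transpose A ** D - transpose C ** B)"
    by (simp add: matrix_transpose_mul transpose_def vec_eq_iff flip: matrix_transpose_mul)
       (simp add: matrix_matrix_mult_def mult.commute)
  have "mk A B C D \<in> Sp6 \<longleftrightarrow>
     - (transpose C ** A) + transpose A ** C = 0 \<and>
     - (transpose C ** B) + transpose A ** D = mat 1 \<and>
     - (transpose D ** A) + transpose B ** C = - mat 1 \<and>
     - (transpose D ** B) + transpose B ** D = 0"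
    by (simp add: Sp6_def transpose_mk sympJ_mk mk_mult mat_distribs mk_eq_iff)
  also have "- (transpose D ** A) + transpose B ** C = - mat 1 \<longleftrightarrow>
      transpose D ** A - transpose B ** C = mat 1"
  proof -
    have "- x + y = - (x - y)" for x y :: "int^3^3" by simp
    then show ?thesis by (simp only: neg_equal_iff_equal)
  qed
  finally show ?thesis
    unfolding *
  proof -
    assume L: "(mk A B C D \<in> Sp6) = (- (transpose C ** A) + transpose A ** C = 0 \<and>
       - (transpose C ** B) + transpose A ** D = mat 1 \<and>
       transpose (transpose A ** D - transpose C ** B) = mat 1 \<and>
       - (transpose D ** B) + transpose B ** D = 0)"
    have m1: "transpose M = mat 1 \<longleftrightarrow> M = mat 1" for M :: "int^3^3"
      by (metis transpose_mat transpose_transpose)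
    have m2: "- x + y = 0 \<longleftrightarrow> y = x" and m3: "- x + y = mat 1 \<longleftrightarrow> y - x = mat 1" for x y :: "int^3^3"
      by simp_all
    show ?thesis
      unfolding L m1 m2 m3 by (rule iffI; elim conjE; intro conjI; assumption)
  qed
qed

lemma of_int_matrix_mult:
  "map_matrix (of_int :: int \<Rightarrow> 'a::ring_1) (A ** B) = map_matrix of_int A ** map_matrix of_int B"
  by (simp add: vec_eq_iff matrix_matrix_mult_def)

lemma of_int_matrix_add:
  "map_matrix (of_int :: int \<Rightarrow> 'a::ring_1) (A + B) = map_matrix of_int A + map_matrix of_int B"
  by (simp add: vec_eq_iff)

lemma of_int_matrix_mat [simp]: "map_matrix (of_int :: int \<Rightarrow> 'a::ring_1) (mat 1) = mat 1"
  by (simp add: vec_eq_iff mat_def)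

lemma of_int_matrix_zero [simp]: "map_matrix (of_int :: int \<Rightarrow> 'a::ring_1) 0 = 0"
  by (simp add: vec_eq_iff)

lemma map_matrix_transpose: "map_matrix f (transpose A) = transpose (map_matrix f A)"
  by (simp add: vec_eq_iff transpose_def)

lemma int_matrix_left_right_inverse:
  fixes A B :: "int^'n^'n"
  assumes "A ** B = mat 1" shows "B ** A = mat 1"
proof -
  have "map_matrix real_of_int A ** map_matrix real_of_int B = mat 1"
    using assms by (metis of_int_matrix_mult of_int_matrix_mat)
  then have "map_matrix real_of_int B ** map_matrix real_of_int A = mat 1"
    by (simp add: matrix_left_right_inverse)
  then have "map_matrix real_of_int (B ** A) = map_matrix real_of_int (mat 1)"
    by (simp add: of_int_matrix_mult)
  then have "real_of_int ((B ** A) $ i $ j) = real_of_int (mat 1 $ i $ j)" for i j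
    by (metis nth_map_matrix)
  then show ?thesis
    by (simp add: vec_eq_iff)
qed

text \<open>This is gamma transposed, conjugated by \<open>sympJ\<close>. It shows at once that the
  inverse is integral and that its lower left block is minus the transpose of
  \<open>C\<close>.\<close>

definition sp_inv :: "int^(3 + 3)^(3 + 3) \<Rightarrow> int^(3 + 3)^(3 + 3)"
  where "sp_inv \<gamma> = mk (transpose (blockD \<gamma>)) (- transpose (blockB \<gamma>))
                      (- transpose (blockC \<gamma>)) (transpose (blockA \<gamma>))"

lemma sp_inv_left:
  assumes "\<gamma> \<in> Sp6" shows "sp_inv \<gamma> ** \<gamma> = mat 1"
proof (rule mk_cases[of \<gamma>])
  fix A B C D assume g: "\<gamma> = mk A B C D"
  have *: "transpose D ** A - transpose B ** C = transpose (transpose A ** D - transpose C ** B)"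
    by (simp add: matrix_transpose_mul transpose_def vec_eq_iff flip: matrix_transpose_mul)
       (simp add: matrix_matrix_mult_def mult.commute)
  from assms g have "transpose A ** C = transpose C ** A" "transpose B ** D = transpose D ** B"
    "transpose A ** D - transpose C ** B = mat 1"
    by (simp_all add: Sp6_mk)
  with * show ?thesis
    unfolding g sp_inv_def mat_mk
    by (simp add: mk_mult mk_eq_iff mat_distribs algebra_simps transpose_mat)
qed

lemma sp_inv_right: "\<gamma> \<in> Sp6 \<Longrightarrow> \<gamma> ** sp_inv \<gamma> = mat 1"
  using sp_inv_left int_matrix_left_right_inverse by blast

lemma Sp6_one [simp]: "mat 1 \<in> Sp6"
  by (simp add: mat_mk Sp6_mk transpose_mat)

lemma Sp6_mult: "\<gamma> \<in> Sp6 \<Longrightarrow> \<delta> \<in> Sp6 \<Longrightarrow> \<gamma> ** \<delta> \<in> Sp6"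
  unfolding Sp6_def by (simp add: matrix_transpose_mul) (metis matrix_mul_assoc)

lemma sp_inv_Sp6: assumes "\<gamma> \<in> Sp6" shows "sp_inv \<gamma> \<in> Sp6"
proof -
  have "transpose (sp_inv \<gamma>) ** sympJ ** sp_inv \<gamma> =
        transpose (sp_inv \<gamma>) ** (transpose \<gamma> ** sympJ ** \<gamma>) ** sp_inv \<gamma>"
    using assms by (simp add: Sp6_def)
  also have "\<dots> = transpose (\<gamma> ** sp_inv \<gamma>) ** sympJ ** (\<gamma> ** sp_inv \<gamma>)"
    by (simp add: matrix_transpose_mul matrix_mul_assoc)
  finally show ?thesis
    using assms by (simp add: sp_inv_right Sp6_def transpose_mat)
qed

lemma sp_inv_unique: "\<gamma> \<in> Sp6 \<Longrightarrow> \<gamma> ** \<delta> = mat 1 \<Longrightarrow> \<delta> = sp_inv \<gamma>"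
  by (metis matrix_mul_assoc matrix_mul_lid matrix_mul_rid sp_inv_left)

lemma Gamma_Sp6: "\<gamma> \<in> Gamma30_2 \<Longrightarrow> \<gamma> \<in> Sp6"
  by (simp add: Gamma30_2_def)

lemma Gamma_one [simp]: "mat 1 \<in> Gamma30_2"
  unfolding Gamma30_2_def by (simp, subst mat_mk, simp)

lemma Gamma_inv: "\<gamma> \<in> Gamma30_2 \<Longrightarrow> sp_inv \<gamma> \<in> Gamma30_2"
  unfolding Gamma30_2_def by (simp add: sp_inv_Sp6) (simp add: sp_inv_def transpose_def)

lemma blockC_mult: "blockC (\<gamma> ** \<delta>) = blockC \<gamma> ** blockA \<delta> + blockD \<gamma> ** blockC \<delta>"
  by (metis mk_blocks mk_mult block_mk(3))

lemma blockD_mult: "blockD (\<gamma> ** \<delta>) = blockC \<gamma> ** blockB \<delta> + blockD \<gamma> ** blockD \<delta>"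
  by (metis mk_blocks mk_mult block_mk(4))

lemma blockA_mult: "blockA (\<gamma> ** \<delta>) = blockA \<gamma> ** blockA \<delta> + blockB \<gamma> ** blockC \<delta>"
  by (metis mk_blocks mk_mult block_mk(1))

lemma blockB_mult: "blockB (\<gamma> ** \<delta>) = blockA \<gamma> ** blockB \<delta> + blockB \<gamma> ** blockD \<delta>"
  by (metis mk_blocks mk_mult block_mk(2))

section \<open>The action on the Siegel space\<close>

abbreviation cm :: "int^3^3 \<Rightarrow> complex^3^3"
  where "cm \<equiv> map_matrix of_int"

lemma matrix_inv_eqI:
  fixes A B :: "'a::field^'n^'n"
  assumes "A ** B = mat 1" shows "matrix_inv A = B"
proof -
  have BA: "B ** A = mat 1" using assms by (simp add: matrix_left_right_inverse)
  with assms have "invertible A" by (auto simp: invertible_def)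
  then have "A ** matrix_inv A = mat 1" "matrix_inv A ** A = mat 1"
    unfolding matrix_inv_def invertible_def by (metis (mono_tags, lifting) someI_ex)+
  then show ?thesis
    by (metis BA matrix_mul_assoc matrix_mul_lid matrix_mul_rid)
qed

lemma matrix_inv_field:
  fixes A :: "'a::field^'n^'n"
  assumes "invertible A"
  shows "A ** matrix_inv A = mat 1" "matrix_inv A ** A = mat 1"
  using assms matrix_inv_eqI by (auto simp: invertible_def)

lemma matrix_inv_mult:
  fixes A B :: "'a::field^'n^'n"
  assumes "invertible A" "invertible B"
  shows "matrix_inv (A ** B) = matrix_inv B ** matrix_inv A"
proof (rule matrix_inv_eqI)
  have "A ** B ** (matrix_inv B ** matrix_inv A) = A ** (B ** matrix_inv B) ** matrix_inv A"
    by (simp add: matrix_mul_assoc)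
  then show "A ** B ** (matrix_inv B ** matrix_inv A) = mat 1"
    using assms by (simp add: matrix_inv_field)
qed

text \<open>Invertibility of \<open>C tau + D\<close> and stability of the Siegel space are packaged
  in a predicate closed under products, so that both are checked on generators only, without a
  positivity argument for a general matrix.\<close>

definition sp_good :: "int^(3 + 3)^(3 + 3) \<Rightarrow> bool"
  where "sp_good \<gamma> \<longleftrightarrow> \<gamma> \<in> Sp6 \<and>
    (\<forall>\<tau>\<in>siegel3. invertible (cocycle \<gamma> \<tau>) \<and> siegel_act \<gamma> \<tau> \<in> siegel3)"

lemma cocycle_mult:
  assumes "invertible (cocycle \<delta> \<tau>)"
  shows "cocycle (\<gamma> ** \<delta>) \<tau> = cocycle \<gamma> (siegel_act \<delta> \<tau>) ** cocycle \<delta> \<tau>"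
proof -
  have "cocycle \<gamma> (siegel_act \<delta> \<tau>) ** cocycle \<delta> \<tau> =
     cm (blockC \<gamma>) ** (cm (blockA \<delta>) ** \<tau> + cm (blockB \<delta>)) **
       (matrix_inv (cocycle \<delta> \<tau>) ** cocycle \<delta> \<tau>) + cm (blockD \<gamma>) ** cocycle \<delta> \<tau>"
    by (simp add: cocycle_def[of \<gamma>] siegel_act_def mat_distribs matrix_mul_assoc)
  also have "\<dots> = cocycle (\<gamma> ** \<delta>) \<tau>"
    unfolding matrix_inv_field(2)[OF assms]
    by (simp add: cocycle_def blockC_mult blockD_mult of_int_matrix_mult
        of_int_matrix_add mat_distribs matrix_mul_assoc)
  finally show ?thesis by simp
qed

lemma siegel_act_mult:
  assumes "invertible (cocycle \<delta> \<tau>)" "invertible (cocycle \<gamma> (siegel_act \<delta> \<tau>))"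
  shows "siegel_act (\<gamma> ** \<delta>) \<tau> = siegel_act \<gamma> (siegel_act \<delta> \<tau>)"
proof -
  have "siegel_act \<gamma> (siegel_act \<delta> \<tau>) =
    (cm (blockA \<gamma>) ** siegel_act \<delta> \<tau> + cm (blockB \<gamma>)) ** (cocycle \<delta> \<tau> ** matrix_inv (cocycle \<delta> \<tau>)) **
      matrix_inv (cocycle \<gamma> (siegel_act \<delta> \<tau>))"
    using assms by (simp add: siegel_act_def[of \<gamma>] matrix_inv_field)
  also have "\<dots> = ((cm (blockA \<gamma>) ** siegel_act \<delta> \<tau> + cm (blockB \<gamma>)) ** cocycle \<delta> \<tau>) **
       matrix_inv (cocycle (\<gamma> ** \<delta>) \<tau>)"
    using assms by (simp add: cocycle_mult matrix_inv_mult matrix_mul_assoc)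
  also have "(cm (blockA \<gamma>) ** siegel_act \<delta> \<tau> + cm (blockB \<gamma>)) ** cocycle \<delta> \<tau> =
     cm (blockA \<gamma>) ** (cm (blockA \<delta>) ** \<tau> + cm (blockB \<delta>)) **
       (matrix_inv (cocycle \<delta> \<tau>) ** cocycle \<delta> \<tau>) + cm (blockB \<gamma>) ** cocycle \<delta> \<tau>"
    by (simp add: siegel_act_def mat_distribs matrix_mul_assoc)
  also have "\<dots> = cm (blockA (\<gamma> ** \<delta>)) ** \<tau> + cm (blockB (\<gamma> ** \<delta>))"
    unfolding matrix_inv_field(2)[OF assms(1)]
    by (simp add: cocycle_def blockA_mult blockB_mult of_int_matrix_mult
        of_int_matrix_add mat_distribs matrix_mul_assoc)
  finally show ?thesis by (simp add: siegel_act_def)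
qed

lemma sp_good_mult:
  assumes "sp_good \<gamma>" "sp_good \<delta>" shows "sp_good (\<gamma> ** \<delta>)"
proof -
  have "invertible (cocycle (\<gamma> ** \<delta>) \<tau>) \<and> siegel_act (\<gamma> ** \<delta>) \<tau> \<in> siegel3" if "\<tau> \<in> siegel3" for \<tau>
  proof -
    have d: "invertible (cocycle \<delta> \<tau>)" "siegel_act \<delta> \<tau> \<in> siegel3"
      using assms that by (auto simp: sp_good_def)
    then have g: "invertible (cocycle \<gamma> (siegel_act \<delta> \<tau>))" "siegel_act \<gamma> (siegel_act \<delta> \<tau>) \<in> siegel3"
      using assms by (auto simp: sp_good_def)
    show ?thesis
      using d g by (simp add: cocycle_mult siegel_act_mult invertible_mult)
  qed
  then show ?thesis
    using assms by (auto simp: sp_good_def Sp6_mult)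
qed

lemma scalar_product_matrix_left:
  "scalar_product (A *v x) y = scalar_product x (transpose A *v (y :: 'a::comm_semiring_1^'n))"
  unfolding scalar_product_def matrix_vector_mult_def transpose_def
  by (simp add: sum_distrib_left sum_distrib_right) (subst sum.swap, simp add: mult_ac)

lemma scalar_product_commute: "scalar_product x y = scalar_product y (x :: 'a::comm_semiring_1^'n)"
  by (simp add: scalar_product_def mult.commute)

lemma scalar_product_add_left: "scalar_product (x + y) z = scalar_product x z + scalar_product y (z :: 'a::comm_semiring_1^'n)"
  and scalar_product_add_right: "scalar_product x (y + z) = scalar_product x y + scalar_product x (z :: 'a::comm_semiring_1^'n)"
  by (simp_all add: scalar_product_def sum.distrib algebra_simps)

lemma siegel3_sym: "\<tau> \<in> siegel3 \<Longrightarrow> transpose \<tau> = \<tau>"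
  by (simp add: siegel3_def)

text \<open>In the form \<open>A = (\<gamma>\<tau>) C + (C\<tau> + D)\<^sup>-\<^sup>t\<close>, this makes the exponential factor
  multiplicative.\<close>

lemma blockA_via_cocycle:
  assumes "\<gamma> \<in> Sp6" "transpose \<tau> = \<tau>" "invertible (cocycle \<gamma> \<tau>)"
    and "transpose (siegel_act \<gamma> \<tau>) = siegel_act \<gamma> \<tau>"
  shows "cm (blockA \<gamma>) = siegel_act \<gamma> \<tau> ** cm (blockC \<gamma>) + transpose (matrix_inv (cocycle \<gamma> \<tau>))"
proof (rule mk_cases[of \<gamma>])
  fix A B C D assume g: "\<gamma> = mk A B C D"
  define K where "K = matrix_inv (cocycle \<gamma> \<tau>)"
  have sp: "transpose A ** C = transpose C ** A" 
    "transpose A ** D - transpose C ** B = mat 1"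
    using assms g by (simp_all add: Sp6_mk)
  have sp1: "transpose (cm A) ** cm C = transpose (cm C) ** cm A"
    using arg_cong[OF sp(1), of cm] by (simp add: of_int_matrix_mult map_matrix_transpose)
  have "transpose (transpose A ** D - transpose C ** B) = mat 1"
    using sp by (simp add: transpose_mat)
  then have "transpose D ** A - transpose B ** C = mat 1"
    by (simp add: transpose_add transpose_minus diff_conv_add_uminus matrix_transpose_mul
        del: add_uminus_conv_diff)
  then have "cm (transpose D ** A) = cm (mat 1 + transpose B ** C)"
    by (metis diff_eq_eq)
  then have sp2: "transpose (cm D) ** cm A = mat 1 + transpose (cm B) ** cm C"
    by (simp add: of_int_matrix_mult of_int_matrix_add map_matrix_transpose)
  have K: "cocycle \<gamma> \<tau> ** K = mat 1" "transpose K ** transpose (cocycle \<gamma> \<tau>) = mat 1"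
    using assms by (simp_all add: K_def matrix_inv_field transpose_mat flip: matrix_transpose_mul)
  have tc: "transpose (cocycle \<gamma> \<tau>) = \<tau> ** transpose (cm C) + transpose (cm D)"
    using assms(2) by (simp add: cocycle_def g transpose_add matrix_transpose_mul)
  have "siegel_act \<gamma> \<tau> = transpose K ** (\<tau> ** transpose (cm A) + transpose (cm B))"
    using assms(2,4) by (simp add: siegel_act_def K_def g transpose_add matrix_transpose_mul)
  then have "siegel_act \<gamma> \<tau> ** cm C + transpose K =
     transpose K ** (\<tau> ** (transpose (cm A) ** cm C) + (mat 1 + transpose (cm B) ** cm C))"
    by (simp add: mat_distribs matrix_mul_assoc)
  also have "\<dots> = transpose K ** (\<tau> ** transpose (cm C) + transpose (cm D)) ** cm A"
    by (simp add: sp1 flip: sp2) (simp add: mat_distribs matrix_mul_assoc)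
  also have "\<dots> = cm A"
    using K tc by simp
  finally show ?thesis by (simp add: g K_def)
qed

lemma transform_z_mult:
  assumes "invertible (cocycle \<delta> \<tau>)" "invertible (cocycle \<gamma> (siegel_act \<delta> \<tau>))"
  shows "transform_z (\<gamma> ** \<delta>) \<tau> z = transform_z \<gamma> (siegel_act \<delta> \<tau>) (transform_z \<delta> \<tau> z)"
  using assms
  by (simp add: transform_z_def cocycle_mult matrix_inv_mult matrix_transpose_mul
      matrix_vector_mul_assoc del: transpose_matrix_vector)

text \<open>The exponent is the quadratic form of \<open>(C tau + D)^-1 C\<close>. Writing the block
  \<open>A\<close> of delta through its cocycle turns the form of the product into the form of delta
  plus the form of gamma at the transformed \<open>z\<close>.\<close>

lemma theta_exp_factor_mult:
  assumes "\<delta> \<in> Sp6" "transpose \<tau> = \<tau>" "transpose (siegel_act \<delta> \<tau>) = siegel_act \<delta> \<tau>"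
    "invertible (cocycle \<delta> \<tau>)" "invertible (cocycle \<gamma> (siegel_act \<delta> \<tau>))"
  shows "theta_exp_factor (\<gamma> ** \<delta>) \<tau> z =
    theta_exp_factor \<delta> \<tau> z * theta_exp_factor \<gamma> (siegel_act \<delta> \<tau>) (transform_z \<delta> \<tau> z)"
proof -
  define K where "K = matrix_inv (cocycle \<delta> \<tau>)"
  define L where "L = matrix_inv (cocycle \<gamma> (siegel_act \<delta> \<tau>))"
  define C1 where "C1 = cm (blockC \<gamma>)"
  define C2 where "C2 = cm (blockC \<delta>)"
  have L: "L ** (C1 ** siegel_act \<delta> \<tau> + cm (blockD \<gamma>)) = mat 1"
    using matrix_inv_field(2)[OF assms(5)] by (simp add: L_def cocycle_def C1_def)
  have "cm (blockC (\<gamma> ** \<delta>)) = C1 ** (siegel_act \<delta> \<tau> ** C2 + transpose K) + cm (blockD \<gamma>) ** C2"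
    using blockA_via_cocycle[OF assms(1,2,4,3)]
    by (simp add: blockC_mult of_int_matrix_add of_int_matrix_mult C1_def C2_def K_def)
  then have "L ** cm (blockC (\<gamma> ** \<delta>)) =
     (L ** (C1 ** siegel_act \<delta> \<tau> + cm (blockD \<gamma>))) ** C2 + L ** C1 ** transpose K"
    by (simp add: mat_distribs matrix_mul_assoc)
  then have LC: "L ** cm (blockC (\<gamma> ** \<delta>)) = C2 + L ** C1 ** transpose K"
    using L by simp
  have "matrix_inv (cocycle (\<gamma> ** \<delta>) \<tau>) = K ** L"
    using assms by (simp add: cocycle_mult matrix_inv_mult K_def L_def)
  then have "matrix_inv (cocycle (\<gamma> ** \<delta>) \<tau>) *v (cm (blockC (\<gamma> ** \<delta>)) *v z) =
     K *v ((L ** cm (blockC (\<gamma> ** \<delta>))) *v z)"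
    by (simp add: matrix_vector_mul_assoc matrix_mul_assoc)
  also have "\<dots> = K *v (C2 *v z) + K *v (L *v (C1 *v (transpose K *v z)))"
    unfolding LC by (simp add: matrix_vector_mult_add_rdistrib matrix_vector_right_distrib
        matrix_vector_mul_assoc matrix_mul_assoc del: transpose_matrix_vector)
  finally have "scalar_product z (matrix_inv (cocycle (\<gamma> ** \<delta>) \<tau>) *v (cm (blockC (\<gamma> ** \<delta>)) *v z)) =
     scalar_product z (K *v (C2 *v z)) +
     scalar_product (transpose K *v z) (L *v (C1 *v (transpose K *v z)))"
    by (simp add: scalar_product_add_right scalar_product_matrix_left del: transpose_matrix_vector)
  then show ?thesis
    by (simp add: theta_exp_factor_def transform_z_def K_def L_def C1_def C2_def
        distrib_left flip: exp_add)
qed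

section \<open>Generators of \<open>\<Gamma>\<^sub>3\<^sub>,\<^sub>0(k)\<close>\<close>

definition Em :: "3 \<Rightarrow> 3 \<Rightarrow> int \<Rightarrow> int^3^3"
  where "Em i j s = (\<chi> a b. if a = i \<and> b = j then s else 0)"

definition Sm :: "3 \<Rightarrow> 3 \<Rightarrow> int \<Rightarrow> int^3^3"
  where "Sm i j s = (if i = j then Em i i s else Em i j s + Em j i s)"

definition Fm :: "3 \<Rightarrow> int^3^3"
  where "Fm i = (\<chi> a b. if a = b then (if a = i then -1 else 1) else 0)"

definition Pm :: "3 \<Rightarrow> 3 \<Rightarrow> int^3^3"
  where "Pm i j = (\<chi> a b. if b = (if a = i then j else if a = j then i else a) then 1 else 0)"

definition tS :: "int^3^3 \<Rightarrow> int^(3 + 3)^(3 + 3)" where "tS S = mk (mat 1) S 0 (mat 1)"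
definition lS :: "int^3^3 \<Rightarrow> int^(3 + 3)^(3 + 3)" where "lS S = mk (mat 1) 0 S (mat 1)"
definition shear :: "3 \<Rightarrow> 3 \<Rightarrow> int \<Rightarrow> int^(3 + 3)^(3 + 3)"
  where "shear i j s = mk (mat 1 + Em i j s) 0 0 (mat 1 - Em j i s)"
definition flip :: "3 \<Rightarrow> int^(3 + 3)^(3 + 3)" where "flip i = mk (Fm i) 0 0 (Fm i)"
definition swap :: "3 \<Rightarrow> 3 \<Rightarrow> int^(3 + 3)^(3 + 3)" where "swap i j = mk (Pm i j) 0 0 (Pm i j)"
text \<open>The inversion in a single hyperbolic plane. It has order 4: its square is
  \<open>flip i\<close>, so its inverse is \<open>jJ i ** flip i\<close>.\<close>

definition jJ :: "3 \<Rightarrow> int^(3 + 3)^(3 + 3)"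
  where "jJ i = mk (mat 1 - Em i i 1) (- Em i i 1) (Em i i 1) (mat 1 - Em i i 1)"

lemmas small_mats = Em_def Sm_def Fm_def Pm_def mat_def transpose_def matrix_matrix_mult_def

lemma tS_add: "tS S ** tS S' = tS (S + S')"
  by (simp add: tS_def mk_mult mk_eq_iff add.commute)

lemma lS_add: "lS S ** lS S' = lS (S + S')"
  by (simp add: lS_def mk_mult mk_eq_iff)

lemma tS_zero: "tS 0 = mat 1" and lS_zero: "lS 0 = mat 1"
  by (simp_all add: tS_def lS_def mat_mk)

lemma tS_Sp6: "transpose S = S \<Longrightarrow> tS S \<in> Sp6"
  by (simp add: tS_def Sp6_mk transpose_mat)

lemma lS_Sp6: "transpose S = S \<Longrightarrow> lS S \<in> Sp6"
  by (simp add: lS_def Sp6_mk transpose_mat)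

lemma transpose_Em [simp]: "transpose (Em i j s) = Em j i s"
  by (auto simp: small_mats vec_eq_iff)

lemma transpose_Sm [simp]: "transpose (Sm i j s) = Sm i j s"
  by (auto simp: Sm_def transpose_add add.commute)

lemma Em_mult: "Em i j s ** Em k l t = (if j = k then Em i l (s * t) else 0)"
proof -
  have "(\<Sum>m\<in>UNIV. (if a = i \<and> m = j then s else 0) * (if m = k \<and> b = l then t else 0)) =
    (if j = k \<and> a = i \<and> b = l then s * t else 0)" for a b
  proof -
    have "(\<Sum>m\<in>UNIV. (if a = i \<and> m = j then s else 0) * (if m = k \<and> b = l then t else 0)) =
      (\<Sum>m\<in>UNIV. if m = j then (if a = i \<and> j = k \<and> b = l then s * t else 0) else 0)"
      by (rule sum.cong) auto
    then show ?thesis by auto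
  qed
  then show ?thesis by (auto simp: Em_def matrix_matrix_mult_def vec_eq_iff)
qed

lemma Em_add: "Em i j s + Em i j t = Em i j (s + t)" and Em_minus: "- Em i j s = Em i j (- s)"
  and Em_zero: "Em i j 0 = 0"
  by (auto simp: Em_def vec_eq_iff)

lemma Fm_square: "Fm i ** Fm i = mat 1" and transpose_Fm: "transpose (Fm i) = Fm i"
  using exhaust_3[of i] by (auto simp: small_mats vec_eq_iff forall_3 sum_3)

lemma Pm_square: "Pm i j ** Pm i j = mat 1" and transpose_Pm: "transpose (Pm i j) = Pm i j"
  using exhaust_3[of i] exhaust_3[of j] by (elim disjE; simp add: small_mats vec_eq_iff forall_3 sum_3)+

lemma shear_Sp6: "i \<noteq> j \<Longrightarrow> shear i j s \<in> Sp6"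
  by (simp add: shear_def Sp6_mk transpose_mat transpose_add mat_distribs Em_mult
      diff_conv_add_uminus transpose_minus Em_minus Em_add Em_zero del: add_uminus_conv_diff)

lemma flip_Sp6: "flip i \<in> Sp6"
  by (simp add: flip_def Sp6_mk transpose_Fm Fm_square)

lemma swap_Sp6: "swap i j \<in> Sp6"
  by (simp add: swap_def Sp6_mk transpose_Pm Pm_square)

lemma jJ_Sp6: "jJ i \<in> Sp6"
  using exhaust_3[of i]
  by (auto simp: jJ_def Sp6_mk) (simp_all add: small_mats vec_eq_iff forall_3 sum_3)

lemma shear_add: "i \<noteq> j \<Longrightarrow> shear i j s ** shear i j t = shear i j (s + t)"
  by (auto simp: shear_def mk_mult mk_eq_iff mat_distribs Em_mult) (auto simp: Em_def vec_eq_iff)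

lemma shear_zero: "shear i j 0 = mat 1"
  by (simp add: shear_def Em_zero mat_mk)

lemma flip_shear: "i \<noteq> j \<Longrightarrow> flip i ** shear i j 1 ** flip i = shear i j (-1)"
  using exhaust_3[of i] exhaust_3[of j]
  by (auto simp: flip_def shear_def mk_mult mk_eq_iff) (simp_all add: small_mats vec_eq_iff forall_3 sum_3)

lemma flip_square: "flip i ** flip i = mat 1"
  by (simp add: flip_def mk_mult Fm_square mat_mk)

lemma swap_square: "swap i j ** swap i j = mat 1"
  by (simp add: swap_def mk_mult Pm_square mat_mk)

lemma tS_swap: "swap 1 i ** tS (Em 1 1 s) ** swap 1 i = tS (Em i i s)"
  using exhaust_3[of i]
  by (auto simp: swap_def tS_def mk_mult mk_eq_iff Pm_square) (simp_all add: small_mats vec_eq_iff forall_3 sum_3)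

lemma lS_swap: "swap 1 i ** lS (Em 1 1 s) ** swap 1 i = lS (Em i i s)"
  using exhaust_3[of i]
  by (auto simp: swap_def lS_def mk_mult mk_eq_iff Pm_square) (simp_all add: small_mats vec_eq_iff forall_3 sum_3)

lemma jJ_swap: "swap 1 i ** jJ 1 ** swap 1 i = jJ i"
  using exhaust_3[of i]
  by (auto simp: swap_def jJ_def mk_mult mk_eq_iff) (simp_all add: small_mats vec_eq_iff forall_3 sum_3)

text \<open>Conjugation by the shear turns \<open>s E_ii\<close> into
  \<open>s (E_ii + E_ij + E_ji + E_jj)\<close>; removing the two diagonal terms leaves the
  off-diagonal translation.\<close>

lemma tS_shear:
  assumes "i \<noteq> j"
  shows "shear j i 1 ** tS (Em i i s) ** shear j i (-1) ** tS (Em i i (-s)) ** tS (Em j j (-s)) = tS (Sm i j s)"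
  using assms
  by (auto simp: shear_def tS_def mk_mult mk_eq_iff mat_distribs Em_mult Sm_def) (auto simp: Em_def vec_eq_iff mat_def)

lemma lS_shear:
  assumes "i \<noteq> j"
  shows "shear i j (-1) ** lS (Em i i s) ** shear i j 1 ** lS (Em i i (-s)) ** lS (Em j j (-s)) = lS (Sm i j s)"
  using assms
  by (auto simp: shear_def lS_def mk_mult mk_eq_iff mat_distribs Em_mult Sm_def) (auto simp: Em_def vec_eq_iff mat_def)

lemma lS_jJ: "jJ 1 ** tS (Em 1 1 (-s)) ** (jJ 1 ** flip 1) = lS (Em 1 1 s)"
  by (auto simp: jJ_def flip_def lS_def tS_def mk_mult mk_eq_iff)
     (simp_all add: small_mats vec_eq_iff forall_3 sum_3)

lemma jJ_square: "jJ i ** jJ i = flip i"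
  using exhaust_3[of i]
  by (auto simp: jJ_def flip_def mk_mult mk_eq_iff) (simp_all add: small_mats vec_eq_iff forall_3 sum_3)

text \<open>The relation \<open>T J T J T = J\<close> of SL(2, Z), solved for the inverse of
  \<open>T\<close>. It allows inductions to treat the positive translation alone.\<close>

lemma tS_minus_jJ: "jJ 1 ** tS (Em 1 1 1) ** jJ 1 ** tS (Em 1 1 1) ** jJ 1 ** flip 1 = tS (Em 1 1 (-1))"
  by (auto simp: jJ_def flip_def tS_def mk_mult mk_eq_iff)
     (simp_all add: small_mats vec_eq_iff forall_3 sum_3)

section \<open>The monoid of elementary symplectic matrices\<close>

text \<open>The parameter treats two groups at once: \<open>k = 1\<close> will give the full group
  and \<open>k = 2\<close> the group \<open>Gamma30_2\<close>. Their generators differ only in the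
  lower translations, which are restricted to multiples of \<open>k\<close>.\<close>

inductive_set Mon :: "int \<Rightarrow> (int^(3 + 3)^(3 + 3)) set" for k where
  one: "mat 1 \<in> Mon k"
| t: "g \<in> Mon k \<Longrightarrow> s = 1 \<or> s = -1 \<Longrightarrow> g ** tS (Em 1 1 s) \<in> Mon k"
| l: "g \<in> Mon k \<Longrightarrow> s = 1 \<or> s = -1 \<Longrightarrow> g ** lS (Em 1 1 (k * s)) \<in> Mon k"
| shear: "g \<in> Mon k \<Longrightarrow> i \<noteq> j \<Longrightarrow> g ** shear i j 1 \<in> Mon k"
| flip: "g \<in> Mon k \<Longrightarrow> g ** flip i \<in> Mon k"
| swap: "g \<in> Mon k \<Longrightarrow> g ** swap i j \<in> Mon k"

lemma Mon_mult: assumes "h \<in> Mon k" "g \<in> Mon k" shows "g ** h \<in> Mon k"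
  using assms(1)
proof induction
  case one then show ?case using assms(2) by simp
qed (auto simp: matrix_mul_assoc intro: Mon.intros)

lemma Mon_gens:
  "s = 1 \<or> s = -1 \<Longrightarrow> tS (Em 1 1 s) \<in> Mon k"
  "s = 1 \<or> s = -1 \<Longrightarrow> lS (Em 1 1 (k * s)) \<in> Mon k"
  "i \<noteq> j \<Longrightarrow> shear i j 1 \<in> Mon k" "flip i \<in> Mon k" "swap i j \<in> Mon k"
  using Mon.t[OF Mon.one, where s = s and k = k] Mon.l[OF Mon.one, where s = s and k = k]
    Mon.shear[OF Mon.one, where i = i and j = j and k = k]
    Mon.flip[OF Mon.one, where i = i and k = k] Mon.swap[OF Mon.one, where i = i and j = j and k = k]
  by simp_all

lemma int_powers_in:
  fixes f :: "int \<Rightarrow> 'a::semiring_1^'n^'n"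
  assumes "f 0 \<in> M" "f 1 \<in> M" "f (-1) \<in> M" "\<And>a b. f (a + b) = f a ** f b"
    and "\<And>g h. g \<in> M \<Longrightarrow> h \<in> M \<Longrightarrow> g ** h \<in> M"
  shows "f s \<in> M"
proof (induction s rule: int_induct[of _ 0])
  case (step2 i)
  then have "f i ** f (-1) \<in> M" using assms(3,5) by blast
  then show ?case using assms(4)[of i "-1"] by simp
qed (use assms in auto)

lemma Mon_shear: "i \<noteq> j \<Longrightarrow> shear i j s \<in> Mon k"
  by (rule int_powers_in) (auto simp: shear_zero Mon.one shear_add Mon_gens Mon_mult simp flip: flip_shear)

lemma Mon_t: "tS (Em i i s) \<in> Mon k"
proof -
  have "tS (Em 1 1 s) \<in> Mon k"
    by (rule int_powers_in) (auto simp: Em_zero tS_zero Mon.one Mon_gens Mon_mult tS_add Em_add)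
  then show ?thesis by (metis tS_swap Mon_mult Mon_gens(5))
qed

lemma Mon_l: "lS (Em i i (k * s)) \<in> Mon k"
proof -
  have "lS (Em 1 1 (k * s)) \<in> Mon k"
    by (rule int_powers_in) 
       (use Mon_gens(2)[of 1 k] Mon_gens(2)[of "-1" k] in \<open>auto simp: Em_zero lS_zero Mon.one Mon_mult lS_add Em_add distrib_left\<close>)
  then show ?thesis by (metis lS_swap Mon_mult Mon_gens(5))
qed

lemma Mon_tSm: "tS (Sm i j s) \<in> Mon k"
proof (cases "i = j")
  case False
  then show ?thesis
    unfolding tS_shear[OF False, symmetric] by (intro Mon_mult Mon_t Mon_shear) auto
qed (simp add: Sm_def Mon_t)

lemma Mon_lSm: "lS (Sm i j (k * s)) \<in> Mon k"
proof (cases "i = j")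
  case False
  have "lS (Em i i (- (k * s))) \<in> Mon k" for i using Mon_l[of i k "-s"] by simp
  then show ?thesis
    using False unfolding lS_shear[OF False, symmetric] by (intro Mon_mult Mon_l Mon_shear) auto
qed (simp add: Sm_def Mon_l)

lemma Mon_tS:
  assumes "transpose S = S" shows "tS S \<in> Mon k"
proof -
  define S' where "S' = Sm 1 1 (S$1$1) + (Sm 2 2 (S$2$2) + (Sm 3 3 (S$3$3) + (Sm 1 2 (S$1$2) + (Sm 1 3 (S$1$3) + Sm 2 3 (S$2$3)))))"
  have "S $ j $ i = S $ i $ j" for i j
    using assms by (metis (no_types, lifting) transpose_def vec_lambda_beta)
  then have "S = S'"
    by (simp add: S'_def Sm_def Em_def vec_eq_iff forall_3)
  moreover have "tS S' \<in> Mon k"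
    unfolding S'_def tS_add[symmetric] by (intro Mon_mult Mon_tSm)
  ultimately show ?thesis by simp
qed

lemma Mon_inverse: "g \<in> Mon k \<Longrightarrow> \<exists>h\<in>Mon k. g ** h = mat 1"
proof (induction rule: Mon.induct)
  case one then show ?case using Mon.one by (metis matrix_mul_lid)
next
  case (t g s)
  then obtain h where h: "h \<in> Mon k" "g ** h = mat 1" by blast
  have "g ** tS (Em 1 1 s) ** (tS (Em 1 1 (- s)) ** h) = g ** (tS (Em 1 1 s) ** tS (Em 1 1 (- s))) ** h"
    by (simp add: matrix_mul_assoc)
  then have "g ** tS (Em 1 1 s) ** (tS (Em 1 1 (- s)) ** h) = mat 1" using h by (simp add: tS_add Em_add Em_zero tS_zero)
  moreover have "tS (Em 1 1 (- s)) ** h \<in> Mon k" using h Mon_t by (intro Mon_mult)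
  ultimately show ?case by blast
next
  case (l g s)
  then obtain h where h: "h \<in> Mon k" "g ** h = mat 1" by blast
  have "g ** lS (Em 1 1 (k * s)) ** (lS (Em 1 1 (k * - s)) ** h) = g ** (lS (Em 1 1 (k * s)) ** lS (Em 1 1 (k * - s))) ** h"
    by (simp add: matrix_mul_assoc)
  then have "g ** lS (Em 1 1 (k * s)) ** (lS (Em 1 1 (k * - s)) ** h) = mat 1" using h by (simp add: lS_add Em_add Em_zero lS_zero)
  moreover have "lS (Em 1 1 (k * - s)) ** h \<in> Mon k" using h Mon_l[of 1 k "-s"] by (intro Mon_mult)
  ultimately show ?case by blast
next
  case (shear g i j)
  then obtain h where h: "h \<in> Mon k" "g ** h = mat 1" by blast
  have "g ** shear i j 1 ** (shear i j (-1) ** h) = g ** (shear i j 1 ** shear i j (-1)) ** h"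
    by (simp add: matrix_mul_assoc)
  then have "g ** shear i j 1 ** (shear i j (-1) ** h) = mat 1" using h by (simp add: shear.hyps shear_add shear_zero)
  moreover have "shear i j (-1) ** h \<in> Mon k" using h shear.hyps Mon_shear by (intro Mon_mult) auto
  ultimately show ?case by blast
next
  case (flip g i)
  then obtain h where h: "h \<in> Mon k" "g ** h = mat 1" by blast
  have "g ** flip i ** (flip i ** h) = g ** (flip i ** flip i) ** h"
    by (simp add: matrix_mul_assoc)
  then have "g ** flip i ** (flip i ** h) = mat 1" using h by (simp add: flip_square)
  moreover have "flip i ** h \<in> Mon k" using h Mon_gens(4) by (intro Mon_mult)
  ultimately show ?case by blast
next
  case (swap g i j)
  then obtain h where h: "h \<in> Mon k" "g ** h = mat 1" by blast
  have "g ** swap i j ** (swap i j ** h) = g ** (swap i j ** swap i j) ** h"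
    by (simp add: matrix_mul_assoc)
  then have "g ** swap i j ** (swap i j ** h) = mat 1" using h by (simp add: swap_square)
  moreover have "swap i j ** h \<in> Mon k" using h Mon_gens(5) by (intro Mon_mult)
  ultimately show ?case by blast
qed

lemma Mon_subset: "g \<in> Mon k \<Longrightarrow> g \<in> Sp6 \<and> (\<forall>i j. k dvd blockC g $ i $ j)"
proof (induction rule: Mon.induct)
  case one then show ?case by (simp, subst mat_mk, simp)
next
  case (l g s)
  have "lS (Em 1 1 (k * s)) \<in> Sp6" by (rule lS_Sp6) simp
  moreover have "blockC (g ** lS (Em 1 1 (k * s))) = blockC g + blockD g ** Em 1 1 (k * s)"
    by (simp add: blockC_mult lS_def)
  moreover have "k dvd (blockD g ** Em 1 1 (k * s)) $ i $ j" for i j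
    by (auto simp: matrix_matrix_mult_def Em_def intro!: dvd_sum)
  ultimately show ?case using l by (auto simp: Sp6_mult)
next
  case (t g s)
  have "blockC (g ** tS (Em 1 1 s)) = blockC g" by (simp add: blockC_mult tS_def)
  then show ?case using t by (simp add: Sp6_mult tS_Sp6)
next
  case (shear g i j)
  have "blockC (g ** shear i j 1) = blockC g ** (mat 1 + Em i j 1)" by (simp add: blockC_mult shear_def)
  then show ?case using shear by (simp add: Sp6_mult shear_Sp6) (auto simp: matrix_matrix_mult_def intro!: dvd_sum)
next
  case (flip g i)
  have "blockC (g ** flip i) = blockC g ** Fm i" by (simp add: blockC_mult flip_def)
  then show ?case using flip by (simp add: Sp6_mult flip_Sp6) (auto simp: matrix_matrix_mult_def intro!: dvd_sum)
next
  case (swap g i j)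
  have "blockC (g ** swap i j) = blockC g ** Pm i j" by (simp add: blockC_mult swap_def)
  then show ?case using swap by (simp add: Sp6_mult swap_Sp6) (auto simp: matrix_matrix_mult_def intro!: dvd_sum)
qed

subsection \<open>Reduction of a row\<close>

definition rowact :: "((int^3) \<times> (int^3)) \<Rightarrow> int^(3 + 3)^(3 + 3) \<Rightarrow> ((int^3) \<times> (int^3))"
  where "rowact r g = (fst r v* blockA g + snd r v* blockC g, fst r v* blockB g + snd r v* blockD g)"

lemma vector_matrix_mul_assoc': "x v* A v* B = x v* (A ** (B::int^3^3))"
  by (metis vector_matrix_mul_assoc)

lemma vector_matrix_add: "x v* (A + B) = x v* A + x v* (B :: 'a::comm_semiring_1^'n^'m)"
  by (simp add: vector_matrix_mult_def vec_eq_iff sum.distrib algebra_simps)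

lemma vector_add_matrix: "(x + y) v* A = x v* A + y v* (A :: 'a::comm_semiring_1^'n^'m)"
  by (simp add: vector_matrix_mult_def vec_eq_iff sum.distrib algebra_simps)

lemma rowact_mult: "rowact r (g ** h) = rowact (rowact r g) h"
  by (simp add: rowact_def blockA_mult blockB_mult blockC_mult blockD_mult vector_matrix_add
      vector_add_matrix vector_matrix_mul_assoc')

lemma row_mult:
  "(blockC (g ** h) $ i, blockD (g ** h) $ i) = rowact (blockC g $ i, blockD g $ i) h"
  unfolding rowact_def blockC_mult blockD_mult fst_conv snd_conv
  by (simp add: vector_matrix_mult_def matrix_matrix_mult_def vec_eq_iff mult.commute)

lemma rowact_one [simp]: "rowact r (mat 1) = r"
  unfolding mat_mk rowact_def by (cases r) (simp add: vector_matrix_mult_def vec_eq_iff mat_def if_distrib cong: if_cong)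

lemma rowact_tS:
  "rowact (c, d) (tS (Sm a b s)) = (c, \<chi> i. d $ i + (if i = a then s * c $ b else if i = b then s * c $ a else 0))"
  using exhaust_3[of a] exhaust_3[of b]
  by (auto simp: rowact_def tS_def vector_matrix_mult_def small_mats vec_eq_iff forall_3 sum_3)

lemma rowact_lS:
  "rowact (c, d) (lS (Sm a b s)) = (\<chi> i. c $ i + (if i = a then s * d $ b else if i = b then s * d $ a else 0), d)"
  using exhaust_3[of a] exhaust_3[of b]
  by (auto simp: rowact_def lS_def vector_matrix_mult_def small_mats vec_eq_iff forall_3 sum_3)

lemma rowact_shear:
  "a \<noteq> b \<Longrightarrow> rowact (c, d) (shear a b s) =
    (\<chi> i. c $ i + (if i = b then s * c $ a else 0), \<chi> i. d $ i - (if i = a then s * d $ b else 0))"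
  using exhaust_3[of a] exhaust_3[of b]
  by (auto simp: rowact_def shear_def vector_matrix_mult_def small_mats vec_eq_iff forall_3 sum_3)

lemma rowact_flip:
  "rowact (c, d) (flip a) = (\<chi> i. if i = a then - c $ i else c $ i, \<chi> i. if i = a then - d $ i else d $ i)"
  using exhaust_3[of a]
  by (auto simp: rowact_def flip_def vector_matrix_mult_def small_mats vec_eq_iff forall_3 sum_3)

text \<open>Generators that touch only the coordinates in \<open>I\<close>. They fix every row
  \<open>(0, d)\<close> with \<open>d\<close> zero on \<open>I\<close>, so rows already normalised
  survive. New factors go on the left because \<open>rowact\<close> applies the leftmost factor
  first.\<close>

inductive_set RI :: "3 set \<Rightarrow> int \<Rightarrow> (int^(3 + 3)^(3 + 3)) set" for I k where
  one: "mat 1 \<in> RI I k"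
| t: "g \<in> RI I k \<Longrightarrow> i \<in> I \<Longrightarrow> j \<in> I \<Longrightarrow> tS (Sm i j s) ** g \<in> RI I k"
| l: "g \<in> RI I k \<Longrightarrow> i \<in> I \<Longrightarrow> j \<in> I \<Longrightarrow> lS (Sm i j (k * s)) ** g \<in> RI I k"
| shear: "g \<in> RI I k \<Longrightarrow> i \<in> I \<Longrightarrow> j \<in> I \<Longrightarrow> i \<noteq> j \<Longrightarrow> shear i j s ** g \<in> RI I k"
| flip: "g \<in> RI I k \<Longrightarrow> i \<in> I \<Longrightarrow> flip i ** g \<in> RI I k"

lemma RI_Mon: "g \<in> RI I k \<Longrightarrow> g \<in> Mon k"
  by (induction rule: RI.induct) (auto intro: Mon.one Mon_mult Mon_tSm Mon_lSm Mon_shear Mon_gens)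

lemma RI_fix:
  assumes "g \<in> RI I k" "\<forall>i\<in>I. d $ i = 0" shows "rowact (0, d) g = (0, d)"
  using assms
proof (induction rule: RI.induct)
  case (t g i j s)
  then have "rowact (0, d) (tS (Sm i j s)) = (0, d)" by (auto simp: rowact_tS vec_eq_iff)
  with t show ?case by (simp add: rowact_mult)
next
  case (l g i j s)
  then have "rowact (0, d) (lS (Sm i j (k * s))) = (0, d)" by (auto simp: rowact_lS vec_eq_iff)
  with l show ?case by (simp add: rowact_mult)
next
  case (shear g i j s)
  then have "rowact (0, d) (shear i j s) = (0, d)" by (auto simp: rowact_shear vec_eq_iff)
  with shear show ?case by (simp add: rowact_mult)
next
  case (flip g i)
  then have "rowact (0, d) (flip i) = (0, d)" by (auto simp: rowact_flip vec_eq_iff)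
  with flip show ?case by (simp add: rowact_mult)
qed simp

definition reducible :: "3 set \<Rightarrow> int \<Rightarrow> 3 \<Rightarrow> int^3 \<Rightarrow> int^3 \<Rightarrow> bool"
  where "reducible I k j c d \<longleftrightarrow> (\<exists>g\<in>RI I k. \<exists>d'. rowact (c, d) g = (0, d') \<and>
     (\<forall>i\<in>I. d' $ i = (if i = j then 1 else 0)) \<and> (\<forall>i. i \<notin> I \<longrightarrow> d' $ i = d $ i))"

text \<open>The row has to be primitive on \<open>I\<close> alone: the Euclidean reduction preserves
  this, and it makes the last remaining entry a unit.\<close>

definition admissible :: "3 set \<Rightarrow> int \<Rightarrow> int^3 \<Rightarrow> int^3 \<Rightarrow> bool"
  where "admissible I k c d \<longleftrightarrow> (\<forall>i. k dvd c $ i) \<and> (\<forall>i. i \<notin> I \<longrightarrow> c $ i = 0) \<and>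
     (\<forall>p. (\<forall>i\<in>I. p dvd c $ i \<and> p dvd d $ i) \<longrightarrow> p dvd 1)"

lemma reducible_step:
  assumes "rowact (c, d) h = (c', d')" "\<forall>i. i \<notin> I \<longrightarrow> d' $ i = d $ i"
    and "\<And>g. g \<in> RI I k \<Longrightarrow> h ** g \<in> RI I k" and "reducible I k j c' d'"
  shows "reducible I k j c d"
  using assms unfolding reducible_def by (metis rowact_mult)

text \<open>For \<open>k = 1\<close> this is division with remainder. For \<open>k = 2\<close> the
  remainder modulo \<open>2 |d|\<close> is even and hence differs from the odd number
  \<open>|d|\<close>, so either it or its translate by \<open>-2 |d|\<close> is strictly smaller
  than \<open>|d|\<close> in absolute value.\<close>

lemma reduce_mod:
  fixes k c d :: int
  assumes "k = 1 \<or> k = 2" "d \<noteq> 0" "k dvd c" "k = 2 \<longrightarrow> odd d"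
  shows "\<exists>s. \<bar>c + k * s * d\<bar> < \<bar>d\<bar>"
proof -
  define m where "m = k * \<bar>d\<bar>"
  have m: "m > 0" using assms by (auto simp: m_def)
  have sgn: "\<bar>d\<bar> = sgn d * d" by (simp add: abs_sgn mult.commute)
  have m_alt: "m = k * (sgn d * d)" unfolding m_def sgn ..
  have eq: "c mod m = c + k * (- (c div m) * sgn d) * d"
  proof -
    have "c mod m = c - m * (c div m)" by (simp add: minus_mult_div_eq_mod)
    also have "m * x = k * (x * sgn d) * d" for x
      unfolding m_def sgn by (simp only: mult_ac)
    finally show ?thesis by (simp only: minus_mult_left[symmetric] minus_mult_right[symmetric] diff_conv_add_uminus)
  qed
  consider "\<bar>c mod m\<bar> < \<bar>d\<bar>" | "\<bar>c mod m - m\<bar> < \<bar>d\<bar>"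
  proof (cases "k = 1")
    case True then show ?thesis using that(1) m by (simp add: m_def)
  next
    case False
    then have k: "k = 2" using assms by simp
    have "even (c mod m)" using assms k by (simp add: m_def dvd_mod)
    then have "c mod m \<noteq> \<bar>d\<bar>" using assms k by (metis dvd_abs_iff)
    moreover have "0 \<le> c mod m" "c mod m < m" using m by simp_all
    ultimately show ?thesis using that m k by (simp add: m_def) linarith
  qed
  moreover obtain q where q: "c mod m = c + k * (- q * sgn d) * d" using eq by blast
  ultimately show ?thesis
  proof cases
    case 1 then show ?thesis unfolding q by blast
  next
    case 2
    have "c mod m - m = c + k * (- q * sgn d - sgn d) * d"
      unfolding q by (simp add: m_alt algebra_simps)
    then show ?thesis using 2 by metis
  qed
qed

text \<open>The sign is chosen so that \<open>|c|\<close> is subtracted from \<open>|d|\<close>. The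
  result is smaller and still nonzero, as the next division by it requires.\<close>

lemma reduce_euclid:
  fixes c d :: int
  assumes "c \<noteq> 0" "\<bar>c\<bar> < \<bar>d\<bar>" shows "\<exists>s. d + s * c \<noteq> 0 \<and> \<bar>d + s * c\<bar> < \<bar>d\<bar>"
  using assms by (intro exI[of _ "- sgn c * sgn d"]) (auto simp: sgn_if abs_if split: if_splits)

text \<open>A Euclidean algorithm. Two nonzero entries of \<open>d\<close> are reduced against each
  other by a shear; with one nonzero entry left, a lower translation reduces an entry of
  \<open>c\<close> modulo it, and an upper translation then makes it smaller. Once \<open>c\<close>
  is zero, primitivity makes the remaining entry of \<open>d\<close> a unit.\<close>

lemma row_reduce:
  assumes "k = 1 \<or> k = 2" "j \<in> I" "admissible I k c d" "\<exists>i\<in>I. d $ i \<noteq> 0"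
  shows "reducible I k j c d"
  using assms(3,4)
\<comment> \<open>A lexicographic measure: the weight 4 exceeds the number of entries of
  \<open>c\<close>, so a drop in the sum of the absolute values of \<open>d\<close> outweighs any
  change in the number of nonzero entries of \<open>c\<close>.\<close>
proof (induction "(\<Sum>i\<in>I. nat \<bar>d $ i\<bar>) * 4 + card {i\<in>I. c $ i \<noteq> 0}" arbitrary: c d rule: less_induct)
  case less
  have fin: "finite I" by simp
  have card3: "card {i\<in>I. c $ i \<noteq> 0} \<le> 3" for c :: "int^3"
    using card_mono[of "UNIV :: 3 set" "{i\<in>I. c $ i \<noteq> 0}"] by simp
  have dec: "reducible I k j c' d'" if "(\<Sum>i\<in>I. nat \<bar>d' $ i\<bar>) < (\<Sum>i\<in>I. nat \<bar>d $ i\<bar>)"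
    "admissible I k c' d'" "\<exists>i\<in>I. d' $ i \<noteq> 0" for c' d'
    using less.hyps[OF _ that(2,3)] that(1) card3[of c'] by simp
  have sumless: "(\<Sum>i\<in>I. nat \<bar>d' $ i\<bar>) < (\<Sum>i\<in>I. nat \<bar>d $ i\<bar>)"
    if "a \<in> I" "\<bar>d' $ a\<bar> < \<bar>d $ a\<bar>" "\<And>i. i \<in> I \<Longrightarrow> i \<noteq> a \<Longrightarrow> d' $ i = d $ i" for d' :: "int^3" and a
    by (rule sum_strict_mono_ex1[OF fin]) (use that in force)+
  have adm: "k dvd c $ i" "i \<notin> I \<Longrightarrow> c $ i = 0" for i using less.prems by (auto simp: admissible_def)
  have unim: "p dvd 1" if "\<And>i. i \<in> I \<Longrightarrow> p dvd c $ i \<and> p dvd d $ i" for p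
    using less.prems that by (auto simp: admissible_def)
  show ?case
  proof (cases "\<exists>a\<in>I. \<exists>b\<in>I. a \<noteq> b \<and> d $ a \<noteq> 0 \<and> d $ b \<noteq> 0")
    case True
    then obtain a b where ab: "a \<in> I" "b \<in> I" "a \<noteq> b" "d $ a \<noteq> 0" "d $ b \<noteq> 0" "\<bar>d $ b\<bar> \<le> \<bar>d $ a\<bar>"
      by (metis linear)
    \<comment> \<open>With this sign the shear replaces \<open>|d a|\<close> by
      \<open>|d a| - |d b|\<close>.\<close>
    define s where "s = sgn (d $ a) * sgn (d $ b)"
    define c' where "c' = (\<chi> i. c $ i + (if i = b then s * c $ a else 0))"
    define d' where "d' = (\<chi> i. d $ i - (if i = a then s * d $ b else 0))"
    have r: "rowact (c, d) (shear a b s) = (c', d')"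
      using ab by (simp add: rowact_shear c'_def d'_def)
    show ?thesis
    proof (rule reducible_step[OF r])
      show "\<forall>i. i \<notin> I \<longrightarrow> d' $ i = d $ i" using ab by (auto simp: d'_def)
      show "shear a b s ** g \<in> RI I k" if "g \<in> RI I k" for g using that ab by (intro RI.shear)
      show "reducible I k j c' d'"
      proof (rule dec)
        show "(\<Sum>i\<in>I. nat \<bar>d' $ i\<bar>) < (\<Sum>i\<in>I. nat \<bar>d $ i\<bar>)"
          by (rule sumless[of a]) (use ab in \<open>auto simp: d'_def s_def sgn_if abs_if split: if_splits\<close>)
        show "\<exists>i\<in>I. d' $ i \<noteq> 0" using ab by (intro bexI[of _ b]) (auto simp: d'_def)
        show "admissible I k c' d'"
          unfolding admissible_def
        proof (intro conjI allI impI)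
          show "k dvd c' $ i" for i using adm by (auto simp: c'_def)
          show "c' $ i = 0" if "i \<notin> I" for i using that ab adm by (auto simp: c'_def)
          fix p assume p: "\<forall>i\<in>I. p dvd c' $ i \<and> p dvd d' $ i"
          have pa: "p dvd c $ a" using p ab by (force simp: c'_def)
          have pb: "p dvd d $ b" using p ab by (force simp: d'_def)
          have "p dvd c' $ i" "p dvd d' $ i" if "i \<in> I" for i using p that by auto
          then show "p dvd 1"
          proof (intro unim conjI)
            fix i assume i: "i \<in> I" and *: "\<And>i. i \<in> I \<Longrightarrow> p dvd c' $ i" "\<And>i. i \<in> I \<Longrightarrow> p dvd d' $ i"
            show "p dvd c $ i" using *(1)[OF i] pa by (auto simp: c'_def dvd_add_left_iff split: if_splits)
            show "p dvd d $ i" using *(2)[OF i] pb by (auto simp: d'_def dvd_diff_left_iff split: if_splits)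
          qed
        qed
      qed
    qed
  next
    case False
    obtain a where a: "a \<in> I" "d $ a \<noteq> 0" using less.prems by blast
    have d0: "d $ i = 0" if "i \<in> I" "i \<noteq> a" for i using False a that by blast
    show ?thesis
    proof (cases "\<forall>i\<in>I. c $ i = 0")
      case True
      have c0: "c = 0" using True adm(2) by (auto simp: vec_eq_iff)
      have "d $ a dvd 1" using unim[of "d $ a"] d0 c0 by (metis dvd_0_right dvd_refl zero_index)
      then have da: "d $ a = 1 \<or> d $ a = -1" by (simp add: zdvd1_eq abs_if split: if_splits)
      show ?thesis
      proof (cases "a = j")
        case True
        show ?thesis
        proof (cases "d $ a = 1")
          case True
          then have "rowact (c, d) (mat 1) = (0, d) \<and> (\<forall>i\<in>I. d $ i = (if i = j then 1 else 0))"
            using d0 c0 \<open>a = j\<close> by auto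
          then show ?thesis unfolding reducible_def using RI.one by blast
        next
          case False
          then have "d $ a = -1" using da by simp
          then have "rowact (c, d) (flip a ** mat 1) = (0, \<chi> i. if i = a then 1 else d $ i)"
            by (auto simp: rowact_flip c0 vec_eq_iff)
          moreover have "flip a ** mat 1 \<in> RI I k" using a by (intro RI.flip RI.one)
          ultimately show ?thesis unfolding reducible_def using d0 \<open>a = j\<close> a by force
        qed
      next
        case False
        \<comment> \<open>The first shear puts the square of the unit, which is 1 for either sign,
          at position \<open>j\<close>; the second clears position \<open>a\<close>.\<close>
        have "rowact (c, d) (shear j a (- d $ a) ** (shear a j (d $ a) ** mat 1)) =
            (0, \<chi> i. if i = j then 1 else if i = a then 0 else d $ i)"
          using False da d0[OF assms(2)] by (auto simp: rowact_mult rowact_shear c0 vec_eq_iff)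
        moreover have "shear j a (- d $ a) ** (shear a j (d $ a) ** mat 1) \<in> RI I k"
          using a assms(2) False by (intro RI.shear RI.one) auto
        ultimately show ?thesis unfolding reducible_def using d0 a assms(2) by (auto 0 3 intro!: bexI)
      qed
    next
      case False
      \<comment> \<open>Position \<open>a\<close> is treated first. For \<open>b\<close> different
        from \<open>a\<close> both \<open>d b\<close> and \<open>c a\<close> are zero, so the
        symmetric translations in \<open>a\<close> and \<open>b\<close> change only
        \<open>c b\<close>, respectively only \<open>d a\<close>.\<close>
      obtain b where b: "b \<in> I" "c $ b \<noteq> 0" "b = a \<or> c $ a = 0"
        using False a by blast
      have odd: "k = 2 \<longrightarrow> odd (d $ a)"
      proof (intro impI notI)
        assume k: "k = 2" "even (d $ a)"
        then have "2 dvd (1::int)" using unim[of 2] adm(1) d0 by (metis dvd_0_right)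
        then show False by simp
      qed
      obtain s where s: "\<bar>c $ b + k * s * d $ a\<bar> < \<bar>d $ a\<bar>"
        using reduce_mod[OF assms(1) a(2) adm(1) odd] by blast
      define c' where "c' = (\<chi> i. c $ i + (if i = b then k * s * d $ a else 0))"
      have db: "b = a \<or> d $ b = 0" using d0 b by blast
      have r: "rowact (c, d) (lS (Sm a b (k * s))) = (c', d)"
        using db by (auto simp: rowact_lS c'_def vec_eq_iff)
      have adm': "admissible I k c' d"
        unfolding admissible_def
      proof (intro conjI allI impI)
        show "k dvd c' $ i" for i using adm by (auto simp: c'_def)
        show "c' $ i = 0" if "i \<notin> I" for i using that b adm by (auto simp: c'_def)
        fix p assume p: "\<forall>i\<in>I. p dvd c' $ i \<and> p dvd d $ i"
        then have "p dvd d $ a" using a by blast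
        then show "p dvd 1" using p
          by (intro unim) (auto simp: c'_def dvd_add_left_iff split: if_splits)
      qed
      show ?thesis
      proof (rule reducible_step[OF r])
        show "\<forall>i. i \<notin> I \<longrightarrow> d $ i = d $ i" by simp
        show "lS (Sm a b (k * s)) ** g \<in> RI I k" if "g \<in> RI I k" for g using that a b by (intro RI.l)
        show "reducible I k j c' d"
        proof (cases "c' $ b = 0")
          case True
          have "{i\<in>I. c' $ i \<noteq> 0} \<subset> {i\<in>I. c $ i \<noteq> 0}"
            using True b by (auto simp: c'_def split: if_splits)
          then have "card {i\<in>I. c' $ i \<noteq> 0} < card {i\<in>I. c $ i \<noteq> 0}"
            by (intro psubset_card_mono) auto
          then show ?thesis using less.hyps[OF _ adm'] less.prems by simp
        next
          case False
          obtain s' where s': "d $ a + s' * c' $ b \<noteq> 0" "\<bar>d $ a + s' * c' $ b\<bar> < \<bar>d $ a\<bar>"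
            using reduce_euclid[OF False, of "d $ a"] s by (auto simp: c'_def)
          define d' where "d' = (\<chi> i. d $ i + (if i = a then s' * c' $ b else 0))"
          have r': "rowact (c', d) (tS (Sm a b s')) = (c', d')"
            using b(3) by (auto simp: rowact_tS d'_def c'_def vec_eq_iff)
          show ?thesis
          proof (rule reducible_step[OF r'])
            show "\<forall>i. i \<notin> I \<longrightarrow> d' $ i = d $ i" using a by (auto simp: d'_def)
            show "tS (Sm a b s') ** g \<in> RI I k" if "g \<in> RI I k" for g using that a b by (intro RI.t)
            show "reducible I k j c' d'"
            proof (rule dec)
              show "(\<Sum>i\<in>I. nat \<bar>d' $ i\<bar>) < (\<Sum>i\<in>I. nat \<bar>d $ i\<bar>)"
                by (rule sumless[of a]) (use a s' in \<open>auto simp: d'_def\<close>)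
              show "\<exists>i\<in>I. d' $ i \<noteq> 0" using a s' by (intro bexI[of _ a]) (auto simp: d'_def)
              show "admissible I k c' d'"
                unfolding admissible_def
              proof (intro conjI allI impI)
                show "k dvd c' $ i" for i using adm' by (auto simp: admissible_def)
                show "c' $ i = 0" if "i \<notin> I" for i using adm' that by (auto simp: admissible_def)
                fix p assume p: "\<forall>i\<in>I. p dvd c' $ i \<and> p dvd d' $ i"
                then have "p dvd c' $ b" using b by blast
                then have "\<forall>i\<in>I. p dvd c' $ i \<and> p dvd d $ i" using p
                  by (auto simp: d'_def dvd_add_left_iff split: if_splits)
                then show "p dvd 1" using adm' by (auto simp: admissible_def)
              qed
            qed
          qed
        qed
      qed
    qed
  qed
qed

text \<open>If \<open>d\<close> vanishes on \<open>I\<close>, primitivity of \<open>c\<close> forces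
  \<open>k = 1\<close>, and one upper translation copies a nonzero entry of \<open>c\<close> into
  \<open>d\<close>.\<close>

lemma row_reduce':
  assumes "k = 1 \<or> k = 2" "j \<in> I" "admissible I k c d"
  shows "reducible I k j c d"
proof (cases "\<exists>i\<in>I. d $ i \<noteq> 0")
  case True then show ?thesis using row_reduce assms by blast
next
  case False
  have adm: "k dvd c $ i" "i \<notin> I \<Longrightarrow> c $ i = 0" for i using assms by (auto simp: admissible_def)
  have unim: "p dvd 1" if "\<And>i. i \<in> I \<Longrightarrow> p dvd c $ i" for p
    using assms that False by (auto simp: admissible_def)
  have k: "k = 1" using unim[of k] adm assms(1) by auto
  obtain a where a: "a \<in> I" "c $ a \<noteq> 0" using unim[of 0] by fastforce
  define d' where "d' = (\<chi> i. d $ i + (if i = a then 1 * c $ a else 0))"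
  have r: "rowact (c, d) (tS (Sm a a 1)) = (c, d')"
    by (auto simp: rowact_tS d'_def vec_eq_iff)
  show ?thesis
  proof (rule reducible_step[OF r])
    show "\<forall>i. i \<notin> I \<longrightarrow> d' $ i = d $ i" using a by (auto simp: d'_def)
    show "tS (Sm a a 1) ** g \<in> RI I k" if "g \<in> RI I k" for g using that a by (intro RI.t)
    show "reducible I k j c d'"
    proof (rule row_reduce[OF assms(1,2)])
      show "\<exists>i\<in>I. d' $ i \<noteq> 0" using a False by (intro bexI[of _ a]) (auto simp: d'_def)
      show "admissible I k c d'"
        unfolding admissible_def using adm unim by blast
    qed
  qed
qed

section \<open>Reduction of the bottom rows of a symplectic matrix\<close>

lemma Sp6_right:
  assumes "\<gamma> \<in> Sp6"
  shows "blockA \<gamma> ** transpose (blockD \<gamma>) - blockB \<gamma> ** transpose (blockC \<gamma>) = mat 1"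
    and "blockC \<gamma> ** transpose (blockD \<gamma>) = blockD \<gamma> ** transpose (blockC \<gamma>)"
proof -
  have "mk (blockA \<gamma>) (blockB \<gamma>) (blockC \<gamma>) (blockD \<gamma>) ** sp_inv \<gamma> = mk (mat 1) 0 0 (mat 1)"
    using sp_inv_right[OF assms] by (simp add: mk_blocks mat_mk)
  then show "blockA \<gamma> ** transpose (blockD \<gamma>) - blockB \<gamma> ** transpose (blockC \<gamma>) = mat 1"
    "blockC \<gamma> ** transpose (blockD \<gamma>) = blockD \<gamma> ** transpose (blockC \<gamma>)"
    by (simp_all add: sp_inv_def mk_mult mk_eq_iff mat_distribs)
qed

definition unit_rows :: "3 set \<Rightarrow> int^(3 + 3)^(3 + 3) \<Rightarrow> bool"
  where "unit_rows J \<gamma> \<longleftrightarrow> (\<forall>i\<in>J. blockC \<gamma> $ i = 0 \<and> blockD \<gamma> $ i = axis i 1)"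

text \<open>Entries of row \<open>j\<close> at the processed positions are removed with its own unit
  entry. The shear adds to column \<open>a\<close> of \<open>D\<close> a multiple of column
  \<open>j\<close>, where the earlier unit rows have a zero.\<close>

lemma clear_row:
  assumes "finite K" "K \<subseteq> J" "j \<notin> J" "blockC \<gamma> $ j = 0" "unit_rows J \<gamma>" "blockD \<gamma> $ j $ j = 1"
    "\<forall>i. i \<notin> J \<longrightarrow> i \<noteq> j \<longrightarrow> blockD \<gamma> $ j $ i = 0"
  shows "\<exists>g\<in>Mon k. unit_rows J (\<gamma> ** g) \<and> blockC (\<gamma> ** g) $ j = 0 \<and> blockD (\<gamma> ** g) $ j $ j = 1 \<and>
    (\<forall>i. (i \<notin> J \<or> i \<in> K) \<longrightarrow> i \<noteq> j \<longrightarrow> blockD (\<gamma> ** g) $ j $ i = 0)"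
  using assms(1,2)
proof (induction K rule: finite_induct)
  case empty
  then show ?case using assms Mon.one by (intro bexI[of _ "mat 1"]) auto
next
  case (insert a K)
  then obtain g where g: "g \<in> Mon k" "unit_rows J (\<gamma> ** g)" "blockC (\<gamma> ** g) $ j = 0"
    "blockD (\<gamma> ** g) $ j $ j = 1"
    "\<And>i. (i \<notin> J \<or> i \<in> K) \<Longrightarrow> i \<noteq> j \<Longrightarrow> blockD (\<gamma> ** g) $ j $ i = 0" by auto
  have aj: "a \<noteq> j" using insert assms by auto
  define h where "h = shear a j (blockD (\<gamma> ** g) $ j $ a)"
  have rows: "(blockC (\<gamma> ** (g ** h)) $ i, blockD (\<gamma> ** (g ** h)) $ i) =
      rowact (blockC (\<gamma> ** g) $ i, blockD (\<gamma> ** g) $ i) h" for i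
    by (simp add: row_mult matrix_mul_assoc flip: row_mult)
  have J: "(blockC (\<gamma> ** (g ** h)) $ i, blockD (\<gamma> ** (g ** h)) $ i) = (0, axis i 1)" if "i \<in> J" for i
    unfolding rows using g(2) that aj assms(3)
    by (auto simp: unit_rows_def h_def rowact_shear vec_eq_iff axis_def)
  have j: "(blockC (\<gamma> ** (g ** h)) $ j, blockD (\<gamma> ** (g ** h)) $ j) =
     (0, \<chi> i. if i = a then 0 else blockD (\<gamma> ** g) $ j $ i)"
    unfolding rows using g aj by (auto simp: h_def rowact_shear vec_eq_iff)
  show ?case
  proof (intro bexI[of _ "g ** h"] conjI allI impI)
    show "unit_rows J (\<gamma> ** (g ** h))" using J by (auto simp: unit_rows_def)
    show "g ** h \<in> Mon k" using g aj by (auto simp: h_def intro!: Mon_mult Mon_shear)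
    show "blockC (\<gamma> ** (g ** h)) $ j = 0" using j by simp
    show "blockD (\<gamma> ** (g ** h)) $ j $ j = 1" using j g aj by simp
    show "blockD (\<gamma> ** (g ** h)) $ j $ i = 0" if "i \<notin> J \<or> i \<in> insert a K" "i \<noteq> j" for i
      using j g(5)[of i] that by auto
  qed
qed

lemma row_stage:
  assumes k: "k = 1 \<or> k = 2" and \<gamma>: "\<gamma> \<in> Sp6" "\<And>i l. k dvd blockC \<gamma> $ i $ l"
    and J: "unit_rows J \<gamma>" "j \<notin> J"
  shows "\<exists>g\<in>Mon k. unit_rows (insert j J) (\<gamma> ** g)"
proof -
  \<comment> \<open>Isotropy against the earlier rows \<open>(0, e_i)\<close> kills the
    \<open>C\<close> entries of row \<open>j\<close> at the processed positions, and the next fact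
    does the same for \<open>A\<close>. The entry \<open>(j, j)\<close> of
    \<open>A D^t - B C^t = 1\<close> then involves only positions outside \<open>J\<close>, so the
    row is primitive there.\<close>
  have cj: "blockC \<gamma> $ j $ i = 0" if "i \<in> J" for i
  proof -
    have "(blockC \<gamma> ** transpose (blockD \<gamma>)) $ j $ i = (blockD \<gamma> ** transpose (blockC \<gamma>)) $ j $ i"
      by (simp add: Sp6_right[OF \<gamma>(1)])
    then show ?thesis
      using J that by (simp add: unit_rows_def matrix_matrix_mult_def transpose_def axis_def if_distrib cong: if_cong)
  qed
  have aj: "blockA \<gamma> $ j $ i = 0" if "i \<in> J" for i
  proof -
    have "(blockA \<gamma> ** transpose (blockD \<gamma>) - blockB \<gamma> ** transpose (blockC \<gamma>)) $ j $ i = mat 1 $ j $ i"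
      by (simp add: Sp6_right[OF \<gamma>(1)])
    moreover have "j \<noteq> i" using that J by auto
    ultimately show ?thesis
      using J that by (simp add: unit_rows_def matrix_matrix_mult_def transpose_def axis_def mat_def if_distrib cong: if_cong)
  qed
  have "admissible (- J) k (blockC \<gamma> $ j) (blockD \<gamma> $ j)"
    unfolding admissible_def
  proof (intro conjI allI impI)
    show "k dvd blockC \<gamma> $ j $ i" for i by (rule \<gamma>)
    show "blockC \<gamma> $ j $ i = 0" if "i \<notin> - J" for i using that cj by simp
    fix p assume p: "\<forall>i\<in>-J. p dvd blockC \<gamma> $ j $ i \<and> p dvd blockD \<gamma> $ j $ i"
    have "(blockA \<gamma> ** transpose (blockD \<gamma>) - blockB \<gamma> ** transpose (blockC \<gamma>)) $ j $ j = mat 1 $ j $ j"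
      by (simp add: Sp6_right[OF \<gamma>(1)])
    then have one: "1 = (\<Sum>i\<in>UNIV. blockA \<gamma> $ j $ i * blockD \<gamma> $ j $ i) - (\<Sum>i\<in>UNIV. blockB \<gamma> $ j $ i * blockC \<gamma> $ j $ i)"
      by (simp add: matrix_matrix_mult_def transpose_def mat_def)
    have "p dvd blockA \<gamma> $ j $ i * blockD \<gamma> $ j $ i" for i using p aj by (cases "i \<in> J") auto
    moreover have "p dvd blockB \<gamma> $ j $ i * blockC \<gamma> $ j $ i" for i using p cj by (cases "i \<in> J") auto
    ultimately have "p dvd (\<Sum>i\<in>UNIV. blockA \<gamma> $ j $ i * blockD \<gamma> $ j $ i) - (\<Sum>i\<in>UNIV. blockB \<gamma> $ j $ i * blockC \<gamma> $ j $ i)"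
      by (intro dvd_diff dvd_sum)
    then show "p dvd 1" by (simp only: one[symmetric])
  qed
  then have "reducible (- J) k j (blockC \<gamma> $ j) (blockD \<gamma> $ j)"
    using k J by (intro row_reduce') auto
  then obtain g d' where g: "g \<in> RI (- J) k" "rowact (blockC \<gamma> $ j, blockD \<gamma> $ j) g = (0, d')"
    "\<forall>i\<in>-J. d' $ i = (if i = j then 1 else 0)"
    unfolding reducible_def by blast
  have "unit_rows J (\<gamma> ** g)"
    unfolding unit_rows_def
  proof
    fix i assume i: "i \<in> J"
    have "(blockC (\<gamma> ** g) $ i, blockD (\<gamma> ** g) $ i) = rowact (0, axis i 1) g"
      using J i by (simp add: row_mult unit_rows_def)
    also have "\<dots> = (0, axis i 1)" using g(1) i by (intro RI_fix) (auto simp: axis_def)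
    finally show "blockC (\<gamma> ** g) $ i = 0 \<and> blockD (\<gamma> ** g) $ i = axis i 1" by simp
  qed
  moreover have "(blockC (\<gamma> ** g) $ j, blockD (\<gamma> ** g) $ j) = (0, d')"
    using g by (simp add: row_mult)
  ultimately obtain h where h: "h \<in> Mon k" "unit_rows J (\<gamma> ** g ** h)" "blockC (\<gamma> ** g ** h) $ j = 0"
    "blockD (\<gamma> ** g ** h) $ j $ j = 1" "\<And>i. i \<noteq> j \<Longrightarrow> blockD (\<gamma> ** g ** h) $ j $ i = 0"
    using clear_row[of J J j "\<gamma> ** g" k] g(3) J by auto
  have "unit_rows (insert j J) (\<gamma> ** (g ** h))"
    using h by (auto simp: unit_rows_def matrix_mul_assoc vec_eq_iff axis_def)
  then show ?thesis using h(1) RI_Mon[OF g(1)] Mon_mult by blast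
qed

text \<open>After three stages the product has \<open>C = 0\<close> and \<open>D = 1\<close>, so it
  is a translation by a symmetric matrix; solving for gamma gives membership.\<close>

theorem Mon_eq:
  assumes "k = 1 \<or> k = 2" "\<gamma> \<in> Sp6" "\<And>i l. k dvd blockC \<gamma> $ i $ l"
  shows "\<gamma> \<in> Mon k"
proof -
  have stage: "\<exists>g\<in>Mon k. unit_rows (insert j J) (\<gamma> ** g)"
    if g: "g \<in> Mon k" "unit_rows J (\<gamma> ** g)" "j \<notin> J" for g J j
  proof -
    have "\<gamma> ** g \<in> Sp6" using assms g Mon_subset Sp6_mult by blast
    moreover have "k dvd blockC (\<gamma> ** g) $ i $ l" for i l
      using assms(3) Mon_subset[OF g(1)]
      by (auto simp: blockC_mult) (auto simp: matrix_matrix_mult_def intro!: dvd_add dvd_sum)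
    ultimately obtain h where "h \<in> Mon k" "unit_rows (insert j J) (\<gamma> ** g ** h)"
      using row_stage[OF assms(1) _ _ g(2,3)] by blast
    then show ?thesis using g by (metis Mon_mult matrix_mul_assoc)
  qed
  obtain g1 where "g1 \<in> Mon k" "unit_rows {1} (\<gamma> ** g1)"
    using stage[of "mat 1" "{}" 1] Mon.one by (auto simp: unit_rows_def)
  then obtain g2 where "g2 \<in> Mon k" "unit_rows {2, 1} (\<gamma> ** g2)" using stage[of g1 "{1}" 2] by auto
  then obtain g where g: "g \<in> Mon k" "unit_rows {3, 2, 1} (\<gamma> ** g)" using stage[of g2 "{2, 1}" 3] by auto
  define \<delta> where "\<delta> = \<gamma> ** g"
  have \<delta>: "\<delta> \<in> Sp6" using assms g Mon_subset Sp6_mult by (auto simp: \<delta>_def)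
  have C: "blockC \<delta> = 0" and D: "blockD \<delta> = mat 1"
    using g(2) by (auto simp: \<delta>_def unit_rows_def vec_eq_iff forall_3 axis_def mat_def)
  have eq: "\<delta> = mk (blockA \<delta>) (blockB \<delta>) 0 (mat 1)" using C D mk_blocks by metis
  then have "blockA \<delta> = mat 1 \<and> transpose (blockB \<delta>) = blockB \<delta>"
    using \<delta> Sp6_mk[of "blockA \<delta>" "blockB \<delta>" 0 "mat 1"]
    by (simp add: transpose_mat) (metis transpose_mat transpose_transpose)
  then have "\<delta> = tS (blockB \<delta>)" "transpose (blockB \<delta>) = blockB \<delta>" using eq by (simp_all add: tS_def)
  then have "\<delta> \<in> Mon k" using Mon_tS by metis
  moreover obtain h where h: "h \<in> Mon k" "g ** h = mat 1" using Mon_inverse[OF g(1)] by blast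
  have "\<gamma> = \<delta> ** h" using h(2) by (simp add: \<delta>_def flip: matrix_mul_assoc)
  ultimately show ?thesis using h Mon_mult by simp
qed

section \<open>Inversion of one-dimensional theta series\<close>

lemma summable_exp_minus_abs_int: "(\<lambda>n::int. exp (- \<bar>real_of_int n\<bar>)) summable_on UNIV"
proof -
  have *: "(\<lambda>n::nat. exp (- real n)) summable_on UNIV"
  proof -
    have "summable (\<lambda>n::nat. exp (-1 :: real) ^ n)" by (rule summable_geometric) simp
    then have "summable (\<lambda>n::nat. exp (- real n))" by (simp flip: exp_of_nat_mult)
    then show ?thesis by (simp add: summable_on_UNIV_nonneg_real_iff)
  qed
  have 1: "(\<lambda>n::int. exp (- \<bar>real_of_int n\<bar>)) summable_on range int"
    by (subst summable_on_reindex) (use * in \<open>auto simp: o_def\<close>)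
  have 2: "(\<lambda>n::int. exp (- \<bar>real_of_int n\<bar>)) summable_on range (\<lambda>n. - int n)"
    by (subst summable_on_reindex) (use * in \<open>auto simp: o_def inj_on_def\<close>)
  have "(UNIV :: int set) = range int \<union> range (\<lambda>n. - int n)"
    by (auto simp: image_iff) (metis int_cases2)
  with summable_on_union[OF 1 2] show ?thesis by simp
qed

definition gterm :: "complex \<Rightarrow> complex \<Rightarrow> complex \<Rightarrow> int \<Rightarrow> complex"
  where "gterm \<alpha> \<beta> \<gamma> n = exp (of_real pi * \<i> * (\<alpha> * (of_int n)\<^sup>2 + 2 * \<beta> * of_int n + \<gamma>))"

text \<open>A majorant that is uniform for parameters in a compact set: completing the square lets
  the quadratic term absorb the linear one together with an extra \<open>|n|\<close>.\<close>

lemma norm_gterm_le: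
  assumes "a > 0" "a \<le> Im \<alpha>" "\<bar>Im \<beta>\<bar> \<le> b" "- c \<le> Im \<gamma>"
  shows "norm (gterm \<alpha> \<beta> \<gamma> n) \<le> exp ((2 * pi * b + 1)\<^sup>2 / (4 * pi * a) + pi * c) * exp (- \<bar>real_of_int n\<bar>)"
proof -
  define x where "x = real_of_int n"
  have n: "norm (gterm \<alpha> \<beta> \<gamma> n) = exp (- pi * (Im \<alpha> * x\<^sup>2 + 2 * Im \<beta> * x + Im \<gamma>))"
    by (simp add: gterm_def x_def Re_exp norm_exp_eq_Re power2_eq_square algebra_simps)
  have 1: "a * \<bar>x\<bar>\<^sup>2 \<le> Im \<alpha> * x\<^sup>2" using assms(2) by (simp add: mult_right_mono)
  have "\<bar>2 * Im \<beta> * x\<bar> \<le> 2 * b * \<bar>x\<bar>" using assms(3) by (simp add: abs_mult mult_right_mono)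
  then have 2: "- (2 * b * \<bar>x\<bar>) \<le> 2 * Im \<beta> * x" by linarith
  have "a * \<bar>x\<bar>\<^sup>2 - 2 * b * \<bar>x\<bar> - c \<le> Im \<alpha> * x\<^sup>2 + 2 * Im \<beta> * x + Im \<gamma>"
    using 1 2 assms(4) by linarith
  then have 3: "- pi * (Im \<alpha> * x\<^sup>2 + 2 * Im \<beta> * x + Im \<gamma>) \<le> - pi * (a * \<bar>x\<bar>\<^sup>2 - 2 * b * \<bar>x\<bar> - c)"
    by (simp add: mult_left_mono)
  have "0 \<le> (2 * pi * a * \<bar>x\<bar> - (2 * pi * b + 1))\<^sup>2" by simp
  then have "4 * pi * a * ((2 * pi * b + 1) * \<bar>x\<bar>) \<le> 4 * pi * a * (pi * a * \<bar>x\<bar>\<^sup>2) + (2 * pi * b + 1)\<^sup>2"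
    by (simp add: power2_eq_square algebra_simps)
  then have "(2 * pi * b + 1) * \<bar>x\<bar> - pi * a * \<bar>x\<bar>\<^sup>2 \<le> (2 * pi * b + 1)\<^sup>2 / (4 * pi * a)"
    using assms(1) by (simp add: field_simps)
  then have "- pi * (a * \<bar>x\<bar>\<^sup>2 - 2 * b * \<bar>x\<bar> - c) \<le> (2 * pi * b + 1)\<^sup>2 / (4 * pi * a) + pi * c - \<bar>x\<bar>"
    by (simp add: algebra_simps)
  from order_trans[OF 3 this] show ?thesis
    unfolding n x_def[symmetric] exp_add[symmetric] by simp
qed

lemma gterm_abs_summable:
  assumes "Im \<alpha> > 0" shows "(\<lambda>n. norm (gterm \<alpha> \<beta> \<gamma> n)) summable_on UNIV"
  using norm_gterm_le[of "Im \<alpha>" \<alpha> \<beta> "\<bar>Im \<beta>\<bar>" "- Im \<gamma>" \<gamma>] assms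
  by (intro Infinite_Sum.abs_summable_on_comparison_test'
      [OF summable_on_cmult_right[OF summable_exp_minus_abs_int,
          of "exp ((2 * pi * \<bar>Im \<beta>\<bar> + 1)\<^sup>2 / (4 * pi * Im \<alpha>) + pi * - Im \<gamma>)"]]) auto

lemma holomorphic_infsum_gterm:
  assumes "open S" "\<alpha> holomorphic_on S" "\<beta> holomorphic_on S" "\<gamma> holomorphic_on S"
    and pos: "\<And>w. w \<in> S \<Longrightarrow> Im (\<alpha> w) > 0"
  shows "(\<lambda>w. \<Sum>\<^sub>\<infinity>n. gterm (\<alpha> w) (\<beta> w) (\<gamma> w) n) holomorphic_on S"
proof -
  have "(\<lambda>w. \<Sum>\<^sub>\<infinity>n. gterm (\<alpha> w) (\<beta> w) (\<gamma> w) n) field_differentiable at z" if z: "z \<in> S" for z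
  proof -
    obtain r where r: "r > 0" "cball z r \<subseteq> S" using assms(1) z open_contains_cball by blast
    have c: "continuous_on (cball z r) \<alpha>" "continuous_on (cball z r) \<beta>" "continuous_on (cball z r) \<gamma>"
      using assms r holomorphic_on_imp_continuous_on continuous_on_subset by blast+
    have ne: "cball z r \<noteq> {}" using r by simp
    have ci: "continuous_on (cball z r) (\<lambda>w. Im (\<alpha> w))" "continuous_on (cball z r) (\<lambda>w. \<bar>Im (\<beta> w)\<bar>)"
      "continuous_on (cball z r) (\<lambda>w. Im (\<gamma> w))"
      using c by (auto intro!: continuous_intros)
    obtain w0 where w0: "w0 \<in> cball z r" "\<And>w. w \<in> cball z r \<Longrightarrow> Im (\<alpha> w0) \<le> Im (\<alpha> w)"
      using continuous_attains_inf[OF compact_cball ne ci(1)] by blast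
    obtain w1 where w1: "\<And>w. w \<in> cball z r \<Longrightarrow> \<bar>Im (\<beta> w)\<bar> \<le> \<bar>Im (\<beta> w1)\<bar>"
      using continuous_attains_sup[OF compact_cball ne ci(2)] by blast
    obtain w2 where w2: "\<And>w. w \<in> cball z r \<Longrightarrow> Im (\<gamma> w2) \<le> Im (\<gamma> w)"
      using continuous_attains_inf[OF compact_cball ne ci(3)] by blast
    define M where "M = (\<lambda>n::int. exp ((2 * pi * \<bar>Im (\<beta> w1)\<bar> + 1)\<^sup>2 / (4 * pi * Im (\<alpha> w0)) + pi * - Im (\<gamma> w2))
       * exp (- \<bar>real_of_int n\<bar>))"
    have M: "M summable_on UNIV"
      unfolding M_def by (intro summable_on_cmult_right summable_exp_minus_abs_int)
    have "uniform_limit (cball z r) (\<lambda>X w. \<Sum>n\<in>X. gterm (\<alpha> w) (\<beta> w) (\<gamma> w) n)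
        (\<lambda>w. \<Sum>\<^sub>\<infinity>n. gterm (\<alpha> w) (\<beta> w) (\<gamma> w) n) (finite_subsets_at_top UNIV)"
    proof (rule Weierstrass_m_test_general[OF _ M])
      fix n w assume "w \<in> cball z r"
      then show "norm (gterm (\<alpha> w) (\<beta> w) (\<gamma> w) n) \<le> M n"
        unfolding M_def using w0 w1 w2 r pos by (intro norm_gterm_le) auto
    qed
    moreover have "continuous_on (cball z r) (\<lambda>w. \<Sum>n\<in>X. gterm (\<alpha> w) (\<beta> w) (\<gamma> w) n) \<and>
       (\<lambda>w. \<Sum>n\<in>X. gterm (\<alpha> w) (\<beta> w) (\<gamma> w) n) holomorphic_on ball z r" for X
    proof
      show "continuous_on (cball z r) (\<lambda>w. \<Sum>n\<in>X. gterm (\<alpha> w) (\<beta> w) (\<gamma> w) n)"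
        unfolding gterm_def using c by (intro continuous_intros)
      have "ball z r \<subseteq> S" using r by auto
      then show "(\<lambda>w. \<Sum>n\<in>X. gterm (\<alpha> w) (\<beta> w) (\<gamma> w) n) holomorphic_on ball z r"
        unfolding gterm_def using assms holomorphic_on_subset by (intro holomorphic_intros) blast+
    qed
    ultimately obtain "(\<lambda>w. \<Sum>\<^sub>\<infinity>n. gterm (\<alpha> w) (\<beta> w) (\<gamma> w) n) holomorphic_on ball z r"
      using holomorphic_uniform_limit[of z r "\<lambda>X w. \<Sum>n\<in>X. gterm (\<alpha> w) (\<beta> w) (\<gamma> w) n"
          "finite_subsets_at_top UNIV"] by auto
    then show ?thesis
      using r by (auto intro: holomorphic_on_imp_differentiable_at)
  qed
  then show ?thesis
    by (simp add: field_differentiable_at_within holomorphic_on_def)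
qed

section \<open>Uniqueness of Fourier coefficients\<close>

lemma periodic_int:
  assumes "\<And>x::real. h (x + 1) = h x" shows "h (x + of_int k) = h x"
proof (induction k rule: int_induct[of _ 0])
  case (step1 i)
  then show ?case using assms[of "x + of_int i"] by (simp add: add.assoc)
next
  case (step2 i)
  then show ?case using assms[of "x + of_int (i - 1)"] by (simp add: add.assoc)
qed simp

text \<open>The functions \<open>u\<close> for which \<open>h u\<close> is orthogonal to every
  character are stable under multiplication by real polynomials on the circle. By Stone-Weierstrass
  such polynomials approximate the conjugate of \<open>h\<close>, so the integral of
  \<open>|h|^2\<close> is below every positive bound.\<close>

lemma fourier_uniqueness:
  fixes h :: "real \<Rightarrow> complex"
  assumes cont: "continuous_on UNIV h" and per: "\<And>x. h (x + 1) = h x"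
    and zero: "\<And>m::int. integral {0..1} (\<lambda>x. h x * cis (2 * pi * of_int m * x)) = 0"
  shows "h x = 0"
proof -
  have ch: "continuous_on A h" for A using cont continuous_on_subset by blast
  define Z where "Z = {u :: real \<Rightarrow> complex. continuous_on {0..1} u \<and>
    (\<forall>m::int. integral {0..1} (\<lambda>x. h x * u x * cis (2 * pi * of_int m * x)) = 0)}"
  define R where "R = (\<lambda>q::complex \<Rightarrow> real. \<forall>u\<in>Z. (\<lambda>x. of_real (q (cis (2 * pi * x))) * u x) \<in> Z)"
  have int: "(\<lambda>x. h x * u x * cis (2 * pi * of_int m * x)) integrable_on {0..1}"
    if "continuous_on {0..1} u" for u and m :: int
    using that ch[of "{0..1}"] by (intro integrable_continuous_real continuous_intros) auto
  have Zadd: "(\<lambda>x. u x + v x) \<in> Z" if "u \<in> Z" "v \<in> Z" for u v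
    using that int[of u] int[of v]
    by (auto simp: Z_def distrib_left distrib_right integral_add intro!: continuous_intros)
  have Zscale: "(\<lambda>x. c * u x) \<in> Z" if "u \<in> Z" for u c
  proof -
    have "integral {0..1} (\<lambda>x. h x * (c * u x) * cis (2 * pi * of_int m * x)) =
        c * integral {0..1} (\<lambda>x. h x * u x * cis (2 * pi * of_int m * x))" for m :: int
      by (subst integral_mult_right[symmetric]) (simp add: mult_ac)
    with that show ?thesis by (auto simp: Z_def intro!: continuous_intros)
  qed
  have Zcis: "(\<lambda>x. cis (2 * pi * of_int k * x) * u x) \<in> Z" if "u \<in> Z" for u and k :: int
  proof -
    have "h x * (cis (2 * pi * of_int k * x) * u x) * cis (2 * pi * of_int m * x) =
          h x * u x * cis (2 * pi * of_int (k + m) * x)" for m :: int and x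
      by (simp add: algebra_simps flip: cis_mult)
    then have "(\<lambda>x. h x * (cis (2 * pi * of_int k * x) * u x) * cis (2 * pi * of_int m * x)) =
          (\<lambda>x. h x * u x * cis (2 * pi * of_int (k + m) * x))" for m :: int
      by (rule ext)
    with that show ?thesis
      unfolding Z_def mem_Collect_eq by (auto simp del: of_int_add intro!: continuous_intros)
  qed
  have R: "R q" if "real_polynomial_function q" for q
    using that
  proof induction
    case (linear f)
    define A where "A = (of_real (f 1) - \<i> * of_real (f \<i>)) / 2"
    define B where "B = (of_real (f 1) + \<i> * of_real (f \<i>)) / 2"
    have f: "f z = Re z * f 1 + Im z * f \<i>" for z
    proof -
      have "z = Re z *\<^sub>R 1 + Im z *\<^sub>R \<i>" by (simp add: complex_eq_iff)
      then have "f z = f (Re z *\<^sub>R 1 + Im z *\<^sub>R \<i>)" by simp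
      then show ?thesis
        using linear_add[OF bounded_linear.linear[OF linear]] linear_scale[OF bounded_linear.linear[OF linear]]
        by simp
    qed
    have "of_real (f (cis (2 * pi * x))) = A * cis (2 * pi * of_int 1 * x) + B * cis (2 * pi * of_int (-1) * x)" for x
    proof -
      have "f (cis (2 * pi * x)) = cos (2 * pi * x) * f 1 + sin (2 * pi * x) * f \<i>"
        using f[of "cis (2 * pi * x)"] by simp
      then show ?thesis by (simp add: A_def B_def complex_eq_iff field_simps)
    qed
    then have eq: "(\<lambda>x. of_real (f (cis (2 * pi * x))) * u x) =
        (\<lambda>x. A * (cis (2 * pi * of_int 1 * x) * u x) + B * (cis (2 * pi * of_int (-1) * x) * u x))" for u
      by (simp only: distrib_right mult.assoc)
    show ?case
      unfolding R_def eq by (intro ballI Zadd Zscale Zcis)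
  next
    case (const c)
    then show ?case by (auto simp: R_def intro!: Zscale)
  next
    case (add f g)
    then show ?case by (auto simp: R_def distrib_right intro!: Zadd)
  next
    case (mult f g)
    then show ?case by (auto simp: R_def mult.assoc)
  qed
  have one: "(\<lambda>x. 1) \<in> Z" using zero by (auto simp: Z_def)
  \<comment> \<open>The conjugate of \<open>h\<close>, transported to the unit circle. The angle
    jumps at 1, so continuity is obtained through the compact interval, whose closed subsets have
    closed images on the circle.\<close>
  define f where "f = (\<lambda>z. cnj (h (Arg2pi z / (2 * pi))))"
  have f: "f (cis (2 * pi * x)) = cnj (h x)" for x
  proof -
    define z where "z = cis (2 * pi * x)"
    have "cis (Arg2pi z) = z" using Arg2pi_eq[of z] by (simp add: z_def cis_conv_exp mult_ac)
    then have "cis (Arg2pi z) = cis (2 * pi * x)" by (simp add: z_def)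
    then have "sin (Arg2pi z) = sin (2 * pi * x) \<and> cos (Arg2pi z) = cos (2 * pi * x)"
      by (simp add: complex_eq_iff)
    then obtain n :: int where "Arg2pi z = 2 * pi * x + 2 * pi * n"
      using sin_cos_eq_iff by metis
    then have "Arg2pi z / (2 * pi) = x + of_int n" by (simp add: field_simps)
    then show ?thesis using periodic_int[of h, OF per] by (simp add: f_def z_def)
  qed
  have circle: "sphere 0 1 = (\<lambda>x. cis (2 * pi * x)) ` {0..1}"
  proof (intro equalityI subsetI)
    fix z :: complex assume z: "z \<in> sphere 0 1"
    then have "cis (Arg2pi z) = z" using Arg2pi_eq[of z] by (simp add: cis_conv_exp mult_ac)
    then have "z = cis (2 * pi * (Arg2pi z / (2 * pi)))" by simp
    moreover have "Arg2pi z / (2 * pi) \<in> {0..1}"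
      using Arg2pi_ge_0[of z] Arg2pi_lt_2pi[of z] by simp
    ultimately show "z \<in> (\<lambda>x. cis (2 * pi * x)) ` {0..1}" by blast
  qed auto
  have "continuous_on (sphere 0 1) f"
  proof (subst continuous_on_closed_gen[where T = UNIV])
    show "\<forall>U. closedin (top_of_set UNIV) U \<longrightarrow> closedin (top_of_set (sphere 0 1)) (sphere 0 1 \<inter> f -` U)"
    proof (intro allI impI)
      fix U :: "complex set" assume "closedin (top_of_set UNIV) U"
      then have U: "closed U" by simp
      have "sphere 0 1 \<inter> f -` U = (\<lambda>x. cis (2 * pi * x)) ` ({0..1} \<inter> (\<lambda>x. cnj (h x)) -` U)"
        unfolding circle by (auto simp: f)
      moreover have "closed ({0..1} \<inter> (\<lambda>x. cnj (h x)) -` U)"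
        using U ch by (intro continuous_closed_preimage continuous_intros) auto
      then have "compact ({0..1} \<inter> ({0..1} \<inter> (\<lambda>x. cnj (h x)) -` U))"
        by (intro compact_Int_closed) auto
      then have "compact ((\<lambda>x. cis (2 * pi * x)) ` ({0..1} \<inter> (\<lambda>x. cnj (h x)) -` U))"
        by (intro compact_continuous_image continuous_intros) (simp add: Int_absorb2)
      ultimately show "closedin (top_of_set (sphere 0 1)) (sphere 0 1 \<inter> f -` U)"
        by (metis Int_lower1 closed_subset compact_imp_closed)
    qed
  qed auto
  note approx = Stone_Weierstrass_polynomial_function[OF compact_sphere this]
  define B where "B = integral {0..1} (\<lambda>x. norm (h x))"
  have "integral {0..1} (\<lambda>x. (norm (h x))\<^sup>2) \<le> e * B" if e: "e > 0" for e
  proof -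
    obtain g where g: "polynomial_function g" "\<And>z. z \<in> sphere 0 1 \<Longrightarrow> norm (f z - g z) < e"
      using approx[OF e] by blast
    have 1: "R (Re \<circ> g)" "R (Im \<circ> g)"
      using g(1) by (auto intro!: R simp: polynomial_function_def bounded_linear_Re bounded_linear_Im)
    have "(\<lambda>x. of_real ((Re \<circ> g) (cis (2 * pi * x))) * 1 + \<i> * (of_real ((Im \<circ> g) (cis (2 * pi * x))) * 1)) \<in> Z"
      using bspec[OF 1(1)[unfolded R_def] one] bspec[OF 1(2)[unfolded R_def] one] by (intro Zadd Zscale)
    then have gz: "(\<lambda>x. g (cis (2 * pi * x))) \<in> Z"
      by (simp flip: complex_eq)
    then have g0: "integral {0..1} (\<lambda>x. h x * g (cis (2 * pi * x))) = 0"
      by (auto simp: Z_def dest!: spec[of _ 0])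
    have cg: "continuous_on {0..1} (\<lambda>x. g (cis (2 * pi * x)))"
      using gz by (simp add: Z_def)
    have "of_real (integral {0..1} (\<lambda>x. (norm (h x))\<^sup>2)) = integral {0..1} (\<lambda>x. h x * cnj (h x))"
    proof -
      have "(\<lambda>x. h x * cnj (h x)) = complex_of_real \<circ> (\<lambda>x. (norm (h x))\<^sup>2)"
        by (auto simp: complex_norm_square simp del: of_real_power)
      then show ?thesis
        by (simp only:) (intro integral_linear[symmetric] bounded_linear_of_real
            integrable_continuous_real continuous_intros ch)
    qed
    also have "\<dots> = integral {0..1} (\<lambda>x. h x * cnj (h x)) - integral {0..1} (\<lambda>x. h x * g (cis (2 * pi * x)))"
      by (simp add: g0)
    also have "\<dots> = integral {0..1} (\<lambda>x. h x * (f (cis (2 * pi * x)) - g (cis (2 * pi * x))))"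
      by (subst integral_diff[symmetric])
         (auto intro!: integrable_continuous_real continuous_intros ch cg simp: f right_diff_distrib)
    finally have eq: "of_real (integral {0..1} (\<lambda>x. (norm (h x))\<^sup>2)) =
       integral {0..1} (\<lambda>x. h x * (f (cis (2 * pi * x)) - g (cis (2 * pi * x))))" .
    have "norm (integral {0..1} (\<lambda>x. h x * (f (cis (2 * pi * x)) - g (cis (2 * pi * x))))) \<le>
       integral {0..1} (\<lambda>x. norm (h x) * e)"
    proof (rule integral_norm_bound_integral)
      fix x :: real
      have "norm (f (cis (2 * pi * x)) - g (cis (2 * pi * x))) < e" by (rule g(2)) simp
      then show "norm (h x * (f (cis (2 * pi * x)) - g (cis (2 * pi * x)))) \<le> norm (h x) * e"
        by (simp add: norm_mult mult_left_mono)
    qed (auto intro!: integrable_continuous_real continuous_intros ch cg simp: f)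
    also have "\<dots> = e * B" by (simp add: B_def mult.commute)
    finally have le: "norm (integral {0..1} (\<lambda>x. h x * (f (cis (2 * pi * x)) - g (cis (2 * pi * x))))) \<le> e * B" .
    have "integral {0..1} (\<lambda>x. (norm (h x))\<^sup>2) \<le> norm (complex_of_real (integral {0..1} (\<lambda>x. (norm (h x))\<^sup>2)))"
      by simp
    then show ?thesis using le unfolding eq by linarith
  qed
  note bound = this
  have "integral {0..1} (\<lambda>x. (norm (h x))\<^sup>2) \<le> 0"
  proof (rule field_le_epsilon)
    fix e :: real assume e: "e > 0"
    have B: "B \<ge> 0" unfolding B_def by (rule integral_nonneg) (auto intro!: integrable_continuous_real continuous_intros ch)
    have "integral {0..1} (\<lambda>x. (norm (h x))\<^sup>2) \<le> e / (B + 1) * B"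
      using e B by (intro bound) auto
    also have "\<dots> \<le> e"
      using e B by (simp add: field_simps)
    finally show "integral {0..1} (\<lambda>x. (norm (h x))\<^sup>2) \<le> 0 + e" by simp
  qed
  moreover have "integral {0..1} (\<lambda>x. (norm (h x))\<^sup>2) \<ge> 0"
    by (rule integral_nonneg) (auto intro!: integrable_continuous_real continuous_intros ch)
  ultimately have "integral {0..1} (\<lambda>x. (norm (h x))\<^sup>2) = 0" by simp
  then have z: "\<forall>x\<in>{0..1}. h x = 0"
    by (subst (asm) integral_eq_0_iff) (auto intro!: continuous_intros ch)
  have "h x = h (frac x + of_int \<lfloor>x\<rfloor>)" by (simp add: frac_def)
  also have "\<dots> = h (frac x)" by (rule periodic_int[of h, OF per])
  also have "\<dots> = 0" using z frac_ge_0[of x] frac_lt_1[of x] by auto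
  finally show ?thesis .
qed

section \<open>Poisson summation for Gaussians\<close>

lemma has_sum_integral_unit:
  fixes a :: "int \<Rightarrow> real \<Rightarrow> complex"
  assumes c: "\<And>n. continuous_on {0..1} (a n)"
    and M: "M summable_on UNIV" "\<And>n x. x \<in> {0..1} \<Longrightarrow> norm (a n x) \<le> M n"
  shows "((\<lambda>n. integral {0..1} (a n)) has_sum integral {0..1} (\<lambda>x. \<Sum>\<^sub>\<infinity>n. a n x)) UNIV"
proof -
  have "uniform_limit {0..1} (\<lambda>X x. \<Sum>n\<in>X. a n x) (\<lambda>x. \<Sum>\<^sub>\<infinity>n. a n x) (finite_subsets_at_top UNIV)"
    using M by (intro Weierstrass_m_test_general) auto
  then obtain I J where IJ: "\<And>X. ((\<lambda>x. \<Sum>n\<in>X. a n x) has_integral I X) {0..1}"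
    "((\<lambda>x. \<Sum>\<^sub>\<infinity>n. a n x) has_integral J) {0..1}" "(I \<longlongrightarrow> J) (finite_subsets_at_top UNIV)"
    by (rule uniform_limit_integral) (auto intro!: continuous_intros c)
  have "I X = (\<Sum>n\<in>X. integral {0..1} (a n))" if "finite X" for X
  proof -
    have "integral {0..1} (\<lambda>x. \<Sum>n\<in>X. a n x) = (\<Sum>n\<in>X. integral {0..1} (a n))"
      using that c by (intro integral_sum integrable_continuous_real)
    then show ?thesis using integral_unique[OF IJ(1)] by simp
  qed
  then have "((\<lambda>X. \<Sum>n\<in>X. integral {0..1} (a n)) \<longlongrightarrow> J) (finite_subsets_at_top UNIV)"
    by (intro Lim_transform_eventually[OF IJ(3)])
       (auto intro: eventually_finite_subsets_at_top_weakI)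
  moreover have "J = integral {0..1} (\<lambda>x. \<Sum>\<^sub>\<infinity>n. a n x)" using IJ(2) by (simp add: integral_unique)
  ultimately show ?thesis by (simp add: has_sum_def)
qed

lemma integral_cis_unit:
  "integral {0..1} (\<lambda>x. cis (2 * pi * of_int j * x)) = (if j = 0 then 1 else 0)"
proof (cases "j = 0")
  case False
  have "((\<lambda>x. cis (2 * pi * of_int j * x)) has_integral
     cis (2 * pi * of_int j * 1) / (2 * pi * of_int j * \<i>) - cis (2 * pi * of_int j * 0) / (2 * pi * of_int j * \<i>)) {0..1}"
    by (rule fundamental_theorem_of_calculus)
       (use False in \<open>auto simp: cis_conv_exp intro!: derivative_eq_intros has_vector_derivative_real_field
          simp: field_simps\<close>)
  then show ?thesis
    using False cis_multiple_2pi[of "of_int j"] by (simp add: integral_unique mult_ac)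
qed simp

text \<open>This is the characteristic function of the standard normal distribution, rescaled by
  \<open>c = sqrt (2 pi / s)\<close>.\<close>

lemma gauss_fourier:
  assumes "s > 0"
  shows "(\<integral>x. complex_of_real (exp (- pi * x\<^sup>2 / s)) * cis (2 * pi * m * x) \<partial>lborel) = complex_of_real (sqrt s * exp (- pi * s * m\<^sup>2))"
    and "integrable lborel (\<lambda>x. complex_of_real (exp (- pi * x\<^sup>2 / s)) * cis (2 * pi * m * x))"
proof -
  define c where "c = sqrt (2 * pi / s)"
  have c: "c > 0" "c\<^sup>2 = 2 * pi / s" using assms by (simp_all add: c_def)
  define t where "t = 2 * pi * m / c"
  define g where "g = (\<lambda>x. std_normal_density x *\<^sub>R iexp (t * x))"
  have "(\<integral>x. g x \<partial>lborel) = char std_normal_distribution t"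
    unfolding char_def g_def by (subst integral_density) auto
  then have 1: "(\<integral>x. g x \<partial>lborel) = of_real (exp (- (t\<^sup>2) / 2))"
    by (simp add: char_std_normal_distribution)
  have ig: "integrable lborel g"
  proof -
    have "integrable lborel (\<lambda>x. norm (g x))"
      unfolding g_def using integrable_normal_density[of 1 0] by simp
    moreover have "g \<in> borel_measurable lborel" unfolding g_def by measurable
    ultimately show ?thesis using integrable_norm_cancel by blast
  qed
  have ga: "g (0 + c * x) = (1 / sqrt (2 * pi)) *\<^sub>R (complex_of_real (exp (- pi * x\<^sup>2 / s)) * cis (2 * pi * m * x))" for x
  proof -
    have 1: "(c * x)\<^sup>2 / 2 = pi * x\<^sup>2 / s" using c by (simp add: power_mult_distrib)
    have 2: "t * (c * x) = 2 * pi * m * x" using c by (simp add: t_def)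
    have "std_normal_density (c * x) = 1 / sqrt (2 * pi) * exp (- ((c * x)\<^sup>2 / 2))"
      by (simp add: std_normal_density_def)
    then have 3: "std_normal_density (c * x) = 1 / sqrt (2 * pi) * exp (- (pi * x\<^sup>2 / s))"
      unfolding 1 .
    have "g (0 + c * x) = std_normal_density (c * x) *\<^sub>R iexp (t * (c * x))"
      unfolding g_def add_0 ..
    also have "iexp (t * (c * x)) = cis (2 * pi * m * x)"
      unfolding 2 cis_conv_exp ..
    finally show ?thesis
      unfolding 3 by (simp add: scaleR_conv_of_real)
  qed
  have i: "integrable lborel (\<lambda>x. g (0 + c * x))" using ig c by (intro lborel_integrable_real_affine) auto
  then have "integrable lborel (\<lambda>x. sqrt (2 * pi) *\<^sub>R g (0 + c * x))" by (rule integrable_scaleR_right)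
  then show int: "integrable lborel (\<lambda>x. complex_of_real (exp (- pi * x\<^sup>2 / s)) * cis (2 * pi * m * x))"
    unfolding ga by simp
  have "of_real (exp (- (t\<^sup>2) / 2)) = \<bar>c\<bar> *\<^sub>R (\<integral>x. g (0 + c * x) \<partial>lborel)"
    using lborel_integral_real_affine[of c g 0] c 1 by simp
  also have "\<dots> = (c / sqrt (2 * pi)) *\<^sub>R (\<integral>x. complex_of_real (exp (- pi * x\<^sup>2 / s)) * cis (2 * pi * m * x) \<partial>lborel)"
    unfolding ga using c by (simp add: scaleR_conv_of_real)
  also have "c / sqrt (2 * pi) = 1 / sqrt s" using assms by (simp add: c_def real_sqrt_divide)
  finally have "(\<integral>x. complex_of_real (exp (- pi * x\<^sup>2 / s)) * cis (2 * pi * m * x) \<partial>lborel) = sqrt s *\<^sub>R of_real (exp (- (t\<^sup>2) / 2))"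
    using assms by (simp add: scaleR_conv_of_real field_simps)
  moreover have "- (t\<^sup>2) / 2 = - pi * s * m\<^sup>2"
    using c assms by (simp add: t_def power_divide power_mult_distrib power2_eq_square field_simps)
  ultimately show "(\<integral>x. complex_of_real (exp (- pi * x\<^sup>2 / s)) * cis (2 * pi * m * x) \<partial>lborel) = complex_of_real (sqrt s * exp (- pi * s * m\<^sup>2))"
    by (simp add: scaleR_conv_of_real)
qed

text \<open>Unfolding: along symmetric intervals the partial sums are integrals over
  \<open>[-N, N]\<close>, and these converge to the integral over the line by dominated
  convergence.\<close>

lemma sum_unit_integrals:
  fixes \<phi> :: "real \<Rightarrow> complex"
  assumes i: "integrable lborel \<phi>" and c: "continuous_on UNIV \<phi>"
    and s: "((\<lambda>n::int. integral {0..1} (\<lambda>x. \<phi> (x + of_int n))) has_sum S) UNIV"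
  shows "S = (\<integral>x. \<phi> x \<partial>lborel)"
proof -
  have cc: "continuous_on A \<phi>" for A using c continuous_on_subset by blast
  have shift: "integral {0..1} (\<lambda>x. \<phi> (x + of_int n)) = integral {of_int n..of_int n + 1} \<phi>" for n :: int
    using integral_shift_Icc_real[of 0 1 \<phi> "of_int n"] by (simp add: o_def add.commute)
  have sums: "(\<Sum>n\<in>{- int N..<int N}. integral {0..1} (\<lambda>x. \<phi> (x + of_int n))) = integral {- real N..real N} \<phi>" for N
  proof (induction N)
    case (Suc N)
    have ioo: "\<phi> integrable_on {a..b}" for a b by (intro integrable_continuous_real cc)
    have "{- int (Suc N)..<int (Suc N)} = insert (- int (Suc N)) (insert (int N) {- int N..<int N})" by auto
    then have "(\<Sum>n\<in>{- int (Suc N)..<int (Suc N)}. integral {0..1} (\<lambda>x. \<phi> (x + of_int n))) =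
       integral {- real (Suc N)..- real N} \<phi> + (integral {real N..real (Suc N)} \<phi> + integral {- real N..real N} \<phi>)"
      using Suc by (simp add: shift add.commute)
    also have "\<dots> = integral {- real (Suc N)..real (Suc N)} \<phi>"
    proof -
      have "integral {- real (Suc N)..- real N} \<phi> + integral {- real N..real N} \<phi> = integral {- real (Suc N)..real N} \<phi>"
        "integral {- real (Suc N)..real N} \<phi> + integral {real N..real (Suc N)} \<phi> = integral {- real (Suc N)..real (Suc N)} \<phi>"
        by (intro Henstock_Kurzweil_Integration.integral_combine ioo; simp)+
      then show ?thesis by (metis add.assoc add.commute)
    qed
    finally show ?case .
  qed simp
  have fl: "filterlim (\<lambda>N. {- int N..<int N}) (finite_subsets_at_top UNIV) sequentially"
  proof (subst filterlim_finite_subsets_at_top, intro allI impI)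
    fix X :: "int set" assume X: "finite X \<and> X \<subseteq> UNIV"
    then obtain B where B: "\<And>x. x \<in> X \<Longrightarrow> \<bar>x\<bar> \<le> B"
      by (metis finite_imageI Max_ge imageI abs_ge_zero)
    show "\<forall>\<^sub>F y in sequentially. finite {- int y..<int y} \<and> X \<subseteq> {- int y..<int y} \<and> {- int y..<int y} \<subseteq> UNIV"
      using eventually_gt_at_top[of "nat B"]
      by eventually_elim (use B in force)
  qed
  have 1: "(\<lambda>N. integral {- real N..real N} \<phi>) \<longlonglongrightarrow> S"
    using filterlim_compose[OF s[unfolded has_sum_def] fl] by (simp add: sums)
  have "(\<lambda>N. \<integral>x. indicator {- real N..real N} x *\<^sub>R \<phi> x \<partial>lborel) \<longlonglongrightarrow> (\<integral>x. \<phi> x \<partial>lborel)"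
  proof (rule integral_dominated_convergence)
    show "integrable lborel (\<lambda>x. norm (\<phi> x))" using i by simp
    show "AE x in lborel. (\<lambda>N. indicator {- real N..real N} x *\<^sub>R \<phi> x) \<longlonglongrightarrow> \<phi> x"
    proof (rule AE_I2)
      fix x :: real
      obtain N0 where "\<bar>x\<bar> \<le> real N0" using real_arch_simple by blast
      then have "\<forall>\<^sub>F N in sequentially. indicator {- real N..real N} x *\<^sub>R \<phi> x = \<phi> x"
        by (intro eventually_sequentiallyI[of N0]) (auto simp: indicator_def)
      then show "(\<lambda>N. indicator {- real N..real N} x *\<^sub>R \<phi> x) \<longlonglongrightarrow> \<phi> x"
        by (simp add: tendsto_eventually)
    qed
    show "AE x in lborel. norm (indicator {- real N..real N} x *\<^sub>R \<phi> x) \<le> norm (\<phi> x)" for N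
      by (auto simp: indicator_def)
    show "\<phi> \<in> borel_measurable lborel" using i by auto
    show "(\<lambda>x. indicator {- real N..real N} x *\<^sub>R \<phi> x) \<in> borel_measurable lborel" for N using i by auto
  qed
  moreover have "(\<integral>x. indicator {- real N..real N} x *\<^sub>R \<phi> x \<partial>lborel) = integral {- real N..real N} \<phi>" for N
  proof -
    have "set_integrable lborel {- real N..real N} \<phi>"
      using i by (rule integrable_mult_indicator[of "{- real N..real N}" lborel \<phi>, folded set_integrable_def, rotated]) auto
    from set_borel_integral_eq_integral(2)[OF this] show ?thesis
      by (simp add: set_lebesgue_integral_def)
  qed
  ultimately show ?thesis using 1 LIMSEQ_unique by auto
qed

text \<open>Poisson summation. The left side is the periodisation of a Gaussian and the right side a
  Fourier series; both are continuous, and their Fourier coefficients agree by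
  \<open>gauss_fourier\<close>.\<close>

lemma theta_inversion_real:
  fixes x s :: real
  assumes s: "s > 0"
  shows "(\<Sum>\<^sub>\<infinity>n. gterm (\<i> / s) (\<i> * of_real x / of_real s) (\<i> * (of_real x)\<^sup>2 / of_real s) n) = sqrt s * (\<Sum>\<^sub>\<infinity>k. gterm (\<i> * s) x 0 k)"
proof -
  define F where "F = (\<lambda>x::real. \<Sum>\<^sub>\<infinity>n. gterm (\<i> / s) (\<i> * of_real x / of_real s) (\<i> * (of_real x)\<^sup>2 / of_real s) n)"
  define G where "G = (\<lambda>x::real. sqrt s * (\<Sum>\<^sub>\<infinity>k. gterm (\<i> * s) x 0 k))"
  have Fterm: "gterm (\<i> / s) (\<i> * of_real x / of_real s) (\<i> * (of_real x)\<^sup>2 / of_real s) n = complex_of_real (exp (- pi * (x + of_int n)\<^sup>2 / s))" for x :: real and n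
  proof -
    have "of_real pi * \<i> * (\<i> / s * (of_int n)\<^sup>2 + 2 * (\<i> * of_real x / of_real s) * of_int n + \<i> * (of_real x)\<^sup>2 / of_real s) =
       of_real (- pi * (x + of_int n)\<^sup>2 / s)"
      using s by (simp add: power2_eq_square add_divide_distrib diff_divide_distrib algebra_simps)
    then show ?thesis unfolding gterm_def exp_of_real[symmetric] by (simp only:)
  qed
  have Gterm: "gterm (\<i> * s) x 0 k = complex_of_real (exp (- pi * s * (of_int k)\<^sup>2)) * cis (2 * pi * of_int k * x)" for x :: real and k
    unfolding gterm_def
    by (simp add: cis_conv_exp power2_eq_square algebra_simps flip: exp_of_real exp_add)
  have cF: "continuous_on UNIV F"
  proof -
    have "(\<lambda>y::complex. \<Sum>\<^sub>\<infinity>n. gterm (\<i> / s) (\<i> * y / s) (\<i> * y\<^sup>2 / s) n) holomorphic_on UNIV"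
      using s by (intro holomorphic_infsum_gterm holomorphic_intros) auto
    then have "continuous_on UNIV (\<lambda>y::complex. \<Sum>\<^sub>\<infinity>n. gterm (\<i> / s) (\<i> * y / s) (\<i> * y\<^sup>2 / s) n)"
      by (rule holomorphic_on_imp_continuous_on)
    from continuous_on_compose2[OF this, of UNIV complex_of_real] show ?thesis
      unfolding F_def by (auto intro: continuous_intros)
  qed
  have cG: "continuous_on UNIV G"
  proof -
    have "(\<lambda>y::complex. \<Sum>\<^sub>\<infinity>k. gterm (\<i> * s) y 0 k) holomorphic_on UNIV"
      using s by (intro holomorphic_infsum_gterm holomorphic_intros) auto
    then have "continuous_on UNIV (\<lambda>y::complex. \<Sum>\<^sub>\<infinity>k. gterm (\<i> * s) y 0 k)"
      by (rule holomorphic_on_imp_continuous_on)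
    from continuous_on_compose2[OF this, of UNIV complex_of_real] show ?thesis
      unfolding G_def by (auto intro!: continuous_intros)
  qed
  have F_alt: "F x = (\<Sum>\<^sub>\<infinity>n. complex_of_real (exp (- pi * (x + of_int n)\<^sup>2 / s)))" for x
    unfolding F_def by (rule infsum_cong) (rule Fterm)
  have G_alt: "G x = sqrt s * (\<Sum>\<^sub>\<infinity>k. complex_of_real (exp (- pi * s * (of_int k)\<^sup>2)) * cis (2 * pi * of_int k * x))" for x
    unfolding G_def by (intro arg_cong[where f = "\<lambda>u. of_real (sqrt s) * u"] infsum_cong) (rule Gterm)
  have perF: "F (x + 1) = F x" for x
    unfolding F_alt
    by (rule infsum_reindex_bij_witness[of _ "\<lambda>n. n - 1" "\<lambda>n. n + 1"]) (auto simp: algebra_simps)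
  have perG: "G (x + 1) = G x" for x
  proof -
    have "cis (2 * pi * of_int k * (x + 1)) = cis (2 * pi * of_int k * x)" for k
      using cis_multiple_2pi[of "of_int k"] by (simp add: distrib_left flip: cis_mult)
    then show ?thesis unfolding G_alt by simp
  qed
  have cc: "continuous_on A F" "continuous_on A G" for A using cF cG continuous_on_subset by blast+
  have coefF: "integral {0..1} (\<lambda>x. F x * cis (2 * pi * of_int m * x)) = complex_of_real (sqrt s * exp (- pi * s * (of_int m)\<^sup>2))" for m :: int
  proof -
    define \<phi> where "\<phi> = (\<lambda>x. complex_of_real (exp (- pi * x\<^sup>2 / s)) * cis (2 * pi * of_int m * x))"
    have \<phi>: "gterm (\<i> / s) (\<i> * of_real x / of_real s) (\<i> * (of_real x)\<^sup>2 / of_real s) n * cis (2 * pi * of_int m * x) = \<phi> (x + of_int n)" for x n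
    proof -
      have "cis (2 * pi * of_int m * (x + of_int n)) = cis (2 * pi * of_int m * x) * cis (2 * pi * of_int (m * n))"
        by (simp add: algebra_simps cis_mult)
      also have "cis (2 * pi * of_int (m * n)) = 1" using cis_multiple_2pi Ints_of_int by blast
      finally show ?thesis unfolding Fterm \<phi>_def by simp
    qed
    have "((\<lambda>n. integral {0..1} (\<lambda>x. gterm (\<i> / s) (\<i> * of_real x / of_real s) (\<i> * (of_real x)\<^sup>2 / of_real s) n * cis (2 * pi * of_int m * x)))
        has_sum integral {0..1} (\<lambda>x. \<Sum>\<^sub>\<infinity>n. gterm (\<i> / s) (\<i> * of_real x / of_real s) (\<i> * (of_real x)\<^sup>2 / of_real s) n * cis (2 * pi * of_int m * x))) UNIV"
    proof (rule has_sum_integral_unit)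
      show "(\<lambda>n::int. exp ((2 * pi * (1 / s) + 1)\<^sup>2 / (4 * pi * (1 / s)) + pi * 0) * exp (- \<bar>real_of_int n\<bar>)) summable_on UNIV"
        by (intro summable_on_cmult_right summable_exp_minus_abs_int)
      show "norm (gterm (\<i> / s) (\<i> * of_real x / of_real s) (\<i> * (of_real x)\<^sup>2 / of_real s) n * cis (2 * pi * of_int m * x))
        \<le> exp ((2 * pi * (1 / s) + 1)\<^sup>2 / (4 * pi * (1 / s)) + pi * 0) * exp (- \<bar>real_of_int n\<bar>)"
        if "x \<in> {0..1}" for x n
      proof -
        have "Im (\<i> * (complex_of_real x)\<^sup>2 / s) = x\<^sup>2 / s" by (simp flip: of_real_power)
        then show ?thesis
          unfolding norm_mult norm_cis mult_1_right
          using s that by (intro norm_gterm_le) (auto simp: divide_right_mono)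
      qed
    qed (use s in \<open>auto simp: Fterm intro!: continuous_intros\<close>)
    also have "(\<lambda>x::real. \<Sum>\<^sub>\<infinity>n. gterm (\<i> / s) (\<i> * of_real x / of_real s) (\<i> * (of_real x)\<^sup>2 / of_real s) n * cis (2 * pi * of_int m * x)) =
        (\<lambda>x. F x * cis (2 * pi * of_int m * x))"
      by (auto simp: F_def infsum_cmult_left')
    finally have "((\<lambda>n. integral {0..1} (\<lambda>x. \<phi> (x + of_int n))) has_sum
        integral {0..1} (\<lambda>x. F x * cis (2 * pi * of_int m * x))) UNIV"
      unfolding \<phi> .
    then have "integral {0..1} (\<lambda>x. F x * cis (2 * pi * of_int m * x)) = (\<integral>x. \<phi> x \<partial>lborel)"
      by (rule sum_unit_integrals[rotated -1])
         (use s gauss_fourier(2)[OF s, of "of_int m"] in \<open>auto simp: \<phi>_def intro!: continuous_intros\<close>)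
    then show ?thesis using gauss_fourier(1)[OF s, of "of_int m"] by (simp add: \<phi>_def)
  qed
  have coefG: "integral {0..1} (\<lambda>x. G x * cis (2 * pi * of_int m * x)) = complex_of_real (sqrt s * exp (- pi * s * (of_int m)\<^sup>2))" for m :: int
  proof -
    have gt: "gterm (\<i> * s) x 0 k * cis (2 * pi * of_int m * x) =
       complex_of_real (exp (- pi * s * (of_int k)\<^sup>2)) * cis (2 * pi * of_int (k + m) * x)" for x :: real and k
      unfolding Gterm by (simp add: cis_mult algebra_simps)
    have "((\<lambda>k. integral {0..1} (\<lambda>x. gterm (\<i> * s) x 0 k * cis (2 * pi * of_int m * x)))
        has_sum integral {0..1} (\<lambda>x. \<Sum>\<^sub>\<infinity>k. gterm (\<i> * s) x 0 k * cis (2 * pi * of_int m * x))) UNIV"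
    proof (rule has_sum_integral_unit)
      show "(\<lambda>n::int. exp ((2 * pi * 0 + 1)\<^sup>2 / (4 * pi * s) + pi * 0) * exp (- \<bar>real_of_int n\<bar>)) summable_on UNIV"
        by (intro summable_on_cmult_right summable_exp_minus_abs_int)
      show "norm (gterm (\<i> * s) (complex_of_real x) 0 k * cis (2 * pi * of_int m * x))
        \<le> exp ((2 * pi * 0 + 1)\<^sup>2 / (4 * pi * s) + pi * 0) * exp (- \<bar>real_of_int k\<bar>)" for x k
        unfolding norm_mult norm_cis mult_1_right
        using s by (intro norm_gterm_le) auto
    qed (auto simp: Gterm intro!: continuous_intros)
    moreover have "integral {0..1} (\<lambda>x. gterm (\<i> * s) x 0 k * cis (2 * pi * of_int m * x)) =
       (if k = - m then complex_of_real (exp (- pi * s * (of_int m)\<^sup>2)) else 0)" for k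
      unfolding gt integral_mult_right integral_cis_unit by auto
    ultimately have "((\<lambda>k. if k = - m then complex_of_real (exp (- pi * s * (of_int m)\<^sup>2)) else 0)
        has_sum integral {0..1} (\<lambda>x. \<Sum>\<^sub>\<infinity>k. gterm (\<i> * s) x 0 k * cis (2 * pi * of_int m * x))) UNIV"
      by (simp add: if_distrib cong: if_cong)
    moreover have "((\<lambda>k. if k = - m then complex_of_real (exp (- pi * s * (of_int m)\<^sup>2)) else 0)
        has_sum complex_of_real (exp (- pi * s * (of_int m)\<^sup>2))) UNIV"
      by (rule has_sum_finite_neutralI[of "{-m}"]) auto
    ultimately have e: "integral {0..1} (\<lambda>x. \<Sum>\<^sub>\<infinity>k. gterm (\<i> * s) x 0 k * cis (2 * pi * of_int m * x)) =
        complex_of_real (exp (- pi * s * (of_int m)\<^sup>2))"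
      using has_sum_unique by blast
    have "(\<lambda>x. G x * cis (2 * pi * of_int m * x)) =
        (\<lambda>x. complex_of_real (sqrt s) * (\<Sum>\<^sub>\<infinity>k. gterm (\<i> * s) x 0 k * cis (2 * pi * of_int m * x)))"
      by (auto simp: G_def infsum_cmult_left' mult.assoc)
    then show ?thesis by (simp add: e)
  qed
  have "F x - G x = 0"
  proof (rule fourier_uniqueness)
    show "continuous_on UNIV (\<lambda>x. F x - G x)" using cF cG by (intro continuous_intros)
    show "F (x + 1) - G (x + 1) = F x - G x" for x by (simp add: perF perG)
    show "integral {0..1} (\<lambda>x. (F x - G x) * cis (2 * pi * of_int m * x)) = 0" for m :: int
      unfolding left_diff_distrib
      by (subst integral_diff) (auto simp: coefF coefG intro!: integrable_continuous_real continuous_intros cc)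
  qed
  then show ?thesis by (simp add: F_def G_def)
qed

section \<open>Analytic continuation of the inversion formula\<close>

lemma islimpt_imaginary_axis: "\<i> islimpt {\<i> * complex_of_real s |s. s > 0}"
  unfolding islimpt_approachable
proof (intro allI impI)
  fix e :: real assume e: "e > 0"
  have "dist (\<i> * complex_of_real (1 + e / 2)) \<i> = norm (\<i> * complex_of_real (e / 2))"
    by (simp add: dist_norm algebra_simps)
  also have "\<dots> < e" using e by (simp only: norm_mult norm_of_real) simp
  finally show "\<exists>x'\<in>{\<i> * complex_of_real s |s. s > 0}. x' \<noteq> \<i> \<and> dist x' \<i> < e"
    using e by (intro bexI[of _ "\<i> * complex_of_real (1 + e / 2)"])
      (auto simp: complex_eq_iff intro!: exI[of _ "1 + e / 2"])
qed

lemma islimpt_real_axis: "0 islimpt range complex_of_real"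
  unfolding islimpt_approachable
proof (intro allI impI)
  fix e :: real assume e: "e > 0"
  then have "complex_of_real (e / 2) \<noteq> 0 \<and> dist (complex_of_real (e / 2)) 0 < e"
    by (simp add: dist_norm del: of_real_divide)
  then show "\<exists>x'\<in>range complex_of_real. x' \<noteq> 0 \<and> dist x' 0 < e" by blast
qed

text \<open>The identity theorem is applied twice: first in \<open>t\<close>, from the imaginary
  axis with \<open>y\<close> real, then in \<open>y\<close>, from the real line with
  \<open>t\<close> fixed.\<close>

theorem theta_inversion:
  assumes t: "Im t > 0"
  shows "(\<Sum>\<^sub>\<infinity>n. gterm (- 1 / t) (- y / t) (- (y\<^sup>2) / t) n) = csqrt (- \<i> * t) * (\<Sum>\<^sub>\<infinity>k. gterm t y 0 k)"
proof -
  define H where "H = {t. Im t > 0}"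
  have H: "open H" "connected H"
    unfolding H_def by (simp_all add: open_halfspace_Im_gt convex_connected convex_halfspace_Im_gt)
  have inv: "Im (- 1 / t) > 0" if "Im t > 0" for t
  proof -
    have "t \<noteq> 0" using that by auto
    then show ?thesis using that by (simp add: Im_divide sum_power2_gt_zero_iff complex_eq_iff)
  qed
  have real: "(\<Sum>\<^sub>\<infinity>n. gterm (- 1 / t) (- of_real x / t) (- ((of_real x)\<^sup>2) / t) n) -
      csqrt (- \<i> * t) * (\<Sum>\<^sub>\<infinity>k. gterm t (of_real x) 0 k) = 0" if t: "Im t > 0" for x t
  proof (rule analytic_continuation[of "\<lambda>t. (\<Sum>\<^sub>\<infinity>n. gterm (- 1 / t) (- of_real x / t) (- ((of_real x)\<^sup>2) / t) n) -
      csqrt (- \<i> * t) * (\<Sum>\<^sub>\<infinity>k. gterm t (of_real x) 0 k)" H "{\<i> * complex_of_real s |s. s > 0}" \<i>])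
    have nz: "t \<noteq> 0" "- \<i> * t \<notin> \<real>\<^sub>\<le>\<^sub>0" if "t \<in> H" for t
      using that by (auto simp: H_def complex_nonpos_Reals_iff)
    show "(\<lambda>t. (\<Sum>\<^sub>\<infinity>n. gterm (- 1 / t) (- of_real x / t) (- ((of_real x)\<^sup>2) / t) n) -
      csqrt (- \<i> * t) * (\<Sum>\<^sub>\<infinity>k. gterm t (of_real x) 0 k)) holomorphic_on H"
      using nz inv by (intro holomorphic_intros holomorphic_infsum_gterm H) (auto simp: H_def)
    fix z assume "z \<in> {\<i> * complex_of_real s |s. s > 0}"
    then obtain s where s: "z = \<i> * of_real s" "s > 0" by auto
    have e: "- 1 / z = \<i> / s" "- of_real x / z = \<i> * x / s" "- ((of_real x)\<^sup>2) / z = \<i> * (of_real x)\<^sup>2 / of_real s"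
      using s by (auto simp: field_simps)
    have "csqrt (- \<i> * z) = sqrt s" using s by (simp add: csqrt_of_real_nonneg flip: mult.assoc)
    then show "(\<Sum>\<^sub>\<infinity>n. gterm (- 1 / z) (- of_real x / z) (- ((of_real x)\<^sup>2) / z) n) -
      csqrt (- \<i> * z) * (\<Sum>\<^sub>\<infinity>k. gterm z (of_real x) 0 k) = 0"
      unfolding e using theta_inversion_real[OF s(2), of x] s(1) by simp
  qed (use H t islimpt_imaginary_axis in \<open>auto simp: H_def\<close>)
  have "(\<Sum>\<^sub>\<infinity>n. gterm (- 1 / t) (- y / t) (- (y\<^sup>2) / t) n) - csqrt (- \<i> * t) * (\<Sum>\<^sub>\<infinity>k. gterm t y 0 k) = 0"
  proof (rule analytic_continuation[of "\<lambda>y. (\<Sum>\<^sub>\<infinity>n. gterm (- 1 / t) (- y / t) (- (y\<^sup>2) / t) n) -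
      csqrt (- \<i> * t) * (\<Sum>\<^sub>\<infinity>k. gterm t y 0 k)" UNIV "range complex_of_real" 0])
    have "t \<noteq> 0" using t by auto
    then show "(\<lambda>y. (\<Sum>\<^sub>\<infinity>n. gterm (- 1 / t) (- y / t) (- (y\<^sup>2) / t) n) -
      csqrt (- \<i> * t) * (\<Sum>\<^sub>\<infinity>k. gterm t y 0 k)) holomorphic_on UNIV"
      using t inv by (intro holomorphic_intros holomorphic_infsum_gterm) auto
  qed (use real[OF t] islimpt_real_axis in auto)
  then show ?thesis by simp
qed

section \<open>Theta functions of genus three\<close>

abbreviation sp :: "'a::semiring_1^'n \<Rightarrow> 'a^'n \<Rightarrow> 'a" where "sp \<equiv> scalar_product"

lemma sp3: "sp x y = x$1 * y$1 + x$2 * y$2 + x$3 * y$(3::3)"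
  by (simp add: scalar_product_def sum_3)

lemma mv3: "(A *v x) $ i = A$i$1 * x$1 + A$i$2 * x$2 + A$i$3 * x$(3::3)"
  by (simp add: matrix_vector_mult_def sum_3)

definition qv :: "int^3 \<Rightarrow> int^3 \<Rightarrow> complex^3"
  where "qv a p = (\<chi> i. of_int (p $ i) + of_int (a $ i) / 2)"

definition vi :: "int^3 \<Rightarrow> complex^3"
  where "vi b = (\<chi> i. of_int (b $ i))"

definition Gq :: "complex^3^3 \<Rightarrow> complex^3 \<Rightarrow> complex^3 \<Rightarrow> complex"
  where "Gq \<tau> z q = sp q (\<tau> *v q) + 2 * sp q z"

definition tterm :: "int^3 \<Rightarrow> int^3 \<Rightarrow> complex^3^3 \<Rightarrow> complex^3 \<Rightarrow> int^3 \<Rightarrow> complex"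
  where "tterm a b \<tau> z p = exp (of_real pi * \<i> * (Gq \<tau> z (qv a p) + sp (qv a p) (vi b)))"

text \<open>With integral characteristics the transformation laws hold without the signs that arise from
  reducing a lower characteristic modulo 2.\<close>

definition thI :: "int^3 \<Rightarrow> int^3 \<Rightarrow> complex^3^3 \<Rightarrow> complex^3 \<Rightarrow> complex"
  where "thI a b \<tau> z = (\<Sum>\<^sub>\<infinity>p. tterm a b \<tau> z p)"

definition lift :: "bit^3 \<Rightarrow> int^3"
  where "lift a = (\<chi> i. if a $ i = 1 then 1 else 0)"

lemma theta_thI: "theta a b \<tau> z = thI (lift a) (lift b) \<tau> z"
proof -
  have q: "(\<chi> i. of_int (p $ i)) + half_char a = qv (lift a) p" for p :: "int^3"
    by (auto simp: vec_eq_iff half_char_def qv_def lift_def)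
  have b: "half_char b = (1/2) *\<^sub>R vi (lift b)"
    by (auto simp: vec_eq_iff half_char_def vi_def lift_def complex_eq_iff)
  have e: "sp q (\<tau> *v q + 2 *\<^sub>R (z + half_char b)) = Gq \<tau> z q + sp q (vi (lift b))" for q
    unfolding b by (simp add: Gq_def sp3 algebra_simps scaleR_conv_of_real[where 'a = complex])
  show ?thesis
    unfolding theta_def thI_def tterm_def Let_def q e ..
qed

subsection \<open>Convergence\<close>

definition vec3 :: "int \<times> int \<times> int \<Rightarrow> int^3"
  where "vec3 x = vector [fst x, fst (snd x), snd (snd x)]"

lemma vec3_nth [simp]: "vec3 x $ 1 = fst x" "vec3 x $ 2 = fst (snd x)" "vec3 x $ 3 = snd (snd x)"
  by (simp_all add: vec3_def)

lemma bij_vec3: "bij vec3"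
  by (rule bij_betwI[where g = "\<lambda>v. (v$1, v$2, v$3)"]) (auto simp: vec_eq_iff forall_3)

lemma abs_summable_times:
  fixes f :: "'a \<Rightarrow> complex" and g :: "'b \<Rightarrow> complex"
  assumes "(\<lambda>x. norm (f x)) summable_on A" "(\<lambda>y. norm (g y)) summable_on B"
  shows "(\<lambda>x. norm (case x of (x, y) \<Rightarrow> f x * g y)) summable_on A \<times> B"
proof (rule summable_on_SigmaI)
  show "((\<lambda>y. norm (case (x, y) of (x, y) \<Rightarrow> f x * g y)) has_sum norm (f x) * (\<Sum>\<^sub>\<infinity>y\<in>B. norm (g y))) B" for x
    using has_sum_cmult_right[OF has_sum_infsum[OF assms(2)], of "norm (f x)"] by (simp add: norm_mult)
  show "(\<lambda>x. norm (f x) * (\<Sum>\<^sub>\<infinity>y\<in>B. norm (g y))) summable_on A"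
    using assms(1) by (rule summable_on_cmult_left)
qed auto

lemma summable_on_int3:
  assumes "(\<lambda>n. norm (f n)) summable_on UNIV" "(\<lambda>n. norm (g n)) summable_on UNIV"
    "(\<lambda>n. norm (h n)) summable_on UNIV"
  shows "(\<lambda>p::int^3. norm (f (p$1) * g (p$2) * h (p$3) :: complex)) summable_on UNIV"
proof -
  have "(\<lambda>x. norm (case x of (x, y) \<Rightarrow> g x * h y)) summable_on UNIV \<times> UNIV"
    by (rule abs_summable_times) (use assms in auto)
  then have "(\<lambda>x. norm (case x of (x, y) \<Rightarrow> f x * (case y of (y, z) \<Rightarrow> g y * h z))) summable_on UNIV \<times> UNIV"
    by (intro abs_summable_times) (use assms in auto)
  then have *: "(\<lambda>(x, y, z). norm (f x * g y * h z)) summable_on UNIV"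
    by (simp add: case_prod_unfold mult.assoc)
  then show ?thesis
    using summable_on_reindex_bij_betw[OF bij_vec3, of "\<lambda>p. norm (f (p$1) * g (p$2) * h (p$3))"]
    by (simp add: case_prod_unfold)
qed

lemma posdef_lower_bound:
  fixes Y :: "real^3^3"
  assumes "\<forall>v. v \<noteq> 0 \<longrightarrow> 0 < v \<bullet> (Y *v v)"
  obtains l where "l > 0" "\<And>v. l * (v \<bullet> v) \<le> v \<bullet> (Y *v v)"
proof -
  have "continuous_on (sphere 0 1) (\<lambda>v. v \<bullet> (Y *v v))"
    by (intro continuous_intros linear_continuous_on matrix_vector_mul_bounded_linear)
  moreover have "sphere (0::real^3) 1 \<noteq> {}" by simp
  ultimately obtain v0 where v0: "v0 \<in> sphere 0 1" "\<And>v. v \<in> sphere 0 1 \<Longrightarrow> v0 \<bullet> (Y *v v0) \<le> v \<bullet> (Y *v v)"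
    using continuous_attains_inf[of "sphere 0 1" "\<lambda>v. v \<bullet> (Y *v v)"] by auto
  show ?thesis
  proof
    have "v0 \<noteq> 0" using v0(1) by auto
    then show "0 < v0 \<bullet> (Y *v v0)" using assms by blast
    fix v :: "real^3"
    show "(v0 \<bullet> (Y *v v0)) * (v \<bullet> v) \<le> v \<bullet> (Y *v v)"
    proof (cases "v = 0")
      case False
      have "v0 \<bullet> (Y *v v0) \<le> (v /\<^sub>R norm v) \<bullet> (Y *v (v /\<^sub>R norm v))"
        by (rule v0) (use False in simp)
      also have "\<dots> = (v \<bullet> (Y *v v)) / (norm v)\<^sup>2"
        by (simp add: matrix_vector_mult_scaleR power2_eq_square divide_inverse)
      finally show ?thesis using False by (simp add: pos_le_divide_eq power2_norm_eq_inner)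
    qed simp
  qed
qed

lemma inner3: "(x::real^3) \<bullet> y = x$1 * y$1 + x$2 * y$2 + x$3 * y$3"
  by (simp add: inner_vec_def sum_3)

text \<open>Bounding the imaginary part from below by a multiple of the sum of squares decouples the
  coordinates, and the general term is dominated by a product of three one-dimensional
  terms.\<close>

lemma tterm_summable:
  assumes "\<tau> \<in> siegel3"
  shows "(\<lambda>p. norm (tterm a b \<tau> z p)) summable_on UNIV"
proof -
  obtain l where l: "l > 0" "\<And>v. l * (v \<bullet> v) \<le> v \<bullet> (map_matrix Im \<tau> *v v)"
    using assms posdef_lower_bound[of "map_matrix Im \<tau>"] by (auto simp: siegel3_def)
  define y where "y = (\<lambda>i. Im (z $ i))"
  define g where "g = (\<lambda>i n. gterm (\<i> * l) (\<i> * (l * a$i / 2 + y i)) (\<i> * (l * (a$i / 2)\<^sup>2 + y i * a$i)) n)"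
  have sg: "(\<lambda>n. norm (g i n)) summable_on UNIV" for i
    unfolding g_def using l by (intro gterm_abs_summable) simp
  have ng: "norm (g i n) = exp (- pi * (l * (n + a$i / 2)\<^sup>2 + 2 * (n + a$i / 2) * y i))" for i n
    by (simp add: g_def gterm_def norm_exp_eq_Re power2_eq_square algebra_simps add_divide_distrib)
  have le: "norm (tterm a b \<tau> z p) \<le> norm (g 1 (p$1) * g 2 (p$2) * g 3 (p$3))" for p
  proof -
    define v :: "real^3" where "v = (\<chi> i. p$i + a$i / 2)"
    have qv: "qv a p = (\<chi> i. of_real (v $ i))" by (simp add: qv_def v_def vec_eq_iff)
    have "norm (tterm a b \<tau> z p) = exp (- pi * (v \<bullet> (map_matrix Im \<tau> *v v) + 2 * (v$1 * y 1 + v$2 * y 2 + v$3 * y 3)))"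
      by (simp add: tterm_def norm_exp_eq_Re Gq_def sp3 mv3 qv inner3 vi_def y_def algebra_simps)
    also have "\<dots> \<le> exp (- pi * (l * (v \<bullet> v) + 2 * (v$1 * y 1 + v$2 * y 2 + v$3 * y 3)))"
      using l by simp
    also have "\<dots> = norm (g 1 (p$1) * g 2 (p$2) * g 3 (p$3))"
      by (simp add: norm_mult ng inner3 v_def power2_eq_square algebra_simps flip: exp_add)
    finally show ?thesis .
  qed
  show ?thesis
    by (rule Infinite_Sum.abs_summable_on_comparison_test'[OF summable_on_int3[OF sg sg sg] le])
qed

lemma tterm_summable': "\<tau> \<in> siegel3 \<Longrightarrow> tterm a b \<tau> z summable_on UNIV"
  using tterm_summable abs_summable_summable by blast

subsection \<open>Elementary transformations\<close>

lemma exp_pi_i_even: "even k \<Longrightarrow> exp (of_real pi * \<i> * of_int k) = 1"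
  by (auto elim!: evenE simp: exp_eq_1)

lemma exp_pi_i_int: "exp (of_real pi * \<i> * of_int k) = (if even k then 1 else -1)"
proof (cases "even k")
  case False
  then obtain m where "k = 2 * m + 1" by (elim oddE)
  then have "exp (of_real pi * \<i> * of_int k) = exp (of_real pi * \<i> * of_int (2 * m)) * exp (of_real pi * \<i>)"
    by (simp only: flip: exp_add) (simp add: algebra_simps)
  also have "\<dots> = -1" by (subst exp_pi_i_even) auto
  finally show ?thesis using False by simp
qed (simp add: exp_pi_i_even)

lemma thI_shift_upper: "thI (a + 2 * k) b \<tau> z = thI a b \<tau> z"
proof -
  have "qv (a + 2 * k) p = qv a (p + k)" for p
    by (simp add: qv_def vec_eq_iff field_simps)
  then show ?thesis
    unfolding thI_def tterm_def
    by (intro infsum_reindex_bij_witness[of _ "\<lambda>p. p - k" "\<lambda>p. p + k"]) auto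
qed

lemma thI_shift_lower: "thI a (b + 2 * k) \<tau> z = (if even (sp a k) then 1 else -1) * thI a b \<tau> z"
proof -
  have "tterm a (b + 2 * k) \<tau> z p = exp (of_real pi * \<i> * of_int (sp a k)) * tterm a b \<tau> z p" for p
  proof -
    have "sp (qv a p) (vi (b + 2 * k)) = sp (qv a p) (vi b) + of_int (2 * sp p k) + of_int (sp a k)"
      by (simp add: sp3 qv_def vi_def field_simps)
    then have "tterm a (b + 2 * k) \<tau> z p = exp (of_real pi * \<i> * of_int (2 * sp p k)) *
        exp (of_real pi * \<i> * of_int (sp a k)) * tterm a b \<tau> z p"
      unfolding tterm_def by (simp only: distrib_left exp_add) (simp only: mult_ac)
    also have "exp (of_real pi * \<i> * of_int (2 * sp p k)) = 1" by (rule exp_pi_i_even) simp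
    finally show ?thesis by simp
  qed
  then have eq: "tterm a (b + 2 * k) \<tau> z = (\<lambda>p. exp (of_real pi * \<i> * of_int (sp a k)) * tterm a b \<tau> z p)"
    by (rule ext)
  show ?thesis
    unfolding thI_def eq infsum_cmult_right' exp_pi_i_int ..
qed

text \<open>The reflection \<open>p |-> -p - a\<close> preserves the quadratic form and changes the
  phase by the parity sign of the characteristic.\<close>

lemma thI_odd: "odd (sp a b) \<Longrightarrow> thI a b \<tau> 0 = 0"
proof -
  assume odd: "odd (sp a b)"
  have "thI a b \<tau> 0 = (\<Sum>\<^sub>\<infinity>p. tterm a b \<tau> 0 (- p - a))"
    unfolding thI_def by (rule infsum_reindex_bij_witness[of _ "\<lambda>p. - p - a" "\<lambda>p. - p - a"]) auto
  also have "tterm a b \<tau> 0 (- p - a) = - tterm a b \<tau> 0 p" for p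
  proof -
    have q: "qv a (- p - a) = - qv a p" by (simp add: qv_def vec_eq_iff field_simps)
    have "sp (- qv a p) (vi b) = sp (qv a p) (vi b) + of_int (2 * (- sp p b)) + of_int (- sp a b)"
      by (simp add: sp3 qv_def vi_def field_simps)
    moreover have "Gq \<tau> 0 (- qv a p) = Gq \<tau> 0 (qv a p)" by (simp add: Gq_def sp3 mv3 algebra_simps)
    ultimately have "tterm a b \<tau> 0 (- p - a) = exp (of_real pi * \<i> * of_int (2 * (- sp p b))) *
        exp (of_real pi * \<i> * of_int (- sp a b)) * tterm a b \<tau> 0 p"
      unfolding tterm_def q by (simp only: distrib_left exp_add) (simp only: mult_ac)
    also have "exp (of_real pi * \<i> * of_int (2 * (- sp p b))) = 1" by (rule exp_pi_i_even) simp
    also have "exp (of_real pi * \<i> * of_int (- sp a b)) = -1" using odd by (simp only: exp_pi_i_int) simp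
    finally show ?thesis by simp
  qed
  then have "(\<Sum>\<^sub>\<infinity>p. tterm a b \<tau> 0 (- p - a)) = - thI a b \<tau> 0"
    by (simp add: thI_def infsum_uminus)
  finally show ?thesis by simp
qed

definition diagv :: "int^3^3 \<Rightarrow> int^3" where "diagv S = (\<chi> i. S $ i $ i)"

lemma thI_translate:
  assumes S: "transpose S = S"
  shows "thI a b (\<tau> + cm S) z =
    exp (- (of_real pi * \<i> / 4) * of_int (sp a (S *v a) + 2 * sp a (diagv S))) * thI a (b + S *v a + diagv S) \<tau> z"
proof -
  have s: "S$2$1 = S$1$2" "S$3$1 = S$1$3" "S$3$2 = S$2$3"
    using S by (metis (no_types, lifting) transpose_def vec_lambda_beta)+
  have "tterm a b (\<tau> + cm S) z p =
    exp (- (of_real pi * \<i> / 4) * of_int (sp a (S *v a) + 2 * sp a (diagv S))) * tterm a (b + S *v a + diagv S) \<tau> z p" for p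
  proof -
    \<comment> \<open>For integral \<open>p\<close> the form \<open>p^t S p\<close> is congruent to
      \<open>p . diag S\<close> modulo 2; this is how the diagonal of \<open>S\<close> enters the
      new characteristic.\<close>
    define k where "k = sp p (S *v p) - sp p (diagv S)"
    have k: "k = S$1$1 * (p$1 * (p$1 - 1)) + S$2$2 * (p$2 * (p$2 - 1)) + S$3$3 * (p$3 * (p$3 - 1))
       + 2 * (S$1$2 * p$1 * p$2 + S$1$3 * p$1 * p$3 + S$2$3 * p$2 * p$3)"
      using s by (simp add: k_def sp3 mv3 diagv_def algebra_simps)
    have "even (n * (n - 1))" for n :: int by simp
    then have "even k" unfolding k by (metis dvd_add dvd_mult dvd_triv_left)
    have E: "Gq (\<tau> + cm S) z (qv a p) + sp (qv a p) (vi b) =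
       of_int k + (Gq \<tau> z (qv a p) + sp (qv a p) (vi (b + S *v a + diagv S))) -
         of_int (sp a (S *v a) + 2 * sp a (diagv S)) / 4"
      using s by (simp add: k_def Gq_def sp3 mv3 diagv_def qv_def vi_def field_simps)
    have "tterm a b (\<tau> + cm S) z p = exp (of_real pi * \<i> * of_int k +
        (- (of_real pi * \<i> / 4) * of_int (sp a (S *v a) + 2 * sp a (diagv S)) +
         of_real pi * \<i> * (Gq \<tau> z (qv a p) + sp (qv a p) (vi (b + S *v a + diagv S)))))"
      unfolding tterm_def E by (rule arg_cong[of _ _ exp]) (simp add: algebra_simps)
    then show ?thesis
      using \<open>even k\<close> by (simp only: exp_add tterm_def exp_pi_i_even mult_1_left)
  qed
  then have eq: "tterm a b (\<tau> + cm S) z = (\<lambda>p. exp (- (of_real pi * \<i> / 4) * of_int (sp a (S *v a) + 2 * sp a (diagv S)))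
      * tterm a (b + S *v a + diagv S) \<tau> z p)"
    by (rule ext)
  show ?thesis
    unfolding thI_def eq infsum_cmult_right' ..
qed

lemma thI_unimodular:
  assumes UV: "U ** V = mat 1"
  shows "thI a b (cm U ** \<tau> ** transpose (cm U)) (cm U *v z) = thI (transpose U *v a) (V *v b) \<tau> z"
proof -
  have VU: "V ** U = mat 1" using UV by (rule int_matrix_left_right_inverse)
  have tUV: "transpose V ** transpose U = mat 1" "transpose U ** transpose V = mat 1"
    using UV VU by (simp_all add: transpose_mat flip: matrix_transpose_mul)
  have q: "transpose (cm U) *v qv a p = qv (transpose U *v a) (transpose U *v p)" for p
    by (simp add: vec_eq_iff qv_def mv3 transpose_def field_simps del: transpose_matrix_vector)
  have b: "sp q (vi b) = sp (transpose (cm U) *v q) (vi (V *v b))" for q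
  proof -
    have "vi b = cm U *v vi (V *v b)"
    proof -
      have "cm U *v vi c = vi (U *v c)" for c by (simp add: vec_eq_iff vi_def mv3)
      then show ?thesis by (simp add: matrix_vector_mul_assoc UV)
    qed
    then show ?thesis by (simp add: scalar_product_matrix_left del: transpose_matrix_vector)
  qed
  have G: "Gq (cm U ** \<tau> ** transpose (cm U)) (cm U *v z) q = Gq \<tau> z (transpose (cm U) *v q)" for q
    by (simp add: Gq_def scalar_product_matrix_left matrix_vector_mul_assoc matrix_mul_assoc del: transpose_matrix_vector)
  have "thI (transpose U *v a) (V *v b) \<tau> z = (\<Sum>\<^sub>\<infinity>p. tterm (transpose U *v a) (V *v b) \<tau> z (transpose U *v p))"
    unfolding thI_def
    by (rule infsum_reindex_bij_witness[of _ "\<lambda>p. transpose U *v p" "\<lambda>p. transpose V *v p"])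
       (simp_all add: matrix_vector_mul_assoc tUV del: transpose_matrix_vector)
  also have "\<dots> = thI a b (cm U ** \<tau> ** transpose (cm U)) (cm U *v z)"
    unfolding thI_def tterm_def G q b[of "qv a _"] ..
  finally show ?thesis ..
qed

subsection \<open>Partial inversion\<close>

definition Jact :: "3 \<Rightarrow> complex^3^3 \<Rightarrow> complex^3^3"
  where "Jact j \<tau> = (\<chi> k l. if k = j \<and> l = j then - 1 / \<tau>$j$j
     else if k = j then \<tau>$j$l / \<tau>$j$j else if l = j then \<tau>$k$j / \<tau>$j$j
     else \<tau>$k$l - \<tau>$k$j * \<tau>$j$l / \<tau>$j$j)"

definition Jz :: "3 \<Rightarrow> complex^3^3 \<Rightarrow> complex^3 \<Rightarrow> complex^3"
  where "Jz j \<tau> z = (\<chi> l. if l = j then z$j / \<tau>$j$j else z$l - \<tau>$j$l * z$j / \<tau>$j$j)"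

definition rest :: "3 \<Rightarrow> 'a::zero^3 \<Rightarrow> 'a^3"
  where "rest j q = (\<chi> i. if i = j then 0 else q $ i)"

lemma quad_split:
  fixes M :: "'a::comm_ring_1^3^3"
  assumes "transpose M = M"
  shows "sp q (M *v q) = M$j$j * (q$j)\<^sup>2 + 2 * q$j * (M *v rest j q) $ j + sp (rest j q) (M *v rest j q)"
proof -
  have s: "M$2$1 = M$1$2" "M$3$1 = M$1$3" "M$3$2 = M$2$3"
    using assms by (metis (no_types, lifting) transpose_def vec_lambda_beta)+
  show ?thesis
    using exhaust_3[of j] s
    by (elim disjE; simp add: sp3 mv3 rest_def power2_eq_square algebra_simps)
qed

lemma Gq_split:
  assumes "transpose \<tau> = \<tau>"
  shows "Gq \<tau> z q = \<tau>$j$j * (q$j)\<^sup>2 + 2 * q$j * ((\<tau> *v rest j q) $ j + z$j) + Gq \<tau> z (rest j q)"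
proof -
  have "sp q z = q$j * z$j + sp (rest j q) z"
    using exhaust_3[of j] by (elim disjE; simp add: sp3 rest_def)
  then show ?thesis
    unfolding Gq_def quad_split[OF assms, of q j] by (simp add: algebra_simps)
qed

text \<open>The form that a Fourier transform in the \<open>j\<close>-th variable alone produces
  from \<open>Gq_split\<close>: the coefficient becomes \<open>-1 / tau_jj\<close>, and the former
  linear term becomes a shift of the variable.\<close>

lemma Gq_Jact:
  assumes sym: "transpose \<tau> = \<tau>" and t: "\<tau>$j$j \<noteq> 0"
  shows "Gq (Jact j \<tau>) (Jz j \<tau> z) q =
    - ((q$j - (\<tau> *v rest j q) $ j - z$j)\<^sup>2) / \<tau>$j$j + (z$j)\<^sup>2 / \<tau>$j$j + Gq \<tau> z (rest j q)"
proof -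
  have s: "\<tau>$2$1 = \<tau>$1$2" "\<tau>$3$1 = \<tau>$1$3" "\<tau>$3$2 = \<tau>$2$3"
    using sym by (metis (no_types, lifting) transpose_def vec_lambda_beta)+
  show ?thesis
    using exhaust_3[of j] s t
    by (elim disjE; hypsubst; simp add: Gq_def Jact_def Jz_def sp3 mv3 rest_def power2_eq_square divide_simps)
       (simp_all add: algebra_simps)
qed

lemma siegel3_nth_sym: "\<tau> \<in> siegel3 \<Longrightarrow> \<tau>$i$j = \<tau>$j$i"
  using siegel3_sym by (metis (no_types, lifting) transpose_def vec_lambda_beta)

lemma siegel3_diag: assumes "\<tau> \<in> siegel3" shows "Im (\<tau>$j$j) > 0" "\<tau>$j$j \<noteq> 0"
proof -
  have "axis j (1::real) \<noteq> 0" by (simp add: axis_eq_0_iff)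
  then have "0 < axis j 1 \<bullet> (map_matrix Im \<tau> *v axis j 1)" using assms by (auto simp: siegel3_def)
  then show "Im (\<tau>$j$j) > 0"
    using exhaust_3[of j] by (elim disjE; simp add: inner3 mv3 axis_def)
  then show "\<tau>$j$j \<noteq> 0" by auto
qed

lemma siegel3_posI:
  assumes "transpose \<tau> = \<tau>"
    and "\<And>v::real^3. v \<noteq> 0 \<Longrightarrow> 0 < Im (sp (\<chi> i. of_real (v$i)) (\<tau> *v (\<chi> i. of_real (v$i))))"
  shows "\<tau> \<in> siegel3"
proof -
  have "v \<bullet> (map_matrix Im \<tau> *v v) = Im (sp (\<chi> i. of_real (v$i)) (\<tau> *v (\<chi> i. of_real (v$i))))" for v
    by (simp add: inner3 mv3 sp3 algebra_simps)
  then show ?thesis using assms by (simp add: siegel3_def)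
qed

lemma siegel3_posD:
  assumes "\<tau> \<in> siegel3" "v \<noteq> 0"
  shows "0 < Im (sp (\<chi> i. of_real (v$i)) (\<tau> *v (\<chi> i. of_real (v$i))))"
proof -
  have *: "v \<bullet> (map_matrix Im \<tau> *v v) = Im (sp (\<chi> i. of_real (v$i)) (\<tau> *v (\<chi> i. of_real (v$i))))"
    by (simp add: inner3 mv3 sp3 algebra_simps)
  have "0 < v \<bullet> (map_matrix Im \<tau> *v v)" using assms by (simp add: siegel3_def)
  then show ?thesis by (simp only: *)
qed

text \<open>The imaginary part of the inverted form at \<open>v\<close> equals that of the original
  form at a real vector \<open>u\<close>, plus a square times \<open>Im t\<close>. Here the
  \<open>j\<close>-th coordinate of \<open>u\<close> is the real part of the solution
  \<open>om\<close> of \<open>t om + l = v_j\<close>, and the square is that of its imaginary part,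
  which is nonzero when \<open>u\<close> is zero.\<close>

lemma Jact_siegel3:
  assumes \<tau>: "\<tau> \<in> siegel3" shows "Jact j \<tau> \<in> siegel3"
proof (rule siegel3_posI)
  have sym: "transpose \<tau> = \<tau>" using \<tau> by (rule siegel3_sym)
  note s = siegel3_nth_sym[OF \<tau>]
  show "transpose (Jact j \<tau>) = Jact j \<tau>"
  proof -
    have "Jact j \<tau> $ l $ k = Jact j \<tau> $ k $ l" for k l
      unfolding Jact_def using s[of l k] s[of j l] s[of k j] by auto
    then show ?thesis by (simp add: transpose_def vec_eq_iff)
  qed
  fix v :: "real^3" assume v: "v \<noteq> 0"
  define t where "t = \<tau>$j$j"
  have t: "Im t > 0" "t \<noteq> 0" using siegel3_diag[OF \<tau>] by (simp_all add: t_def)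
  define q :: "complex^3" where "q = (\<chi> i. of_real (v$i))"
  define r where "r = rest j v"
  define rc :: "complex^3" where "rc = (\<chi> i. of_real (r$i))"
  have rc: "rest j q = rc" by (simp add: rc_def r_def q_def rest_def vec_eq_iff)
  define l where "l = (\<tau> *v rc) $ j"
  define om where "om = (of_real (v$j) - l) / t"
  define u where "u = r + Re om *\<^sub>R axis j 1"
  define uc :: "complex^3" where "uc = (\<chi> i. of_real (u$i))"
  have uj: "u $ j = Re om" "rest j u = r"
    by (simp_all add: u_def r_def rest_def axis_def vec_eq_iff)
  have "rest j uc = rc" by (simp add: uc_def rc_def rest_def vec_eq_iff flip: uj(2))
  then have qu: "sp uc (\<tau> *v uc) = t * (Re om)\<^sup>2 + 2 * Re om * l + sp rc (\<tau> *v rc)"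
    using quad_split[OF sym, of uc j] by (simp add: t_def l_def uj(1) uc_def)
  have tom: "t * om = of_real (v$j) - l" using t by (simp add: om_def)
  have "sp q (Jact j \<tau> *v q) = - ((q$j - l)\<^sup>2) / t + sp rc (\<tau> *v rc)"
  proof -
    have "Gq (Jact j \<tau>) (Jz j \<tau> 0) q = - ((q$j - l)\<^sup>2) / t + sp rc (\<tau> *v rc)"
      using Gq_Jact[OF sym, of j 0 q] t by (simp add: t_def l_def rc Gq_def)
         (simp add: sp3)
    moreover have "Jz j \<tau> 0 = 0" by (simp add: Jz_def vec_eq_iff)
    ultimately show ?thesis by (simp add: Gq_def) (simp add: sp3)
  qed
  also have "(q$j - l)\<^sup>2 / t = t * om * om"
    using t by (simp add: om_def q_def power2_eq_square)
  then have "- ((q$j - l)\<^sup>2) / t = - (t * om * om)" by simp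
  finally have Q: "sp q (Jact j \<tau> *v q) = - (t * om * om) + sp rc (\<tau> *v rc)" .
  have iml: "Im (t * om) = - Im l" by (simp add: tom)
  have "Im (t * om * om) = Im (t * om) * Re om + Re (t * om) * Im om" by simp
  moreover have "((Re om)\<^sup>2 + (Im om)\<^sup>2) * Im t = Im (t * om) * Re om - Re (t * om) * Im om"
    by (simp add: power2_eq_square algebra_simps)
  ultimately have "Im (sp q (Jact j \<tau> *v q)) = Im (sp uc (\<tau> *v uc)) + (Im om)\<^sup>2 * Im t"
  proof -
    have "Re om * Im (t * om) = Re om * (- Im l)" unfolding iml ..
    then show ?thesis unfolding Q qu by (simp add: power2_eq_square algebra_simps)
  qed
  also have "\<dots> > 0"
  proof (cases "u = 0")
    case False
    then have "Im (sp uc (\<tau> *v uc)) > 0" unfolding uc_def by (rule siegel3_posD[OF \<tau>])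
    then show ?thesis using t by (simp add: add_pos_nonneg)
  next
    case True
    have "r = rest j 0" using uj(2) True by simp
    then have r0: "r = 0" "Re om = 0" using uj(1) True by (simp_all add: rest_def vec_eq_iff)
    then have "l = 0" by (simp add: l_def rc_def mv3)
    have "v $ j \<noteq> 0"
    proof
      assume "v $ j = 0"
      then have "v = rest j v" by (simp add: rest_def vec_eq_iff)
      then show False using v r0 by (simp add: r_def)
    qed
    then have "om \<noteq> 0" using \<open>l = 0\<close> t by (simp add: om_def)
    then have "Im om \<noteq> 0" using r0 by (simp add: complex_eq_iff)
    moreover have "uc = 0" using True by (simp add: uc_def vec_eq_iff)
    ultimately show ?thesis using t by (simp add: sp3)
  qed
  finally show "0 < Im (sp (\<chi> i. of_real (v$i)) (Jact j \<tau> *v (\<chi> i. of_real (v$i))))"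
    by (simp add: q_def)
qed

definition updj :: "3 \<Rightarrow> int^3 \<Rightarrow> int \<Rightarrow> int^3"
  where "updj j p n = (\<chi> i. if i = j then n else p $ i)"

lemma infsum_split_coordinate:
  fixes f :: "int^3 \<Rightarrow> complex"
  assumes "f summable_on UNIV"
  shows "infsum f UNIV = (\<Sum>\<^sub>\<infinity>r\<in>{r. r $ j = 0}. \<Sum>\<^sub>\<infinity>n. f (updj j r n))"
proof -
  have bij: "bij_betw (\<lambda>(r, n). updj j r n) ({r. r $ j = 0} \<times> UNIV) UNIV"
    by (rule bij_betwI[where g = "\<lambda>p. (updj j p 0, p $ j)"]) (auto simp: updj_def vec_eq_iff)
  have s: "(\<lambda>(r, n). f (updj j r n)) summable_on ({r. r $ j = 0} \<times> UNIV)"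
    using summable_on_reindex_bij_betw[OF bij, of f] assms by (simp add: case_prod_unfold)
  have "infsum f UNIV = infsum (\<lambda>(r, n). f (updj j r n)) ({r. r $ j = 0} \<times> UNIV)"
    using infsum_reindex_bij_betw[OF bij, of f] by (simp add: case_prod_unfold)
  also have "\<dots> = (\<Sum>\<^sub>\<infinity>r\<in>{r. r $ j = 0}. \<Sum>\<^sub>\<infinity>n. f (updj j r n))"
    using infsum_Sigma'_banach[of "\<lambda>r n. f (updj j r n)" "{r. r $ j = 0}" "\<lambda>_. UNIV"] s by simp
  finally show ?thesis .
qed

definition Jup :: "3 \<Rightarrow> int^3 \<Rightarrow> int^3 \<Rightarrow> int^3" where "Jup j a b = updj j a (b $ j)"
definition Jlo :: "3 \<Rightarrow> int^3 \<Rightarrow> int^3 \<Rightarrow> int^3" where "Jlo j a b = updj j b (- a $ j)"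

text \<open>The sum over \<open>p_j\<close> is carried out first, with the other coordinates fixed;
  \<open>theta_inversion\<close> applies to it, and the outer sums are untouched.\<close>

theorem thI_inversion:
  assumes \<tau>: "\<tau> \<in> siegel3"
  shows "thI a b (Jact j \<tau>) (Jz j \<tau> z) = csqrt (- \<i> * \<tau>$j$j) * exp (of_real pi * \<i> * (z$j)\<^sup>2 / \<tau>$j$j)
    * exp (of_real pi * \<i> * of_int (a$j * b$j) / 2) * thI (Jup j a b) (Jlo j a b) \<tau> z"
proof -
  define t where "t = \<tau>$j$j"
  have t: "Im t > 0" "t \<noteq> 0" using siegel3_diag[OF \<tau>] by (simp_all add: t_def)
  have sym: "transpose \<tau> = \<tau>" using \<tau> by (rule siegel3_sym)
  define c where "c = csqrt (- \<i> * t) * exp (of_real pi * \<i> * (z$j)\<^sup>2 / t) * exp (of_real pi * \<i> * of_int (a$j * b$j) / 2)"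
  have inner: "(\<Sum>\<^sub>\<infinity>n. tterm a b (Jact j \<tau>) (Jz j \<tau> z) (updj j r n)) =
      c * (\<Sum>\<^sub>\<infinity>n. tterm (Jup j a b) (Jlo j a b) \<tau> z (updj j r n))" if r: "r $ j = 0" for r
  proof -
    define rq where "rq = rest j (qv a r)"
    define l where "l = (\<tau> *v rq) $ j + z $ j"
    define R where "R = Gq \<tau> z rq + sp rq (vi b)"
    have rest1: "rest j (qv a (updj j r n)) = rq" for n
      by (simp add: rq_def rest_def qv_def updj_def vec_eq_iff)
    have rest2: "rest j (qv (Jup j a b) (updj j r n)) = rq" for n
      by (simp add: rq_def rest_def qv_def updj_def Jup_def vec_eq_iff)
    have spv: "sp q (vi d) = q$j * of_int (d$j) + sp (rest j q) (vi d)" for q d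
      using exhaust_3[of j] by (elim disjE; simp add: sp3 rest_def vi_def)
    have vJ: "sp rq (vi (Jlo j a b)) = sp rq (vi b)"
      using exhaust_3[of j] by (elim disjE; simp add: sp3 rq_def rest_def vi_def Jlo_def updj_def)
    define y where "y = of_int (a$j) / 2 - l - of_int (b$j) * t / 2"
    have L: "tterm a b (Jact j \<tau>) (Jz j \<tau> z) (updj j r n) =
      exp (of_real pi * \<i> * ((z$j)\<^sup>2 / t + R + (of_int (b$j))\<^sup>2 * t / 4 + of_int (b$j) * l)) * gterm (- 1 / t) (- y / t) (- (y\<^sup>2) / t) n" for n
    proof -
      have qj: "qv a (updj j r n) $ j = of_int n + of_int (a$j) / 2" by (simp add: qv_def updj_def)
      have "Gq (Jact j \<tau>) (Jz j \<tau> z) (qv a (updj j r n)) + sp (qv a (updj j r n)) (vi b) =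
        - ((of_int n + of_int (a$j) / 2 - l)\<^sup>2) / t + (z$j)\<^sup>2 / t + R + (of_int n + of_int (a$j) / 2) * of_int (b$j)"
        using t unfolding Gq_Jact[OF sym t(2)[unfolded t_def]] spv[of "qv a _"] rest1 qj
        by (simp add: R_def l_def t_def algebra_simps)
      also have "\<dots> = ((z$j)\<^sup>2 / t + R + (of_int (b$j))\<^sup>2 * t / 4 + of_int (b$j) * l) +
         ((- 1 / t) * (of_int n)\<^sup>2 + 2 * (- y / t) * of_int n + (- (y\<^sup>2) / t))"
        using t by (simp add: y_def power2_eq_square field_simps)
      finally show ?thesis
        unfolding tterm_def gterm_def by (simp only: distrib_left[of "of_real pi * \<i>"] exp_add)
    qed
    \<comment> \<open>Reversing the summation index gives the linear term the sign
      \<open>+2 l n\<close> that the form of tau requires.\<close>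
    have Rt: "gterm t y 0 (- n) * exp (of_real pi * \<i> * ((of_int (b$j))\<^sup>2 * t / 4 + of_int (b$j) * l + R)) =
      exp (of_real pi * \<i> * of_int (a$j * b$j) / 2) * tterm (Jup j a b) (Jlo j a b) \<tau> z (updj j r n)" for n
    proof -
      have qj: "qv (Jup j a b) (updj j r n) $ j = of_int n + of_int (b$j) / 2" by (simp add: qv_def updj_def Jup_def)
      have bj: "Jlo j a b $ j = - a $ j" by (simp add: Jlo_def updj_def)
      have G: "Gq \<tau> z (qv (Jup j a b) (updj j r n)) + sp (qv (Jup j a b) (updj j r n)) (vi (Jlo j a b)) =
         t * (of_int n + of_int (b$j) / 2)\<^sup>2 + 2 * (of_int n + of_int (b$j) / 2) * l + R
          - (of_int n + of_int (b$j) / 2) * of_int (a$j)"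
        unfolding Gq_split[OF sym, of z "qv _ _" j] spv[of "qv _ _"] rest2 qj bj vJ
        by (simp add: R_def l_def t_def algebra_simps)
      have "(t * (of_int (- n))\<^sup>2 + 2 * y * of_int (- n) + 0) + ((of_int (b$j))\<^sup>2 * t / 4 + of_int (b$j) * l + R) =
         of_int (a$j * b$j) / 2 + (Gq \<tau> z (qv (Jup j a b) (updj j r n)) + sp (qv (Jup j a b) (updj j r n)) (vi (Jlo j a b)))"
        unfolding G by (simp add: y_def power2_eq_square field_simps)
      from arg_cong[OF this, of "\<lambda>x. exp (of_real pi * \<i> * x)"] show ?thesis
        unfolding tterm_def gterm_def by (simp add: distrib_left exp_add)
    qed
    have "(\<Sum>\<^sub>\<infinity>n. tterm a b (Jact j \<tau>) (Jz j \<tau> z) (updj j r n)) =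
       exp (of_real pi * \<i> * ((z$j)\<^sup>2 / t + R + (of_int (b$j))\<^sup>2 * t / 4 + of_int (b$j) * l)) *
         (csqrt (- \<i> * t) * (\<Sum>\<^sub>\<infinity>k. gterm t y 0 k))"
      unfolding L by (simp only: infsum_cmult_right' theta_inversion[OF t(1)])
    also have "exp (of_real pi * \<i> * ((z$j)\<^sup>2 / t + R + (of_int (b$j))\<^sup>2 * t / 4 + of_int (b$j) * l)) =
       exp (of_real pi * \<i> * (z$j)\<^sup>2 / t) * exp (of_real pi * \<i> * ((of_int (b$j))\<^sup>2 * t / 4 + of_int (b$j) * l + R))"
      unfolding exp_add[symmetric] by (rule arg_cong[of _ _ exp]) (simp add: algebra_simps)
    also have "(\<Sum>\<^sub>\<infinity>k. gterm t y 0 k) = (\<Sum>\<^sub>\<infinity>n. gterm t y 0 (- n))"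
      by (rule infsum_reindex_bij_witness[of _ uminus uminus]) auto
    also have "exp (of_real pi * \<i> * (z$j)\<^sup>2 / t) * exp (of_real pi * \<i> * ((of_int (b$j))\<^sup>2 * t / 4 + of_int (b$j) * l + R)) *
         (csqrt (- \<i> * t) * (\<Sum>\<^sub>\<infinity>n. gterm t y 0 (- n))) =
       csqrt (- \<i> * t) * exp (of_real pi * \<i> * (z$j)\<^sup>2 / t) *
       (\<Sum>\<^sub>\<infinity>n. gterm t y 0 (- n) * exp (of_real pi * \<i> * ((of_int (b$j))\<^sup>2 * t / 4 + of_int (b$j) * l + R)))"
      by (simp add: infsum_cmult_left')
    also have "\<dots> = c * (\<Sum>\<^sub>\<infinity>n. tterm (Jup j a b) (Jlo j a b) \<tau> z (updj j r n))"
      unfolding Rt infsum_cmult_right' c_def by (simp only: mult_ac)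
    finally show ?thesis .
  qed
  have "thI a b (Jact j \<tau>) (Jz j \<tau> z) =
      (\<Sum>\<^sub>\<infinity>r\<in>{r. r $ j = 0}. \<Sum>\<^sub>\<infinity>n. tterm a b (Jact j \<tau>) (Jz j \<tau> z) (updj j r n))"
    unfolding thI_def by (intro infsum_split_coordinate tterm_summable' Jact_siegel3 \<tau>)
  also have "\<dots> = (\<Sum>\<^sub>\<infinity>r\<in>{r. r $ j = 0}. c * (\<Sum>\<^sub>\<infinity>n. tterm (Jup j a b) (Jlo j a b) \<tau> z (updj j r n)))"
    by (rule infsum_cong) (use inner in auto)
  also have "\<dots> = c * thI (Jup j a b) (Jlo j a b) \<tau> z"
    unfolding infsum_cmult_right' thI_def
    by (subst infsum_split_coordinate[of _ j]) (auto intro: tterm_summable' \<tau>)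
  finally show ?thesis by (simp add: c_def t_def)
qed

subsection \<open>Reduction of characteristics modulo 2\<close>

definition red :: "int^3 \<Rightarrow> bit^3" where "red a = (\<chi> i. if odd (a $ i) then 1 else 0)"
definition redm :: "int^3^3 \<Rightarrow> bit^3^3" where "redm A = (\<chi> i j. if odd (A $ i $ j) then 1 else 0)"

lemma bit_cases01: "(x::bit) = 0 \<or> x = 1" by (cases x) auto

lemma red_lift [simp]: "red (lift \<epsilon>) = \<epsilon>"
  using bit_cases01 by (force simp: red_def lift_def vec_eq_iff)

lemma red_add: "red (a + b) = red a + red b"
  by (auto simp: red_def vec_eq_iff)

lemma red_mv: "red (A *v x) = redm A *v red x"
proof -
  have "(if odd (x + y + z) then 1 else (0::bit)) = (if odd x then 1 else 0) + (if odd y then 1 else 0) + (if odd (z::int) then 1 else 0)" for x y z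
    by auto
  moreover have "(if odd (x * y) then 1 else (0::bit)) = (if odd x then 1 else 0) * (if odd (y::int) then 1 else 0)" for x y
    by auto
  ultimately show ?thesis
    by (simp only: vec_eq_iff red_def redm_def mv3 vec_lambda_beta simp_thms)
qed

lemma red_sp: "sp (red x) (red y) = (if odd (sp x y) then 1 else 0)"
  by (auto simp: sp3 red_def)

lemma mv_axis: "(M *v axis j 1) $ i = (M :: 'a::comm_ring_1^3^3) $ i $ j"
  using exhaust_3[of j] by (elim disjE; simp add: mv3 axis_def)

lemma redm_mult: "redm (A ** B) = redm A ** redm B"
proof -
  have "red ((A ** B) *v axis j 1) $ i = (redm A ** redm B *v red (axis j 1)) $ i" for i j
    by (simp add: red_mv flip: matrix_vector_mul_assoc)
  moreover have "red (axis j 1) = axis j 1" for j by (auto simp: red_def axis_def vec_eq_iff)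
  moreover have "red (M *v axis j 1) $ i = redm M $ i $ j" for M i j
    by (simp add: red_def redm_def mv_axis)
  ultimately show ?thesis by (simp add: vec_eq_iff mv_axis)
qed

lemma redm_one [simp]: "redm (mat 1) = mat 1" and redm_transpose: "redm (transpose A) = transpose (redm A)"
  by (auto simp: redm_def mat_def transpose_def vec_eq_iff)

lemma red_eq_iff: "red a = red b \<longleftrightarrow> (\<exists>k. a = b + 2 * k)"
proof
  assume "red a = red b"
  then have "even (a $ i - b $ i)" for i by (auto simp: red_def vec_eq_iff split: if_splits)
  then have "a = b + 2 * (\<chi> i. (a $ i - b $ i) div 2)" by (auto simp: vec_eq_iff)
  then show "\<exists>k. a = b + 2 * k" ..
qed (auto simp: red_def vec_eq_iff)

lemma thI_upper_cong: "red a = red a' \<Longrightarrow> thI a b \<tau> z = thI a' b \<tau> z"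
  unfolding red_eq_iff using thI_shift_upper by auto

lemma thI_lower_cong:
  assumes "red b = red b'"
  obtains s where "s = 1 \<or> s = -1" "\<And>\<tau> z. thI a b \<tau> z = s * thI a b' \<tau> z"
  using assms thI_shift_lower[of a b'] unfolding red_eq_iff by metis

lemma theta_red:
  obtains s where "s = 1 \<or> s = -1" "\<And>\<tau> z. thI a b \<tau> z = s * theta (red a) (red b) \<tau> z"
proof -
  obtain s where s: "s = 1 \<or> s = -1" "\<And>\<tau> z. thI a b \<tau> z = s * thI a (lift (red b)) \<tau> z"
    using thI_lower_cong[of b "lift (red b)" a] by auto
  have "thI a (lift (red b)) \<tau> z = theta (red a) (red b) \<tau> z" for \<tau> z
    unfolding theta_thI by (rule thI_upper_cong) simp
  then show ?thesis using that s by simp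
qed

subsection \<open>Transformation of the theta constants\<close>

lemma theta_unimodular:
  assumes "U ** V = mat 1"
  obtains s where "s = 1 \<or> s = -1"
    "\<And>\<tau>. theta \<alpha> \<beta> (cm U ** \<tau> ** transpose (cm U)) 0 = s * theta (transpose (redm U) *v \<alpha>) (redm V *v \<beta>) \<tau> 0"
proof -
  obtain s where s: "s = 1 \<or> s = -1" "\<And>\<tau> z. thI (transpose U *v lift \<alpha>) (V *v lift \<beta>) \<tau> z =
      s * theta (red (transpose U *v lift \<alpha>)) (red (V *v lift \<beta>)) \<tau> z"
    using theta_red by blast
  have "theta \<alpha> \<beta> (cm U ** \<tau> ** transpose (cm U)) 0 = thI (transpose U *v lift \<alpha>) (V *v lift \<beta>) \<tau> 0" for \<tau>
    using thI_unimodular[OF assms, of "lift \<alpha>" "lift \<beta>" \<tau> 0] by (simp add: theta_thI)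
  then show ?thesis
    using that[OF s(1)] s(2) by (simp add: red_mv redm_transpose del: transpose_matrix_vector)
qed

lemma theta_translate:
  assumes "transpose S = S"
  obtains c where "c \<noteq> 0"
    "\<And>\<tau>. theta \<alpha> \<beta> (\<tau> + cm S) 0 = c * theta \<alpha> (\<beta> + redm S *v \<alpha> + red (diagv S)) \<tau> 0"
proof -
  obtain s where s: "s = 1 \<or> s = -1" "\<And>\<tau> z. thI (lift \<alpha>) (lift \<beta> + S *v lift \<alpha> + diagv S) \<tau> z =
      s * theta (red (lift \<alpha>)) (red (lift \<beta> + S *v lift \<alpha> + diagv S)) \<tau> z"
    using theta_red by blast
  define c where "c = exp (- (of_real pi * \<i> / 4) * of_int (sp (lift \<alpha>) (S *v lift \<alpha>) + 2 * sp (lift \<alpha>) (diagv S))) * s"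
  show ?thesis
  proof
    show "c \<noteq> 0" using s by (auto simp: c_def)
    show "theta \<alpha> \<beta> (\<tau> + cm S) 0 = c * theta \<alpha> (\<beta> + redm S *v \<alpha> + red (diagv S)) \<tau> 0" for \<tau>
      unfolding theta_thI[of \<alpha> \<beta>] thI_translate[OF assms] s(2) by (simp add: c_def red_add red_mv)
  qed
qed

text \<open>The constant is exact here, in contrast to \<open>theta_translate\<close>: the eighth
  root of unity is later raised to the number of characteristics in a product, and the resulting
  sign is essential.\<close>

lemma theta_translate_11:
  "theta \<alpha> \<beta> (\<tau> + cm (Em 1 1 1)) 0 =
    (if \<alpha> $ 1 = 1 then exp (of_real pi * \<i> / 4) * theta \<alpha> \<beta> \<tau> 0 else theta \<alpha> (\<beta> + axis 1 1) \<tau> 0)"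
proof (cases "\<alpha> $ 1 = 1")
  case True
  have e: "lift \<beta> + Em 1 1 1 *v lift \<alpha> + diagv (Em 1 1 1) = lift \<beta> + 2 * axis 1 1"
    using True by (simp add: vec_eq_iff forall_3 mv3 Em_def lift_def diagv_def axis_def)
  have n: "sp (lift \<alpha>) (Em 1 1 1 *v lift \<alpha>) + 2 * sp (lift \<alpha>) (diagv (Em 1 1 1)) = 3"
    "odd (sp (lift \<alpha>) (axis 1 1))"
    using True by (simp_all add: sp3 mv3 Em_def lift_def diagv_def axis_def)
  have "theta \<alpha> \<beta> (\<tau> + cm (Em 1 1 1)) 0 = exp (- (of_real pi * \<i> / 4) * of_int 3) * (- 1 * theta \<alpha> \<beta> \<tau> 0)"
    unfolding theta_thI thI_translate[OF transpose_Em] n(1) e thI_shift_lower using n(2) by simp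
  also have "\<dots> = exp (- (of_real pi * \<i> / 4) * of_int 3) * exp (of_real pi * \<i>) * theta \<alpha> \<beta> \<tau> 0" by simp
  also have "exp (- (of_real pi * \<i> / 4) * of_int 3) * exp (of_real pi * \<i>) = exp (of_real pi * \<i> / 4)"
    unfolding exp_add[symmetric] by (rule arg_cong[of _ _ exp]) (simp add: field_simps)
  finally show ?thesis using True by simp
next
  case False
  have e: "lift \<beta> + Em 1 1 1 *v lift \<alpha> + diagv (Em 1 1 1) = lift \<beta> + axis 1 1"
    using False by (simp add: vec_eq_iff forall_3 mv3 Em_def lift_def diagv_def axis_def)
  have z: "sp (lift \<alpha>) (Em 1 1 1 *v lift \<alpha>) + 2 * sp (lift \<alpha>) (diagv (Em 1 1 1)) = 0"
    "\<And>k. k $ 2 = 0 \<Longrightarrow> k $ 3 = 0 \<Longrightarrow> even (sp (lift \<alpha>) k)"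
    using False by (simp_all add: sp3 mv3 Em_def lift_def diagv_def axis_def)
  have "red (lift \<beta> + axis 1 1) = red (lift (\<beta> + axis 1 1))"
    by (simp add: red_add) (simp add: red_def axis_def vec_eq_iff)
  then obtain k where k: "lift \<beta> + axis 1 1 = lift (\<beta> + axis 1 1) + 2 * k" unfolding red_eq_iff by blast
  have "k $ i = 0" if "i \<noteq> 1" for i
    using arg_cong[OF k, of "\<lambda>v. v $ i"] that by (auto simp: lift_def axis_def split: if_splits)
  then have "even (sp (lift \<alpha>) k)" by (intro z(2)) auto
  then show ?thesis
    using False unfolding theta_thI thI_translate[OF transpose_Em] z(1) e k thI_shift_lower by simp
qed

definition swapj :: "3 \<Rightarrow> bit^3 \<Rightarrow> bit^3 \<Rightarrow> bit^3"
  where "swapj j x y = (\<chi> i. if i = j then y $ i else x $ i)"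

lemma theta_inversion_3:
  assumes "\<tau> \<in> siegel3"
  shows "theta \<alpha> \<beta> (Jact j \<tau>) 0 = csqrt (- \<i> * \<tau>$j$j) * (if \<alpha>$j = 1 \<and> \<beta>$j = 1 then - \<i> else 1) *
    theta (swapj j \<alpha> \<beta>) (swapj j \<beta> \<alpha>) \<tau> 0"
proof -
  have Jz: "Jz j \<tau> 0 = 0" by (simp add: Jz_def vec_eq_iff)
  have up: "Jup j (lift \<alpha>) (lift \<beta>) = lift (swapj j \<alpha> \<beta>)"
    by (auto simp: Jup_def updj_def swapj_def lift_def vec_eq_iff)
  define k :: "int^3" where "k = updj j 0 (- lift \<alpha> $ j)"
  have lo: "Jlo j (lift \<alpha>) (lift \<beta>) = lift (swapj j \<beta> \<alpha>) + 2 * k"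
    by (auto simp: Jlo_def updj_def swapj_def lift_def vec_eq_iff k_def)
  have spk: "sp (lift (swapj j \<alpha> \<beta>)) k = - (lift \<alpha> $ j * lift \<beta> $ j)"
    using exhaust_3[of j] by (elim disjE; simp add: sp3 k_def updj_def swapj_def lift_def)
  have e: "exp (of_real pi * \<i> * of_int (lift \<alpha> $ j * lift \<beta> $ j) / 2) * (if even (sp (lift (swapj j \<alpha> \<beta>)) k) then 1 else - 1) =
      (if \<alpha>$j = 1 \<and> \<beta>$j = 1 then - \<i> else 1)"
  proof -
    have "exp (of_real pi * \<i> / 2) = cis (pi / 2)" by (simp add: cis_conv_exp mult.commute)
    then show ?thesis unfolding spk by (simp add: lift_def)
  qed
  show ?thesis
    using thI_inversion[OF assms, of "lift \<alpha>" "lift \<beta>" j 0]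
    unfolding theta_thI Jz up lo thI_shift_lower e[symmetric] by simp
qed

subsection \<open>Transformation of the second order theta functions\<close>

lemma Theta2_thI: "Theta2 \<tau> z $ \<epsilon> = thI (lift \<epsilon>) 0 (2 *\<^sub>R \<tau>) (2 *\<^sub>R z)"
proof -
  have "lift 0 = 0" by (simp add: lift_def vec_eq_iff)
  then show ?thesis by (simp add: Theta2_def theta_thI)
qed

lemma Theta2_unimodular:
  assumes "U ** V = mat 1"
  shows "Theta2 (cm U ** \<tau> ** transpose (cm U)) (cm U *v z) $ \<epsilon> = Theta2 \<tau> z $ (transpose (redm U) *v \<epsilon>)"
proof -
  have e: "2 *\<^sub>R (cm U ** \<tau> ** transpose (cm U)) = cm U ** (2 *\<^sub>R \<tau>) ** transpose (cm U)"
    by (simp add: vec_eq_iff matrix_matrix_mult_def sum_3 algebra_simps)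
  have "2 *\<^sub>R (cm U *v z) = cm U *v (2 *\<^sub>R z)" by (simp add: vec_eq_iff mv3 algebra_simps)
  then have "Theta2 (cm U ** \<tau> ** transpose (cm U)) (cm U *v z) $ \<epsilon> = thI (transpose U *v lift \<epsilon>) 0 (2 *\<^sub>R \<tau>) (2 *\<^sub>R z)"
    unfolding Theta2_thI e using thI_unimodular[OF assms, of "lift \<epsilon>" 0] by simp
  also have "\<dots> = Theta2 \<tau> z $ (transpose (redm U) *v \<epsilon>)"
    unfolding Theta2_thI by (rule thI_upper_cong) (simp add: red_mv redm_transpose del: transpose_matrix_vector)
  finally show ?thesis .
qed

lemma Theta2_translate:
  assumes "transpose S = S"
  shows "Theta2 (\<tau> + cm S) z $ \<epsilon> = exp (of_real pi * \<i> / 2 * of_int (sp (lift \<epsilon>) (S *v lift \<epsilon>))) * Theta2 \<tau> z $ \<epsilon>"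
proof -
  define a where "a = lift \<epsilon>"
  define n where "n = sp a (S *v a)"
  define d where "d = sp a (diagv S)"
  have e: "2 *\<^sub>R (\<tau> + cm S) = 2 *\<^sub>R \<tau> + cm (S + S)"
    by (simp add: vec_eq_iff scaleR_2)
  have SS: "transpose (S + S) = S + S" by (simp only: transpose_add assms)
  have b: "0 + (S + S) *v a + diagv (S + S) = 0 + 2 * (S *v a + diagv S)"
    by (simp add: vec_eq_iff mv3 diagv_def algebra_simps)
  have s1: "sp a ((S + S) *v a) + 2 * sp a (diagv (S + S)) = 2 * n + 4 * d"
    by (simp add: n_def d_def sp3 mv3 diagv_def algebra_simps)
  have s2: "sp a (S *v a + diagv S) = n + d"
    by (simp add: n_def d_def sp3 algebra_simps)
  have "Theta2 (\<tau> + cm S) z $ \<epsilon> = exp (- (of_real pi * \<i> / 4) * of_int (2 * n + 4 * d)) *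
      exp (of_real pi * \<i> * of_int (n + d)) * Theta2 \<tau> z $ \<epsilon>"
    unfolding Theta2_thI a_def[symmetric] e thI_translate[OF SS] b s1 thI_shift_lower s2 exp_pi_i_int by simp
  also have "exp (- (of_real pi * \<i> / 4) * of_int (2 * n + 4 * d)) * exp (of_real pi * \<i> * of_int (n + d)) =
     exp (of_real pi * \<i> / 2 * of_int n)"
    unfolding exp_add[symmetric] by (rule arg_cong[of _ _ exp]) (simp add: field_simps)
  finally show ?thesis by (simp add: n_def a_def)
qed

lemma infsum_parity_coordinate:
  fixes f :: "int^3 \<Rightarrow> complex"
  assumes "f summable_on UNIV"
  shows "infsum f UNIV = (\<Sum>\<^sub>\<infinity>p. f (updj j p (2 * p$j))) + (\<Sum>\<^sub>\<infinity>p. f (updj j p (2 * p$j + 1)))"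
proof -
  define E where "E = (\<lambda>p::int^3. updj j p (2 * p$j))"
  define D where "D = (\<lambda>p::int^3. updj j p (2 * p$j + 1))"
  have "p = q" if eq: "\<And>i. updj j p (2 * p$j + s) $ i = updj j q (2 * q$j + s) $ i" for p q s
  proof -
    have "p $ i = q $ i" for i using eq[of i] by (cases "i = j") (simp_all add: updj_def)
    then show ?thesis by (simp add: vec_eq_iff)
  qed
  note inj' = this
  have inj: "inj E" "inj D"
    by (rule injI, rule inj'[of _ 0], simp add: E_def) (rule injI, rule inj'[of _ 1], simp add: D_def)
  have disj: "range E \<inter> range D = {}"
  proof -
    have par: "even (E p $ j)" "odd (D p $ j)" for p by (simp_all add: E_def D_def updj_def)
    have False if x: "x \<in> range E" "x \<in> range D" for x
    proof -
      obtain p q where "x = E p" "x = D q" using x by blast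
      then show False using par[of p] par(2)[of q] by simp
    qed
    then show ?thesis by blast
  qed
  have un: "UNIV = range E \<union> range D"
  proof (rule UNIV_eq_I)
    fix p :: "int^3"
    show "p \<in> range E \<union> range D"
    proof (cases "even (p $ j)")
      case True
      then have "p = E (updj j p (p$j div 2))" by (auto simp: E_def updj_def vec_eq_iff)
      then show ?thesis by blast
    next
      case False
      then have "p = D (updj j p (p$j div 2))" by (auto simp: D_def updj_def vec_eq_iff)
      then show ?thesis by blast
    qed
  qed
  have "infsum f (range E \<union> range D) = infsum f (range E) + infsum f (range D)"
    by (rule infsum_Un_disjoint[OF summable_on_subset_banach[OF assms] summable_on_subset_banach[OF assms] disj]) simp_all
  then have "infsum f UNIV = infsum f (range E) + infsum f (range D)"
    by (rule trans[OF arg_cong[OF un, of "infsum f"]])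
  also have "\<dots> = infsum (f \<circ> E) UNIV + infsum (f \<circ> D) UNIV"
    using inj by (simp add: infsum_reindex)
  finally show ?thesis by (simp add: o_def E_def D_def)
qed

text \<open>Doubling and partial inversion do not commute. This is the matrix with
  \<open>2 (Jact j tau) = Jact j (halfj j tau)\<close>; as a form it is \<open>2 tau\<close> with
  the \<open>j\<close>-th variable halved.\<close>

definition halfj :: "3 \<Rightarrow> complex^3^3 \<Rightarrow> complex^3^3"
  where "halfj j \<tau> = (\<chi> k l. if k = j \<and> l = j then \<tau>$j$j / 2 else if k = j \<or> l = j then \<tau>$k$l else 2 * \<tau>$k$l)"

lemma halfj_siegel3: assumes \<tau>: "\<tau> \<in> siegel3" shows "halfj j \<tau> \<in> siegel3"
proof (rule siegel3_posI)
  have "halfj j \<tau> $ l $ k = halfj j \<tau> $ k $ l" for k l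
    unfolding halfj_def using siegel3_nth_sym[OF \<tau>, of l k] by auto
  then show "transpose (halfj j \<tau>) = halfj j \<tau>" by (simp add: transpose_def vec_eq_iff)
  fix v :: "real^3" assume v: "v \<noteq> 0"
  define u where "u = (\<chi> i. if i = j then v $ i / 2 else v $ i)"
  have "u \<noteq> 0" using v by (auto simp: u_def vec_eq_iff split: if_splits)
  then have "0 < Im (sp (\<chi> i. of_real (u$i)) (\<tau> *v (\<chi> i. of_real (u$i))))" by (rule siegel3_posD[OF \<tau>])
  moreover have "sp (\<chi> i. of_real (v$i)) (halfj j \<tau> *v (\<chi> i. of_real (v$i))) =
      2 * sp (\<chi> i. of_real (u$i)) (\<tau> *v (\<chi> i. complex_of_real (u$i)))"
    using exhaust_3[of j] by (elim disjE; simp add: sp3 mv3 halfj_def u_def field_simps)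
  ultimately show "0 < Im (sp (\<chi> i. of_real (v$i)) (halfj j \<tau> *v (\<chi> i. of_real (v$i))))" by simp
qed

definition setj :: "3 \<Rightarrow> bit^3 \<Rightarrow> bit \<Rightarrow> bit^3"
  where "setj j \<epsilon> s = (\<chi> i. if i = j then s else \<epsilon> $ i)"

lemma Theta2_inversion:
  assumes \<tau>: "\<tau> \<in> siegel3"
  shows "Theta2 (Jact j \<tau>) (Jz j \<tau> z) $ \<epsilon> =
    csqrt (- \<i> * (\<tau>$j$j / 2)) * exp (2 * of_real pi * \<i> * (z$j)\<^sup>2 / \<tau>$j$j) *
    (Theta2 \<tau> z $ setj j \<epsilon> 0 + (if \<epsilon>$j = 1 then -1 else 1) * Theta2 \<tau> z $ setj j \<epsilon> 1)"
proof -
  define h where "h = halfj j \<tau>"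
  have h: "h \<in> siegel3" unfolding h_def by (rule halfj_siegel3[OF \<tau>])
  have hjj: "h$j$j = \<tau>$j$j / 2" by (simp add: h_def halfj_def)
  define zh where "zh = (\<chi> l. if l = j then z$l else 2 * z$l)"
  have t: "\<tau>$j$j \<noteq> 0" using siegel3_diag[OF \<tau>] by simp
  have e1: "2 *\<^sub>R Jact j \<tau> = Jact j h"
    using t by (auto simp: h_def vec_eq_iff Jact_def halfj_def scaleR_conv_of_real[where 'a = complex] field_simps)
  have e2: "2 *\<^sub>R Jz j \<tau> z = Jz j h zh"
    using t by (auto simp: h_def vec_eq_iff Jz_def zh_def halfj_def scaleR_conv_of_real[where 'a = complex] field_simps)
  define a where "a = lift \<epsilon>"
  \<comment> \<open>Splitting \<open>p_j\<close> by parity undoes the halving: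
    \<open>p_j = 2 p + s\<close> leads back to the form \<open>2 tau\<close> with upper
    characteristic \<open>s\<close>, and the lower characteristic left by the inversion becomes a
    sign.\<close>
  have half: "(\<Sum>\<^sub>\<infinity>p. tterm (Jup j a 0) (Jlo j a 0) h zh (updj j p (2 * p$j + s))) =
      (if even (s * a$j) then 1 else -1) * thI (updj j a s) 0 (2 *\<^sub>R \<tau>) (2 *\<^sub>R z)" if s: "s = 0 \<or> s = 1" for s
  proof -
    have "tterm (Jup j a 0) (Jlo j a 0) h zh (updj j p (2 * p$j + s)) =
       (if even (s * a$j) then 1 else -1) * tterm (updj j a s) 0 (2 *\<^sub>R \<tau>) (2 *\<^sub>R z) p" for p
    proof -
      define k where "k = - (2 * p$j + s) * a$j"
      have G: "Gq h zh (qv (Jup j a 0) (updj j p (2 * p$j + s))) = Gq (2 *\<^sub>R \<tau>) (2 *\<^sub>R z) (qv (updj j a s) p)"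
        using exhaust_3[of j]
        by (elim disjE; hypsubst; simp add: Gq_def sp3 mv3 qv_def Jup_def updj_def h_def halfj_def zh_def
              scaleR_conv_of_real[where 'a = complex]) (simp_all add: field_simps)
      have V: "sp (qv (Jup j a 0) (updj j p (2 * p$j + s))) (vi (Jlo j a 0)) = of_int k + sp (qv (updj j a s) p) (vi 0)"
        using exhaust_3[of j]
        by (elim disjE; hypsubst; simp add: sp3 qv_def vi_def Jup_def Jlo_def updj_def k_def algebra_simps)
      have "even k \<longleftrightarrow> even (s * a$j)" by (simp add: k_def)
      then have "exp (of_real pi * \<i> * of_int k) = (if even (s * a$j) then 1 else -1)" by (simp only: exp_pi_i_int)
      moreover have "tterm (Jup j a 0) (Jlo j a 0) h zh (updj j p (2 * p$j + s)) =
          exp (of_real pi * \<i> * of_int k) * tterm (updj j a s) 0 (2 *\<^sub>R \<tau>) (2 *\<^sub>R z) p"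
        unfolding tterm_def G V exp_add[symmetric] by (rule arg_cong[of _ _ exp]) (simp add: algebra_simps)
      ultimately show ?thesis by simp
    qed
    then show ?thesis unfolding thI_def by (simp only: infsum_cmult_right')
  qed
  have u: "updj j a 0 = lift (setj j \<epsilon> 0)" "updj j a 1 = lift (setj j \<epsilon> 1)"
    by (auto simp: a_def updj_def lift_def setj_def vec_eq_iff)
  have aj: "even (1 * a$j) \<longleftrightarrow> \<epsilon>$j \<noteq> 1" by (simp add: a_def lift_def)
  have "Theta2 (Jact j \<tau>) (Jz j \<tau> z) $ \<epsilon> = csqrt (- \<i> * h$j$j) * exp (of_real pi * \<i> * (zh$j)\<^sup>2 / h$j$j) *
      thI (Jup j a 0) (Jlo j a 0) h zh"
    unfolding Theta2_thI e1 e2 a_def[symmetric] thI_inversion[OF h] by simp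
  also have "thI (Jup j a 0) (Jlo j a 0) h zh = thI (updj j a 0) 0 (2 *\<^sub>R \<tau>) (2 *\<^sub>R z) +
      (if even (1 * a$j) then 1 else -1) * thI (updj j a 1) 0 (2 *\<^sub>R \<tau>) (2 *\<^sub>R z)"
    using half[of 0] half[of 1] infsum_parity_coordinate[OF tterm_summable'[OF h], of "Jup j a 0" "Jlo j a 0" zh j]
    by (simp add: thI_def[of "Jup j a 0"])
  also have "of_real pi * \<i> * (zh$j)\<^sup>2 / h$j$j = 2 * of_real pi * \<i> * (z$j)\<^sup>2 / \<tau>$j$j"
    using t by (simp add: zh_def hjj)
  finally show ?thesis unfolding hjj u aj Theta2_thI by simp
qed

subsection \<open>Riemann's quartic relation\<close>

definition bv :: "bit \<Rightarrow> bit \<Rightarrow> bit \<Rightarrow> bit^3"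
  where "bv x y z = (\<chi> i. if i = 1 then x else if i = 2 then y else z)"

lemma bv_nth [simp]: "bv x y z $ 1 = x" "bv x y z $ 2 = y" "bv x y z $ 3 = z"
  by (simp_all add: bv_def)

lemma bv_eta: "bv (v$1) (v$2) (v$3) = v"
  by (simp add: vec_eq_iff forall_3)

lemma bv_eq_iff [simp]: "bv x y z = bv x' y' z' \<longleftrightarrow> x = x' \<and> y = y' \<and> z = z'"
  by (auto simp: vec_eq_iff forall_3)

lemma bv_zero: "0 = bv 0 0 0"
  by (simp add: vec_eq_iff forall_3)

lemma UNIV_bit3: "UNIV = {bv 0 0 0, bv 0 0 1, bv 0 1 0, bv 0 1 1, bv 1 0 0, bv 1 0 1, bv 1 1 0, bv 1 1 1}"
proof (rule UNIV_eq_I)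
  fix v :: "bit^3"
  show "v \<in> {bv 0 0 0, bv 0 0 1, bv 0 1 0, bv 0 1 1, bv 1 0 0, bv 1 0 1, bv 1 1 0, bv 1 1 1}"
    using bit_cases01[of "v$1"] bit_cases01[of "v$2"] bit_cases01[of "v$3"] bv_eta[of v] by auto
qed

lemma sum_bit3: "(\<Sum>v\<in>UNIV. f v) = f (bv 0 0 0) + f (bv 0 0 1) + f (bv 0 1 0) + f (bv 0 1 1)
   + f (bv 1 0 0) + f (bv 1 0 1) + f (bv 1 1 0) + f (bv 1 1 1)"
  for f :: "bit^3 \<Rightarrow> 'a::comm_monoid_add"
  unfolding UNIV_bit3 by (simp add: add.assoc)

lemma all_bit3: "(\<forall>v. P v) \<longleftrightarrow> P (bv 0 0 0) \<and> P (bv 0 0 1) \<and> P (bv 0 1 0) \<and> P (bv 0 1 1)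
   \<and> P (bv 1 0 0) \<and> P (bv 1 0 1) \<and> P (bv 1 1 0) \<and> P (bv 1 1 1)"
  using UNIV_bit3 by (metis UNIV_I empty_iff insert_iff)

definition iv :: "int \<Rightarrow> int \<Rightarrow> int \<Rightarrow> int^3"
  where "iv x y z = (\<chi> i. if i = 1 then x else if i = 2 then y else z)"

lemma iv_nth [simp]: "iv x y z $ 1 = x" "iv x y z $ 2 = y" "iv x y z $ 3 = z"
  by (simp_all add: iv_def)

lemma lift_bv: "lift (bv x y z) = iv (if x = 1 then 1 else 0) (if y = 1 then 1 else 0) (if z = 1 then 1 else 0)"
  by (simp add: vec_eq_iff forall_3 lift_def)

lemma infsum_times:
  fixes f :: "'a \<Rightarrow> complex" and g :: "'b \<Rightarrow> complex"
  assumes "(\<lambda>x. norm (f x)) summable_on UNIV" "(\<lambda>y. norm (g y)) summable_on UNIV"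
  shows "infsum f UNIV * infsum g UNIV = infsum (\<lambda>(x, y). f x * g y) UNIV"
proof -
  have "(\<lambda>(x, y). f x * g y) summable_on UNIV \<times> UNIV"
    using abs_summable_times[OF assms] abs_summable_summable by blast
  then have "infsum (\<lambda>(x, y). f x * g y) (UNIV \<times> UNIV) = (\<Sum>\<^sub>\<infinity>x. \<Sum>\<^sub>\<infinity>y. f x * g y)"
    using infsum_Sigma'_banach[of "\<lambda>x y. f x * g y" UNIV "\<lambda>_. UNIV"] by simp
  then show ?thesis by (simp add: infsum_cmult_right' infsum_cmult_left')
qed

lemma siegel3_double: "\<tau> \<in> siegel3 \<Longrightarrow> 2 *\<^sub>R \<tau> \<in> siegel3"
proof -
  assume t: "\<tau> \<in> siegel3"
  have "map_matrix Im (2 *\<^sub>R \<tau>) = 2 *\<^sub>R map_matrix Im \<tau>" by (simp add: vec_eq_iff)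
  moreover have "v \<bullet> ((2 *\<^sub>R M) *v v) = 2 * (v \<bullet> (M *v v))" for v :: "real^3" and M
    by (simp add: inner3 mv3 algebra_simps)
  moreover have "transpose (2 *\<^sub>R \<tau>) = 2 *\<^sub>R transpose \<tau>" by (simp add: transpose_def vec_eq_iff)
  ultimately show ?thesis using t by (simp add: siegel3_def)
qed

text \<open>By the parallelogram law, passing to half sum and half difference takes two copies of
  the form of tau to two copies of that of \<open>2 tau\<close>. A pair of integral vectors has such
  coordinates only up to parity, and \<open>\<sigma>\<close> records the parity of the
  difference.\<close>

lemma thI_duplication:
  assumes \<tau>: "\<tau> \<in> siegel3"
  shows "thI a b \<tau> 0 * thI a (b + c) \<tau> 0 =
    (\<Sum>\<sigma>\<in>UNIV. (if even (sp (lift \<sigma> + a) b + sp (lift \<sigma>) c) then 1 else -1) *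
       (thI (lift \<sigma> + a) c (2 *\<^sub>R \<tau>) 0 * thI (lift \<sigma>) c (2 *\<^sub>R \<tau>) 0))"
proof -
  define f where "f = (\<lambda>x. tterm a b \<tau> 0 (fst x) * tterm a (b + c) \<tau> 0 (snd x))"
  define B where "B = (\<lambda>(\<sigma>, w', w). (w' + w + lift \<sigma>, w' - w))"
  define g where "g = (\<lambda>\<sigma> (w', w). tterm (lift \<sigma> + a) c (2 *\<^sub>R \<tau>) 0 w' * tterm (lift \<sigma>) c (2 *\<^sub>R \<tau>) 0 w)"
  define s where "s = (\<lambda>\<sigma>. if even (sp (lift \<sigma> + a) b + sp (lift \<sigma>) c) then 1 else (-1::complex))"
  have fs: "f summable_on UNIV"
    using abs_summable_times[OF tterm_summable[OF \<tau>, of a b 0] tterm_summable[OF \<tau>, of a "b + c" 0]] abs_summable_summable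
    by (auto simp: f_def case_prod_unfold)
  have bij: "bij B"
  proof (rule bij_betwI[where g = "\<lambda>(p, p'). (red (p - p'), p' + (\<chi> i. (p$i - p'$i) div 2), \<chi> i. (p$i - p'$i) div 2)"])
    show "(case B x of (p, p') \<Rightarrow> (red (p - p'), p' + (\<chi> i. (p$i - p'$i) div 2), \<chi> i. (p$i - p'$i) div 2)) = x" for x
    proof -
      obtain \<sigma> w' w where x: "x = (\<sigma>, w', w)" by (metis prod_cases3)
      have 1: "w' + w + lift \<sigma> - (w' - w) = lift \<sigma> + 2 * w" by (simp add: vec_eq_iff)
      have "red (lift \<sigma> + 2 * w) = red (lift \<sigma>)" unfolding red_eq_iff by blast
      moreover have "((w' + w + lift \<sigma>) $ i - (w' - w) $ i) div 2 = w $ i" for i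
        by (auto simp: lift_def)
      ultimately show ?thesis unfolding x B_def by (simp add: 1 vec_eq_iff)
    qed
    show "B (case y of (p, p') \<Rightarrow> (red (p - p'), p' + (\<chi> i. (p$i - p'$i) div 2), \<chi> i. (p$i - p'$i) div 2)) = y" for y
    proof -
      obtain p p' where y: "y = (p, p')" by fastforce
      have "p' $ i + (p $ i - p' $ i) div 2 + (p $ i - p' $ i) div 2 + lift (red (p - p')) $ i = p $ i" for i
      proof -
        have "lift (red (p - p')) $ i = (p $ i - p' $ i) mod 2"
          by (simp add: lift_def red_def even_iff_mod_2_eq_zero)
        then show ?thesis using mult_div_mod_eq[of 2 "p $ i - p' $ i"] by linarith
      qed
      then show ?thesis unfolding y B_def by (simp add: vec_eq_iff)
    qed
  qed auto
  have fB: "f (B (\<sigma>, x)) = s \<sigma> * g \<sigma> x" for \<sigma> x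
  proof -
    obtain w' w where x: "x = (w', w)" by fastforce
    define u where "u = qv (lift \<sigma> + a) w'"
    define v where "v = qv (lift \<sigma>) w"
    define k where "k = sp (2 * w' + lift \<sigma> + a) b - sp (2 * w + lift \<sigma>) c"
    have q: "qv a (w' + w + lift \<sigma>) = u + v" "qv a (w' - w) = u - v"
      by (simp_all add: u_def v_def qv_def vec_eq_iff field_simps)
    have G: "Gq \<tau> 0 (u + v) + Gq \<tau> 0 (u - v) = Gq (2 *\<^sub>R \<tau>) 0 u + Gq (2 *\<^sub>R \<tau>) 0 v"
      by (simp add: Gq_def sp3 mv3 scaleR_conv_of_real[where 'a = complex] algebra_simps)
    have V: "sp (u + v) (vi b) + sp (u - v) (vi (b + c)) = of_int k + (sp u (vi c) + sp v (vi c))"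
      by (simp add: k_def u_def v_def sp3 vi_def qv_def field_simps)
    have "f (B (\<sigma>, x)) = exp (of_real pi * \<i> * of_int k) * (tterm (lift \<sigma> + a) c (2 *\<^sub>R \<tau>) 0 w' * tterm (lift \<sigma>) c (2 *\<^sub>R \<tau>) 0 w)"
      unfolding f_def B_def x prod.case fst_conv snd_conv tterm_def q u_def[symmetric] v_def[symmetric] exp_add[symmetric]
      by (rule arg_cong[of _ _ exp]) (use G V in algebra)
    moreover have "even k \<longleftrightarrow> even (sp (lift \<sigma> + a) b + sp (lift \<sigma>) c)"
      by (simp add: k_def sp3 algebra_simps)
    ultimately show ?thesis by (simp add: exp_pi_i_int s_def g_def x)
  qed
  have fs2: "(\<lambda>(\<sigma>, x). f (B (\<sigma>, x))) summable_on UNIV \<times> UNIV"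
    using summable_on_reindex_bij_betw[OF bij, of f] fs by (simp add: case_prod_unfold)
  have "thI a b \<tau> 0 * thI a (b + c) \<tau> 0 = infsum f UNIV"
    unfolding thI_def f_def using infsum_times[OF tterm_summable[OF \<tau>] tterm_summable[OF \<tau>]]
    by (simp add: case_prod_unfold)
  also have "\<dots> = infsum (\<lambda>(\<sigma>, x). f (B (\<sigma>, x))) (UNIV \<times> UNIV)"
    using infsum_reindex_bij_betw[OF bij, of f] by (simp add: case_prod_unfold)
  also have "\<dots> = (\<Sum>\<^sub>\<infinity>\<sigma>. \<Sum>\<^sub>\<infinity>x. f (B (\<sigma>, x)))"
    using infsum_Sigma'_banach[of "\<lambda>\<sigma> x. f (B (\<sigma>, x))" UNIV "\<lambda>_. UNIV"] fs2 by simp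
  also have "\<dots> = (\<Sum>\<sigma>\<in>UNIV. s \<sigma> * infsum (g \<sigma>) UNIV)"
    by (simp add: fB infsum_cmult_right')
  also have "\<dots> = (\<Sum>\<sigma>\<in>UNIV. s \<sigma> * (thI (lift \<sigma> + a) c (2 *\<^sub>R \<tau>) 0 * thI (lift \<sigma>) c (2 *\<^sub>R \<tau>) 0))"
  proof -
    have "infsum (g \<sigma>) UNIV = thI (lift \<sigma> + a) c (2 *\<^sub>R \<tau>) 0 * thI (lift \<sigma>) c (2 *\<^sub>R \<tau>) 0" for \<sigma>
      unfolding g_def thI_def
      using infsum_times[OF tterm_summable[OF siegel3_double[OF \<tau>]] tterm_summable[OF siegel3_double[OF \<tau>]]]
      by (simp add: case_prod_unfold)
    then show ?thesis by simp
  qed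
  finally show ?thesis by (simp add: s_def)
qed

text \<open>Each product of two theta constants is quadratic in the four numbers
  \<open>X i j\<close>, since upper characteristics with third entry 1 are odd and drop out. The
  claim becomes \<open>(A^2 - B^2) - (C^2 - D^2) = 4 X00^2 X10^2 - 4 X01^2 X11^2\<close>, where
  \<open>A\<close>, \<open>C\<close> are sum and difference of \<open>X00^2\<close>,
  \<open>X10^2\<close>, and \<open>B\<close>, \<open>D\<close> those of \<open>X01^2\<close>,
  \<open>X11^2\<close>.\<close>

lemma riemann_quartic:
  assumes \<tau>: "\<tau> \<in> siegel3"
  shows "theta (bv 0 0 0) (bv 0 0 0) \<tau> 0 * theta (bv 0 0 0) (bv 0 0 1) \<tau> 0 * (theta (bv 0 0 0) (bv 0 1 0) \<tau> 0 * theta (bv 0 0 0) (bv 0 1 1) \<tau> 0)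
     - theta (bv 0 0 0) (bv 1 0 0) \<tau> 0 * theta (bv 0 0 0) (bv 1 0 1) \<tau> 0 * (theta (bv 0 0 0) (bv 1 1 0) \<tau> 0 * theta (bv 0 0 0) (bv 1 1 1) \<tau> 0)
     = theta (bv 1 0 0) (bv 0 0 0) \<tau> 0 * theta (bv 1 0 0) (bv 0 0 1) \<tau> 0 * (theta (bv 1 0 0) (bv 0 1 0) \<tau> 0 * theta (bv 1 0 0) (bv 0 1 1) \<tau> 0)"
proof -
  define X where "X = (\<lambda>i j. thI (iv i j 0) (iv 0 0 1) (2 *\<^sub>R \<tau>) 0)"
  have Xf: "thI (iv i j 0) (iv 0 0 1) (2 *\<^sub>R \<tau>) 0 = X i j" for i j by (simp add: X_def)
  have odd: "thI (iv i j 1) (iv 0 0 1) (2 *\<^sub>R \<tau>) 0 = 0" for i j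
    by (rule thI_odd) (simp add: sp3)
  have iv_add: "iv x y z + iv x' y' z' = iv (x + x') (y + y') (z + z')" for x y z x' y' z'
    by (simp add: vec_eq_iff forall_3)
  have X2: "X 2 j = X 0 j" for j
    unfolding X_def by (rule thI_upper_cong) (simp add: red_def vec_eq_iff forall_3)
  have X20: "thI (iv 2 j 1) (iv 0 0 1) (2 *\<^sub>R \<tau>) 0 = 0" for j
    by (rule thI_odd) (simp add: sp3)
  have D: "thI (iv e 0 0) (iv x y 0) \<tau> 0 * thI (iv e 0 0) (iv x y 1) \<tau> 0 =
    (\<Sum>\<sigma>\<in>UNIV. (if even (sp (lift \<sigma> + iv e 0 0) (iv x y 0) + sp (lift \<sigma>) (iv 0 0 1)) then 1 else -1) *
       (thI (lift \<sigma> + iv e 0 0) (iv 0 0 1) (2 *\<^sub>R \<tau>) 0 * thI (lift \<sigma>) (iv 0 0 1) (2 *\<^sub>R \<tau>) 0))" for e x y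
    using thI_duplication[OF \<tau>, of "iv e 0 0" "iv x y 0" "iv 0 0 1"] by (simp add: iv_add)
  have D1: "thI (iv 0 0 0) (iv x y 0) \<tau> 0 * thI (iv 0 0 0) (iv x y 1) \<tau> 0 =
     (X 0 0)\<^sup>2 + (if even y then 1 else -1) * (X 0 1)\<^sup>2 + (if even x then 1 else -1) * (X 1 0)\<^sup>2 + (if even (x + y) then 1 else -1) * (X 1 1)\<^sup>2" for x y
    unfolding D sum_bit3 lift_bv iv_add by (simp add: odd Xf sp3 power2_eq_square)
  have D2: "thI (iv 1 0 0) (iv 0 y 0) \<tau> 0 * thI (iv 1 0 0) (iv 0 y 1) \<tau> 0 =
     2 * X 0 0 * X 1 0 + (if even y then 2 else -2) * X 0 1 * X 1 1" for y
    unfolding D sum_bit3 lift_bv iv_add by (simp add: odd Xf X2 X20 sp3)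
  show ?thesis
    unfolding theta_thI lift_bv if_P[OF refl] if_not_P[OF zero_neq_one] D1 D2
    by (simp add: power2_eq_square) algebra
qed

subsection \<open>Asymptotics along a ray\<close>

definition ray :: "real^3^3 \<Rightarrow> real \<Rightarrow> complex^3^3"
  where "ray Y t = (\<chi> k l. \<i> * of_real (t * Y $ k $ l))"

definition rv :: "int^3 \<Rightarrow> int^3 \<Rightarrow> real^3" where "rv a p = (\<chi> i. of_int (p$i) + of_int (a$i) / 2)"

lemma ray_siegel3:
  assumes "transpose Y = Y" "\<And>v. v \<noteq> 0 \<Longrightarrow> 0 < v \<bullet> (Y *v v)" "t > 0"
  shows "ray Y t \<in> siegel3"
proof -
  have "map_matrix Im (ray Y t) = t *\<^sub>R Y" by (simp add: ray_def vec_eq_iff)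
  moreover have "v \<bullet> ((t *\<^sub>R Y) *v v) = t * (v \<bullet> (Y *v v))" for v
    by (simp add: inner3 mv3 algebra_simps)
  moreover have "Y $ l $ k = Y $ k $ l" for k l
    using assms(1) by (metis (no_types, lifting) transpose_def vec_lambda_beta)
  then have "transpose (ray Y t) = ray Y t" by (simp add: ray_def transpose_def vec_eq_iff)
  ultimately show ?thesis using assms by (simp add: siegel3_def)
qed

text \<open>Laplace's method: along a ray only the lattice points of \<open>M\<close>, at the
  minimum, survive; the gap to the other values makes the remainder decay exponentially.\<close>

lemma thI_ray_asymptotics:
  assumes Y: "transpose Y = Y" "\<And>v. v \<noteq> 0 \<Longrightarrow> 0 < v \<bullet> (Y *v v)"
    and M: "finite M" "\<And>p. p \<in> M \<Longrightarrow> rv a p \<bullet> (Y *v rv a p) = \<mu>" "\<delta> > 0"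
      "\<And>p. p \<notin> M \<Longrightarrow> \<mu> + \<delta> \<le> rv a p \<bullet> (Y *v rv a p)"
  shows "((\<lambda>t. of_real (exp (pi * t * \<mu>)) * thI a b (ray Y t) 0) \<longlongrightarrow>
    (\<Sum>p\<in>M. exp (of_real pi * \<i> * sp (qv a p) (vi b)))) at_top"
proof -
  define Q where "Q = (\<lambda>p. rv a p \<bullet> (Y *v rv a p))"
  define ph where "ph = (\<lambda>p. exp (of_real pi * \<i> * sp (qv a p) (vi b)))"
  have nph: "norm (ph p) = 1" for p
    by (simp add: ph_def norm_exp_eq_Re sp3 qv_def vi_def)
  have tm: "of_real (exp (pi * t * \<mu>)) * tterm a b (ray Y t) 0 p = of_real (exp (- pi * t * (Q p - \<mu>))) * ph p" for t p
  proof -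
    have q: "qv a p = (\<chi> i. of_real (rv a p $ i))" by (simp add: qv_def rv_def vec_eq_iff)
    have "Gq (ray Y t) 0 (qv a p) = \<i> * of_real (t * Q p)"
      unfolding q by (simp add: Gq_def sp3 mv3 ray_def Q_def inner3 algebra_simps)
    then have "of_real pi * \<i> * (Gq (ray Y t) 0 (qv a p) + sp (qv a p) (vi b)) =
        of_real (- pi * t * Q p) + of_real pi * \<i> * sp (qv a p) (vi b)"
      by (simp add: algebra_simps)
    then have "tterm a b (ray Y t) 0 p = of_real (exp (- pi * t * Q p)) * ph p"
      unfolding tterm_def ph_def by (simp only: exp_add exp_of_real)
    moreover have "exp (pi * t * \<mu>) * exp (- pi * t * Q p) = exp (- pi * t * (Q p - \<mu>))"
      by (simp add: algebra_simps flip: exp_add)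
    ultimately show ?thesis by (metis mult.assoc of_real_mult)
  qed
  have sm: "(\<lambda>p. exp (- pi * t * (Q p - \<mu>))) summable_on UNIV" if "t > 0" for t
  proof -
    have "(\<lambda>p. exp (pi * t * \<mu>) * norm (tterm a b (ray Y t) 0 p)) summable_on UNIV"
      by (intro summable_on_cmult_right tterm_summable ray_siegel3 Y that)
    moreover have "exp (pi * t * \<mu>) * norm (tterm a b (ray Y t) 0 p) = exp (- pi * t * (Q p - \<mu>))" for p
      using arg_cong[OF tm[of t p], of norm] by (simp add: norm_mult nph)
    ultimately show ?thesis by simp
  qed
  \<comment> \<open>The tail at time 1; at a later time \<open>t\<close> it has shrunk at least by
    the factor \<open>exp (- pi * \<delta> * (t - 1))\<close>.\<close>
  define K where "K = (\<Sum>\<^sub>\<infinity>p\<in>-M. exp (- pi * 1 * (Q p - \<mu>)))"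
  have bound: "norm (of_real (exp (pi * t * \<mu>)) * thI a b (ray Y t) 0 - (\<Sum>p\<in>M. ph p)) \<le> exp (- pi * \<delta> * (t - 1)) * K"
    if t: "t \<ge> 1" for t
  proof -
    define g where "g = (\<lambda>p. of_real (exp (- pi * t * (Q p - \<mu>))) * ph p)"
    have gs: "(\<lambda>p. norm (g p)) summable_on A" for A
      using sm[of t] t summable_on_subset_banach by (fastforce simp: g_def norm_mult nph)
    then have gs': "g summable_on A" for A using abs_summable_summable by blast
    have "of_real (exp (pi * t * \<mu>)) * thI a b (ray Y t) 0 = infsum g UNIV"
      unfolding thI_def infsum_cmult_right'[symmetric] tm g_def ..
    also have "\<dots> = infsum g M + infsum g (- M)"
      using infsum_Un_disjoint[of g M "-M"] gs' by simp
    also have "infsum g M = (\<Sum>p\<in>M. ph p)"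
      using M(1,2) by (auto simp: g_def Q_def intro!: sum.cong)
    finally have "norm (of_real (exp (pi * t * \<mu>)) * thI a b (ray Y t) 0 - (\<Sum>p\<in>M. ph p)) = norm (infsum g (- M))"
      by simp
    also have "\<dots> \<le> (\<Sum>\<^sub>\<infinity>p\<in>-M. norm (g p))" using gs by (rule norm_infsum_bound)
    also have "\<dots> \<le> (\<Sum>\<^sub>\<infinity>p\<in>-M. exp (- pi * \<delta> * (t - 1)) * exp (- pi * 1 * (Q p - \<mu>)))"
    proof (rule infsum_mono)
      show "(\<lambda>p. exp (- pi * \<delta> * (t - 1)) * exp (- pi * 1 * (Q p - \<mu>))) summable_on - M"
        by (intro summable_on_cmult_right summable_on_subset_banach[OF sm]) auto
      fix p assume "p \<in> - M"
      then have "\<delta> \<le> Q p - \<mu>" using M(4)[of p] by (simp add: Q_def)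
      then have "\<delta> * (t - 1) \<le> (Q p - \<mu>) * (t - 1)" using t by (intro mult_right_mono) auto
      then have "pi * (\<delta> * (t - 1)) \<le> pi * ((Q p - \<mu>) * (t - 1))" by (intro mult_left_mono) auto
      then show "norm (g p) \<le> exp (- pi * \<delta> * (t - 1)) * exp (- pi * 1 * (Q p - \<mu>))"
        unfolding g_def norm_mult nph exp_add[symmetric] by (simp add: algebra_simps)
    qed (rule gs)
    also have "\<dots> = exp (- pi * \<delta> * (t - 1)) * K" unfolding K_def by (rule infsum_cmult_right')
    finally show ?thesis .
  qed
  have "((\<lambda>t. exp (- pi * \<delta> * (t - 1)) * K) \<longlongrightarrow> 0) at_top"
  proof -
    have "filterlim (\<lambda>t::real. t - 1) at_top at_top"
      unfolding filterlim_at_top eventually_at_top_linorder by (metis add_le_cancel_right diff_add_cancel)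
    then have "filterlim (\<lambda>t. pi * \<delta> * (t - 1)) at_top at_top"
      using M(3) by (intro filterlim_tendsto_pos_mult_at_top[OF tendsto_const]) auto
    then have "((\<lambda>t. exp (- (pi * \<delta> * (t - 1)))) \<longlongrightarrow> 0) at_top"
      by (intro filterlim_compose[OF exp_at_bot]) (simp add: filterlim_uminus_at_bot)
    from tendsto_mult_left_zero[OF this, of K] show ?thesis by (simp add: minus_mult_left[symmetric])
  qed
  then have "((\<lambda>t. of_real (exp (pi * t * \<mu>)) * thI a b (ray Y t) 0 - (\<Sum>p\<in>M. ph p)) \<longlongrightarrow> 0) at_top"
    by (rule Lim_null_comparison[rotated]) (rule eventually_mono[OF eventually_ge_at_top[of 1] bound])
  then show ?thesis unfolding ph_def by (simp add: LIM_zero_iff)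
qed

lemma Theta2_ray_limit:
  "((\<lambda>t. Theta2 (ray (mat 1) t) 0 $ \<epsilon>) \<longlongrightarrow> (if \<epsilon> = 0 then 1 else 0)) at_top"
proof -
  define Y :: "real^3^3" where "Y = 2 *\<^sub>R mat 1"
  have Y: "transpose Y = Y" "\<And>v. v \<bullet> (Y *v v) = 2 * ((v$1)\<^sup>2 + (v$2)\<^sup>2 + (v$3)\<^sup>2)"
    by (auto simp: Y_def transpose_def mat_def vec_eq_iff inner3 mv3 power2_eq_square)
  have pos: "0 < v \<bullet> (Y *v v)" if "v \<noteq> 0" for v
    using that unfolding Y(2) by (auto simp: vec_eq_iff forall_3 add_nonneg_pos add_pos_nonneg)
  have sq: "(1/4::real) \<le> (of_int n + 1/2)\<^sup>2" for n :: int
  proof -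
    have "0 \<le> n * (n + 1)" by (cases "0 \<le> n") (auto intro: mult_nonpos_nonpos)
    then have "0 \<le> real_of_int (n * (n + 1))" by (simp only: of_int_0_le_iff)
    then have "0 \<le> real_of_int n * (real_of_int n + 1)" by simp
    then show ?thesis by (simp add: power2_eq_square algebra_simps)
  qed
  have e: "2 *\<^sub>R ray (mat 1) t = ray Y t" for t
    by (simp add: ray_def Y_def vec_eq_iff scaleR_conv_of_real[where 'a = complex])
  show ?thesis
  proof (cases "\<epsilon> = 0")
    case True
    have l0: "lift \<epsilon> = 0" using True by (simp add: lift_def vec_eq_iff)
    have "((\<lambda>t. of_real (exp (pi * t * 0)) * thI 0 0 (ray Y t) 0) \<longlongrightarrow>
      (\<Sum>p\<in>{0}. exp (of_real pi * \<i> * sp (qv 0 p) (vi 0)))) at_top"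
    proof (rule thI_ray_asymptotics[OF Y(1) pos, where \<delta> = 2])
      fix p :: "int^3" assume "p \<notin> {0}"
      then obtain i where "p $ i \<noteq> 0" by (auto simp: vec_eq_iff)
      then have "1 \<le> (p $ i)\<^sup>2" by (metis int_one_le_iff_zero_less zero_less_power2)
      then have "1 \<le> (p $ 1)\<^sup>2 + (p $ 2)\<^sup>2 + (p $ 3)\<^sup>2"
        using exhaust_3[of i] zero_le_power2[of "p$1"] zero_le_power2[of "p$2"] zero_le_power2[of "p$3"] by (elim disjE; hypsubst; linarith)
      then have "real_of_int 1 \<le> real_of_int ((p $ 1)\<^sup>2 + (p $ 2)\<^sup>2 + (p $ 3)\<^sup>2)"
        by (simp only: of_int_le_iff)
      then have "1 \<le> (real_of_int (p $ 1))\<^sup>2 + (real_of_int (p $ 2))\<^sup>2 + (real_of_int (p $ 3))\<^sup>2" by simp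
      then show "0 + 2 \<le> rv 0 p \<bullet> (Y *v rv 0 p)" unfolding Y(2) by (simp add: rv_def)
    qed (auto simp: rv_def Y(2))
    then show ?thesis using True l0 by (simp add: Theta2_thI e sp3 vi_def)
  next
    case False
    then obtain i where i: "\<epsilon> $ i = 1" by (auto simp: vec_eq_iff)
    have "((\<lambda>t. of_real (exp (pi * t * 0)) * thI (lift \<epsilon>) 0 (ray Y t) 0) \<longlongrightarrow>
      (\<Sum>p\<in>{}. exp (of_real pi * \<i> * sp (qv (lift \<epsilon>) p) (vi 0)))) at_top"
    proof (rule thI_ray_asymptotics[OF Y(1) pos, where \<delta> = "1/2"])
      fix p :: "int^3"
      define v where "v = rv (lift \<epsilon>) p"
      have "1/4 \<le> (v $ i)\<^sup>2" using i sq[of "p$i"] by (simp add: v_def rv_def lift_def)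
      then have "1/4 \<le> (v$1)\<^sup>2 + (v$2)\<^sup>2 + (v$3)\<^sup>2"
        using exhaust_3[of i] zero_le_power2[of "v$1"] zero_le_power2[of "v$2"] zero_le_power2[of "v$3"] by (elim disjE; hypsubst; linarith)
      then show "0 + 1/2 \<le> rv (lift \<epsilon>) p \<bullet> (Y *v rv (lift \<epsilon>) p)" unfolding Y(2) v_def by simp
    qed auto
    then show ?thesis using False by (simp add: Theta2_thI e)
  qed
qed

lemma ray_id_siegel3: "t > 0 \<Longrightarrow> ray (mat 1) t \<in> siegel3"
  by (rule ray_siegel3) (auto simp: transpose_mat)

text \<open>The direction of the ray is chosen so that on each nonzero class modulo 2 the form \<open>Qint\<close> has a
  minimum that is unique up to sign; two terms then dominate each even theta constant.\<close>

definition Qint :: "int^3 \<Rightarrow> int"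
  where "Qint n = 3 * ((n$1)\<^sup>2 + (n$2)\<^sup>2 + (n$3)\<^sup>2) + (n$1 + 2 * n$2 + 3 * n$3)\<^sup>2"

lemma Qint_minimum:
  assumes "\<alpha> \<noteq> 0"
  shows "\<exists>m. m \<noteq> 0 \<and> red m = \<alpha> \<and> (\<forall>n. red n = \<alpha> \<longrightarrow> n = m \<or> n = - m \<or> Qint m < Qint n)"
proof -
  \<comment> \<open>The largest of the seven minima is 12, attained at \<open>(0, 0, 1)\<close>.
    Values up to 12 force entries of absolute value at most 2, which leaves finitely many
    candidates.\<close>
  have bound: "\<bar>n $ i\<bar> \<le> 2" if "Qint n \<le> 12" for n :: "int^3" and i
  proof -
    have "(n$i)\<^sup>2 \<le> (n$1)\<^sup>2 + (n$2)\<^sup>2 + (n$3)\<^sup>2"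
      using exhaust_3[of i] zero_le_power2[of "n$1"] zero_le_power2[of "n$2"] zero_le_power2[of "n$3"] by (elim disjE; hypsubst; linarith)
    moreover have "3 * ((n$1)\<^sup>2 + (n$2)\<^sup>2 + (n$3)\<^sup>2) \<le> 12"
      using that zero_le_power2[of "n$1 + 2 * n$2 + 3 * n$3"] unfolding Qint_def by linarith
    ultimately have "(n$i)\<^sup>2 \<le> 2\<^sup>2" by simp
    then show ?thesis by (metis abs_le_square_iff abs_numeral)
  qed
  have opts: "x \<in> {-1, 1}" if "\<bar>x\<bar> \<le> 2" "odd x" for x :: int
  proof -
    have "x = -2 \<or> x = -1 \<or> x = 0 \<or> x = 1 \<or> x = 2" using that by arith
    then show ?thesis using that by auto
  qed
  have opts': "x \<in> {-2, 0, 2}" if "\<bar>x\<bar> \<le> 2" "even x" for x :: int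
  proof -
    have "x = -2 \<or> x = -1 \<or> x = 0 \<or> x = 1 \<or> x = 2" using that by arith
    then show ?thesis using that by auto
  qed
  have gen: "\<exists>m. m \<noteq> 0 \<and> red m = bv x y z \<and> (\<forall>n. red n = bv x y z \<longrightarrow> n = m \<or> n = - m \<or> Qint m < Qint n)"
    if m: "m \<noteq> 0" "red m = bv x y z" "Qint m \<le> 12"
      and n: "\<And>n. n$1 \<in> (if x = 1 then {-1, 1} else {-2, 0, 2}) \<Longrightarrow> n$2 \<in> (if y = 1 then {-1, 1} else {-2, 0, 2}) \<Longrightarrow>
        n$3 \<in> (if z = 1 then {-1, 1} else {-2, 0, 2}) \<Longrightarrow> n = m \<or> n = - m \<or> Qint m < Qint n" for m x y z
  proof (intro exI[of _ m] conjI m(1,2) allI impI)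
    fix n :: "int^3" assume r: "red n = bv x y z"
    show "n = m \<or> n = - m \<or> Qint m < Qint n"
    proof (cases "Qint n \<le> 12")
      case True
      have "odd (n$1) \<longleftrightarrow> x = 1" "odd (n$2) \<longleftrightarrow> y = 1" "odd (n$3) \<longleftrightarrow> z = 1"
        using arg_cong[OF r, of "\<lambda>v. v$1"] arg_cong[OF r, of "\<lambda>v. v$2"] arg_cong[OF r, of "\<lambda>v. v$3"]
        by (auto simp: red_def split: if_splits)
      then show ?thesis using bound[OF True] opts opts' by (intro n) auto
    next
      case False
      then show ?thesis using m(3) by linarith
    qed
  qed
  have neg: "- iv x y z = iv (- x) (- y) (- z)" for x y z by (simp add: vec_eq_iff forall_3)
  have iveq: "n = iv x y z \<longleftrightarrow> n$1 = x \<and> n$2 = y \<and> n$3 = z" for n x y z by (auto simp: vec_eq_iff forall_3)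
  have redb: "red (iv x y z) = bv (if odd x then 1 else 0) (if odd y then 1 else 0) (if odd z then 1 else 0)" for x y z
    by (simp add: red_def vec_eq_iff forall_3)
  have nz: "iv x y z \<noteq> 0" if "x \<noteq> 0 \<or> y \<noteq> 0 \<or> z \<noteq> 0" for x y z using that by (auto simp: vec_eq_iff forall_3)
  have "\<alpha> \<in> {bv 0 0 1, bv 0 1 0, bv 0 1 1, bv 1 0 0, bv 1 0 1, bv 1 1 0, bv 1 1 1}"
    using assms UNIV_bit3 bv_zero by (metis UNIV_I insert_iff)
  then consider "\<alpha> = bv 0 0 1" | "\<alpha> = bv 0 1 0" | "\<alpha> = bv 0 1 1" | "\<alpha> = bv 1 0 0" | "\<alpha> = bv 1 0 1"
    | "\<alpha> = bv 1 1 0" | "\<alpha> = bv 1 1 1" by blast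
  then show ?thesis
  proof cases
    case 1 show ?thesis unfolding 1 by (rule gen[of "iv 0 0 1"]) (auto simp: redb nz Qint_def iveq neg)
  next
    case 2 show ?thesis unfolding 2 by (rule gen[of "iv 0 1 0"]) (auto simp: redb nz Qint_def iveq neg)
  next
    case 3 show ?thesis unfolding 3 by (rule gen[of "iv 0 1 (-1)"]) (auto simp: redb nz Qint_def iveq neg)
  next
    case 4 show ?thesis unfolding 4 by (rule gen[of "iv 1 0 0"]) (auto simp: redb nz Qint_def iveq neg)
  next
    case 5 show ?thesis unfolding 5 by (rule gen[of "iv 1 0 (-1)"]) (auto simp: redb nz Qint_def iveq neg)
  next
    case 6 show ?thesis unfolding 6 by (rule gen[of "iv 1 (-1) 0"]) (auto simp: redb nz Qint_def iveq neg)
  next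
    case 7 show ?thesis unfolding 7 by (rule gen[of "iv 1 1 (-1)"]) (auto simp: redb nz Qint_def iveq neg)
  qed
qed

text \<open>Four times the Gram matrix of \<open>Qint\<close>: the vectors \<open>rv a p\<close> are
  halves of integral ones, so this form takes the values of \<open>Qint\<close> on the doubled
  vectors.\<close>

definition Yw :: "real^3^3"
  where "Yw = (\<chi> i j. 4 * ((if i = j then 3 else 0) + (if i = 1 then 1 else if i = 2 then 2 else 3) * (if j = 1 then 1 else if j = 2 then 2 else 3)))"

lemma Yw_form: "v \<bullet> (Yw *v v) = 3 * ((2 * v$1)\<^sup>2 + (2 * v$2)\<^sup>2 + (2 * v$3)\<^sup>2) + (2 * v$1 + 2 * (2 * v$2) + 3 * (2 * v$3))\<^sup>2"
  by (simp add: inner3 mv3 Yw_def power2_eq_square algebra_simps)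

lemma Yw_sym: "transpose Yw = Yw" and Yw_pos: "v \<noteq> 0 \<Longrightarrow> 0 < v \<bullet> (Yw *v v)"
proof -
  show "transpose Yw = Yw" by (simp add: Yw_def transpose_def vec_eq_iff)
  assume "v \<noteq> 0"
  then have "0 < (v$1)\<^sup>2 + (v$2)\<^sup>2 + (v$3)\<^sup>2"
    by (auto simp: vec_eq_iff forall_3 add_nonneg_pos add_pos_nonneg)
  moreover have "0 \<le> (2 * v$1 + 2 * (2 * v$2) + 3 * (2 * v$3))\<^sup>2" by simp
  ultimately show "0 < v \<bullet> (Yw *v v)" unfolding Yw_form by (simp add: power_mult_distrib add_pos_nonneg)
qed

lemma theta_ray_nonzero:
  assumes "\<alpha> \<noteq> 0" "sp \<alpha> \<beta> = 0"
  shows "\<forall>\<^sub>F t in at_top. theta \<alpha> \<beta> (ray Yw t) 0 \<noteq> 0"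
proof -
  obtain m where m: "m \<noteq> 0" "red m = \<alpha>" "\<And>n. red n = \<alpha> \<Longrightarrow> n = m \<or> n = - m \<or> Qint m < Qint n"
    using Qint_minimum[OF assms(1)] by blast
  define a where "a = lift \<alpha>"
  define b where "b = lift \<beta>"
  have dm: "even (m$i - a$i)" "even (- m$i - a$i)" for i
    using arg_cong[OF m(2), of "\<lambda>v. v$i"] by (auto simp: a_def lift_def red_def split: if_splits)
  define p1 where "p1 = (\<chi> i. (m$i - a$i) div 2)"
  define p2 where "p2 = (\<chi> i. (- m$i - a$i) div 2)"
  have p: "2 * p1 + a = m" "2 * p2 + a = - m"
    using dm by (auto simp: p1_def p2_def vec_eq_iff)
  have ne: "p1 \<noteq> p2"
  proof
    assume "p1 = p2"
    then have "m = - m" using p by simp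
    then have "m $ i = 0" for i by (simp add: vec_eq_iff)
    then show False using m(1) by (simp add: vec_eq_iff)
  qed
  have form: "rv a q \<bullet> (Yw *v rv a q) = of_int (Qint (2 * q + a))" for q
    unfolding Yw_form by (simp add: rv_def Qint_def algebra_simps)
  have lim: "((\<lambda>t. of_real (exp (pi * t * of_int (Qint m))) * thI a b (ray Yw t) 0) \<longlongrightarrow>
    (\<Sum>q\<in>{p1, p2}. exp (of_real pi * \<i> * sp (qv a q) (vi b)))) at_top"
  proof (rule thI_ray_asymptotics[OF Yw_sym Yw_pos, where \<delta> = 1])
    show "rv a q \<bullet> (Yw *v rv a q) = of_int (Qint m)" if "q \<in> {p1, p2}" for q
    proof -
      have "Qint (- m) = Qint m" by (simp add: Qint_def power2_eq_square algebra_simps)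
      then have "Qint (2 * p1 + a) = Qint m" "Qint (2 * p2 + a) = Qint m" by (simp_all only: p)
      then show ?thesis using that by (auto simp only: form insert_iff empty_iff)
    qed
    fix q assume q: "q \<notin> {p1, p2}"
    have "red (2 * q + a) = red a" by (auto simp: red_eq_iff add.commute)
    then have r: "red (2 * q + a) = \<alpha>" by (simp add: a_def)
    have "2 * q + a \<noteq> 2 * p1 + a" "2 * q + a \<noteq> 2 * p2 + a"
      using q by (auto simp: vec_eq_iff)
    then have "2 * q + a \<noteq> m" "2 * q + a \<noteq> - m" unfolding p .
    then have "Qint m + 1 \<le> Qint (2 * q + a)" using m(3)[OF r] by auto
    then show "of_int (Qint m) + 1 \<le> rv a q \<bullet> (Yw *v rv a q)" unfolding form by linarith
  qed auto
  \<comment> \<open>For an even characteristic the two dominant terms, at \<open>m\<close> and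
    \<open>-m\<close>, carry the same sign and add up instead of cancelling.\<close>
  obtain k where k: "sp m b = 2 * k"
  proof -
    have "(if odd (sp m b) then 1 else (0::bit)) = sp (red m) (red b)" by (simp add: red_sp)
    also have "\<dots> = 0" using assms(2) m(2) by (simp add: b_def)
    finally have "even (sp m b)" by (simp split: if_splits)
    then show ?thesis using that by (elim evenE)
  qed
  have "sp (qv a p1) (vi b) = of_int k" "sp (qv a p2) (vi b) = of_int (- k)"
  proof -
    have "2 * sp (qv a q) (vi b) = of_int (sp (2 * q + a) b)" for q
      by (simp add: sp3 qv_def vi_def algebra_simps)
    moreover have "sp (- m) b = 2 * (- k)" using k by (simp add: sp3)
    ultimately have "2 * sp (qv a p1) (vi b) = 2 * of_int k" "2 * sp (qv a p2) (vi b) = 2 * of_int (- k)"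
      using k by (simp_all only: p of_int_mult of_int_numeral)
    then show "sp (qv a p1) (vi b) = of_int k" "sp (qv a p2) (vi b) = of_int (- k)"
      by simp_all
  qed
  note vals = this
  have "exp (of_real pi * \<i> * of_int (- k)) = exp (of_real pi * \<i> * of_int k)"
    unfolding exp_pi_i_int by simp
  moreover have "(\<Sum>q\<in>{p1, p2}. exp (of_real pi * \<i> * sp (qv a q) (vi b))) =
      exp (of_real pi * \<i> * sp (qv a p1) (vi b)) + exp (of_real pi * \<i> * sp (qv a p2) (vi b))"
    using ne by (subst sum.insert) auto
  ultimately have "(\<Sum>q\<in>{p1, p2}. exp (of_real pi * \<i> * sp (qv a q) (vi b))) \<noteq> 0"
    unfolding vals by simp
  from tendsto_imp_eventually_ne[OF lim this] show ?thesis
    by eventually_elim (auto simp: theta_thI a_def b_def)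
qed

text \<open>Finitely many conditions that hold eventually along one ray hold at a common point of
  it. Products of these theta constants are thus nonzero without any argument on zero sets in
  several variables.\<close>

lemma common_nonzero_point:
  obtains \<tau> where "\<tau> \<in> siegel3" "\<And>\<alpha> \<beta>. \<alpha> \<noteq> 0 \<Longrightarrow> sp \<alpha> \<beta> = 0 \<Longrightarrow> theta \<alpha> \<beta> \<tau> 0 \<noteq> 0"
proof -
  have "\<forall>\<^sub>F t in at_top. \<forall>x\<in>{x :: (bit^3) \<times> (bit^3). fst x \<noteq> 0 \<and> sp (fst x) (snd x) = 0}. theta (fst x) (snd x) (ray Yw t) 0 \<noteq> 0"
    by (rule eventually_ball_finite) (auto intro: theta_ray_nonzero)
  then have "\<forall>\<^sub>F t in at_top. t > 0 \<and> (\<forall>x\<in>{x :: (bit^3) \<times> (bit^3). fst x \<noteq> 0 \<and> sp (fst x) (snd x) = 0}. theta (fst x) (snd x) (ray Yw t) 0 \<noteq> 0)"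
    by (intro eventually_conj eventually_gt_at_top)
  then obtain t where "t > 0" "\<forall>x\<in>{x :: (bit^3) \<times> (bit^3). fst x \<noteq> 0 \<and> sp (fst x) (snd x) = 0}. theta (fst x) (snd x) (ray Yw t) 0 \<noteq> 0"
    using eventually_happens'[OF trivial_limit_at_top_linorder] by blast
  then show ?thesis using that[of "ray Yw t"] ray_siegel3[OF Yw_sym Yw_pos] by force
qed

section \<open>Generators acting on the Siegel space\<close>

definition uU :: "int^3^3 \<Rightarrow> int^3^3 \<Rightarrow> int^(3 + 3)^(3 + 3)"
  where "uU U V = mk U 0 0 (transpose V)"

lemma shear_uU: "shear i j s = uU (mat 1 + Em i j s) (mat 1 - Em i j s)"
proof -
  have "transpose (mat 1 - Em i j s) = mat 1 - Em j i s"
    by (auto simp: transpose_def Em_def mat_def vec_eq_iff)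
  then show ?thesis by (simp add: shear_def uU_def)
qed

lemma flip_uU: "flip i = uU (Fm i) (Fm i)" by (simp add: flip_def uU_def transpose_Fm)
lemma swap_uU: "swap i j = uU (Pm i j) (Pm i j)" by (simp add: swap_def uU_def transpose_Pm)
lemma one_uU: "mat 1 = uU (mat 1) (mat 1)" by (simp add: uU_def transpose_mat mat_mk)

lemma shear_inverse: "i \<noteq> j \<Longrightarrow> (mat 1 + Em i j s) ** (mat 1 - Em i j s) = mat 1"
  by (simp add: mat_distribs Em_mult Em_zero)

lemma uU_Sp6: "U ** V = mat 1 \<Longrightarrow> uU U V \<in> Sp6"
  using int_matrix_left_right_inverse[of U V]
  by (simp add: uU_def Sp6_mk transpose_mat flip: matrix_transpose_mul)

text \<open>The negative translation comes from \<open>tS_minus_jJ\<close>, lower translations from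
  \<open>lS_jJ\<close>, and shears, flips and swaps are unimodular substitutions.\<close>

lemma Sp6_induct [consumes 1, case_names mult T J U]:
  assumes "\<gamma> \<in> Sp6"
    and mult: "\<And>g h. g \<in> Sp6 \<Longrightarrow> h \<in> Sp6 \<Longrightarrow> P g \<Longrightarrow> P h \<Longrightarrow> P (g ** h)"
    and T: "P (tS (Em 1 1 1))" and J: "P (jJ 1)" and U: "\<And>U V. U ** V = mat 1 \<Longrightarrow> P (uU U V)"
  shows "P \<gamma>"
proof -
  have T_Sp6: "tS (Em 1 1 s) \<in> Sp6" for s by (rule tS_Sp6) simp
  have F: "P (flip i)" for i unfolding flip_uU by (rule U) (rule Fm_square)
  have T': "P (tS (Em 1 1 (-1)))"
    unfolding tS_minus_jJ[symmetric] by (intro mult Sp6_mult jJ_Sp6 T_Sp6 flip_Sp6 T J F)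
  have L: "P (lS (Em 1 1 s))" if "s = 1 \<or> s = -1" for s
  proof -
    have "P (tS (Em 1 1 (- s)))" using that T T' by auto
    then show ?thesis
      unfolding lS_jJ[symmetric] by (intro mult Sp6_mult jJ_Sp6 T_Sp6 flip_Sp6 J F)
  qed
  have "\<gamma> \<in> Mon 1" using assms(1) by (intro Mon_eq) auto
  then show ?thesis
  proof induction
    case one show ?case unfolding one_uU by (rule U) simp
  next
    case (t g s) then show ?case using mult T T' Mon_subset T_Sp6 by blast
  next
    case (l g s)
    have "lS (Em 1 1 (1 * s)) \<in> Sp6" by (rule lS_Sp6) simp
    then show ?case using l mult L Mon_subset by simp
  next
    case (shear g i j)
    then show ?case using mult Mon_subset shear_Sp6 U[OF shear_inverse] by (metis shear_uU)
  next
    case (flip g i) then show ?case using mult Mon_subset flip_Sp6 F by blast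
  next
    case (swap g i j)
    then show ?case using mult Mon_subset swap_Sp6 U[OF Pm_square] by (metis swap_uU)
  qed
qed

section \<open>Explicit action of the generators on tau and z\<close>

lemma cocycle_tS [simp]: "cocycle (tS S) \<tau> = mat 1"
  and siegel_act_tS: "siegel_act (tS S) \<tau> = \<tau> + cm S"
  and transform_z_tS: "transform_z (tS S) \<tau> z = z"
  and theta_exp_factor_tS: "theta_exp_factor (tS S) \<tau> z = 1"
proof -
  show c: "cocycle (tS S) \<tau> = mat 1" by (simp add: cocycle_def tS_def)
  have i: "matrix_inv (mat 1 :: complex^3^3) = mat 1" by (rule matrix_inv_eqI) simp
  show "siegel_act (tS S) \<tau> = \<tau> + cm S" by (simp add: siegel_act_def c i) (simp add: tS_def)
  show "transform_z (tS S) \<tau> z = z" by (simp add: transform_z_def c i transpose_mat del: transpose_matrix_vector)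
  show "theta_exp_factor (tS S) \<tau> z = 1"
    by (simp add: theta_exp_factor_def c i) (simp add: tS_def scalar_product_def)
qed

lemma
  assumes "U ** V = mat 1"
  shows cocycle_uU: "cocycle (uU U V) \<tau> = transpose (cm V)"
    and siegel_act_uU: "siegel_act (uU U V) \<tau> = cm U ** \<tau> ** transpose (cm U)"
    and transform_z_uU: "transform_z (uU U V) \<tau> z = cm U *v z"
    and theta_exp_factor_uU: "theta_exp_factor (uU U V) \<tau> z = 1"
    and invertible_uU: "invertible (cocycle (uU U V) \<tau>)"
    and det_uU: "det (cocycle (uU U V) \<tau>) = 1 \<or> det (cocycle (uU U V) \<tau>) = -1"
proof -
  show c: "cocycle (uU U V) \<tau> = transpose (cm V)"
    by (simp add: cocycle_def uU_def map_matrix_transpose)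
  have "cm U ** cm V = mat 1" using assms by (metis of_int_matrix_mult of_int_matrix_mat)
  then have VU: "transpose (cm V) ** transpose (cm U) = mat 1"
    by (simp add: transpose_mat flip: matrix_transpose_mul)
  have i: "matrix_inv (transpose (cm V)) = transpose (cm U)"
    using VU by (rule matrix_inv_eqI)
  show "siegel_act (uU U V) \<tau> = cm U ** \<tau> ** transpose (cm U)" by (simp add: siegel_act_def c i) (simp add: uU_def)
  show "transform_z (uU U V) \<tau> z = cm U *v z" by (simp add: transform_z_def c i)
  show "theta_exp_factor (uU U V) \<tau> z = 1"
    by (simp add: theta_exp_factor_def c i) (simp add: uU_def scalar_product_def)
  show "invertible (cocycle (uU U V) \<tau>)"
    unfolding c using VU by (metis invertible_right_inverse)
  have "det V * det U = 1" using int_matrix_left_right_inverse[OF assms] by (metis det_I det_mul)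
  then have "det V = 1 \<or> det V = -1" by (metis pos_zmult_eq_1_iff_lemma zmult_eq_1_iff)
  moreover have "det (transpose (cm V)) = of_int (det V)"
    unfolding det_transpose by (simp add: det_3)
  ultimately show "det (cocycle (uU U V) \<tau>) = 1 \<or> det (cocycle (uU U V) \<tau>) = -1" unfolding c by auto
qed

lemma
  assumes t: "\<tau>$j$j \<noteq> 0"
  shows siegel_act_jJ: "siegel_act (jJ j) \<tau> = Jact j \<tau>"
    and transform_z_jJ: "transform_z (jJ j) \<tau> z = Jz j \<tau> z"
    and theta_exp_factor_jJ: "theta_exp_factor (jJ j) \<tau> z = exp (- 8 * of_real pi * \<i> * ((z$j)\<^sup>2 / \<tau>$j$j))"
    and invertible_jJ: "invertible (cocycle (jJ j) \<tau>)"
    and det_jJ: "det (cocycle (jJ j) \<tau>) = \<tau>$j$j"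
proof -
  define N :: "complex^3^3" where "N = (\<chi> k l. if k = j then (if l = j then 1 / \<tau>$j$j else - \<tau>$j$l / \<tau>$j$j) else if k = l then 1 else 0)"
  have c: "cocycle (jJ j) \<tau> = (\<chi> k l. if k = j then \<tau>$j$l else if k = l then 1 else 0)"
    using exhaust_3[of j]
    by (elim disjE; simp add: cocycle_def jJ_def Em_def mat_def vec_eq_iff forall_3 matrix_matrix_mult_def sum_3)
  have CN: "cocycle (jJ j) \<tau> ** N = mat 1"
    using exhaust_3[of j] t c N_def
    by (elim disjE; simp add: mat_def vec_eq_iff forall_3 matrix_matrix_mult_def sum_3 field_simps)
  then have i: "matrix_inv (cocycle (jJ j) \<tau>) = N" by (rule matrix_inv_eqI)
  show "invertible (cocycle (jJ j) \<tau>)" using CN by (metis invertible_right_inverse)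
  show "det (cocycle (jJ j) \<tau>) = \<tau>$j$j"
    using exhaust_3[of j] c by (elim disjE; simp add: det_3)
  have a: "cm (blockA (jJ j)) ** \<tau> + cm (blockB (jJ j)) = (\<chi> k l. if k = j then (if l = j then -1 else 0) else \<tau>$k$l)"
    using exhaust_3[of j]
    by (elim disjE; simp add: jJ_def Em_def mat_def vec_eq_iff forall_3 matrix_matrix_mult_def sum_3)
  show "siegel_act (jJ j) \<tau> = Jact j \<tau>"
    unfolding siegel_act_def i a
    using exhaust_3[of j] t
    by (elim disjE; simp add: N_def Jact_def vec_eq_iff forall_3 matrix_matrix_mult_def sum_3 field_simps)
  show "transform_z (jJ j) \<tau> z = Jz j \<tau> z"
    unfolding transform_z_def i
    using exhaust_3[of j] t c N_def
    by (elim disjE; simp add: Jz_def vec_eq_iff forall_3 mv3 transpose_def field_simps del: transpose_matrix_vector)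
  have "sp z (N *v (cm (blockC (jJ j)) *v z)) = (z$j)\<^sup>2 / \<tau>$j$j"
    using exhaust_3[of j] t c N_def
    by (elim disjE; simp add: jJ_def Em_def sp3 mv3 power2_eq_square)
  then show "theta_exp_factor (jJ j) \<tau> z = exp (- 8 * of_real pi * \<i> * ((z$j)\<^sup>2 / \<tau>$j$j))"
    unfolding theta_exp_factor_def i by simp
qed

lemma siegel3_translate: "\<tau> \<in> siegel3 \<Longrightarrow> transpose S = S \<Longrightarrow> \<tau> + cm S \<in> siegel3"
proof -
  assume "\<tau> \<in> siegel3" "transpose S = S"
  moreover have "map_matrix Im (\<tau> + cm S) = map_matrix Im \<tau>" by (simp add: vec_eq_iff)
  moreover have "transpose (\<tau> + cm S) = transpose \<tau> + cm (transpose S)"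
    by (simp add: transpose_add map_matrix_transpose)
  ultimately show ?thesis by (simp add: siegel3_def)
qed

lemma siegel3_unimodular:
  assumes "\<tau> \<in> siegel3" "U ** V = mat 1"
  shows "cm U ** \<tau> ** transpose (cm U) \<in> siegel3"
proof (rule siegel3_posI)
  show "transpose (cm U ** \<tau> ** transpose (cm U)) = cm U ** \<tau> ** transpose (cm U)"
    using siegel3_sym[OF assms(1)] by (simp add: matrix_transpose_mul matrix_mul_assoc)
  fix v :: "real^3" assume v: "v \<noteq> 0"
  define u where "u = transpose (map_matrix real_of_int U) *v v"
  have "map_matrix real_of_int U ** map_matrix real_of_int V = mat 1"
    using assms(2) by (metis of_int_matrix_mult of_int_matrix_mat)
  then have "transpose (map_matrix real_of_int V) ** transpose (map_matrix real_of_int U) = mat 1"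
    by (simp add: transpose_mat flip: matrix_transpose_mul)
  then have "transpose (map_matrix real_of_int V) *v u = v"
    by (simp add: u_def matrix_vector_mul_assoc del: transpose_matrix_vector)
  then have "u \<noteq> 0" using v by auto
  then have "0 < Im (sp (\<chi> i. of_real (u$i)) (\<tau> *v (\<chi> i. of_real (u$i))))" by (rule siegel3_posD[OF assms(1)])
  also have "(\<chi> i. of_real (u$i)) = transpose (cm U) *v (\<chi> i. of_real (v$i))"
    by (simp add: u_def vec_eq_iff mv3 transpose_def del: transpose_matrix_vector)
  also have "sp (transpose (cm U) *v (\<chi> i. of_real (v$i))) (\<tau> *v (transpose (cm U) *v (\<chi> i. of_real (v$i)))) =
      sp (\<chi> i. of_real (v$i)) (cm U ** \<tau> ** transpose (cm U) *v (\<chi> i. of_real (v$i)))"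
    by (simp add: sp3 mv3 transpose_def matrix_matrix_mult_def sum_3 algebra_simps del: transpose_matrix_vector)
  finally show "0 < Im (sp (\<chi> i. of_real (v$i)) (cm U ** \<tau> ** transpose (cm U) *v (\<chi> i. of_real (v$i))))" .
qed

lemma sp_good_Sp6: "\<gamma> \<in> Sp6 \<Longrightarrow> sp_good \<gamma>"
proof (induction rule: Sp6_induct)
  case (mult g h) then show ?case by (intro sp_good_mult)
next
  case T
  have "invertible (mat 1 :: complex^3^3)" by (metis invertible_right_inverse matrix_mul_lid)
  then show ?case by (auto simp: sp_good_def tS_Sp6 siegel_act_tS siegel3_translate)
next
  case J
  then show ?case
    using invertible_jJ siegel_act_jJ Jact_siegel3 siegel3_diag by (auto simp: sp_good_def jJ_Sp6)
next
  case (U U V)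
  then show ?case
    using invertible_uU siegel_act_uU siegel3_unimodular by (auto simp: sp_good_def uU_Sp6)
qed

lemmas siegel_act_siegel3 = sp_good_Sp6[unfolded sp_good_def, THEN conjunct2, rule_format, THEN conjunct2]
lemmas invertible_cocycle = sp_good_Sp6[unfolded sp_good_def, THEN conjunct2, rule_format, THEN conjunct1]

lemma det_cocycle_nz: "\<gamma> \<in> Sp6 \<Longrightarrow> \<tau> \<in> siegel3 \<Longrightarrow> det (cocycle \<gamma> \<tau>) \<noteq> 0"
  using invertible_cocycle invertible_det_nz by blast

lemma siegel_act_compose:
  assumes "g \<in> Sp6" "h \<in> Sp6" "\<tau> \<in> siegel3"
  shows "siegel_act (g ** h) \<tau> = siegel_act g (siegel_act h \<tau>)"
    "cocycle (g ** h) \<tau> = cocycle g (siegel_act h \<tau>) ** cocycle h \<tau>"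
    "transform_z (g ** h) \<tau> z = transform_z g (siegel_act h \<tau>) (transform_z h \<tau> z)"
    "theta_exp_factor (g ** h) \<tau> z = theta_exp_factor h \<tau> z * theta_exp_factor g (siegel_act h \<tau>) (transform_z h \<tau> z)"
proof -
  have i: "invertible (cocycle h \<tau>)" "invertible (cocycle g (siegel_act h \<tau>))"
    using assms invertible_cocycle siegel_act_siegel3 by auto
  show "siegel_act (g ** h) \<tau> = siegel_act g (siegel_act h \<tau>)" using i by (rule siegel_act_mult)
  show "cocycle (g ** h) \<tau> = cocycle g (siegel_act h \<tau>) ** cocycle h \<tau>" using i(1) by (rule cocycle_mult)
  show "transform_z (g ** h) \<tau> z = transform_z g (siegel_act h \<tau>) (transform_z h \<tau> z)" using i by (rule transform_z_mult)
  show "theta_exp_factor (g ** h) \<tau> z = theta_exp_factor h \<tau> z * theta_exp_factor g (siegel_act h \<tau>) (transform_z h \<tau> z)"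
    using assms siegel3_sym siegel_act_siegel3 i by (intro theta_exp_factor_mult) auto
qed

lemma siegel_act_one: "siegel_act (mat 1) \<tau> = \<tau>" and cocycle_one: "cocycle (mat 1) \<tau> = mat 1"
  using siegel_act_tS[of 0 \<tau>] cocycle_tS[of 0 \<tau>] by (simp_all add: tS_zero)

section \<open>The action on the space of quartics\<close>

text \<open>Together with \<open>actU\<close> and \<open>actH\<close>, these are the linear maps of
  \<open>C^8\<close> by which \<open>Theta2\<close> transforms under translations, unimodular
  substitutions and inversions, up to a scalar function of tau and z. They do not involve tau and
  hence act on \<open>x\<close> by itself.\<close>

definition actS :: "int^3^3 \<Rightarrow> complex^(bit^3) \<Rightarrow> complex^(bit^3)"
  where "actS S x = (\<chi> \<epsilon>. exp (of_real pi * \<i> / 2 * of_int (sp (lift \<epsilon>) (S *v lift \<epsilon>))) * x $ \<epsilon>)"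

definition actU :: "bit^3^3 \<Rightarrow> complex^(bit^3) \<Rightarrow> complex^(bit^3)"
  where "actU L x = (\<chi> \<epsilon>. x $ (L *v \<epsilon>))"

definition actH :: "3 \<Rightarrow> complex^(bit^3) \<Rightarrow> complex^(bit^3)"
  where "actH j x = (\<chi> \<epsilon>. x $ setj j \<epsilon> 0 + (if \<epsilon>$j = 1 then -1 else 1) * x $ setj j \<epsilon> 1)"

lemma W'_basis: "Q_one \<in> spaceW'" "\<alpha> \<noteq> 0 \<Longrightarrow> Q_sq \<alpha> \<in> spaceW'" "\<alpha> \<noteq> 0 \<Longrightarrow> Q_perp \<alpha> \<in> spaceW'"
  unfolding spaceW'_def by (auto intro: cfun.span_base)

lemma W'_add: "p \<in> spaceW' \<Longrightarrow> q \<in> spaceW' \<Longrightarrow> p + q \<in> spaceW'"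
  and W'_scale: "q \<in> spaceW' \<Longrightarrow> cscale c q \<in> spaceW'"
  and W'_zero: "0 \<in> spaceW'"
  unfolding spaceW'_def by (auto intro: cfun.span_add cfun.span_scale cfun.span_zero)

lemma W'_diff: "p \<in> spaceW' \<Longrightarrow> q \<in> spaceW' \<Longrightarrow> p - q \<in> spaceW'"
  unfolding spaceW'_def by (rule cfun.span_diff)

lemma W'_induct [consumes 1, case_names one sq perp add scale zero]:
  assumes "q \<in> spaceW'" "P Q_one" "\<And>\<alpha>. \<alpha> \<noteq> 0 \<Longrightarrow> P (Q_sq \<alpha>)" "\<And>\<alpha>. \<alpha> \<noteq> 0 \<Longrightarrow> P (Q_perp \<alpha>)"
    "\<And>p q. P p \<Longrightarrow> P q \<Longrightarrow> P (p + q)" "\<And>c q. P q \<Longrightarrow> P (cscale c q)" "P 0"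
  shows "P q"
proof -
  have "cfun.subspace {q. P q}" unfolding cfun.subspace_def using assms by auto
  then show ?thesis
    using cfun.span_induct[of q "{Q_one} \<union> Q_sq ` {\<alpha>. \<alpha> \<noteq> 0} \<union> Q_perp ` {\<alpha>. \<alpha> \<noteq> 0}" P] assms
    unfolding spaceW'_def by auto
qed

lemma bit_plus_self [simp]: "(x::bit) + x = 0" by (cases x) auto

lemma bv_add: "bv x y z + bv x' y' z' = bv (x + x') (y + y') (z + z')"
  by (simp add: vec_eq_iff forall_3)

lemma Q_sq_explicit:
  "Q_sq (bv 0 0 1) x = (x$bv 0 0 0)\<^sup>2 * (x$bv 0 0 1)\<^sup>2 + (x$bv 0 1 0)\<^sup>2 * (x$bv 0 1 1)\<^sup>2 + (x$bv 1 0 0)\<^sup>2 * (x$bv 1 0 1)\<^sup>2 + (x$bv 1 1 0)\<^sup>2 * (x$bv 1 1 1)\<^sup>2"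
  "Q_sq (bv 0 1 0) x = (x$bv 0 0 0)\<^sup>2 * (x$bv 0 1 0)\<^sup>2 + (x$bv 0 0 1)\<^sup>2 * (x$bv 0 1 1)\<^sup>2 + (x$bv 1 0 0)\<^sup>2 * (x$bv 1 1 0)\<^sup>2 + (x$bv 1 0 1)\<^sup>2 * (x$bv 1 1 1)\<^sup>2"
  "Q_sq (bv 0 1 1) x = (x$bv 0 0 0)\<^sup>2 * (x$bv 0 1 1)\<^sup>2 + (x$bv 0 0 1)\<^sup>2 * (x$bv 0 1 0)\<^sup>2 + (x$bv 1 0 0)\<^sup>2 * (x$bv 1 1 1)\<^sup>2 + (x$bv 1 0 1)\<^sup>2 * (x$bv 1 1 0)\<^sup>2"
  "Q_sq (bv 1 0 0) x = (x$bv 0 0 0)\<^sup>2 * (x$bv 1 0 0)\<^sup>2 + (x$bv 0 0 1)\<^sup>2 * (x$bv 1 0 1)\<^sup>2 + (x$bv 0 1 0)\<^sup>2 * (x$bv 1 1 0)\<^sup>2 + (x$bv 0 1 1)\<^sup>2 * (x$bv 1 1 1)\<^sup>2"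
  "Q_sq (bv 1 0 1) x = (x$bv 0 0 0)\<^sup>2 * (x$bv 1 0 1)\<^sup>2 + (x$bv 0 0 1)\<^sup>2 * (x$bv 1 0 0)\<^sup>2 + (x$bv 0 1 0)\<^sup>2 * (x$bv 1 1 1)\<^sup>2 + (x$bv 0 1 1)\<^sup>2 * (x$bv 1 1 0)\<^sup>2"
  "Q_sq (bv 1 1 0) x = (x$bv 0 0 0)\<^sup>2 * (x$bv 1 1 0)\<^sup>2 + (x$bv 0 0 1)\<^sup>2 * (x$bv 1 1 1)\<^sup>2 + (x$bv 0 1 0)\<^sup>2 * (x$bv 1 0 0)\<^sup>2 + (x$bv 0 1 1)\<^sup>2 * (x$bv 1 0 1)\<^sup>2"
  "Q_sq (bv 1 1 1) x = (x$bv 0 0 0)\<^sup>2 * (x$bv 1 1 1)\<^sup>2 + (x$bv 0 0 1)\<^sup>2 * (x$bv 1 1 0)\<^sup>2 + (x$bv 0 1 0)\<^sup>2 * (x$bv 1 0 1)\<^sup>2 + (x$bv 0 1 1)\<^sup>2 * (x$bv 1 0 0)\<^sup>2"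
  by (simp_all add: Q_sq_def sum_bit3 bv_add mult.commute)

lemma prod_bit3_filter: "(\<Prod>v\<in>{v. P v}. f v) = (\<Prod>v\<leftarrow>[bv 0 0 0, bv 0 0 1, bv 0 1 0, bv 0 1 1, bv 1 0 0, bv 1 0 1, bv 1 1 0, bv 1 1 1]. if P v then f v else 1)"
  for f :: "bit^3 \<Rightarrow> complex"
proof -
  have "(\<Prod>v\<in>{v. P v}. f v) = (\<Prod>v\<in>UNIV. if P v then f v else 1)"
    by (simp add: prod.If_cases)
  then show ?thesis unfolding UNIV_bit3 by simp
qed

lemma Q_perp_explicit:
  "Q_perp (bv 0 0 1) x = x$bv 0 0 0 * x$bv 0 1 0 * x$bv 1 0 0 * x$bv 1 1 0 + x$bv 0 0 1 * x$bv 0 1 1 * x$bv 1 0 1 * x$bv 1 1 1"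
  "Q_perp (bv 0 1 0) x = x$bv 0 0 0 * x$bv 0 0 1 * x$bv 1 0 0 * x$bv 1 0 1 + x$bv 0 1 0 * x$bv 0 1 1 * x$bv 1 1 0 * x$bv 1 1 1"
  "Q_perp (bv 0 1 1) x = x$bv 0 0 0 * x$bv 0 1 1 * x$bv 1 0 0 * x$bv 1 1 1 + x$bv 0 0 1 * x$bv 0 1 0 * x$bv 1 0 1 * x$bv 1 1 0"
  "Q_perp (bv 1 0 0) x = x$bv 0 0 0 * x$bv 0 0 1 * x$bv 0 1 0 * x$bv 0 1 1 + x$bv 1 0 0 * x$bv 1 0 1 * x$bv 1 1 0 * x$bv 1 1 1"
  "Q_perp (bv 1 0 1) x = x$bv 0 0 0 * x$bv 0 1 0 * x$bv 1 0 1 * x$bv 1 1 1 + x$bv 0 0 1 * x$bv 0 1 1 * x$bv 1 0 0 * x$bv 1 1 0"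
  "Q_perp (bv 1 1 0) x = x$bv 0 0 0 * x$bv 0 0 1 * x$bv 1 1 0 * x$bv 1 1 1 + x$bv 0 1 0 * x$bv 0 1 1 * x$bv 1 0 0 * x$bv 1 0 1"
  "Q_perp (bv 1 1 1) x = x$bv 0 0 0 * x$bv 0 1 1 * x$bv 1 0 1 * x$bv 1 1 0 + x$bv 0 0 1 * x$bv 0 1 0 * x$bv 1 0 0 * x$bv 1 1 1"
  by (simp_all add: Q_perp_def sum_bit3 prod_bit3_filter bv_add sp3 mult_ac)

lemma Q_one_explicit: "Q_one x = (x$bv 0 0 0)^4 + (x$bv 0 0 1)^4 + (x$bv 0 1 0)^4 + (x$bv 0 1 1)^4
   + (x$bv 1 0 0)^4 + (x$bv 1 0 1)^4 + (x$bv 1 1 0)^4 + (x$bv 1 1 1)^4"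
  by (simp add: Q_one_def sum_bit3)

lemma nonzero_bit3: "\<alpha> \<noteq> 0 \<longleftrightarrow> \<alpha> \<in> {bv 0 0 1, bv 0 1 0, bv 0 1 1, bv 1 0 0, bv 1 0 1, bv 1 1 0, bv 1 1 1}"
proof -
  have "\<forall>\<alpha>. \<alpha> \<noteq> 0 \<longleftrightarrow> \<alpha> \<in> {bv 0 0 1, bv 0 1 0, bv 0 1 1, bv 1 0 0, bv 1 0 1, bv 1 1 0, bv 1 1 1}"
    unfolding all_bit3 by (simp add: bv_zero)
  then show ?thesis by blast
qed

lemma W'_compose:
  assumes "q \<in> spaceW'" "(\<lambda>x. Q_one (f x)) \<in> spaceW'" "\<And>\<alpha>. \<alpha> \<noteq> 0 \<Longrightarrow> (\<lambda>x. Q_sq \<alpha> (f x)) \<in> spaceW'"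
    "\<And>\<alpha>. \<alpha> \<noteq> 0 \<Longrightarrow> (\<lambda>x. Q_perp \<alpha> (f x)) \<in> spaceW'"
  shows "(\<lambda>x. q (f x)) \<in> spaceW'"
  using assms(1)
proof (induction rule: W'_induct)
  case (add p q)
  then show ?case using W'_add[of "\<lambda>x. p (f x)" "\<lambda>x. q (f x)"] by (simp add: plus_fun_def)
next
  case (scale c q)
  then show ?case using W'_scale[of "\<lambda>x. q (f x)" c] by (simp add: cscale_def)
next
  case zero
  then show ?case using W'_zero by (simp add: zero_fun_def)
qed (use assms in auto)

lemma W'_homogeneous: "q \<in> spaceW' \<Longrightarrow> q (c *s x) = c ^ 4 * q x"
proof (induction rule: W'_induct)
  case one then show ?case by (simp add: Q_one_def power_mult_distrib sum_distrib_left)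
next
  case (sq \<alpha>)
  have "c ^ 4 = c\<^sup>2 * c\<^sup>2" by simp
  then show ?case by (simp add: Q_sq_def power_mult_distrib sum_distrib_left mult_ac)
next
  case (perp \<alpha>)
  then show ?case unfolding nonzero_bit3
    by (auto simp: Q_perp_explicit power4_eq_xxxx algebra_simps)
qed (auto simp: cscale_def algebra_simps)

lemma W'_continuous: "q \<in> spaceW' \<Longrightarrow> continuous_on UNIV q"
proof (induction rule: W'_induct)
  case (add p q) then show ?case unfolding plus_fun_def by (intro continuous_intros)
next
  case (scale c q) then show ?case unfolding cscale_def by (intro continuous_intros)
qed (auto simp: Q_one_def Q_sq_def Q_perp_def zero_fun_def intro!: continuous_intros)

lemma actT: "actS (Em 1 1 1) x $ bv a b c = (if a = 1 then \<i> else 1) * x $ bv a b c"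
proof -
  have "exp (of_real pi * \<i> / 2) = cis (pi / 2)" by (simp add: cis_conv_exp mult.commute)
  then show ?thesis by (simp add: actS_def sp3 mv3 lift_def Em_def)
qed

lemma W'_actT_eigen:
  "Q_one (actS (Em 1 1 1) x) = Q_one x"
  "\<alpha> \<noteq> 0 \<Longrightarrow> Q_sq \<alpha> (actS (Em 1 1 1) x) = (if \<alpha> $ 1 = 1 then -1 else 1) * Q_sq \<alpha> x"
  "\<alpha> \<noteq> 0 \<Longrightarrow> Q_perp \<alpha> (actS (Em 1 1 1) x) = (if \<alpha> = bv 1 0 0 then 1 else -1) * Q_perp \<alpha> x"
proof -
  show "Q_one (actS (Em 1 1 1) x) = Q_one x" by (simp add: Q_one_explicit actT power_mult_distrib)
  show "\<alpha> \<noteq> 0 \<Longrightarrow> Q_sq \<alpha> (actS (Em 1 1 1) x) = (if \<alpha> $ 1 = 1 then -1 else 1) * Q_sq \<alpha> x"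
    unfolding nonzero_bit3 by (elim insertE; simp add: Q_sq_explicit actT power_mult_distrib)
  show "\<alpha> \<noteq> 0 \<Longrightarrow> Q_perp \<alpha> (actS (Em 1 1 1) x) = (if \<alpha> = bv 1 0 0 then 1 else -1) * Q_perp \<alpha> x"
    unfolding nonzero_bit3 by (elim insertE; simp add: Q_perp_explicit actT mult_ac)
qed

lemma W'_actT: "q \<in> spaceW' \<Longrightarrow> (\<lambda>x. q (actS (Em 1 1 1) x)) \<in> spaceW'"
proof (rule W'_compose)
  show "(\<lambda>x. Q_one (actS (Em 1 1 1) x)) \<in> spaceW'" by (simp add: W'_actT_eigen W'_basis)
  show "(\<lambda>x. Q_sq \<alpha> (actS (Em 1 1 1) x)) \<in> spaceW'" if "\<alpha> \<noteq> 0" for \<alpha>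
    unfolding W'_actT_eigen(2)[OF that] using W'_scale[OF W'_basis(2)[OF that]] by (simp only: cscale_def)
  show "(\<lambda>x. Q_perp \<alpha> (actS (Em 1 1 1) x)) \<in> spaceW'" if "\<alpha> \<noteq> 0" for \<alpha>
    unfolding W'_actT_eigen(3)[OF that] using W'_scale[OF W'_basis(3)[OF that]] by (simp only: cscale_def)
qed

text \<open>Linear substitutions permute the spanning quartics: \<open>L\<close> acts on the index
  of \<open>Q_sq\<close>, and its inverse transpose on the index of \<open>Q_perp\<close>, which
  names a plane by its normal vector.\<close>

lemma W'_actU:
  assumes LK: "L ** K = mat 1" "K ** L = mat 1" and q: "q \<in> spaceW'"
  shows "(\<lambda>x. q (actU L x)) \<in> spaceW'"
proof (rule W'_compose[OF q])
  have bij: "bij (\<lambda>\<epsilon>. L *v \<epsilon>)"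
    by (rule bij_betwI[where g = "\<lambda>\<epsilon>. K *v \<epsilon>"]) (auto simp: matrix_vector_mul_assoc LK)
  have add: "L *v (a + b) = L *v a + L *v b" for a b by (rule matrix_vector_right_distrib)
  have nz: "M *v \<alpha> \<noteq> 0" if "\<alpha> \<noteq> 0" "N ** M = mat 1" for M N :: "bit^3^3" and \<alpha>
    using that by (metis matrix_vector_mul_assoc matrix_vector_mul_lid matrix_vector_mult_0_right)
  have "Q_one (actU L x) = Q_one x" for x
    unfolding Q_one_def actU_def using sum.reindex_bij_betw[OF bij, of "\<lambda>\<epsilon>. (x $ \<epsilon>) ^ 4"] by simp
  then show "(\<lambda>x. Q_one (actU L x)) \<in> spaceW'" by (simp add: W'_basis)
  fix \<alpha> :: "bit^3" assume \<alpha>: "\<alpha> \<noteq> 0"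
  have "Q_sq \<alpha> (actU L x) = Q_sq (L *v \<alpha>) x" for x
    unfolding Q_sq_def actU_def
    using sum.reindex_bij_betw[OF bij, of "\<lambda>\<epsilon>. (x $ \<epsilon>)\<^sup>2 * (x $ (\<epsilon> + L *v \<alpha>))\<^sup>2"] by (simp add: add)
  then show "(\<lambda>x. Q_sq \<alpha> (actU L x)) \<in> spaceW'" using nz[OF \<alpha> LK(2)] by (simp add: W'_basis)
  define \<beta> where "\<beta> = transpose K *v \<alpha>"
  have tr: "transpose L ** transpose K = mat 1"
    by (simp add: LK transpose_mat flip: matrix_transpose_mul)
  have \<beta>: "\<beta> \<noteq> 0" unfolding \<beta>_def by (rule nz[OF \<alpha> tr])
  have sL: "sp \<beta> (L *v \<mu>) = sp \<alpha> \<mu>" for \<mu>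
    unfolding \<beta>_def by (simp add: scalar_product_matrix_left matrix_vector_mul_assoc LK del: transpose_matrix_vector)
  have bij2: "bij_betw (\<lambda>\<mu>. L *v \<mu>) {\<mu>. sp \<alpha> \<mu> = 0} {\<mu>. sp \<beta> \<mu> = 0}"
  proof (rule bij_betwI[where g = "\<lambda>\<mu>. K *v \<mu>"])
    show "(\<lambda>\<mu>. K *v \<mu>) \<in> {\<mu>. sp \<beta> \<mu> = 0} \<rightarrow> {\<mu>. sp \<alpha> \<mu> = 0}"
      using sL[of "K *v _"] by (auto simp: matrix_vector_mul_assoc LK)
  qed (auto simp: sL matrix_vector_mul_assoc LK)
  have "Q_perp \<alpha> (actU L x) = Q_perp \<beta> x" for x
  proof -
    have "(\<Prod>\<mu>\<in>{\<mu>. sp \<alpha> \<mu> = 0}. actU L x $ (\<epsilon> + \<mu>)) = (\<Prod>\<mu>\<in>{\<mu>. sp \<beta> \<mu> = 0}. x $ (L *v \<epsilon> + \<mu>))" for \<epsilon>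
      using prod.reindex_bij_betw[OF bij2, of "\<lambda>\<mu>. x $ (L *v \<epsilon> + \<mu>)"] by (simp add: actU_def add)
    then show ?thesis
      unfolding Q_perp_def using sum.reindex_bij_betw[OF bij, of "\<lambda>\<epsilon>. \<Prod>\<mu>\<in>{\<mu>. sp \<beta> \<mu> = 0}. x $ (\<epsilon> + \<mu>)"] by simp
  qed
  then show "(\<lambda>x. Q_perp \<alpha> (actU L x)) \<in> spaceW'" using \<beta> by (simp add: W'_basis)
qed

lemma setj_bv: "setj 1 (bv a b c) s = bv s b c" "setj 2 (bv a b c) s = bv a s c" "setj 3 (bv a b c) s = bv a b s"
  by (simp_all add: setj_def vec_eq_iff forall_3)

lemma actH1: "actH 1 x $ bv a b c = x $ bv 0 b c + (if a = 1 then -1 else 1) * x $ bv 1 b c"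
  by (simp add: actH_def setj_bv)

lemma W'_lincomb3:
  assumes "a \<in> spaceW'" "b \<in> spaceW'" "c \<in> spaceW'" "\<And>x. f x = r * a x + s * b x + t * c x"
  shows "f \<in> spaceW'"
proof -
  have "f = cscale r a + cscale s b + cscale t c" using assms(4) by (auto simp: fun_eq_iff cscale_def)
  then show ?thesis using assms(1-3) by (auto intro!: W'_add W'_scale)
qed

lemma W'_lincomb4:
  assumes "a \<in> spaceW'" "b \<in> spaceW'" "c \<in> spaceW'" "d \<in> spaceW'" "\<And>x. f x = r * a x + s * b x + t * c x + u * d x"
  shows "f \<in> spaceW'"
proof -
  have "f = cscale r a + cscale s b + cscale t c + cscale u d" using assms(5) by (auto simp: fun_eq_iff cscale_def)
  then show ?thesis using assms(1-4) by (auto intro!: W'_add W'_scale)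
qed

text \<open>Pairs \<open>(a, b)\<close> of coordinates differing in the first bit become
  \<open>(a + b, a - b)\<close>, and the coefficients come from expansions such as
  \<open>(a + b)^4 + (a - b)^4 = 2 a^4 + 12 a^2 b^2 + 2 b^4\<close>. For alpha outside the span of
  \<open>e_1\<close>, \<open>Q_sq\<close> at alpha and at alpha plus \<open>e_1\<close> mix with the
  \<open>Q_perp\<close> of the plane spanned by alpha and \<open>e_1\<close>; the
  \<open>Q_perp\<close> of planes without \<open>e_1\<close> mix among themselves.\<close>

lemma W'_actH1: "q \<in> spaceW' \<Longrightarrow> (\<lambda>x. q (actH 1 x)) \<in> spaceW'"
proof (rule W'_compose)
  have nz: "bv 0 0 1 \<noteq> 0" "bv 0 1 0 \<noteq> 0" "bv 0 1 1 \<noteq> 0" "bv 1 0 0 \<noteq> 0" "bv 1 0 1 \<noteq> 0" "bv 1 1 0 \<noteq> 0" "bv 1 1 1 \<noteq> 0"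
    by (simp_all add: bv_zero)
  note E = Q_one_explicit Q_sq_explicit Q_perp_explicit actH1
  show "(\<lambda>x. Q_one (actH 1 x)) \<in> spaceW'"
    by (rule W'_lincomb3[where r = 2 and s = 12 and t = 0, OF W'_basis(1) W'_basis(2)[OF nz(4)] W'_basis(1)])
       (simp add: E power2_eq_square power4_eq_xxxx algebra_simps)
  fix \<alpha> :: "bit^3" assume "\<alpha> \<noteq> 0"
  then have \<alpha>: "\<alpha> = bv 0 0 1 \<or> \<alpha> = bv 0 1 0 \<or> \<alpha> = bv 0 1 1 \<or> \<alpha> = bv 1 0 0 \<or> \<alpha> = bv 1 0 1 \<or> \<alpha> = bv 1 1 0 \<or> \<alpha> = bv 1 1 1"
    unfolding nonzero_bit3 by blast
  have sq0: "(\<lambda>x. Q_sq (bv 1 0 0) (actH 1 x)) \<in> spaceW'"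
    by (rule W'_lincomb3[where r = 1 and s = "-2" and t = 0, OF W'_basis(1) W'_basis(2)[OF nz(4)] W'_basis(1)])
       (simp add: E power2_eq_square power4_eq_xxxx algebra_simps)
  have sq: "(\<lambda>x. Q_sq (bv 0 0 1) (actH 1 x)) \<in> spaceW'"
    by (rule W'_lincomb3[where r = 2 and s = 2 and t = 8, OF W'_basis(2)[OF nz(1)] W'_basis(2)[OF nz(5)] W'_basis(3)[OF nz(2)]])
       (simp add: E power2_eq_square algebra_simps)
  have sq': "(\<lambda>x. Q_sq (bv 1 0 1) (actH 1 x)) \<in> spaceW'"
    by (rule W'_lincomb3[where r = 2 and s = 2 and t = "-8", OF W'_basis(2)[OF nz(1)] W'_basis(2)[OF nz(5)] W'_basis(3)[OF nz(2)]])
       (simp add: E power2_eq_square algebra_simps)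
  have sq2: "(\<lambda>x. Q_sq (bv 0 1 0) (actH 1 x)) \<in> spaceW'"
    by (rule W'_lincomb3[where r = 2 and s = 2 and t = 8, OF W'_basis(2)[OF nz(2)] W'_basis(2)[OF nz(6)] W'_basis(3)[OF nz(1)]])
       (simp add: E power2_eq_square algebra_simps)
  have sq2': "(\<lambda>x. Q_sq (bv 1 1 0) (actH 1 x)) \<in> spaceW'"
    by (rule W'_lincomb3[where r = 2 and s = 2 and t = "-8", OF W'_basis(2)[OF nz(2)] W'_basis(2)[OF nz(6)] W'_basis(3)[OF nz(1)]])
       (simp add: E power2_eq_square algebra_simps)
  have sq3: "(\<lambda>x. Q_sq (bv 0 1 1) (actH 1 x)) \<in> spaceW'"
    by (rule W'_lincomb3[where r = 2 and s = 2 and t = 8, OF W'_basis(2)[OF nz(3)] W'_basis(2)[OF nz(7)] W'_basis(3)[OF nz(3)]])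
       (simp add: E power2_eq_square algebra_simps)
  have sq3': "(\<lambda>x. Q_sq (bv 1 1 1) (actH 1 x)) \<in> spaceW'"
    by (rule W'_lincomb3[where r = 2 and s = 2 and t = "-8", OF W'_basis(2)[OF nz(3)] W'_basis(2)[OF nz(7)] W'_basis(3)[OF nz(3)]])
       (simp add: E power2_eq_square algebra_simps)
  show "(\<lambda>x. Q_sq \<alpha> (actH 1 x)) \<in> spaceW'"
    using \<alpha> sq0 sq sq' sq2 sq2' sq3 sq3' by auto
  have p1: "(\<lambda>x. Q_perp (bv 0 1 0) (actH 1 x)) \<in> spaceW'"
    by (rule W'_lincomb3[where r = 1 and s = "-1" and t = 0, OF W'_basis(2)[OF nz(1)] W'_basis(2)[OF nz(5)] W'_basis(1)])
       (simp add: E power2_eq_square algebra_simps)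
  have p2: "(\<lambda>x. Q_perp (bv 0 0 1) (actH 1 x)) \<in> spaceW'"
    by (rule W'_lincomb3[where r = 1 and s = "-1" and t = 0, OF W'_basis(2)[OF nz(2)] W'_basis(2)[OF nz(6)] W'_basis(1)])
       (simp add: E power2_eq_square algebra_simps)
  have p3: "(\<lambda>x. Q_perp (bv 0 1 1) (actH 1 x)) \<in> spaceW'"
    by (rule W'_lincomb3[where r = 1 and s = "-1" and t = 0, OF W'_basis(2)[OF nz(3)] W'_basis(2)[OF nz(7)] W'_basis(1)])
       (simp add: E power2_eq_square algebra_simps)
  note P4 = W'_basis(3)[OF nz(4)] W'_basis(3)[OF nz(5)] W'_basis(3)[OF nz(6)] W'_basis(3)[OF nz(7)]
  have p4: "(\<lambda>x. Q_perp (bv 1 0 0) (actH 1 x)) \<in> spaceW'"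
    by (rule W'_lincomb4[where r = 2 and s = 2 and t = 2 and u = 2, OF P4]) (simp add: E algebra_simps)
  have p5: "(\<lambda>x. Q_perp (bv 1 0 1) (actH 1 x)) \<in> spaceW'"
    by (rule W'_lincomb4[where r = 2 and s = 2 and t = "-2" and u = "-2", OF P4]) (simp add: E algebra_simps)
  have p6: "(\<lambda>x. Q_perp (bv 1 1 0) (actH 1 x)) \<in> spaceW'"
    by (rule W'_lincomb4[where r = 2 and s = "-2" and t = 2 and u = "-2", OF P4]) (simp add: E algebra_simps)
  have p7: "(\<lambda>x. Q_perp (bv 1 1 1) (actH 1 x)) \<in> spaceW'"
    by (rule W'_lincomb4[where r = 2 and s = "-2" and t = "-2" and u = 2, OF P4]) (simp add: E algebra_simps)
  show "(\<lambda>x. Q_perp \<alpha> (actH 1 x)) \<in> spaceW'"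
    using \<alpha> p1 p2 p3 p4 p5 p6 p7 by auto
qed

subsection \<open>Separation of quartics by points\<close>

definition ind :: "(bit^3) set \<Rightarrow> complex^(bit^3)"
  where "ind A = (\<chi> \<epsilon>. if \<epsilon> \<in> A then 1 else 0)"

definition shL :: "3 \<Rightarrow> 3 \<Rightarrow> bit^3^3"
  where "shL i j = transpose (redm (mat 1 + Em i j 1))"

lemma actU_shL: "actU (shL i j) x $ \<epsilon> = x $ (\<chi> k. \<epsilon> $ k + (if k = j then \<epsilon> $ i else 0))" if "i \<noteq> j"
proof -
  have "shL i j *v \<epsilon> = (\<chi> k. \<epsilon> $ k + (if k = j then \<epsilon> $ i else 0))"
    using that exhaust_3[of i] exhaust_3[of j] bit_cases01[of "\<epsilon>$1"] bit_cases01[of "\<epsilon>$2"] bit_cases01[of "\<epsilon>$3"]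
    by (elim disjE; simp add: shL_def redm_def transpose_def Em_def mat_def vec_eq_iff forall_3 mv3 del: transpose_matrix_vector)
  then show ?thesis by (simp add: actU_def)
qed

text \<open>From the origin, the closure conditions reach the indicators of all seven lines and
  seven planes over \<open>F_2\<close>, so there are 1 + 7 + 7 points, as many as spanning quartics.
  At the origin only \<open>Q_one\<close> is nonzero; at a line one \<open>Q_sq\<close> is added; at
  a plane exactly one \<open>Q_perp\<close> is nonzero. Evaluation is triangular by
  dimension.\<close>

lemma W'_separation:
  assumes q: "q \<in> spaceW'" and zero: "\<And>x. x \<in> Z \<Longrightarrow> q x = 0"
    and e0: "ind {0} \<in> Z" and H: "\<And>x j. x \<in> Z \<Longrightarrow> actH j x \<in> Z"
    and U: "\<And>x i j. x \<in> Z \<Longrightarrow> i \<noteq> j \<Longrightarrow> actU (shL i j) x \<in> Z"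
  shows "q = 0"
proof -
  have shv: "(\<chi> k. bv a b c $ k + (if k = 1 then s else 0)) = bv (a + s) b c"
    "(\<chi> k. bv a b c $ k + (if k = 2 then s else 0)) = bv a (b + s) c"
    "(\<chi> k. bv a b c $ k + (if k = 3 then s else 0)) = bv a b (c + s)" for a b c s
    by (simp_all add: vec_eq_iff forall_3)
  have sh: "actU (shL 1 2) x $ bv a b c = x $ bv a (b + a) c" "actU (shL 1 3) x $ bv a b c = x $ bv a b (c + a)"
    "actU (shL 2 3) x $ bv a b c = x $ bv a b (c + b)" "actU (shL 2 1) x $ bv a b c = x $ bv (a + b) b c"
    "actU (shL 3 1) x $ bv a b c = x $ bv (a + c) b c" for x a b c
  proof -
    have d: "(1::3) \<noteq> 2" "(1::3) \<noteq> 3" "(2::3) \<noteq> 3" "(2::3) \<noteq> 1" "(3::3) \<noteq> 1" by simp_all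
    show "actU (shL 1 2) x $ bv a b c = x $ bv a (b + a) c" "actU (shL 1 3) x $ bv a b c = x $ bv a b (c + a)"
      "actU (shL 2 3) x $ bv a b c = x $ bv a b (c + b)" "actU (shL 2 1) x $ bv a b c = x $ bv (a + b) b c"
      "actU (shL 3 1) x $ bv a b c = x $ bv (a + c) b c"
      by (simp_all only: actU_shL d not_False_eq_True bv_nth shv)
  qed
  have vec8: "x = y \<longleftrightarrow> (\<forall>\<epsilon>. x $ \<epsilon> = y $ \<epsilon>)" for x y :: "complex^(bit^3)" by (simp add: vec_eq_iff)
  have inn: "ind A $ \<epsilon> = (if \<epsilon> \<in> A then 1 else 0)" for A \<epsilon> by (simp add: ind_def)
  have aH: "actH 1 x $ bv a b c = x $ bv 0 b c + (if a = 1 then -1 else 1) * x $ bv 1 b c"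
    "actH 2 x $ bv a b c = x $ bv a 0 c + (if b = 1 then -1 else 1) * x $ bv a 1 c"
    "actH 3 x $ bv a b c = x $ bv a b 0 + (if c = 1 then -1 else 1) * x $ bv a b 1" for x a b c
    by (simp_all add: actH_def setj_bv)
  note ev = vec8[unfolded all_bit3] sh aH inn bv_zero insert_iff empty_iff bv_eq_iff if_True if_False simp_thms
    zero_neq_one one_neq_zero bit_plus_self add_0_left add_0_right mult_1 mult_zero_right mult_minus1 
  have H1: "actH 1 (ind {0}) = ind {0, bv 1 0 0}" "actH 2 (ind {0}) = ind {0, bv 0 1 0}" "actH 3 (ind {0}) = ind {0, bv 0 0 1}"
    by (simp_all only: ev)
  have l: "ind {0, bv 1 0 0} \<in> Z" "ind {0, bv 0 1 0} \<in> Z" "ind {0, bv 0 0 1} \<in> Z"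
    using H[OF e0, of 1] H[OF e0, of 2] H[OF e0, of 3] by (simp_all add: H1)
  have l2_eq: "actU (shL 1 2) (ind {0, bv 1 0 0}) = ind {0, bv 1 1 0}" "actU (shL 1 3) (ind {0, bv 1 0 0}) = ind {0, bv 1 0 1}" "actU (shL 2 3) (ind {0, bv 0 1 0}) = ind {0, bv 0 1 1}"
    by (simp_all only: ev)
  have l2: "ind {0, bv 1 1 0} \<in> Z" "ind {0, bv 1 0 1} \<in> Z" "ind {0, bv 0 1 1} \<in> Z"
    using U[OF l(1), of 1 2, simplified] U[OF l(1), of 1 3, simplified] U[OF l(2), of 2 3, simplified] by (simp_all only: l2_eq)
  have l3_eq: "actU (shL 1 3) (ind {0, bv 1 1 0}) = ind {0, bv 1 1 1}"
    by (simp_all only: ev)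
  have l3: "ind {0, bv 1 1 1} \<in> Z"
    using U[OF l2(1), of 1 3, simplified] by (simp_all only: l3_eq)
  have p_eq: "actH 2 (ind {0, bv 1 0 0}) = ind {0, bv 1 0 0, bv 0 1 0, bv 1 1 0}" "actH 3 (ind {0, bv 1 0 0}) = ind {0, bv 1 0 0, bv 0 0 1, bv 1 0 1}" "actH 3 (ind {0, bv 0 1 0}) = ind {0, bv 0 1 0, bv 0 0 1, bv 0 1 1}"
    by (simp_all only: ev)
  have p: "ind {0, bv 1 0 0, bv 0 1 0, bv 1 1 0} \<in> Z" "ind {0, bv 1 0 0, bv 0 0 1, bv 1 0 1} \<in> Z" "ind {0, bv 0 1 0, bv 0 0 1, bv 0 1 1} \<in> Z"
    using H[OF l(1), of 2] H[OF l(1), of 3] H[OF l(2), of 3] by (simp_all only: p_eq)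
  have p2_eq: "actU (shL 1 2) (ind {0, bv 1 0 0, bv 0 0 1, bv 1 0 1}) = ind {0, bv 1 1 0, bv 0 0 1, bv 1 1 1}" "actU (shL 1 3) (ind {0, bv 1 0 0, bv 0 1 0, bv 1 1 0}) = ind {0, bv 1 0 1, bv 0 1 0, bv 1 1 1}" "actU (shL 2 3) (ind {0, bv 1 0 0, bv 0 1 0, bv 1 1 0}) = ind {0, bv 1 0 0, bv 0 1 1, bv 1 1 1}"
    by (simp_all only: ev)
  have p2: "ind {0, bv 1 1 0, bv 0 0 1, bv 1 1 1} \<in> Z" "ind {0, bv 1 0 1, bv 0 1 0, bv 1 1 1} \<in> Z" "ind {0, bv 1 0 0, bv 0 1 1, bv 1 1 1} \<in> Z"
    using U[OF p(2), of 1 2, simplified] U[OF p(1), of 1 3, simplified] U[OF p(1), of 2 3, simplified] by (simp_all only: p2_eq)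
  have p3a_eq: "actU (shL 2 1) (ind {0, bv 0 1 0, bv 0 0 1, bv 0 1 1}) = ind {0, bv 1 1 0, bv 0 0 1, bv 1 1 1}"
    by (simp_all only: ev)
  have p3a: "ind {0, bv 1 1 0, bv 0 0 1, bv 1 1 1} \<in> Z"
    using U[OF p(3), of 2 1, simplified] by (simp_all only: p3a_eq)
  have p3_eq: "actU (shL 3 1) (ind {0, bv 1 1 0, bv 0 0 1, bv 1 1 1}) = ind {0, bv 1 1 0, bv 1 0 1, bv 0 1 1}"
    by (simp_all only: ev)
  have p3: "ind {0, bv 1 1 0, bv 1 0 1, bv 0 1 1} \<in> Z"
    using U[OF p3a, of 3 1, simplified] by (simp_all only: p3_eq)
  have "\<exists>r s t. \<forall>x. q x = r * Q_one x + (\<Sum>\<alpha>\<in>-{0}. s \<alpha> * Q_sq \<alpha> x) + (\<Sum>\<alpha>\<in>-{0}. t \<alpha> * Q_perp \<alpha> x)"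
    using q
  proof (induction rule: W'_induct)
    case one
    show ?case by (rule exI[of _ 1], rule exI[of _ "\<lambda>_. 0"], rule exI[of _ "\<lambda>_. 0"]) simp
  next
    case (sq \<alpha>)
    then show ?case
      by (intro exI[of _ 0] exI[of _ "\<lambda>\<beta>. if \<beta> = \<alpha> then 1 else 0"] exI[of _ "\<lambda>_. 0"]) (simp add: if_distrib if_distribR sum.delta cong: if_cong)
  next
    case (perp \<alpha>)
    then show ?case
      by (intro exI[of _ 0] exI[of _ "\<lambda>_. 0"] exI[of _ "\<lambda>\<beta>. if \<beta> = \<alpha> then 1 else 0"]) (simp add: if_distrib if_distribR sum.delta cong: if_cong)
  next
    case (add p q)
    from add.IH(1) obtain r s t where P:
      "\<forall>x. p x = r * Q_one x + (\<Sum>\<alpha>\<in>-{0}. s \<alpha> * Q_sq \<alpha> x) + (\<Sum>\<alpha>\<in>-{0}. t \<alpha> * Q_perp \<alpha> x)"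
      by (elim exE)
    from add.IH(2) obtain r' s' t' where Q:
      "\<forall>x. q x = r' * Q_one x + (\<Sum>\<alpha>\<in>-{0}. s' \<alpha> * Q_sq \<alpha> x) + (\<Sum>\<alpha>\<in>-{0}. t' \<alpha> * Q_perp \<alpha> x)"
      by (elim exE)
    from P Q show ?case
      by (intro exI[of _ "r + r'"] exI[of _ "\<lambda>\<alpha>. s \<alpha> + s' \<alpha>"] exI[of _ "\<lambda>\<alpha>. t \<alpha> + t' \<alpha>"])
         (simp add: distrib_right sum.distrib)
  next
    case (scale c q)
    from scale.IH obtain r s t where P:
      "\<forall>x. q x = r * Q_one x + (\<Sum>\<alpha>\<in>-{0}. s \<alpha> * Q_sq \<alpha> x) + (\<Sum>\<alpha>\<in>-{0}. t \<alpha> * Q_perp \<alpha> x)"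
      by (elim exE)
    from P show ?case
      by (intro exI[of _ "c * r"] exI[of _ "\<lambda>\<alpha>. c * s \<alpha>"] exI[of _ "\<lambda>\<alpha>. c * t \<alpha>"])
         (simp add: cscale_def distrib_left sum_distrib_left mult.assoc)
  next
    case zero
    show ?case by (rule exI[of _ 0], rule exI[of _ "\<lambda>_. 0"], rule exI[of _ "\<lambda>_. 0"]) simp
  qed
  then obtain r s t where rst: "\<And>x. q x = r * Q_one x + (\<Sum>\<alpha>\<in>-{0}. s \<alpha> * Q_sq \<alpha> x) + (\<Sum>\<alpha>\<in>-{0}. t \<alpha> * Q_perp \<alpha> x)"
    by blast
  have c: "- {0} = {bv 0 0 1, bv 0 1 0, bv 0 1 1, bv 1 0 0, bv 1 0 1, bv 1 1 0, bv 1 1 1}"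
    using nonzero_bit3 by blast
  have s7: "(\<Sum>\<alpha>\<in>-{0}. f \<alpha>) = f (bv 0 0 1) + f (bv 0 1 0) + f (bv 0 1 1) + f (bv 1 0 0) + f (bv 1 0 1) + f (bv 1 1 0) + f (bv 1 1 1)" for f :: "bit^3 \<Rightarrow> complex"
    unfolding c by (simp add: add.assoc)
  note Q = rst[unfolded s7]
  note E = Q_one_explicit Q_sq_explicit Q_perp_explicit inn bv_zero
  have r: "r = 0" using zero[OF e0] unfolding Q by (simp add: E)
  have s0: "s (bv 0 0 1) = 0" using zero[OF l(3)] unfolding Q by (simp add: E r)
  have s1: "s (bv 0 1 0) = 0" using zero[OF l(2)] unfolding Q by (simp add: E r)
  have s2: "s (bv 1 0 0) = 0" using zero[OF l(1)] unfolding Q by (simp add: E r)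
  have s3: "s (bv 1 1 0) = 0" using zero[OF l2(1)] unfolding Q by (simp add: E r)
  have s4: "s (bv 1 0 1) = 0" using zero[OF l2(2)] unfolding Q by (simp add: E r)
  have s5: "s (bv 0 1 1) = 0" using zero[OF l2(3)] unfolding Q by (simp add: E r)
  have s6: "s (bv 1 1 1) = 0" using zero[OF l3] unfolding Q by (simp add: E r)
  note s = s0 s1 s2 s3 s4 s5 s6
  have t0: "t (bv 0 0 1) = 0" using zero[OF p(1)] unfolding Q by (simp add: E r s)
  have t1: "t (bv 0 1 0) = 0" using zero[OF p(2)] unfolding Q by (simp add: E r s)
  have t2: "t (bv 1 0 0) = 0" using zero[OF p(3)] unfolding Q by (simp add: E r s)
  have t3: "t (bv 1 1 0) = 0" using zero[OF p2(1)] unfolding Q by (simp add: E r s)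
  have t4: "t (bv 1 0 1) = 0" using zero[OF p2(2)] unfolding Q by (simp add: E r s)
  have t5: "t (bv 0 1 1) = 0" using zero[OF p2(3)] unfolding Q by (simp add: E r s)
  have t6: "t (bv 1 1 1) = 0" using zero[OF p3] unfolding Q by (simp add: E r s)
  show ?thesis unfolding fun_eq_iff Q by (simp add: r s t0 t1 t2 t3 t4 t5 t6)
qed

subsection \<open>The action of the symplectic group on quartics\<close>

text \<open>The relation behind \<open>quartic_act\<close> without its uniqueness claim. Images can
  be exhibited generator by generator, before \<open>W'_unique\<close> shows that they are
  determined.\<close>

definition acts_as :: "int^(3 + 3)^(3 + 3) \<Rightarrow> (complex^(bit^3) \<Rightarrow> complex) \<Rightarrow> (complex^(bit^3) \<Rightarrow> complex) \<Rightarrow> bool"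
  where "acts_as \<gamma> q q' \<longleftrightarrow> q' \<in> spaceW' \<and>
    (\<forall>\<tau>\<in>siegel3. \<forall>z. q' (Theta2 \<tau> z) =
       det (cocycle \<gamma> \<tau>) powi (-2) * theta_exp_factor \<gamma> \<tau> z *
       q (Theta2 (siegel_act \<gamma> \<tau>) (transform_z \<gamma> \<tau> z)))"

lemma actH_bv:
  "actH 1 x $ bv a b c = x $ bv 0 b c + (if a = 1 then -1 else 1) * x $ bv 1 b c"
  "actH 2 x $ bv a b c = x $ bv a 0 c + (if b = 1 then -1 else 1) * x $ bv a 1 c"
  "actH 3 x $ bv a b c = x $ bv a b 0 + (if c = 1 then -1 else 1) * x $ bv a b 1"
  by (simp_all add: actH_def setj_bv)

lemma vec8_eqI:
  assumes "\<And>a b c. x $ bv a b c = y $ bv a b c"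
  shows "(x :: 'a^(bit^3)) = y"
  unfolding vec_eq_iff
proof
  fix v show "x $ v = y $ v" using assms[of "v $ 1" "v $ 2" "v $ 3"] by (simp add: bv_eta)
qed

lemma W'_actH:
  assumes "q \<in> spaceW'" shows "(\<lambda>x. q (actH j x)) \<in> spaceW'"
proof -
  define L where "L = redm (Pm 1 j)"
  have LL: "L ** L = mat 1" by (simp add: L_def Pm_square flip: redm_mult)
  have m: "redm (Pm 1 1) *v bv a b c = bv a b c" "redm (Pm 1 2) *v bv a b c = bv b a c"
    "redm (Pm 1 3) *v bv a b c = bv c b a" for a b c
    by (simp_all add: vec_eq_iff forall_3 redm_def Pm_def mv3)
  have "actH j x = actU L (actH 1 (actU L x))" for x
  proof (rule vec8_eqI)
    fix a b c
    have u: "actU M y $ v = y $ (M *v v)" for M y v by (simp add: actU_def)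
    show "actH j x $ bv a b c = actU L (actH 1 (actU L x)) $ bv a b c"
      using exhaust_3[of j] by (elim disjE; simp add: L_def u m actH_bv)
  qed
  then show ?thesis
    using W'_actU[OF LL LL W'_actH1[OF W'_actU[OF LL LL assms]]] by simp
qed

lemma acts_as_mult:
  assumes "g \<in> Sp6" "h \<in> Sp6" "acts_as g q q1" "acts_as h q1 q2"
  shows "acts_as (g ** h) q q2"
  unfolding acts_as_def
proof (intro conjI ballI allI)
  show "q2 \<in> spaceW'" using assms by (simp add: acts_as_def)
  fix \<tau> z assume t: "\<tau> \<in> siegel3"
  have "siegel_act h \<tau> \<in> siegel3" using assms t siegel_act_siegel3 by blast
  then show "q2 (Theta2 \<tau> z) = det (cocycle (g ** h) \<tau>) powi - 2 * theta_exp_factor (g ** h) \<tau> z *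
      q (Theta2 (siegel_act (g ** h) \<tau>) (transform_z (g ** h) \<tau> z))"
    using assms(3,4) t
    by (simp add: acts_as_def siegel_act_compose[OF assms(1,2) t] det_mul power_int_mult_distrib mult_ac)
qed

lemma acts_as_T:
  assumes "q \<in> spaceW'" shows "acts_as (tS (Em 1 1 1)) q (\<lambda>x. q (actS (Em 1 1 1) x))"
proof -
  have "Theta2 (\<tau> + cm (Em 1 1 1)) z = actS (Em 1 1 1) (Theta2 \<tau> z)" for \<tau> z
    by (simp add: vec_eq_iff actS_def Theta2_translate)
  then show ?thesis
    unfolding acts_as_def using W'_actT[OF assms] by (simp add: siegel_act_tS transform_z_tS theta_exp_factor_tS)
qed

lemma redm_inverse: "U ** V = mat 1 \<Longrightarrow> redm U ** redm V = mat 1"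
  by (metis redm_mult redm_one)

lemma transpose_inverse: "A ** B = mat 1 \<Longrightarrow> transpose B ** transpose A = (mat 1 :: 'a::comm_semiring_1^'n^'n)"
  by (metis matrix_transpose_mul transpose_mat)

lemma acts_as_U:
  assumes UV: "U ** V = mat 1" and "q \<in> spaceW'"
  shows "acts_as (uU U V) q (\<lambda>x. q (actU (transpose (redm U)) x))"
proof -
  have "Theta2 (cm U ** \<tau> ** transpose (cm U)) (cm U *v z) = actU (transpose (redm U)) (Theta2 \<tau> z)" for \<tau> z
    unfolding vec_eq_iff Theta2_unimodular[OF UV] by (simp add: actU_def)
  moreover have "(\<lambda>x. q (actU (transpose (redm U)) x)) \<in> spaceW'"
    using UV int_matrix_left_right_inverse[OF UV] assms(2)
    by (intro W'_actU[where K = "transpose (redm V)"] transpose_inverse redm_inverse)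
  moreover have "det (cocycle (uU U V) \<tau>) powi -2 = 1" for \<tau>
    using det_uU[OF UV, of \<tau>] by auto
  ultimately show ?thesis
    unfolding acts_as_def by (simp add: siegel_act_uU[OF UV] transform_z_uU[OF UV] theta_exp_factor_uU[OF UV])
qed

text \<open>A quartic sees only the fourth power of the scalar in \<open>Theta2_inversion\<close>.
  The square root yields \<open>- tau_jj^2 / 4\<close>, which cancels the weight and leaves -1/4;
  the exponential cancels \<open>theta_exp_factor\<close>.\<close>

lemma acts_as_J:
  assumes q: "q \<in> spaceW'"
  shows "acts_as (jJ j) q (\<lambda>x. - 1 / 4 * q (actH j x))"
  unfolding acts_as_def
proof (intro conjI ballI allI)
  show "(\<lambda>x. - 1 / 4 * q (actH j x)) \<in> spaceW'"
    using W'_scale[OF W'_actH[OF q]] by (simp only: cscale_def)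
  fix \<tau> :: "complex^3^3" and z assume \<tau>: "\<tau> \<in> siegel3"
  have t: "\<tau>$j$j \<noteq> 0" using siegel3_diag[OF \<tau>] by simp
  define w where "w = (z$j)\<^sup>2 / \<tau>$j$j"
  define c where "c = csqrt (- \<i> * (\<tau>$j$j / 2)) * exp (2 * of_real pi * \<i> * w)"
  have th: "Theta2 (Jact j \<tau>) (Jz j \<tau> z) = c *s actH j (Theta2 \<tau> z)"
    unfolding vec_eq_iff Theta2_inversion[OF \<tau>] by (simp add: c_def w_def actH_def)
  have x4: "x ^ 4 = (x\<^sup>2)\<^sup>2" for x :: complex by simp
  have "c ^ 4 = csqrt (- \<i> * (\<tau>$j$j / 2)) ^ 4 * exp (2 * of_real pi * \<i> * w) ^ 4"
    by (simp add: c_def power_mult_distrib)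
  also have "exp (2 * of_real pi * \<i> * w) ^ 4 = exp (8 * of_real pi * \<i> * w)"
    by (simp add: exp_of_nat_mult[symmetric] algebra_simps)
  also have "csqrt (- \<i> * (\<tau>$j$j / 2)) ^ 4 = ((csqrt (- \<i> * (\<tau>$j$j / 2)))\<^sup>2)\<^sup>2" by (rule x4)
  also have "\<dots> = (- \<i> * (\<tau>$j$j / 2))\<^sup>2" by (simp only: power2_csqrt)
  also have "\<dots> = - (\<tau>$j$j)\<^sup>2 / 4" by (simp add: power_mult_distrib power_divide)
  finally have c4: "c ^ 4 = - (\<tau>$j$j)\<^sup>2 / 4 * exp (8 * of_real pi * \<i> * w)" .
  have "(\<tau>$j$j) powi -2 * exp (- (8 * of_real pi * \<i> * w)) * c ^ 4 = - 1 / 4"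
    unfolding c4 using t by (simp add: power_int_minus exp_minus field_simps)
  then show "- 1 / 4 * q (actH j (Theta2 \<tau> z)) = det (cocycle (jJ j) \<tau>) powi - 2 * theta_exp_factor (jJ j) \<tau> z *
      q (Theta2 (siegel_act (jJ j) \<tau>) (transform_z (jJ j) \<tau> z))"
    unfolding siegel_act_jJ[OF t] transform_z_jJ[OF t] theta_exp_factor_jJ[OF t] det_jJ[OF t] th W'_homogeneous[OF q]
    by (simp add: w_def mult.assoc[symmetric])
qed

lemma acts_as_exists: "\<gamma> \<in> Sp6 \<Longrightarrow> \<forall>q\<in>spaceW'. \<exists>q'. acts_as \<gamma> q q'"
proof (induction rule: Sp6_induct)
  case (mult g h)
  show ?case
  proof
    fix q assume "q \<in> spaceW'"
    then obtain q1 where q1: "acts_as g q q1" using mult by blast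
    then obtain q2 where "acts_as h q1 q2" using mult by (auto simp: acts_as_def)
    then show "\<exists>q'. acts_as (g ** h) q q'" using acts_as_mult mult q1 by blast
  qed
qed (use acts_as_T acts_as_J acts_as_U in blast)+

lemma Theta2_ray: "((\<lambda>t. Theta2 (ray (mat 1) t) 0) \<longlongrightarrow> ind {0}) at_top"
  by (rule vec_tendstoI) (use Theta2_ray_limit in \<open>simp add: ind_def\<close>)

text \<open>The bridge from theta vectors to \<open>ind {0}\<close>: the vectors
  \<open>Theta2 (ray (mat 1) t) 0\<close> converge to it.\<close>

lemma eq_at_zero_point:
  assumes f: "continuous_on UNIV f" and g: "continuous_on UNIV g"
    and "\<And>\<tau>. \<tau> \<in> siegel3 \<Longrightarrow> f (Theta2 \<tau> 0) = g (Theta2 \<tau> 0)"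
  shows "f (ind {0}) = (g (ind {0}) :: complex)"
proof -
  have lim: "((\<lambda>t. h (Theta2 (ray (mat 1) t) 0)) \<longlongrightarrow> h (ind {0})) at_top" if "continuous_on UNIV h" for h :: "complex^(bit^3) \<Rightarrow> complex"
    using continuous_on_tendsto_compose[OF that Theta2_ray] by simp
  have "\<forall>\<^sub>F t in at_top. g (Theta2 (ray (mat 1) t) 0) = f (Theta2 (ray (mat 1) t) 0)"
    using eventually_gt_at_top[of 0] by eventually_elim (simp add: assms(3) ray_id_siegel3)
  with lim[OF g] have "((\<lambda>t. f (Theta2 (ray (mat 1) t) 0)) \<longlongrightarrow> g (ind {0})) at_top"
    by (rule Lim_transform_eventually)
  from tendsto_unique[OF trivial_limit_at_top_linorder lim[OF f] this] show ?thesis .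
qed

text \<open>A quartic vanishing on all second order theta vectors vanishes at their limit point
  \<open>ind {0}\<close>, and the set of such quartics is stable under the generators.\<close>

lemma W'_unique:
  assumes "q \<in> spaceW'" "\<And>\<tau> z. \<tau> \<in> siegel3 \<Longrightarrow> q (Theta2 \<tau> z) = 0"
  shows "q = 0"
proof -
  define N where "N = {q \<in> spaceW'. \<forall>\<tau>\<in>siegel3. \<forall>z. q (Theta2 \<tau> z) = 0}"
  define Z where "Z = {x. \<forall>q\<in>N. q x = 0}"
  have N: "q' \<in> N" if "g \<in> Sp6" "acts_as g q q'" "q \<in> N" for g q q'
    using that siegel_act_siegel3[OF that(1)] by (auto simp: N_def acts_as_def)
  show ?thesis
  proof (rule W'_separation[OF assms(1), of Z])
    have "q \<in> N" using assms by (simp add: N_def)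
    then show "q x = 0" if "x \<in> Z" for x using that by (simp add: Z_def)
    show "ind {0} \<in> Z"
      using eq_at_zero_point[OF W'_continuous continuous_on_const[of _ 0]] by (auto simp: Z_def N_def)
    fix x assume x: "x \<in> Z"
    show "actH j x \<in> Z" for j
    proof -
      have "q (actH j x) = 0" if "q \<in> N" for q
      proof -
        have "(\<lambda>x. - 1 / 4 * q (actH j x)) \<in> N" using N[OF jJ_Sp6 acts_as_J that] that by (simp add: N_def)
        then show ?thesis using x unfolding Z_def by force
      qed
      then show ?thesis by (simp add: Z_def)
    qed
    show "actU (shL i j) x \<in> Z" if "i \<noteq> j" for i j
    proof -
      have "q (actU (shL i j) x) = 0" if "q \<in> N" for q
      proof -
        have "(\<lambda>x. q (actU (shL i j) x)) \<in> N"
          unfolding shL_def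
          using N[OF uU_Sp6[OF shear_inverse[OF \<open>i \<noteq> j\<close>]] acts_as_U[OF shear_inverse[OF \<open>i \<noteq> j\<close>]] that] that by (simp add: N_def)
        then show ?thesis using x unfolding Z_def by force
      qed
      then show ?thesis by (simp add: Z_def)
    qed
  qed
qed

lemma W'_eqI:
  assumes "q \<in> spaceW'" "q' \<in> spaceW'" "\<And>\<tau> z. \<tau> \<in> siegel3 \<Longrightarrow> q (Theta2 \<tau> z) = q' (Theta2 \<tau> z)"
  shows "q = q'"
proof -
  have "q - q' = 0" using assms by (intro W'_unique W'_diff) auto
  then show ?thesis by simp
qed

lemma quartic_act_eqI: "acts_as \<gamma> q q' \<Longrightarrow> quartic_act \<gamma> q = q'"
  unfolding quartic_act_def
  by (rule the_equality) (auto simp: acts_as_def intro!: W'_eqI)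

lemma acts_as_quartic_act: "\<gamma> \<in> Sp6 \<Longrightarrow> q \<in> spaceW' \<Longrightarrow> acts_as \<gamma> q (quartic_act \<gamma> q)"
  using acts_as_exists quartic_act_eqI by blast

lemma quartic_act_W': "\<gamma> \<in> Sp6 \<Longrightarrow> q \<in> spaceW' \<Longrightarrow> quartic_act \<gamma> q \<in> spaceW'"
  using acts_as_quartic_act by (auto simp: acts_as_def)

text \<open>A right action: the left factor acts first, as for \<open>slash\<close>. Invariance
  under \<open>Gamma30_2\<close> therefore makes a summand depend only on the coset with
  \<open>Gamma30_2\<close> on the left.\<close>

lemma quartic_act_mult:
  "g \<in> Sp6 \<Longrightarrow> h \<in> Sp6 \<Longrightarrow> q \<in> spaceW' \<Longrightarrow> quartic_act (g ** h) q = quartic_act h (quartic_act g q)"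
  by (intro quartic_act_eqI acts_as_mult) (auto intro: acts_as_quartic_act quartic_act_W')

lemma quartic_act_add:
  assumes "\<gamma> \<in> Sp6" "p \<in> spaceW'" "q \<in> spaceW'"
  shows "quartic_act \<gamma> (p + q) = quartic_act \<gamma> p + quartic_act \<gamma> q"
  using acts_as_quartic_act[OF assms(1,2)] acts_as_quartic_act[OF assms(1,3)]
  by (intro quartic_act_eqI) (auto simp: acts_as_def W'_add distrib_left)

lemma quartic_act_scale:
  assumes "\<gamma> \<in> Sp6" "q \<in> spaceW'"
  shows "quartic_act \<gamma> (cscale c q) = cscale c (quartic_act \<gamma> q)"
  using acts_as_quartic_act[OF assms]
  by (intro quartic_act_eqI) (auto simp: acts_as_def W'_scale, auto simp: cscale_def)

lemma quartic_act_zero: "\<gamma> \<in> Sp6 \<Longrightarrow> quartic_act \<gamma> 0 = 0"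
  by (rule quartic_act_eqI) (auto simp: acts_as_def W'_zero)

lemma quartic_act_one: "q \<in> spaceW' \<Longrightarrow> quartic_act (mat 1) q = q"
  by (rule quartic_act_eqI) (simp add: acts_as_def tS_zero[symmetric] siegel_act_tS transform_z_tS theta_exp_factor_tS vec_eq_iff)

lemmas quartic_act_T = quartic_act_eqI[OF acts_as_T]
lemmas quartic_act_U = quartic_act_eqI[OF acts_as_U]
lemmas quartic_act_J = quartic_act_eqI[OF acts_as_J]

text \<open>The phase at the zero characteristic is 1, so \<open>actS S\<close> fixes
  \<open>ind {0}\<close>. The closed formula \<open>acts_as_T\<close> concerns
  \<open>Em 1 1 1\<close> only; for general \<open>S\<close> the comparison is made at the limit
  point alone.\<close>

lemma quartic_act_tS_zero_point:
  assumes S: "transpose S = S" and q: "q \<in> spaceW'"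
  shows "quartic_act (tS S) q (ind {0}) = q (ind {0})"
proof -
  have "quartic_act (tS S) q (ind {0}) = q (actS S (ind {0}))"
  proof (rule eq_at_zero_point)
    show "continuous_on UNIV (quartic_act (tS S) q)"
      using S q by (intro W'_continuous quartic_act_W' tS_Sp6)
    show "continuous_on UNIV (\<lambda>x. q (actS S x))"
      unfolding actS_def
      by (rule continuous_on_compose2[OF W'_continuous[OF q]]) (auto intro!: continuous_intros)
    have "Theta2 (\<tau> + cm S) 0 = actS S (Theta2 \<tau> 0)" for \<tau>
      by (simp add: vec_eq_iff actS_def Theta2_translate[OF S])
    then show "quartic_act (tS S) q (Theta2 \<tau> 0) = q (actS S (Theta2 \<tau> 0))" if "\<tau> \<in> siegel3" for \<tau>
      using acts_as_quartic_act[OF tS_Sp6[OF S] q] that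
      by (simp add: acts_as_def siegel_act_tS transform_z_tS theta_exp_factor_tS)
  qed
  also have "actS S (ind {0}) = ind {0}"
    by (simp add: actS_def ind_def vec_eq_iff sp3 mv3 lift_def)
  finally show ?thesis .
qed

lemma quartic_act_uU_zero_point:
  assumes "U ** V = mat 1" "q \<in> spaceW'"
  shows "quartic_act (uU U V) q (ind {0}) = q (ind {0})"
proof -
  have "transpose (redm V) ** transpose (redm U) = mat 1"
    by (intro transpose_inverse redm_inverse assms)
  then have "transpose (redm U) *v \<epsilon> = 0 \<longleftrightarrow> \<epsilon> = 0" for \<epsilon>
    by (metis matrix_vector_mul_assoc matrix_vector_mul_lid matrix_vector_mult_0_right)
  then have "actU (transpose (redm U)) (ind {0}) = ind {0}"
    by (simp add: actU_def ind_def vec_eq_iff del: transpose_matrix_vector)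
  then show ?thesis by (simp add: quartic_act_U[OF assms])
qed

section \<open>Invariance and three-term relation of the quartic \<open>Q_one\<close>\<close>

lemma Q_one_uU:
  assumes "U ** V = mat 1" shows "quartic_act (uU U V) Q_one = Q_one"
proof -
  define L where "L = transpose (redm U)"
  have LK: "transpose (redm V) ** L = mat 1" "L ** transpose (redm V) = mat 1"
    unfolding L_def using assms int_matrix_left_right_inverse[OF assms]
    by (intro transpose_inverse redm_inverse; simp)+
  have bij: "bij (\<lambda>\<epsilon>. L *v \<epsilon>)"
    by (rule bij_betwI[where g = "\<lambda>\<epsilon>. transpose (redm V) *v \<epsilon>"]) (auto simp: matrix_vector_mul_assoc LK simp del: transpose_matrix_vector)
  have "Q_one (actU L x) = Q_one x" for x
    unfolding Q_one_def actU_def using sum.reindex_bij_betw[OF bij, of "\<lambda>\<epsilon>. (x $ \<epsilon>) ^ 4"] by simp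
  then show ?thesis unfolding quartic_act_U[OF assms W'_basis(1)] L_def[symmetric] by (simp add: fun_eq_iff)
qed

lemma Q_one_T: "quartic_act (tS (Em 1 1 1)) Q_one = Q_one"
  by (simp add: quartic_act_T[OF W'_basis(1)] W'_actT_eigen fun_eq_iff)

lemma quartic_act_T2:
  assumes "q \<in> spaceW'" shows "quartic_act (tS (Em 1 1 2)) q = q"
proof -
  have "q (actS (Em 1 1 1) (actS (Em 1 1 1) x)) = q x" for x
    using assms by (induction rule: W'_induct) (auto simp: W'_actT_eigen cscale_def)
  moreover have "tS (Em 1 1 2) = tS (Em 1 1 1) ** tS (Em 1 1 1)" by (simp add: tS_add Em_add)
  ultimately show ?thesis
    using assms by (simp add: quartic_act_mult tS_Sp6 quartic_act_T W'_actT)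
qed

lemma quartic_act_inverse:
  assumes "g \<in> Sp6" "h \<in> Sp6" "q \<in> spaceW'" "g ** h = mat 1" "quartic_act g q = q"
  shows "quartic_act h q = q"
  using quartic_act_mult[OF assms(1-3)] assms quartic_act_one by simp

text \<open>The lower translation is an even upper translation between two inversions, followed by a
  flip. Even translations in the first coordinate act trivially on all of \<open>W'\<close>, so only
  \<open>jJ 1 ** jJ 1\<close> and the flip remain.\<close>

lemma Q_one_lS:
  assumes "s = 1 \<or> s = -1" shows "quartic_act (lS (Em 1 1 (2 * s))) Q_one = Q_one"
proof -
  have T: "tS (Em 1 1 s) \<in> Sp6" for s by (rule tS_Sp6) simp
  have m2: "quartic_act (tS (Em 1 1 (-2))) q = q" if "q \<in> spaceW'" for q
    by (rule quartic_act_inverse[OF T T that _ quartic_act_T2[OF that]]) (simp add: tS_add Em_add Em_zero tS_zero)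
  have "quartic_act (tS (Em 1 1 (- (2 * s)))) q = q" if "q \<in> spaceW'" for q
    using assms m2[OF that] quartic_act_T2[OF that] by auto
  then have "quartic_act (lS (Em 1 1 (2 * s))) Q_one = quartic_act (flip 1) (quartic_act (jJ 1 ** jJ 1) Q_one)"
    unfolding lS_jJ[symmetric]
    by (simp add: quartic_act_mult Sp6_mult T jJ_Sp6 flip_Sp6 W'_basis quartic_act_W')
  then show ?thesis unfolding jJ_square flip_uU by (simp add: Q_one_uU Fm_square)
qed

lemma Gamma_Mon: "\<delta> \<in> Gamma30_2 \<Longrightarrow> \<delta> \<in> Mon 2"
  by (rule Mon_eq) (auto simp: Gamma30_2_def)

lemma Q_one_Gamma: "\<delta> \<in> Gamma30_2 \<Longrightarrow> quartic_act \<delta> Q_one = Q_one"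
proof -
  have T: "tS (Em 1 1 s) \<in> Sp6" for s by (rule tS_Sp6) simp
  have T': "quartic_act (tS (Em 1 1 (-1))) Q_one = Q_one"
    by (rule quartic_act_inverse[OF T T W'_basis(1) _ Q_one_T]) (simp add: tS_add Em_add Em_zero tS_zero)
  assume "\<delta> \<in> Gamma30_2"
  then have "\<delta> \<in> Mon 2" by (rule Gamma_Mon)
  then show ?thesis
  proof induction
    case one then show ?case by (simp add: quartic_act_one W'_basis)
  next
    case (t g s)
    then show ?case using T' Q_one_T Mon_subset by (auto simp: quartic_act_mult T W'_basis)
  next
    case (l g s)
    moreover have "lS (Em 1 1 (2 * s)) \<in> Sp6" by (rule lS_Sp6) simp
    ultimately show ?case using Q_one_lS Mon_subset by (auto simp: quartic_act_mult W'_basis)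
  next
    case (shear g i j)
    then show ?case
      using Mon_subset shear_Sp6 Q_one_uU[OF shear_inverse] by (auto simp: quartic_act_mult W'_basis simp flip: shear_uU)
  next
    case (flip g i)
    then show ?case
      using Mon_subset flip_Sp6 Q_one_uU[OF Fm_square] by (auto simp: quartic_act_mult W'_basis simp flip: flip_uU)
  next
    case (swap g i j)
    then show ?case
      using Mon_subset swap_Sp6 Q_one_uU[OF Pm_square] by (auto simp: quartic_act_mult W'_basis simp flip: swap_uU)
  qed
qed

text \<open>For \<open>j = 1\<close> the inversion gives -1/4 times
  \<open>2 Q_one + 12 Q_sq (bv 1 0 0)\<close>, and the translation flips the sign of the second
  term, so the sum is \<open>- Q_one\<close>. Conjugation by a swap gives the other
  coordinates.\<close>

lemma Q_one_relation:
  "quartic_act (jJ j) Q_one + quartic_act (jJ j ** tS (Em j j 1)) Q_one = - Q_one"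
proof -
  have T: "tS (Em i i s) \<in> Sp6" for i s by (rule tS_Sp6) simp
  have nz: "bv 1 0 0 \<noteq> 0" by (simp add: bv_zero)
  have H: "Q_one (actH 1 x) = 2 * Q_one x + 12 * Q_sq (bv 1 0 0) x" for x
    by (simp add: Q_one_explicit Q_sq_explicit actH1 power2_eq_square power4_eq_xxxx algebra_simps)
  have J1: "quartic_act (jJ 1) Q_one = (\<lambda>x. - 1 / 4 * (2 * Q_one x + 12 * Q_sq (bv 1 0 0) x))"
    by (simp add: quartic_act_J[OF W'_basis(1)] H)
  have W: "quartic_act (jJ 1) Q_one \<in> spaceW'" by (intro quartic_act_W' jJ_Sp6 W'_basis)
  have JT: "quartic_act (jJ 1 ** tS (Em 1 1 1)) Q_one = (\<lambda>x. - 1 / 4 * (2 * Q_one x - 12 * Q_sq (bv 1 0 0) x))"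
    unfolding quartic_act_mult[OF jJ_Sp6 T W'_basis(1)] quartic_act_T[OF W] unfolding J1
    by (simp add: W'_actT_eigen nz)
  define a where "a = quartic_act (jJ 1) Q_one"
  define b where "b = quartic_act (jJ 1 ** tS (Em 1 1 1)) Q_one"
  have ab: "a + b = cscale (-1) Q_one" "a \<in> spaceW'" "b \<in> spaceW'"
  proof -
    show "a + b = cscale (-1) Q_one" by (simp add: a_def b_def J1 JT fun_eq_iff cscale_def field_simps)
    show "a \<in> spaceW'" "b \<in> spaceW'" unfolding a_def b_def by (intro quartic_act_W' Sp6_mult jJ_Sp6 T W'_basis)+
  qed
  have s: "swap 1 j \<in> Sp6" by (rule swap_Sp6)
  have Qs: "quartic_act (swap 1 j) Q_one = Q_one" unfolding swap_uU by (rule Q_one_uU[OF Pm_square])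
  have e: "jJ j ** tS (Em j j 1) = swap 1 j ** (jJ 1 ** tS (Em 1 1 1)) ** swap 1 j"
  proof -
    have "jJ j ** tS (Em j j 1) = swap 1 j ** jJ 1 ** (swap 1 j ** swap 1 j) ** tS (Em 1 1 1) ** swap 1 j"
      unfolding jJ_swap[of j, symmetric] tS_swap[of j 1, symmetric] by (simp only: matrix_mul_assoc)
    then show ?thesis by (simp add: swap_square matrix_mul_assoc)
  qed
  have "quartic_act (jJ j) Q_one = quartic_act (swap 1 j) a"
    unfolding jJ_swap[of j, symmetric] a_def
    by (simp add: quartic_act_mult Sp6_mult s jJ_Sp6 W'_basis Qs)
  moreover have "quartic_act (jJ j ** tS (Em j j 1)) Q_one = quartic_act (swap 1 j) b"
    unfolding e b_def
    by (simp add: quartic_act_mult[of "swap 1 j ** (jJ 1 ** tS (Em 1 1 1))"] quartic_act_mult[of "swap 1 j"] Sp6_mult s jJ_Sp6 T W'_basis Qs)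
  ultimately have "quartic_act (jJ j) Q_one + quartic_act (jJ j ** tS (Em j j 1)) Q_one = quartic_act (swap 1 j) (a + b)"
    using quartic_act_add[OF s ab(2,3)] by simp
  also have "\<dots> = cscale (-1) Q_one"
    unfolding ab(1) quartic_act_scale[OF s W'_basis(1)] Qs ..
  finally show ?thesis by (simp add: cscale_def fun_eq_iff)
qed

subsection \<open>The action on functions on the Siegel space\<close>

definition slash :: "(complex^3^3 \<Rightarrow> complex) \<Rightarrow> int^(3 + 3)^(3 + 3) \<Rightarrow> complex^3^3 \<Rightarrow> complex"
  where "slash h \<gamma> = (\<lambda>\<tau>. if \<tau> \<in> siegel3 then det (cocycle \<gamma> \<tau>) powi (-14) * h (siegel_act \<gamma> \<tau>) else 0)"

lemma slash_mult:
  assumes "g \<in> Sp6" "k \<in> Sp6" shows "slash h (g ** k) = slash (slash h g) k"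
proof
  fix \<tau> show "slash h (g ** k) \<tau> = slash (slash h g) k \<tau>"
  proof (cases "\<tau> \<in> siegel3")
    case True
    then show ?thesis
      using siegel_act_siegel3[OF assms(2)]
      by (simp add: slash_def siegel_act_compose[OF assms True] det_mul power_int_mult_distrib mult_ac)
  qed (simp add: slash_def)
qed

lemma slash_add: "slash (h + k) \<gamma> = slash h \<gamma> + slash k \<gamma>"
  and slash_scale: "slash (cscale c h) \<gamma> = cscale c (slash h \<gamma>)"
  and slash_zero: "slash 0 \<gamma> = 0"
  and slash_diff: "slash (h - k) \<gamma> = slash h \<gamma> - slash k \<gamma>"
  by (auto simp: slash_def cscale_def fun_eq_iff algebra_simps)

lemma slash_one: "(\<And>\<tau>. \<tau> \<notin> siegel3 \<Longrightarrow> h \<tau> = 0) \<Longrightarrow> slash h (mat 1) = h"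
  by (auto simp: slash_def siegel_act_one cocycle_one fun_eq_iff)

section \<open>Products of theta constants\<close>

definition char_pair :: "bit^3 \<Rightarrow> bit^3 \<Rightarrow> bit^(3 + 3)"
  where "char_pair a b = (\<chi> k. case k of Inl i \<Rightarrow> a $ i | Inr i \<Rightarrow> b $ i)"

lemma upper_char_pair [simp]: "upper (char_pair a b) = a" and lower_char_pair [simp]: "lower (char_pair a b) = b"
  by (simp_all add: upper_def lower_def char_pair_def vec_eq_iff)

lemma char_pair_eta: "char_pair (upper m) (lower m) = m"
  by (simp add: upper_def lower_def char_pair_def vec_eq_iff all33)

lemma char_pair_eq_iff [simp]: "char_pair a b = char_pair c d \<longleftrightarrow> a = c \<and> b = d"
  by (metis upper_char_pair lower_char_pair)

lemma char_eqI: "upper m = upper n \<Longrightarrow> lower m = lower n \<Longrightarrow> m = n"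
  for m n :: "bit^(3 + 3)"
  by (metis char_pair_eta)

lemma all_chars: "(\<forall>m. P m) \<longleftrightarrow> (\<forall>a b. P (char_pair a b))"
  by (metis char_pair_eta)

lemma card_chars:
  "card {m. P (upper m) (lower m)} = (\<Sum>a\<in>UNIV. \<Sum>b\<in>UNIV. if P a b then 1 else 0)"
  for P :: "bit^3 \<Rightarrow> bit^3 \<Rightarrow> bool"
proof -
  have "{m. P (upper m) (lower m)} = (\<lambda>x. char_pair (fst x) (snd x)) ` {x. P (fst x) (snd x)}"
    by (force simp: char_pair_eta image_iff)
  then have "card {m. P (upper m) (lower m)} = card {x. P (fst x) (snd x)}"
    by (simp add: card_image inj_on_def prod_eq_iff)
  also have "\<dots> = (\<Sum>x\<in>UNIV \<times> UNIV. if P (fst x) (snd x) then 1 else 0)"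
    by (simp add: sum.If_cases)
  also have "\<dots> = (\<Sum>a\<in>UNIV. \<Sum>b\<in>UNIV. if P a b then 1 else 0)"
    by (simp only: sum.cartesian_product case_prod_unfold)
  finally show ?thesis .
qed

definition linU :: "int^3^3 \<Rightarrow> int^3^3 \<Rightarrow> bit^(3 + 3) \<Rightarrow> bit^(3 + 3)"
  where "linU U V m = char_pair (transpose (redm U) *v upper m) (redm V *v lower m)"

definition linT :: "int^3^3 \<Rightarrow> bit^(3 + 3) \<Rightarrow> bit^(3 + 3)"
  where "linT S m = char_pair (upper m) (lower m + redm S *v upper m)"

definition linJ :: "3 \<Rightarrow> bit^(3 + 3) \<Rightarrow> bit^(3 + 3)"
  where "linJ j m = char_pair (swapj j (upper m) (lower m)) (swapj j (lower m) (upper m))"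

text \<open>The map adding \<open>(upper_1 + 1) e_1\<close> to the lower half. Its constant term
  comes from the odd diagonal entry and makes it affine, so that it need not preserve subspaces;
  \<open>linT\<close> describes translations with even diagonal.\<close>

definition affT :: "bit^(3 + 3) \<Rightarrow> bit^(3 + 3)"
  where "affT m = (if upper m $ 1 = 1 then m else char_pair (upper m) (lower m + axis 1 1))"

lemma linU_linU: "U ** V = mat 1 \<Longrightarrow> linU V U (linU U V m) = m"
  using redm_inverse[of U V] transpose_inverse[of "redm U" "redm V"] int_matrix_left_right_inverse[of U V]
  by (intro char_eqI) (simp_all add: linU_def matrix_vector_mul_assoc redm_inverse del: transpose_matrix_vector)

lemma linT_linT: "linT S (linT S m) = m"
proof (rule char_eqI)
  have "x + y + y = x" for x y :: "bit^3" by (simp add: vec_eq_iff add.assoc)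
  then show "lower (linT S (linT S m)) = lower m" by (simp add: linT_def)
qed (simp add: linT_def)

lemma linJ_linJ: "linJ j (linJ j m) = m"
  by (rule char_eqI) (auto simp: linJ_def swapj_def vec_eq_iff)

lemma affT_affT: "affT (affT m) = m"
proof -
  have "x + y + y = x" for x y :: "bit^3" by (simp add: vec_eq_iff add.assoc)
  then show ?thesis by (auto simp: affT_def char_pair_eta)
qed

lemma inj_linU: "U ** V = mat 1 \<Longrightarrow> inj (linU U V)"
  and inj_linT: "inj (linT S)" and inj_linJ: "inj (linJ j)" and inj_affT: "inj affT"
  by (metis injI linU_linU) (metis injI linT_linT linJ_linJ affT_affT)+

lemma image_involution: "(\<And>m. f (f m) = m) \<Longrightarrow> f ` X = {m. f m \<in> X}"
  by (auto simp: image_iff) metis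

lemma even_linU: "U ** V = mat 1 \<Longrightarrow> even_char (linU U V m) \<longleftrightarrow> even_char m"
  by (simp add: even_char_def linU_def scalar_product_matrix_left matrix_vector_mul_assoc redm_inverse del: transpose_matrix_vector)

lemma redm_sym: "transpose S = S \<Longrightarrow> redm S $ k $ l = redm S $ l $ k"
proof -
  assume "transpose S = S"
  then have "S $ k $ l = S $ l $ k" by (metis (no_types, lifting) transpose_def vec_lambda_beta)
  then show ?thesis by (simp add: redm_def)
qed

lemma even_linT:
  assumes "transpose S = S" "\<And>i. even (S $ i $ i)"
  shows "even_char (linT S m) \<longleftrightarrow> even_char m"
proof -
  have d: "redm S $ i $ i = 0" for i using assms(2) by (simp add: redm_def)
  have s: "redm S $ 2 $ 1 = redm S $ 1 $ 2" "redm S $ 3 $ 1 = redm S $ 1 $ 3" "redm S $ 3 $ 2 = redm S $ 2 $ 3"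
    using redm_sym[OF assms(1)] by blast+
  have "sp a (redm S *v a) = 0" for a
    using bit_cases01[of "a$1"] bit_cases01[of "a$2"] bit_cases01[of "a$3"]
    by (elim disjE; auto simp: sp3 mv3 d s)
  then show ?thesis by (simp add: even_char_def linT_def scalar_product_add_right)
qed

lemma even_linJ: "even_char (linJ j m) \<longleftrightarrow> even_char m"
  using exhaust_3[of j] by (elim disjE; simp add: even_char_def linJ_def sp3 swapj_def mult.commute conj_commute)

definition prodX :: "(bit^(3 + 3)) set \<Rightarrow> complex^3^3 \<Rightarrow> complex"
  where "prodX X \<tau> = (if \<tau> \<in> siegel3 then \<Prod>m\<in>X. theta_const m \<tau> else 0)"

lemma formH_prodX: "formH F = prodX ({m. even_char m} - F)"
  by (simp add: fun_eq_iff formH_def prodX_def)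

lemma slash_prodX:
  assumes "g \<in> Sp6" "inj f"
    and "\<And>\<tau> m. \<tau> \<in> siegel3 \<Longrightarrow> theta_const m (siegel_act g \<tau>) = c m \<tau> * theta_const (f m) \<tau>"
    and "\<And>\<tau>. \<tau> \<in> siegel3 \<Longrightarrow> det (cocycle g \<tau>) powi (-14) * (\<Prod>m\<in>X. c m \<tau>) = \<kappa>"
  shows "slash (prodX X) g = cscale \<kappa> (prodX (f ` X))"
proof
  fix \<tau>
  have inj: "inj_on f X" using assms(2) by (rule inj_on_subset) simp
  show "slash (prodX X) g \<tau> = cscale \<kappa> (prodX (f ` X)) \<tau>"
  proof (cases "\<tau> \<in> siegel3")
    case True
    then have "slash (prodX X) g \<tau> = (det (cocycle g \<tau>) powi (-14) * (\<Prod>m\<in>X. c m \<tau>)) * (\<Prod>m\<in>X. theta_const (f m) \<tau>)"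
      using siegel_act_siegel3[OF assms(1) True] by (simp add: slash_def prodX_def assms(3) prod.distrib)
    then show ?thesis
      using True by (simp add: assms(4) prodX_def cscale_def prod.reindex[OF inj])
  qed (simp add: slash_def prodX_def cscale_def)
qed

lemma slash_prodX_uU:
  assumes UV: "U ** V = mat 1"
  shows "\<exists>\<kappa>. \<kappa> \<noteq> 0 \<and> slash (prodX X) (uU U V) = cscale \<kappa> (prodX (linU U V ` X))"
proof -
  have "\<forall>m. \<exists>s. (s = 1 \<or> s = -1) \<and> (\<forall>\<tau>. theta_const m (cm U ** \<tau> ** transpose (cm U)) = s * theta_const (linU U V m) \<tau>)"
    unfolding theta_const_def linU_def upper_char_pair lower_char_pair using theta_unimodular[OF UV] by metis
  then obtain s where s: "\<And>m. s m = 1 \<or> s m = -1"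
    "\<And>m \<tau>. theta_const m (cm U ** \<tau> ** transpose (cm U)) = s m * theta_const (linU U V m) \<tau>" by metis
  have d: "det (cocycle (uU U V) \<tau>) powi (-14) = 1" for \<tau> using det_uU[OF UV, of \<tau>] by auto
  have "slash (prodX X) (uU U V) = cscale (\<Prod>m\<in>X. s m) (prodX (linU U V ` X))"
    by (rule slash_prodX[where c = "\<lambda>m _. s m"])
       (simp_all add: uU_Sp6[OF UV] inj_linU[OF UV] siegel_act_uU[OF UV] s(2) d)
  moreover have "s m \<noteq> 0" for m using s(1)[of m] by auto
  ultimately show ?thesis by (intro exI[of _ "\<Prod>m\<in>X. s m"]) simp
qed

lemma slash_prodX_tS:
  assumes S: "transpose S = S" "\<And>i. even (S $ i $ i)"
  shows "\<exists>\<kappa>. \<kappa> \<noteq> 0 \<and> slash (prodX X) (tS S) = cscale \<kappa> (prodX (linT S ` X))"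
proof -
  have "red (diagv S) = 0" using S(2) by (simp add: red_def diagv_def vec_eq_iff)
  then have "\<forall>m. \<exists>s. s \<noteq> 0 \<and> (\<forall>\<tau>. theta_const m (\<tau> + cm S) = s * theta_const (linT S m) \<tau>)"
    unfolding theta_const_def linT_def upper_char_pair lower_char_pair using theta_translate[OF S(1)] by (metis add_0_right)
  then obtain s where s: "\<And>m. s m \<noteq> 0"
    "\<And>m \<tau>. theta_const m (\<tau> + cm S) = s m * theta_const (linT S m) \<tau>" by metis
  have "slash (prodX X) (tS S) = cscale (\<Prod>m\<in>X. s m) (prodX (linT S ` X))"
    by (rule slash_prodX[where c = "\<lambda>m _. s m"])
       (simp_all add: tS_Sp6[OF S(1)] inj_linT siegel_act_tS s(2))
  then show ?thesis using s(1) by (intro exI[of _ "\<Prod>m\<in>X. s m"]) simp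
qed

lemma prod_if_power: "finite X \<Longrightarrow> (\<Prod>m\<in>X. if P m then c else 1) = (c :: complex) ^ card {m \<in> X. P m}"
  by (simp add: prod.If_cases Collect_conj_eq Int_commute)

text \<open>With 28 factors the square roots combine to \<open>(-i tau_jj)^14\<close>, which cancels
  the weight and leaves the sign -1; the factors -i are counted separately.\<close>

lemma slash_prodX_jJ:
  assumes X: "card X = 28"
  shows "slash (prodX X) (jJ j) =
    cscale (- ((- \<i>) ^ card {m \<in> X. upper m $ j = 1 \<and> lower m $ j = 1})) (prodX (linJ j ` X))"
proof -
  define n where "n = card {m \<in> X. upper m $ j = 1 \<and> lower m $ j = 1}"
  define c where "c = (\<lambda>(m::bit^(3 + 3)) (\<tau>::complex^3^3). csqrt (- \<i> * \<tau>$j$j) * (if upper m $ j = 1 \<and> lower m $ j = 1 then - \<i> else 1))"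
  have "slash (prodX X) (jJ j) = cscale (- ((- \<i>) ^ n)) (prodX (linJ j ` X))"
  proof (rule slash_prodX[where c = c])
    fix \<tau> :: "complex^3^3" assume \<tau>: "\<tau> \<in> siegel3"
    have t: "\<tau>$j$j \<noteq> 0" using siegel3_diag[OF \<tau>] by simp
    show "theta_const m (siegel_act (jJ j) \<tau>) = c m \<tau> * theta_const (linJ j m) \<tau>" for m
      unfolding siegel_act_jJ[OF t] theta_const_def theta_inversion_3[OF \<tau>] c_def linJ_def upper_char_pair lower_char_pair ..
    have i14: "(- \<i>) ^ 14 = -1"
    proof -
      have "(- \<i>) ^ 14 = ((- \<i>)\<^sup>2) ^ 7" unfolding power_mult[symmetric] by simp
      also have "\<dots> = -1" by simp
      finally show ?thesis .
    qed
    have "csqrt (- \<i> * \<tau>$j$j) ^ 28 = ((csqrt (- \<i> * \<tau>$j$j))\<^sup>2) ^ 14" unfolding power_mult[symmetric] by simp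
    also have "\<dots> = (- \<i> * \<tau>$j$j) ^ 14" by (simp only: power2_csqrt)
    also have "\<dots> = - ((\<tau>$j$j) ^ 14)" unfolding power_mult_distrib i14 by simp
    finally have "(\<Prod>m\<in>X. c m \<tau>) = - ((\<tau>$j$j) ^ 14) * (- \<i>) ^ n"
      unfolding c_def prod.distrib n_def by (simp only: prod_constant X prod_if_power[OF finite])
    moreover have "(\<tau>$j$j) powi (-14) * (\<tau>$j$j) ^ 14 = 1" using t by (simp add: power_int_minus)
    ultimately show "det (cocycle (jJ j) \<tau>) powi - 14 * (\<Prod>m\<in>X. c m \<tau>) = - ((- \<i>) ^ n)"
      unfolding det_jJ[OF t] by simp
  qed (simp_all add: jJ_Sp6 inj_linJ)
  then show ?thesis by (simp add: n_def)
qed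

lemma slash_prodX_t11:
  "slash (prodX X) (tS (Em 1 1 1)) =
    cscale (exp (of_real pi * \<i> / 4) ^ card {m \<in> X. upper m $ 1 = 1}) (prodX (affT ` X))"
proof (rule slash_prodX[where c = "\<lambda>m _. if upper m $ 1 = 1 then exp (of_real pi * \<i> / 4) else 1"])
  show "tS (Em 1 1 1) \<in> Sp6" by (rule tS_Sp6) simp
  show "theta_const m (siegel_act (tS (Em 1 1 1)) \<tau>) =
      (if upper m $ 1 = 1 then exp (of_real pi * \<i> / 4) else 1) * theta_const (affT m) \<tau>" for m \<tau>
    by (simp add: siegel_act_tS theta_const_def theta_translate_11 affT_def)
  show "det (cocycle (tS (Em 1 1 1)) \<tau>) powi - 14 * (\<Prod>m\<in>X. if upper m $ 1 = 1 then exp (of_real pi * \<i> / 4) else 1) =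
      exp (of_real pi * \<i> / 4) ^ card {m \<in> X. upper m $ 1 = 1}" for \<tau>
    by (simp add: prod_if_power)
qed (rule inj_affT)

subsection \<open>The form of the standard Fano configuration\<close>

abbreviation std_form :: "complex^3^3 \<Rightarrow> complex" where "std_form \<equiv> formH fano1"

definition std_chars :: "(bit^(3 + 3)) set" where "std_chars = {m. even_char m \<and> upper m \<noteq> 0}"
definition std_chars_J :: "(bit^(3 + 3)) set" where "std_chars_J = {m. linJ 1 m \<in> std_chars}"

lemma std_form_prodX: "std_form = prodX std_chars"
proof -
  have "{m. even_char m} - fano1 = std_chars" by (auto simp: std_chars_def fano1_def)
  then show ?thesis by (simp add: formH_prodX)
qed

lemma linJ_std_chars: "linJ 1 ` std_chars = std_chars_J" and linJ_std_chars_J: "linJ 1 ` std_chars_J = std_chars"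
  by (auto simp: std_chars_J_def image_involution[OF linJ_linJ] linJ_linJ)

lemma swapj_bv: "swapj 1 (bv a b c) (bv a' b' c') = bv a' b c"
  by (simp add: swapj_def vec_eq_iff forall_3)

text \<open>These counts fix the constants: \<open>-(-i)^6 = 1\<close> for the inversion and the
  sixteenth power of \<open>exp (pi i / 4)\<close>, again 1, for the translation. For
  \<open>std_chars_J\<close> the corresponding last count is 12, whence the sign -1 in the
  three-term relation.\<close>

lemma card_std_chars: "card std_chars = 28" "card {m \<in> std_chars. upper m $ 1 = 1 \<and> lower m $ 1 = 1} = 6"
    "card {m \<in> std_chars. upper m $ 1 = 1} = 16"
  using card_chars[of "\<lambda>a b. sp a b = 0 \<and> a \<noteq> 0"]
    card_chars[of "\<lambda>a b. (sp a b = 0 \<and> a \<noteq> 0) \<and> a $ 1 = 1 \<and> b $ 1 = 1"]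
    card_chars[of "\<lambda>a b. (sp a b = 0 \<and> a \<noteq> 0) \<and> a $ 1 = 1"]
  by (simp_all add: std_chars_def even_char_def sum_bit3 sp3 bv_zero)

lemma std_chars_J_alt: "std_chars_J = {m. sp (upper m) (lower m) = 0 \<and> swapj 1 (upper m) (lower m) \<noteq> 0}"
  by (simp only: std_chars_J_def std_chars_def mem_Collect_eq even_linJ) (simp add: even_char_def linJ_def)

lemma card_std_chars_J: "card std_chars_J = 28" "card {m \<in> std_chars_J. upper m $ 1 = 1 \<and> lower m $ 1 = 1} = 6"
    "card {m \<in> std_chars_J. upper m $ 1 = 1} = 12"
  using card_chars[of "\<lambda>a b. sp a b = 0 \<and> swapj 1 a b \<noteq> 0"]
    card_chars[of "\<lambda>a b. (sp a b = 0 \<and> swapj 1 a b \<noteq> 0) \<and> a $ 1 = 1 \<and> b $ 1 = 1"]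
    card_chars[of "\<lambda>a b. (sp a b = 0 \<and> swapj 1 a b \<noteq> 0) \<and> a $ 1 = 1"]
  by (simp_all add: std_chars_J_alt sum_bit3 sp3 bv_zero swapj_bv)

lemma affT_std_chars: "affT ` std_chars = std_chars"
proof -
  have e: "even_char (affT m) \<longleftrightarrow> even_char m" for m
  proof (cases "upper m $ 1 = 1")
    case False
    have "sp (upper m) (axis 1 1) = upper m $ 1" by (simp only: sp3) (simp add: axis_def)
    then have "sp (upper m) (axis 1 1) = 0" using False bit_cases01 by metis
    then show ?thesis using False by (simp add: affT_def even_char_def scalar_product_add_right)
  qed (simp add: affT_def)
  have "upper (affT m) = upper m" for m by (simp add: affT_def)
  with e show ?thesis by (simp add: image_involution[OF affT_affT] std_chars_def)
qed

lemma card_affT: "card {m \<in> affT ` X. upper m $ 1 = 1} = card {m \<in> X. upper m $ 1 = 1}"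
proof -
  have "{m \<in> affT ` X. upper m $ 1 = 1} = affT ` {m \<in> X. upper m $ 1 = 1}"
    by (auto simp: affT_def split: if_splits)
  then show ?thesis using card_image[OF inj_on_subset[OF inj_affT subset_UNIV]] by simp
qed

lemma slash_minus: "slash (- h) \<gamma> = - slash h \<gamma>"
  by (auto simp: slash_def fun_eq_iff)

lemma omega_powers: "exp (of_real pi * \<i> / 4) ^ 16 = 1" "exp (of_real pi * \<i> / 4) ^ 12 = -1"
proof -
  have 4: "exp (of_real pi * \<i> / 4) ^ 4 = -1"
    by (simp add: exp_of_nat_mult[symmetric])
  show "exp (of_real pi * \<i> / 4) ^ 16 = 1"
    using power_mult[of "exp (of_real pi * \<i> / 4)" 4 4] by (simp add: 4)
  show "exp (of_real pi * \<i> / 4) ^ 12 = -1"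
    using power_mult[of "exp (of_real pi * \<i> / 4)" 4 3] by (simp add: 4)
qed

lemma cscale_one [simp]: "cscale 1 f = f" by (simp add: cscale_def)

lemma cscale_cscale: "cscale a (cscale b f) = cscale (a * b) f" by (simp add: cscale_def mult.assoc)

lemma neg_i_6: "- ((- \<i>) ^ 6) = 1"
  using power_mult[of "- \<i>" 2 3] by simp

lemma slash_std_form_J: "slash std_form (jJ 1) = prodX std_chars_J" and slash_std_chars_J_J: "slash (prodX std_chars_J) (jJ 1) = std_form"
  by (simp_all add: std_form_prodX slash_prodX_jJ card_std_chars card_std_chars_J linJ_std_chars linJ_std_chars_J neg_i_6 del: power_minus_even)

lemma slash_std_form_t11: "slash std_form (tS (Em 1 1 1)) = std_form"
  by (simp add: std_form_prodX slash_prodX_t11 card_std_chars affT_std_chars omega_powers)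

lemma std_form_off: "\<tau> \<notin> siegel3 \<Longrightarrow> std_form \<tau> = 0" by (simp add: formH_def)

lemma std_form_nonzero: obtains \<tau> where "\<tau> \<in> siegel3" "std_form \<tau> \<noteq> 0"
proof -
  obtain \<tau> where \<tau>: "\<tau> \<in> siegel3" "\<And>\<alpha> \<beta>. \<alpha> \<noteq> 0 \<Longrightarrow> sp \<alpha> \<beta> = 0 \<Longrightarrow> theta \<alpha> \<beta> \<tau> 0 \<noteq> 0"
    using common_nonzero_point by blast
  then have "std_form \<tau> \<noteq> 0"
    by (auto simp: std_form_prodX prodX_def std_chars_def even_char_def theta_const_def)
  then show ?thesis using that \<tau>(1) by blast
qed

lemma cscale_std_form_cancel: "cscale c std_form = std_form \<Longrightarrow> c = 1"
  using std_form_nonzero by (metis cscale_def mult_cancel_right2)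

section \<open>Invariance and three-term relation of the standard form\<close>

lemma slash_std_form_uU:
  assumes "U ** V = mat 1"
  shows "\<exists>\<kappa>. slash std_form (uU U V) = cscale \<kappa> std_form"
proof -
  have VU: "V ** U = mat 1" using assms by (rule int_matrix_left_right_inverse)
  have nz: "upper (linU U V m) \<noteq> 0" if "upper m \<noteq> 0" "U ** V = mat 1" for m U V
  proof
    assume "upper (linU U V m) = 0"
    then have "upper (linU V U (linU U V m)) = 0" by (simp add: linU_def)
    then show False using that linU_linU by metis
  qed
  have "linU U V ` std_chars = std_chars"
  proof
    show "linU U V ` std_chars \<subseteq> std_chars" using nz[OF _ assms] even_linU[OF assms] by (auto simp: std_chars_def)
    have "linU V U m \<in> std_chars" if "m \<in> std_chars" for m using that nz[OF _ VU] even_linU[OF VU] by (auto simp: std_chars_def)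
    then show "std_chars \<subseteq> linU U V ` std_chars" using linU_linU[OF VU] by (metis image_iff subsetI)
  qed
  then show ?thesis using slash_prodX_uU[OF assms, of std_chars] by (auto simp: std_form_prodX)
qed

text \<open>The scalar by which a unimodular substitution acts is a character, hence trivial on shears,
  which are commutators.\<close>

lemma slash_std_form_shear:
  assumes "i \<noteq> k" shows "slash std_form (shear i k 1) = std_form"
proof -
  obtain j where j: "i \<noteq> j" "j \<noteq> k"
  proof -
    have "\<exists>j. i \<noteq> j \<and> j \<noteq> k"
      using exhaust_3[of i] exhaust_3[of k]
      by (elim disjE) (auto intro: exI[of _ "1::3"] exI[of _ "2::3"] exI[of _ "3::3"])
    then show ?thesis using that by blast
  qed
  have k: "\<exists>\<kappa>. slash std_form (shear a b s) = cscale \<kappa> std_form" if "a \<noteq> b" for a b s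
    unfolding shear_uU using slash_std_form_uU[OF shear_inverse[OF that]] .
  obtain a a' b b' where ab: "slash std_form (shear i j 1) = cscale a std_form" "slash std_form (shear i j (-1)) = cscale a' std_form"
    "slash std_form (shear j k 1) = cscale b std_form" "slash std_form (shear j k (-1)) = cscale b' std_form"
    using k j by metis
  have "slash std_form (shear i j 1 ** shear i j (-1)) = std_form" "slash std_form (shear j k 1 ** shear j k (-1)) = std_form"
    using j by (simp_all add: shear_add shear_zero slash_one std_form_off)
  then have "a * a' = 1" "b * b' = 1"
    using j by (auto intro!: cscale_std_form_cancel simp: slash_mult shear_Sp6 ab slash_scale cscale_cscale mult.commute)
  moreover have "shear i k 1 = shear i j 1 ** shear j k 1 ** shear i j (-1) ** shear j k (-1)"
    using j assms by (auto simp: shear_def mk_mult mk_eq_iff mat_distribs Em_mult) (auto simp: Em_def vec_eq_iff)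
  then have "slash std_form (shear i k 1) = cscale ((a * a') * (b * b')) std_form"
    using j by (simp add: slash_mult Sp6_mult shear_Sp6 ab slash_scale cscale_cscale mult_ac)
  ultimately show ?thesis by simp
qed

lemma slash_inverse:
  assumes "g \<in> Sp6" "k \<in> Sp6" "g ** k = mat 1" "slash h g = h" "\<And>\<tau>. \<tau> \<notin> siegel3 \<Longrightarrow> h \<tau> = 0"
  shows "slash h k = h"
  using slash_mult[OF assms(1,2), of h] slash_one[of h] assms by simp

text \<open>A swap is a product of shears and one flip, and flips are conjugate under swaps. The
  circle is entered at \<open>flip 1\<close>, the square of \<open>jJ 1\<close>: it gives
  \<open>swap 1 i\<close>, hence every flip, hence every swap.\<close>

lemma slash_std_form_swap_flip: "slash std_form (swap i j) = std_form" "slash std_form (flip i) = std_form"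
proof -
  have neg: "slash std_form (shear i j (-1)) = std_form" if "i \<noteq> j" for i j
    by (rule slash_inverse[OF shear_Sp6[OF that] shear_Sp6[OF that] _ slash_std_form_shear[OF that]])
       (use that in \<open>simp_all add: shear_add shear_zero std_form_off\<close>)
  have f1: "slash std_form (flip 1) = std_form"
    unfolding jJ_square[symmetric] slash_mult[OF jJ_Sp6 jJ_Sp6] slash_std_form_J by (rule slash_std_chars_J_J)
  have sw: "slash std_form (swap i j) = std_form" if "slash std_form (flip i) = std_form" for i j
  proof (cases "i = j")
    case True
    have "Pm i i = mat 1" by (auto simp: Pm_def mat_def vec_eq_iff)
    then have "swap i i = mat 1" by (simp only: swap_def mat_mk[symmetric])
    then show ?thesis using True by (simp add: slash_one std_form_off)
  next
    case False
    have "swap i j = shear i j 1 ** shear j i (-1) ** shear i j 1 ** flip i"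
      using exhaust_3[of i] exhaust_3[of j] False
      by (auto simp: swap_def shear_def flip_def mk_mult mk_eq_iff) (simp_all add: small_mats vec_eq_iff forall_3 sum_3)
    then show ?thesis
      using False by (simp add: slash_mult Sp6_mult shear_Sp6 flip_Sp6 slash_std_form_shear neg that)
  qed
  show f: "slash std_form (flip i) = std_form" for i
  proof -
    have "flip i = swap 1 i ** flip 1 ** swap 1 i"
      using exhaust_3[of i]
      by (auto simp: swap_def flip_def mk_mult mk_eq_iff) (simp_all add: small_mats vec_eq_iff forall_3 sum_3)
    then show ?thesis by (simp add: slash_mult Sp6_mult swap_Sp6 flip_Sp6 f1 sw)
  qed
  show "slash std_form (swap i j) = std_form" by (rule sw[OF f])
qed

lemma slash_std_form_Gamma: "\<delta> \<in> Gamma30_2 \<Longrightarrow> slash std_form \<delta> = std_form"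
proof -
  have T: "tS (Em 1 1 s) \<in> Sp6" for s by (rule tS_Sp6) simp
  have T': "slash std_form (tS (Em 1 1 (-1))) = std_form"
    by (rule slash_inverse[OF T T _ slash_std_form_t11]) (simp_all add: tS_add Em_add Em_zero tS_zero std_form_off)
  have Eo0: "prodX std_chars_J \<tau> = 0" if "\<tau> \<notin> siegel3" for \<tau> using that by (simp add: prodX_def)
  \<comment> \<open>Two unit translations restore every characteristic and contribute
    \<open>(-1)^2\<close>, so the double translation fixes the inverted form; between two inversions
    it yields the lower translations by 2.\<close>
  have "affT ` affT ` std_chars_J = std_chars_J" by (simp add: image_image affT_affT)
  then have "slash (prodX std_chars_J) (tS (Em 1 1 1) ** tS (Em 1 1 1)) = prodX std_chars_J"
    by (simp add: slash_mult T slash_prodX_t11 card_affT card_std_chars_J omega_powers slash_minus)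
  then have o2: "slash (prodX std_chars_J) (tS (Em 1 1 2)) = prodX std_chars_J" by (simp add: tS_add Em_add)
  have o2': "slash (prodX std_chars_J) (tS (Em 1 1 (-2))) = prodX std_chars_J"
    by (rule slash_inverse[OF T T _ o2]) (simp_all add: tS_add Em_add Em_zero tS_zero Eo0)
  have l: "slash std_form (lS (Em 1 1 (2 * s))) = std_form" if "s = 1 \<or> s = -1" for s
  proof -
    have "slash (prodX std_chars_J) (tS (Em 1 1 (- (2 * s)))) = prodX std_chars_J" using that o2 o2' by auto
    then show ?thesis
      unfolding lS_jJ[symmetric]
      by (simp add: slash_mult Sp6_mult T jJ_Sp6 flip_Sp6 slash_std_form_J slash_std_chars_J_J slash_std_form_swap_flip)
  qed
  assume "\<delta> \<in> Gamma30_2"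
  then have "\<delta> \<in> Mon 2" by (rule Gamma_Mon)
  then show ?thesis
  proof induction
    case one then show ?case by (simp add: slash_one std_form_off)
  next
    case (t g s)
    then show ?case using T' slash_std_form_t11 Mon_subset by (auto simp: slash_mult T)
  next
    case (l g s)
    moreover have "lS (Em 1 1 (2 * s)) \<in> Sp6" by (rule lS_Sp6) simp
    ultimately show ?case using \<open>\<And>s. s = 1 \<or> s = -1 \<Longrightarrow> slash std_form (lS (Em 1 1 (2 * s))) = std_form\<close> Mon_subset
      by (auto simp: slash_mult)
  next
    case (shear g i j)
    then show ?case using Mon_subset by (auto simp: slash_mult shear_Sp6 slash_std_form_shear)
  next
    case (flip g i)
    then show ?case using Mon_subset by (auto simp: slash_mult flip_Sp6 slash_std_form_swap_flip)
  next
    case (swap g i j)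
    then show ?case using Mon_subset by (auto simp: slash_mult swap_Sp6 slash_std_form_swap_flip)
  qed
qed

text \<open>The three products share the 24 theta constants in \<open>R\<close> and differ in four
  each: \<open>A\<close> for the form itself, \<open>B\<close> after the inversion, \<open>C\<close>
  after inversion and translation, the last with sign -1. Multiplying Riemann's relation for these
  twelve constants by the common factor gives the claim.\<close>

lemma std_form_relation: "slash std_form (jJ j) + slash std_form (jJ j ** tS (Em j j 1)) = - std_form"
proof -
  define R where "R = {m. even_char m \<and> (upper m $ 2 = 1 \<or> upper m $ 3 = 1)}"
  define A where "A = {char_pair (bv 1 0 0) (bv 0 0 0), char_pair (bv 1 0 0) (bv 0 0 1), char_pair (bv 1 0 0) (bv 0 1 0), char_pair (bv 1 0 0) (bv 0 1 1)}"
  define B where "B = {char_pair (bv 0 0 0) (bv 1 0 0), char_pair (bv 0 0 0) (bv 1 0 1), char_pair (bv 0 0 0) (bv 1 1 0), char_pair (bv 0 0 0) (bv 1 1 1)}"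
  define C where "C = {char_pair (bv 0 0 0) (bv 0 0 0), char_pair (bv 0 0 0) (bv 0 0 1), char_pair (bv 0 0 0) (bv 0 1 0), char_pair (bv 0 0 0) (bv 0 1 1)}"
  have ax: "bv a b c + axis 1 1 = bv (a + 1) b c" for a b c by (simp add: vec_eq_iff forall_3 axis_def)
  have "\<forall>m. m \<in> std_chars \<longleftrightarrow> m \<in> R \<union> A" "\<forall>m. m \<in> std_chars_J \<longleftrightarrow> m \<in> R \<union> B"
    "\<forall>m. affT m \<in> std_chars_J \<longleftrightarrow> m \<in> R \<union> C"
    unfolding all_chars all_bit3
    by (simp_all add: std_chars_def std_chars_J_alt R_def A_def B_def C_def even_char_def sp3 bv_zero swapj_bv affT_def ax)
  then have sets: "std_chars = R \<union> A" "std_chars_J = R \<union> B" "affT ` std_chars_J = R \<union> C"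
    unfolding image_involution[OF affT_affT] by blast+
  have disj: "R \<inter> A = {}" "R \<inter> B = {}" "R \<inter> C = {}"
    by (auto simp: R_def A_def B_def C_def)
  have pA: "(\<Prod>m\<in>A. theta_const m \<tau>) = theta (bv 1 0 0) (bv 0 0 0) \<tau> 0 * theta (bv 1 0 0) (bv 0 0 1) \<tau> 0 * (theta (bv 1 0 0) (bv 0 1 0) \<tau> 0 * theta (bv 1 0 0) (bv 0 1 1) \<tau> 0)"
    and pB: "(\<Prod>m\<in>B. theta_const m \<tau>) = theta (bv 0 0 0) (bv 1 0 0) \<tau> 0 * theta (bv 0 0 0) (bv 1 0 1) \<tau> 0 * (theta (bv 0 0 0) (bv 1 1 0) \<tau> 0 * theta (bv 0 0 0) (bv 1 1 1) \<tau> 0)"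
    and pC: "(\<Prod>m\<in>C. theta_const m \<tau>) = theta (bv 0 0 0) (bv 0 0 0) \<tau> 0 * theta (bv 0 0 0) (bv 0 0 1) \<tau> 0 * (theta (bv 0 0 0) (bv 0 1 0) \<tau> 0 * theta (bv 0 0 0) (bv 0 1 1) \<tau> 0)" for \<tau>
    by (simp_all add: A_def B_def C_def theta_const_def mult.assoc)
  have T: "tS (Em i i s) \<in> Sp6" for i s by (rule tS_Sp6) simp
  have J1: "slash std_form (jJ 1) + slash std_form (jJ 1 ** tS (Em 1 1 1)) = - std_form"
  proof
    fix \<tau>
    show "(slash std_form (jJ 1) + slash std_form (jJ 1 ** tS (Em 1 1 1))) \<tau> = (- std_form) \<tau>"
    proof (cases "\<tau> \<in> siegel3")
      case True
      have "prodX (R \<union> Y) \<tau> = (\<Prod>m\<in>R. theta_const m \<tau>) * (\<Prod>m\<in>Y. theta_const m \<tau>)" if "R \<inter> Y = {}" for Y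
        using True that by (simp add: prodX_def prod.union_disjoint)
      then have p: "prodX std_chars \<tau> = (\<Prod>m\<in>R. theta_const m \<tau>) * (\<Prod>m\<in>A. theta_const m \<tau>)"
        "prodX std_chars_J \<tau> = (\<Prod>m\<in>R. theta_const m \<tau>) * (\<Prod>m\<in>B. theta_const m \<tau>)"
        "prodX (affT ` std_chars_J) \<tau> = (\<Prod>m\<in>R. theta_const m \<tau>) * (\<Prod>m\<in>C. theta_const m \<tau>)"
        using disj by (simp_all only: sets(1)) (simp_all only: sets(2) sets(3)[unfolded sets(2)])
      have "(\<Prod>m\<in>C. theta_const m \<tau>) - (\<Prod>m\<in>B. theta_const m \<tau>) = (\<Prod>m\<in>A. theta_const m \<tau>)"
        unfolding pA pB pC by (rule riemann_quartic[OF True])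
      then have "prodX std_chars_J \<tau> - prodX (affT ` std_chars_J) \<tau> = - prodX std_chars \<tau>"
        unfolding p by (metis (no_types) minus_diff_eq right_diff_distrib')
      then show ?thesis
        by (simp add: slash_mult T jJ_Sp6 slash_std_form_J slash_prodX_t11 card_std_chars_J omega_powers) (simp add: cscale_def std_form_prodX)
    qed (simp add: slash_def std_form_off)
  qed
  have s: "swap 1 j \<in> Sp6" by (rule swap_Sp6)
  have e: "jJ j ** tS (Em j j 1) = swap 1 j ** (jJ 1 ** tS (Em 1 1 1)) ** swap 1 j"
  proof -
    have "jJ j ** tS (Em j j 1) = swap 1 j ** jJ 1 ** (swap 1 j ** swap 1 j) ** tS (Em 1 1 1) ** swap 1 j"
      unfolding jJ_swap[of j, symmetric] tS_swap[of j 1, symmetric] by (simp only: matrix_mul_assoc)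
    then show ?thesis by (simp add: swap_square matrix_mul_assoc)
  qed
  have "slash std_form (jJ j) = slash (slash std_form (jJ 1)) (swap 1 j)"
    unfolding jJ_swap[of j, symmetric] by (simp add: slash_mult Sp6_mult s jJ_Sp6 slash_std_form_swap_flip)
  moreover have "slash std_form (jJ j ** tS (Em j j 1)) = slash (slash std_form (jJ 1 ** tS (Em 1 1 1))) (swap 1 j)"
    unfolding e by (simp add: slash_mult[of "swap 1 j ** (jJ 1 ** tS (Em 1 1 1))"] slash_mult[of "swap 1 j"] Sp6_mult s jJ_Sp6 T slash_std_form_swap_flip)
  ultimately have "slash std_form (jJ j) + slash std_form (jJ j ** tS (Em j j 1)) = slash (cscale (-1) std_form) (swap 1 j)"
    using J1 by (simp add: slash_add[symmetric])
  also have "\<dots> = - std_form" by (simp add: slash_minus slash_std_form_swap_flip)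
  finally show ?thesis .
qed

section \<open>Reduction of isotropic sets\<close>

definition pairing :: "bit^(3 + 3) \<Rightarrow> bit^(3 + 3) \<Rightarrow> bit"
  where "pairing m n = sp (upper m) (lower n) + sp (lower m) (upper n)"

lemma pairing_linU: "U ** V = mat 1 \<Longrightarrow> pairing (linU U V m) (linU U V n) = pairing m n"
proof -
  assume UV: "U ** V = mat 1"
  have "sp (transpose (redm U) *v a) (redm V *v b) = sp a b" for a b
    by (simp add: scalar_product_matrix_left matrix_vector_mul_assoc redm_inverse[OF UV] del: transpose_matrix_vector)
  then show ?thesis
    by (simp add: pairing_def linU_def scalar_product_commute[of "redm V *v _"] scalar_product_commute[of "lower m"] del: transpose_matrix_vector)
qed

lemma pairing_linT:
  assumes "transpose S = S" shows "pairing (linT S m) (linT S n) = pairing m n"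
proof -
  have "sp (redm S *v a) b = sp a (redm S *v b)" for a b
    using assms by (simp add: scalar_product_matrix_left redm_transpose[symmetric] del: transpose_matrix_vector)
  moreover have "x + y + (z + y) = x + z" for x y z :: bit
    using bit_cases01[of x] bit_cases01[of y] bit_cases01[of z] by auto
  ultimately show ?thesis
    by (simp add: pairing_def linT_def scalar_product_add_left scalar_product_add_right)
qed

lemma pairing_linJ: "pairing (linJ j m) (linJ j n) = pairing m n"
proof -
  have s: "pairing m n = (\<Sum>i\<in>UNIV. upper m $ i * lower n $ i + lower m $ i * upper n $ i)" for m n
    by (simp only: pairing_def scalar_product_def sum.distrib)
  show ?thesis unfolding s by (rule sum.cong) (auto simp: linJ_def swapj_def add.commute)
qed

text \<open>The substitution makes \<open>e_j\<close> the upper half of \<open>m0\<close>, the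
  translation clears its lower half outside \<open>I\<close>, and the inversion exchanges the
  \<open>j\<close>-th entries. Isotropy against this image forces the \<open>j\<close>-th upper
  entry of every element of \<open>X\<close> to vanish. The matrices are trivial in the rows and
  columns of \<open>I\<close>, which keeps earlier zeros. Both Fano configurations and rows of
  symplectic matrices are reduced in this way; for the former, evenness of \<open>m0\<close> makes
  the diagonal of \<open>S\<close> even.\<close>

lemma tower_step:
  assumes iso: "\<And>m n. m \<in> X \<Longrightarrow> n \<in> X \<Longrightarrow> pairing m n = 0"
    and I: "\<And>m i. m \<in> X \<Longrightarrow> i \<in> I \<Longrightarrow> upper m $ i = 0" "j \<notin> I"
    and m0: "m0 \<in> X" "upper m0 $ j = 1"
  obtains U V S where "U ** V = mat 1" "transpose S = S" "\<And>i. i \<noteq> j \<Longrightarrow> S $ i $ i = 0"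
    "S $ j $ j = (if sp (upper m0) (lower m0) = 0 then 0 else 1)"
    "\<And>i k. i \<in> I \<Longrightarrow> U $ i $ k = mat 1 $ i $ k \<and> U $ k $ i = mat 1 $ k $ i"
    "\<And>i k. i \<in> I \<Longrightarrow> V $ i $ k = mat 1 $ i $ k \<and> V $ k $ i = mat 1 $ k $ i"
    "\<And>i k. i \<in> I \<Longrightarrow> S $ i $ k = 0 \<and> S $ k $ i = 0"
    "\<And>m i. m \<in> X \<Longrightarrow> i \<in> insert j I \<Longrightarrow> upper (linJ j (linT S (linU U V m))) $ i = 0"
proof -
  define a where "a = upper m0"
  have aj: "a $ j = 1" and aI: "a $ i = 0" if "i \<in> I" for i using m0 I that by (auto simp: a_def)
  have aj: "a $ j = 1" using m0 by (simp add: a_def)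
  \<comment> \<open>Modulo 2 the transpose of \<open>1 + N\<close> adds \<open>a_k\<close> times the
    \<open>j\<close>-th entry to the \<open>k\<close>-th, which cancels \<open>a_k\<close> because
    \<open>a_j\<close> is 1. As \<open>N\<close> has square zero, \<open>1 - N\<close> is the
    inverse.\<close>
  define N :: "int^3^3" where "N = (\<chi> r k. if r = j \<and> k \<noteq> j then lift a $ k else 0)"
  define U where "U = mat 1 + N"
  define V where "V = mat 1 - N"
  have "(\<Sum>s\<in>UNIV. N $ r $ s * N $ s $ k) = 0" for r k by (rule sum.neutral) (simp add: N_def)
  then have NN: "N ** N = 0" by (simp add: matrix_matrix_mult_def vec_eq_iff)
  have UV: "U ** V = mat 1" by (simp add: U_def V_def mat_distribs NN)
  have rU: "redm U $ r $ k = (if r = k then 1 else if r = j then a $ k else 0)"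
    and rV: "redm V $ r $ k = (if r = k then 1 else if r = j then a $ k else 0)" for r k
    using bit_cases01[of "a $ k"] by (auto simp: redm_def U_def V_def N_def mat_def lift_def)
  have up: "upper (linU U V m) $ k = upper m $ k + (if k = j then 0 else a $ k * upper m $ j)" for m k
    using exhaust_3[of j] exhaust_3[of k] bit_cases01[of "a $ k"] bit_cases01[of "upper m $ j"]
    by (elim disjE; simp add: linU_def mv3 transpose_def rU del: transpose_matrix_vector)
  define b where "b = lower (linU U V m0)"
  have bj: "b $ j = sp a (lower m0)"
    using exhaust_3[of j] aj by (elim disjE; simp add: b_def linU_def mv3 rV sp3 add_ac)
  have up0: "upper (linU U V m0) = axis j 1"
    using aj by (auto simp: vec_eq_iff up axis_def simp flip: a_def)
  define S :: "int^3^3" where "S = (\<chi> r k. if r = j \<and> (k = j \<or> k \<notin> I) then lift b $ k else if k = j \<and> r \<notin> I then lift b $ r else 0)"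
  have S: "transpose S = S" by (auto simp: S_def transpose_def vec_eq_iff)
  have rS: "redm S $ k $ j = (if k \<in> I then 0 else b $ k)" for k
    using I(2) bit_cases01[of "b $ k"] by (auto simp: redm_def S_def lift_def)
  have low0: "lower (linT S (linU U V m0)) $ k = (if k \<in> I then b $ k else 0)" for k
    by (simp add: linT_def up0 mv_axis rS flip: b_def)
  define t where "t = (\<lambda>m. linJ j (linT S (linU U V m)))"
  have t_up: "upper (t m) $ i = upper (linU U V m) $ i" if "i \<noteq> j" for m i
    using that by (simp add: t_def linJ_def swapj_def linT_def)
  have t0_up: "upper (t m0) = 0"
    using I(2) by (auto simp: t_def linJ_def swapj_def low0 vec_eq_iff) (simp add: linT_def up0 axis_def)
  have t0_low: "lower (t m0) $ i = (if i = j then 1 else if i \<in> I then b $ i else 0)" for i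
    by (auto simp: t_def linJ_def swapj_def low0) (simp add: linT_def up0 axis_def)
  have tI: "upper (t m) $ i = 0" if "m \<in> X" "i \<in> I" for m i
  proof -
    have "i \<noteq> j" using that I(2) by auto
    then show ?thesis using that I(1) aI by (simp add: t_up up)
  qed
  \<comment> \<open>\<open>t m0\<close> has upper half zero, and its lower half is
    \<open>e_j\<close> outside \<open>I\<close>, where alone \<open>t m\<close> can have nonzero
    upper entries; their pairing is therefore the entry in question.\<close>
  have tj: "upper (t m) $ j = 0" if m: "m \<in> X" for m
  proof -
    have "0 = pairing (t m) (t m0)" using iso[OF m m0(1)] by (simp add: t_def pairing_linJ pairing_linT[OF S] pairing_linU[OF UV])
    also have "\<dots> = sp (upper (t m)) (lower (t m0))" by (simp add: pairing_def t0_up) (simp add: sp3)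
    also have "\<dots> = (\<Sum>i\<in>UNIV. if i = j then upper (t m) $ j else 0)"
      unfolding scalar_product_def by (rule sum.cong) (auto simp: t0_low tI[OF m])
    finally show ?thesis by simp
  qed
  have lb: "lift b $ j = (if sp (upper m0) (lower m0) = 0 then 0 else 1)"
    using bj bit_cases01[of "b $ j"] by (auto simp: lift_def a_def)
  show ?thesis
  proof (rule that[OF UV S])
    show "S $ i $ i = 0" if "i \<noteq> j" for i using that by (simp add: S_def)
    show "S $ j $ j = (if sp (upper m0) (lower m0) = 0 then 0 else 1)" using lb by (simp add: S_def)
    show "U $ i $ k = mat 1 $ i $ k \<and> U $ k $ i = mat 1 $ k $ i" if "i \<in> I" for i k
      using that I(2) aI[OF that] by (auto simp: U_def N_def lift_def)
    show "V $ i $ k = mat 1 $ i $ k \<and> V $ k $ i = mat 1 $ k $ i" if "i \<in> I" for i k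
      using that I(2) aI[OF that] by (auto simp: V_def N_def lift_def)
    show "S $ i $ k = 0 \<and> S $ k $ i = 0" if "i \<in> I" for i k
      using that I(2) by (auto simp: S_def)
    show "upper (linJ j (linT S (linU U V m))) $ i = 0" if "m \<in> X" "i \<in> insert j I" for m i
      using tI tj that by (auto simp: t_def)
  qed
qed

subsection \<open>Fano configurations\<close>

text \<open>Isotropy follows by polarisation: the parity of \<open>m + n\<close> differs from the
  sum of the parities of \<open>m\<close> and \<open>n\<close> by their pairing.\<close>

lemma fano_iff: "fano F \<longleftrightarrow> vec.subspace F \<and> vec.dim F = 3 \<and> (\<forall>m\<in>F. even_char m)"
proof -
  have "sp (upper m) (lower n) - sp (lower m) (upper n) = 0"
    if F: "vec.subspace F" "\<forall>m\<in>F. even_char m" "m \<in> F" "n \<in> F" for m n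
  proof -
    have add: "upper (m + n) = upper m + upper n" "lower (m + n) = lower m + lower n"
      by (simp_all add: upper_def lower_def vec_eq_iff)
    have "even_char (m + n)" using F vec.subspace_add by blast
    moreover have "even_char m" "even_char n" using F by auto
    ultimately have "sp (upper m) (lower n) + sp (upper n) (lower m) = 0"
      by (simp add: even_char_def add scalar_product_add_left scalar_product_add_right)
    then have "sp (upper m) (lower n) = sp (lower m) (upper n)"
      unfolding scalar_product_commute[of "upper n"]
      using bit_cases01[of "sp (upper m) (lower n)"] bit_cases01[of "sp (lower m) (upper n)"] by auto
    then show ?thesis by simp
  qed
  then show ?thesis unfolding fano_def by blast
qed

lemma additive_linear:
  fixes f :: "bit^'n \<Rightarrow> bit^'m"
  assumes add: "\<And>m n. f (m + n) = f m + f n"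
  shows "f (c *s m) = c *s f m" "Vector_Spaces.linear (*s) (*s) f"
proof -
  have "f 0 + f 0 = f 0 + 0" using add[of 0 0] by simp
  then have "f 0 = 0" by (rule add_left_imp_eq)
  then show s: "f (c *s m) = c *s f m" for c m using bit_cases01[of c] by auto
  show "Vector_Spaces.linear (*s) (*s) f"
    unfolding Vector_Spaces.linear_iff by (auto simp: add s intro: vec.vector_space_axioms)
qed

lemma fano_image:
  assumes add: "\<And>m n. f (m + n) = f m + f n" and "inj f" "\<And>m. even_char m \<Longrightarrow> even_char (f m)" "fano F"
  shows "fano (f ` F)"
proof -
  note lin = additive_linear[of f, OF add]
  have F: "vec.subspace F" "vec.dim F = 3" "\<forall>m\<in>F. even_char m" using assms(4) by (auto simp: fano_iff)
  have "vec.dim (f ` F) = vec.dim F"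
    using assms(2) by (intro vec.dim_image_eq[OF lin(2)]) (auto intro: inj_on_subset)
  moreover have "vec.subspace (f ` F)"
  proof -
    have "f 0 = 0" using lin(1)[of 0 0] by simp
    then have "0 \<in> f ` F" using F(1) by (metis imageI vec.subspace_0)
    moreover have "f m + f n \<in> f ` F" "c *s f m \<in> f ` F" if "m \<in> F" "n \<in> F" for m n c
      unfolding add[symmetric] lin(1)[symmetric] using that F(1) vec.subspace_add vec.subspace_scale by blast+
    ultimately show ?thesis unfolding vec.subspace_def by auto
  qed
  ultimately show ?thesis using F assms(3) by (simp add: fano_iff)
qed

lemma char_pair_add: "char_pair a b + char_pair c d = char_pair (a + c) (b + d)"
  by (rule char_eqI) (simp_all add: upper_def lower_def char_pair_def vec_eq_iff)

lemma upper_add: "upper (m + n) = upper m + upper n" and lower_add: "lower (m + n) = lower m + lower n"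
  by (simp_all add: upper_def lower_def vec_eq_iff)

lemma lin_add: "linU U V (m + n) = linU U V m + linU U V n" "linT S (m + n) = linT S m + linT S n"
  "linJ j (m + n) = linJ j m + linJ j n"
proof -
  have "swapj j (a + b) (c + d) = swapj j a c + swapj j b d" for a b c d
    by (simp add: swapj_def vec_eq_iff)
  then show "linJ j (m + n) = linJ j m + linJ j n" by (simp add: linJ_def char_pair_add upper_add lower_add)
qed (simp_all add: linU_def linT_def char_pair_add upper_add lower_add matrix_vector_right_distrib add_ac del: transpose_matrix_vector)

lemma fano_linU: "U ** V = mat 1 \<Longrightarrow> fano F \<Longrightarrow> fano (linU U V ` F)"
  by (rule fano_image) (auto simp: lin_add inj_linU even_linU)

lemma fano_linT: "transpose S = S \<Longrightarrow> (\<And>i. even (S $ i $ i)) \<Longrightarrow> fano F \<Longrightarrow> fano (linT S ` F)"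
  by (rule fano_image) (auto simp: lin_add inj_linT even_linT)

lemma fano_linJ: "fano F \<Longrightarrow> fano (linJ j ` F)"
  by (rule fano_image) (auto simp: lin_add inj_linJ even_linJ)

lemma fano1_range: "fano1 = range (char_pair 0)"
proof -
  have "m \<in> range (char_pair 0)" if "upper m = 0" for m using char_pair_eta[of m] that by (metis rangeI)
  then show ?thesis by (auto simp: fano1_def)
qed

lemma fano_fano1: "fano fano1"
proof -
  have add: "char_pair 0 (m + n) = char_pair 0 m + char_pair 0 n" for m n by (simp add: char_pair_add)
  note lin = additive_linear[of "char_pair 0", OF add]
  have "vec.dim fano1 = vec.dim (UNIV :: (bit^3) set)"
    unfolding fano1_range by (rule vec.dim_image_eq[OF lin(2)]) (simp add: inj_on_def)
  then have "vec.dim fano1 = 3" by (simp only: vec_dim_card) simp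
  moreover have "vec.subspace fano1"
  proof -
    have "upper 0 = (0 :: bit^3)" "upper (c *s m) = c *s upper m" for c :: bit and m by (simp_all add: upper_def vec_eq_iff)
    then show ?thesis by (simp add: vec.subspace_def fano1_def upper_add)
  qed
  ultimately show ?thesis by (simp add: fano_iff) (simp add: fano1_def even_char_def sp3)
qed

section \<open>Connecting all Fano configurations with the standard one\<close>

text \<open>Translations are limited to even diagonals, since the others act affinely on
  characteristics.\<close>

inductive reach :: "(bit^(3 + 3)) set \<Rightarrow> bool" where
  base: "reach fano1"
| U: "U ** V = mat 1 \<Longrightarrow> reach (linU U V ` F) \<Longrightarrow> reach F"
| T: "transpose S = S \<Longrightarrow> (\<And>i. even (S $ i $ i)) \<Longrightarrow> reach (linT S ` F) \<Longrightarrow> reach F"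
| J: "reach (linJ j ` F) \<Longrightarrow> reach F"

lemma reach_fano: "fano F \<Longrightarrow> reach F"
proof -
  have step: "reach F" if F: "fano F" and Z: "\<forall>m\<in>F. \<forall>i\<in>I. upper m $ i = 0" and j: "j \<notin> I"
    and IH: "\<And>F. fano F \<Longrightarrow> (\<forall>m\<in>F. \<forall>i\<in>insert j I. upper m $ i = 0) \<Longrightarrow> reach F" for F I j
  proof (cases "\<forall>m\<in>F. upper m $ j = 0")
    case True
    then show ?thesis using F Z IH by auto
  next
    case False
    then obtain m0 where m0: "m0 \<in> F" "upper m0 $ j = 1" using bit_cases01 by metis
    have "sp (upper m) (lower n) = sp (lower m) (upper n)" if "m \<in> F" "n \<in> F" for m n
      using \<open>fano F\<close> that unfolding fano_def by (metis eq_iff_diff_eq_0)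
    then have iso: "pairing m n = 0" if "m \<in> F" "n \<in> F" for m n using that by (simp add: pairing_def)
    have ev: "sp (upper m0) (lower m0) = 0" using F m0(1) by (simp add: fano_iff even_char_def)
    obtain U V S where U: "U ** V = mat 1" "transpose S = S" "\<And>i. i \<noteq> j \<Longrightarrow> S $ i $ i = 0"
      "S $ j $ j = (if sp (upper m0) (lower m0) = 0 then 0 else 1)"
      "\<And>m i. m \<in> F \<Longrightarrow> i \<in> insert j I \<Longrightarrow> upper (linJ j (linT S (linU U V m))) $ i = 0"
      by (rule tower_step[of F I j m0]) (use iso Z j m0 in auto)
    have S: "even (S $ i $ i)" for i using U(3,4) ev by (cases "i = j") auto
    have "reach (linJ j ` linT S ` linU U V ` F)"
      by (rule IH) (use U S F in \<open>auto intro!: fano_linJ fano_linT fano_linU\<close>)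
    then show ?thesis using reach.J reach.T[OF U(2) S] reach.U[OF U(1)] by blast
  qed
  have full: "reach F" if "fano F" "\<forall>m\<in>F. \<forall>i\<in>{1, 2, 3}. upper m $ i = 0" for F
  proof -
    have "F \<subseteq> fano1" using that(2) by (auto simp: fano1_def vec_eq_iff forall_3)
    then have "F = fano1"
      using that(1) fano_fano1 by (intro vec.subspace_dim_equal) (auto simp: fano_iff)
    then show ?thesis by (simp add: reach.base)
  qed
  have 1: "reach F" if "fano F" "\<forall>m\<in>F. \<forall>i\<in>{1, 2}. upper m $ i = 0" for F
    by (rule step[OF that, of 3]) (use full in \<open>auto simp: insert_commute\<close>)
  have 2: "reach F" if "fano F" "\<forall>m\<in>F. \<forall>i\<in>{1}. upper m $ i = 0" for F
    by (rule step[OF that, of 2]) (use 1 in \<open>auto simp: insert_commute\<close>)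
  show "fano F \<Longrightarrow> reach F"
    by (rule step[of F "{}" 1]) (use 2 in auto)
qed

section \<open>The span of the orbit of the standard form\<close>

definition orbit_span :: "(complex^3^3 \<Rightarrow> complex) set"
  where "orbit_span = cfun.span {slash std_form \<gamma> | \<gamma>. \<gamma> \<in> Sp6}"

lemma slash_span:
  assumes "h \<in> cfun.span B" "\<And>b. b \<in> B \<Longrightarrow> slash b g \<in> cfun.span B'"
  shows "slash h g \<in> cfun.span B'"
proof -
  have "cfun.subspace {h. slash h g \<in> cfun.span B'}"
    unfolding cfun.subspace_def
    by (auto simp: slash_zero slash_add slash_scale cfun.span_zero cfun.span_add cfun.span_scale)
  from cfun.span_induct[OF assms(1) this] assms(2) show ?thesis by auto
qed

lemma orbit_span_slash: "h \<in> orbit_span \<Longrightarrow> g \<in> Sp6 \<Longrightarrow> slash h g \<in> orbit_span"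
  unfolding orbit_span_def
  by (rule slash_span, assumption) (force intro: cfun.span_base Sp6_mult simp flip: slash_mult)

lemma orbit_span_off: "h \<in> orbit_span \<Longrightarrow> \<tau> \<notin> siegel3 \<Longrightarrow> h \<tau> = 0"
proof -
  assume t: "\<tau> \<notin> siegel3" and h: "h \<in> orbit_span"
  have "cfun.subspace {h. h \<tau> = 0}" by (auto simp: cfun.subspace_def cscale_def)
  then show ?thesis
  proof (rule cfun.span_induct[OF h[unfolded orbit_span_def], of "\<lambda>h. h \<tau> = 0"])
    fix x assume "x \<in> {slash std_form \<gamma> |\<gamma>. \<gamma> \<in> Sp6}"
    then show "x \<tau> = 0" using t by (auto simp: slash_def)
  qed
qed

lemma slash_formH:
  assumes "card F = 8" "F \<subseteq> {m. even_char m}"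
  shows "U ** V = mat 1 \<Longrightarrow> \<exists>\<kappa>. \<kappa> \<noteq> 0 \<and> slash (formH F) (uU U V) = cscale \<kappa> (formH (linU U V ` F))"
    "transpose S = S \<Longrightarrow> (\<And>i. even (S $ i $ i)) \<Longrightarrow> \<exists>\<kappa>. \<kappa> \<noteq> 0 \<and> slash (formH F) (tS S) = cscale \<kappa> (formH (linT S ` F))"
    "\<exists>\<kappa>. \<kappa> \<noteq> 0 \<and> slash (formH F) (jJ j) = cscale \<kappa> (formH (linJ j ` F))"
proof -
  have img: "f ` ({m. even_char m} - F) = {m. even_char m} - f ` F"
    if inj: "inj f" and ev: "\<And>m. even_char (f m) \<longleftrightarrow> even_char m" and sj: "surj f" for f
  proof -
    have "f ` {m. even_char m} = {m. even_char m}"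
    proof (intro equalityI subsetI)
      fix m assume "m \<in> {m. even_char m}"
      moreover obtain m' where "m = f m'" using sj by (metis surjD)
      ultimately show "m \<in> f ` {m. even_char m}" using ev by auto
    qed (use ev in auto)
    then show ?thesis by (simp add: image_set_diff[OF inj])
  qed
  show "\<exists>\<kappa>. \<kappa> \<noteq> 0 \<and> slash (formH F) (uU U V) = cscale \<kappa> (formH (linU U V ` F))" if UV: "U ** V = mat 1"
    using slash_prodX_uU[OF UV, of "{m. even_char m} - F"] linU_linU[OF int_matrix_left_right_inverse[OF UV]]
    unfolding formH_prodX by (subst img[symmetric]) (auto simp: inj_linU[OF UV] even_linU[OF UV] intro!: surjI)
  show "\<exists>\<kappa>. \<kappa> \<noteq> 0 \<and> slash (formH F) (tS S) = cscale \<kappa> (formH (linT S ` F))"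
    if S: "transpose S = S" "\<And>i. even (S $ i $ i)"
    using slash_prodX_tS[OF S, of "{m. even_char m} - F"]
    unfolding formH_prodX by (subst img[symmetric]) (auto simp: inj_linT even_linT[OF S] intro!: surjI linT_linT)
  have "card {m. even_char m} = 36"
    using card_chars[of "\<lambda>a b. sp a b = 0"] by (simp add: even_char_def sum_bit3 sp3)
  then have c28: "card ({m. even_char m} - F) = 28" using assms by (simp add: card_Diff_subset)
  have eq: "linJ j ` ({m. even_char m} - F) = {m. even_char m} - linJ j ` F"
    by (rule img) (auto simp: inj_linJ even_linJ intro!: surjI linJ_linJ)
  obtain n where n: "slash (formH F) (jJ j) = cscale (- ((- \<i>) ^ n)) (formH (linJ j ` F))"
    unfolding formH_prodX eq[symmetric] using slash_prodX_jJ[OF c28] by blast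
  have "- ((- \<i>) ^ n) \<noteq> 0" by simp
  with n show "\<exists>\<kappa>. \<kappa> \<noteq> 0 \<and> slash (formH F) (jJ j) = cscale \<kappa> (formH (linJ j ` F))"
    by blast
qed

lemma card_fano1: "card fano1 = 8"
proof -
  have "card fano1 = card (UNIV :: (bit^3) set)"
    unfolding fano1_range by (rule card_image) (simp add: inj_on_def)
  then show ?thesis by (simp add: UNIV_bit3)
qed

text \<open>The chain of generators leading to \<open>fano1\<close> is run backwards: if
  \<open>H(F)|g\<close> lies in the span, applying the inverse of \<open>g\<close> puts
  \<open>H(F)\<close> there. Cardinality 8 is carried along because the inversion formula is for
  exactly 28 factors.\<close>

lemma reach_orbit_span:
  assumes "reach F"
  shows "card F = 8 \<and> F \<subseteq> {m. even_char m} \<and> formH F \<in> orbit_span"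
proof -
  have card: "card F = card (f ` F)" if "inj f" for f :: "bit^(3 + 3) \<Rightarrow> bit^(3 + 3)" and F
    using that by (metis card_image inj_on_subset subset_UNIV)
  have pull: "formH F \<in> orbit_span" if ex: "\<exists>\<kappa>. \<kappa> \<noteq> 0 \<and> slash (formH F) g = cscale \<kappa> (formH F')" and F': "formH F' \<in> orbit_span" and g: "g \<in> Sp6" for F F' g
  proof -
    obtain \<kappa> where "slash (formH F) g = cscale \<kappa> (formH F')" using ex by blast
    then have "slash (formH F) g \<in> orbit_span" using F' unfolding orbit_span_def by (simp add: cfun.span_scale)
    then have "slash (slash (formH F) g) (sp_inv g) \<in> orbit_span" using sp_inv_Sp6[OF g] by (rule orbit_span_slash)
    moreover have "slash (slash (formH F) g) (sp_inv g) = formH F"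
      using g by (simp add: slash_mult[symmetric] sp_inv_Sp6 sp_inv_right slash_one formH_def)
    ultimately show ?thesis by simp
  qed
  show ?thesis using assms
  proof induction
    case base
    have "std_form = slash std_form (mat 1)" by (rule slash_one[symmetric]) (rule std_form_off)
    then have "std_form \<in> {slash std_form \<gamma> | \<gamma>. \<gamma> \<in> Sp6}" using Sp6_one by blast
    then have "std_form \<in> orbit_span" unfolding orbit_span_def by (rule cfun.span_base)
    then show ?case by (simp add: card_fano1) (auto simp: fano1_def even_char_def sp3)
  next
    case (U U V F)
    then have "card F = 8" "F \<subseteq> {m. even_char m}"
      using card[OF inj_linU[OF U(1)], of F] even_linU[OF U(1)] by auto
    then show ?case using pull[OF slash_formH(1)] U uU_Sp6 by blast
  next
    case (T S F)
    then have F: "card F = 8" "F \<subseteq> {m. even_char m}"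
      using card[OF inj_linT[of S], of F] even_linT[OF T(1,2)] by auto
    then show ?case using pull[OF slash_formH(2)[OF F T(1,2)]] T(1,4) tS_Sp6 by blast
  next
    case (J j F)
    then have "card F = 8" "F \<subseteq> {m. even_char m}"
      using card[OF inj_linJ[of j], of F] even_linJ by auto
    then show ?case using pull[OF slash_formH(3)] J jJ_Sp6 by blast
  qed
qed

lemma spaceW_orbit_span: "h \<in> spaceW \<Longrightarrow> h \<in> orbit_span"
proof -
  have "spaceW \<subseteq> cfun.span orbit_span"
    unfolding spaceW_def by (rule cfun.span_mono) (use reach_fano reach_orbit_span in auto)
  then show "h \<in> spaceW \<Longrightarrow> h \<in> orbit_span" by (auto simp: orbit_span_def cfun.span_span)
qed

text \<open>A translation with odd diagonal can take a single \<open>H(F)\<close> out of the family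
  of these forms; such translations are handled in \<open>good_word_step\<close> through the
  three-term relation.\<close>

lemma spaceW_slash:
  assumes "h \<in> spaceW"
  shows "U ** V = mat 1 \<Longrightarrow> slash h (uU U V) \<in> spaceW"
    "transpose S = S \<Longrightarrow> (\<And>i. even (S $ i $ i)) \<Longrightarrow> slash h (tS S) \<in> spaceW"
    "slash h (jJ j) \<in> spaceW"
proof -
  have F: "card F = 8" "F \<subseteq> {m. even_char m}" if "fano F" for F
    using reach_orbit_span[OF reach_fano[OF that]] by auto
  have gen: "slash h g \<in> spaceW" if g: "\<And>F. fano F \<Longrightarrow> \<exists>\<kappa> F'. fano F' \<and> slash (formH F) g = cscale \<kappa> (formH F')" for g
    using assms unfolding spaceW_def
  proof (rule slash_span)
    fix b assume "b \<in> formH ` {F. fano F}"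
    then obtain \<kappa> F' where F': "fano F'" "slash b g = cscale \<kappa> (formH F')" using g by blast
    then show "slash b g \<in> cfun.span (formH ` {F. fano F})" by (auto intro: cfun.span_scale cfun.span_base)
  qed
  show "slash h (uU U V) \<in> spaceW" if "U ** V = mat 1"
    by (rule gen) (use slash_formH(1)[OF F that] fano_linU[OF that] in blast)
  show "slash h (tS S) \<in> spaceW" if S: "transpose S = S" "\<And>i. even (S $ i $ i)"
    by (rule gen) (use slash_formH(2)[OF F S] fano_linT[OF S] in blast)
  show "slash h (jJ j) \<in> spaceW"
    by (rule gen) (use slash_formH(3)[OF F] fano_linJ in blast)
qed

section \<open>The orbit of the standard form\<close>

text \<open>Modulo \<open>translation_span\<close>, which is killed by averaging over translations, every \<open>slash std_form \<gamma>\<close> becomes a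
  multiple of \<open>std_form\<close>.\<close>

definition translation_span :: "(complex^3^3 \<Rightarrow> complex) set"
  where "translation_span = cfun.span {slash h (tS S) - h | h S. h \<in> orbit_span \<and> transpose S = S}"

lemma translation_span_diff: "h \<in> orbit_span \<Longrightarrow> transpose S = S \<Longrightarrow> slash h (tS S) - h \<in> translation_span"
  unfolding translation_span_def by (rule cfun.span_base) blast

lemma translation_span_add: "h \<in> translation_span \<Longrightarrow> k \<in> translation_span \<Longrightarrow> h + k \<in> translation_span" and translation_span_scale: "h \<in> translation_span \<Longrightarrow> cscale c h \<in> translation_span"
  and translation_span_zero: "0 \<in> translation_span"
  unfolding translation_span_def by (auto intro: cfun.span_add cfun.span_scale cfun.span_zero)

lemma uU_Gamma: "U ** V = mat 1 \<Longrightarrow> uU U V \<in> Gamma30_2"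
  using uU_Sp6[of U V] by (simp add: Gamma30_2_def) (simp add: uU_def)

lemma tS_Gamma: "transpose S = S \<Longrightarrow> tS S \<in> Gamma30_2"
  using tS_Sp6[of S] by (simp add: Gamma30_2_def) (simp add: tS_def)

text \<open>Unimodular substitutions normalise the translations, so a translation difference goes to
  another one, with \<open>S\<close> replaced by \<open>V S V^t\<close>.\<close>

lemma translation_span_slash_uU:
  assumes "h \<in> translation_span" and UV: "U ** V = mat 1"
  shows "slash h (uU U V) \<in> translation_span"
  using assms(1) unfolding translation_span_def
proof (rule slash_span)
  fix b assume "b \<in> {slash h (tS S) - h | h S. h \<in> orbit_span \<and> transpose S = S}"
  then obtain h S where b: "b = slash h (tS S) - h" and h: "h \<in> orbit_span" "transpose S = S" by blast
  define S' where "S' = V ** S ** transpose V"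
  have S': "transpose S' = S'" using h(2) by (simp add: S'_def matrix_transpose_mul matrix_mul_assoc)
  have "U ** S' = U ** V ** S ** transpose V" by (simp only: S'_def matrix_mul_assoc)
  then have "U ** S' = S ** transpose V" using UV by simp
  then have "tS S ** uU U V = uU U V ** tS S'"
    by (simp add: tS_def uU_def mk_mult mk_eq_iff)
  then have "slash (slash h (tS S)) (uU U V) = slash (slash h (uU U V)) (tS S')"
    using slash_mult[of "tS S" "uU U V"] slash_mult[of "uU U V" "tS S'"] tS_Sp6 uU_Sp6[OF UV] h(2) S' by metis
  then show "slash b (uU U V) \<in> cfun.span {slash h (tS S) - h | h S. h \<in> orbit_span \<and> transpose S = S}"
    using translation_span_diff[OF orbit_span_slash[OF h(1) uU_Sp6[OF UV]] S'] by (simp add: b slash_diff translation_span_def)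
qed

lemma spaceW_add: "h \<in> spaceW \<Longrightarrow> k \<in> spaceW \<Longrightarrow> h + k \<in> spaceW"
  and spaceW_scale: "h \<in> spaceW \<Longrightarrow> cscale c h \<in> spaceW"
  unfolding spaceW_def by (auto intro: cfun.span_add cfun.span_scale)

lemma std_form_spaceW: "std_form \<in> spaceW"
  unfolding spaceW_def using fano_fano1 by (intro cfun.span_base) auto

text \<open>One real number describes both sides: the residue of the form modulo translation
  differences and the value of the quartic at \<open>ind {0}\<close>. Membership in
  \<open>spaceW\<close> is part of the induction because \<open>spaceW_slash\<close> does not cover
  odd translations.\<close>

definition good_word :: "int^(3 + 3)^(3 + 3) \<Rightarrow> complex \<Rightarrow> bool"
  where "good_word w \<rho> \<longleftrightarrow> w \<in> Sp6 \<and> \<rho> \<in> \<real> \<and> slash std_form w \<in> spaceW \<and> slash std_form w - cscale \<rho> std_form \<in> translation_span \<and>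
    quartic_act w Q_one (ind {0}) = \<rho>"

lemma good_word_one: "good_word (mat 1) 1"
proof -
  have "slash std_form (mat 1) = std_form" by (rule slash_one) (rule std_form_off)
  moreover have "Q_one (ind {0}) = 1" by (simp add: Q_one_explicit ind_def bv_zero)
  ultimately show ?thesis by (simp add: good_word_def std_form_spaceW quartic_act_one W'_basis translation_span_zero)
qed

lemma comm_mult:
  assumes "v ** x = x ** v" "w ** x = x ** (w :: 'a::semiring_1^'n^'n)"
  shows "v ** w ** x = x ** (v ** w)"
proof -
  have "v ** w ** x = v ** (x ** w)" by (simp only: matrix_mul_assoc[symmetric] assms(2))
  also have "\<dots> = x ** v ** w" by (simp only: matrix_mul_assoc assms(1))
  finally show ?thesis by (simp only: matrix_mul_assoc)
qed

text \<open>The inductive step combines the two relations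
  \<open>std_form = - (std_form|J\<^sub>j + std_form|J\<^sub>j t\<^sub>j\<^sub>j)\<close> and \<open>Q\<^sub>1 = - (Q\<^sub>1|J\<^sub>j + Q\<^sub>1|J\<^sub>j t\<^sub>j\<^sub>j)\<close>.\<close>

lemma good_word_step:
  assumes N: "good_word w \<rho>" and cJ: "w ** jJ j = jJ j ** w"
    and cT: "w ** tS (Em j j 1) = tS (Em j j 1) ** w"
    and UV: "U ** V = mat 1" and S: "transpose S = S" "\<And>i. i \<noteq> j \<Longrightarrow> S $ i $ i = 0" "S $ j $ j = 0 \<or> S $ j $ j = 1"
  shows "good_word (w ** (jJ j ** tS S ** uU U V)) (- \<rho> / 2)"
proof -
  have w: "w \<in> Sp6" and lam: "\<rho> \<in> \<real>" and wW: "slash std_form w \<in> spaceW" and wK: "slash std_form w - cscale \<rho> std_form \<in> translation_span"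
    and wQ: "quartic_act w Q_one (ind {0}) = \<rho>"
    using N by (auto simp: good_word_def)
  have sp: "jJ j \<in> Sp6" "tS S \<in> Sp6" "uU U V \<in> Sp6" "tS (Em j j 1) \<in> Sp6"
    using jJ_Sp6 tS_Sp6 uU_Sp6 UV S by auto
  \<comment> \<open>The three-term relations concern \<open>std_form\<close> and
    \<open>Q_one\<close> themselves, so the inversion has to be moved to the left of
    \<open>w\<close>; the commutation hypotheses serve this purpose.\<close>
  have comm: "w ** (jJ j ** tS (Em j j 1)) = jJ j ** tS (Em j j 1) ** w"
    using comm_mult[OF cJ[symmetric] cT[symmetric]] by simp
  define a where "a = slash (slash std_form w) (jJ j)"
  define b where "b = slash a (tS (Em j j 1))"
  define c where "c = slash a (tS S)"
  have a': "a = slash (slash std_form (jJ j)) w"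
    using cJ slash_mult[OF w sp(1), of std_form] slash_mult[OF sp(1) w, of std_form] by (simp add: a_def)
  have b': "b = slash (slash std_form (jJ j ** tS (Em j j 1))) w"
    unfolding b_def a_def using comm w sp by (simp flip: slash_mult add: Sp6_mult) (simp add: matrix_mul_assoc)
  have ab: "a + b = - slash std_form w"
    unfolding a' b' slash_add[symmetric] std_form_relation slash_minus ..
  have aW: "a \<in> spaceW" unfolding a_def by (rule spaceW_slash(3)[OF wW])
  have aV: "a \<in> orbit_span" using aW by (rule spaceW_orbit_span)
  \<comment> \<open>\<open>b\<close> arises from an odd translation, to which
    \<open>spaceW_slash\<close> does not apply; the relation
    \<open>a + b = - slash std_form w\<close> puts it into \<open>W\<close> instead.\<close>
  have "b = cscale (-1) (slash std_form w + a)"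
  proof
    fix \<tau>
    have "b \<tau> = - slash std_form w \<tau> - a \<tau>" using fun_cong[OF ab, of \<tau>] by (simp add: eq_diff_eq add.commute)
    then show "b \<tau> = cscale (-1) (slash std_form w + a) \<tau>" unfolding cscale_def by simp
  qed
  then have bW: "b \<in> spaceW" using aW wW by (simp add: spaceW_add spaceW_scale del: cfun.scale_minus_left)
  have cW: "c \<in> spaceW"
  proof (cases "S $ j $ j = 0")
    case True
    have "even (S $ i $ i)" for i using True S(2) by (cases "i = j") auto
    then show ?thesis unfolding c_def by (rule spaceW_slash(2)[OF aW S(1)])
  next
    case False
    \<comment> \<open>The odd diagonal entry is split off as the unit translation leading from
      \<open>a\<close> to \<open>b\<close>; what remains has even diagonal.\<close>
    define S' where "S' = S - Em j j 1"
    have "S' $ i $ i = 0" for i using False S(2,3) by (cases "i = j") (auto simp: S'_def Em_def)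
    moreover have S': "transpose S' = S'"
      using S(1) by (simp add: S'_def diff_conv_add_uminus transpose_add transpose_minus del: add_uminus_conv_diff)
    ultimately have "slash b (tS S') \<in> spaceW" by (intro spaceW_slash(2)[OF bW]) auto
    moreover have "tS S = tS (Em j j 1) ** tS S'" by (simp add: tS_add S'_def)
    ultimately show ?thesis unfolding c_def b_def using S' by (simp add: slash_mult sp tS_Sp6)
  qed
  have bK: "b - a \<in> translation_span" unfolding b_def by (rule translation_span_diff[OF aV]) simp
  have cK: "c - a \<in> translation_span" unfolding c_def by (rule translation_span_diff[OF aV S(1)])
  \<comment> \<open>Modulo translation differences \<open>a\<close>, \<open>b\<close> and
    \<open>c\<close> agree, and \<open>a + b = - slash std_form w\<close>; hence \<open>c\<close> is
    -1/2 times \<open>slash std_form w\<close>, that is \<open>- \<rho> / 2\<close> times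
    \<open>std_form\<close>.\<close>
  have "c - cscale (- \<rho> / 2) std_form = (c - a) + cscale (- 1 / 2) ((slash std_form w - cscale \<rho> std_form) + (b - a))"
  proof
    fix \<tau>
    have "a \<tau> + b \<tau> = - slash std_form w \<tau>" using ab by (metis fun_Compl_def plus_fun_apply)
    then have "slash std_form w \<tau> = - (a \<tau> + b \<tau>)" by simp
    then show "(c - cscale (- \<rho> / 2) std_form) \<tau> = ((c - a) + cscale (- 1 / 2) ((slash std_form w - cscale \<rho> std_form) + (b - a))) \<tau>"
      by (simp add: cscale_def field_simps)
  qed
  also have "\<dots> \<in> translation_span" by (intro translation_span_add translation_span_scale cK bK wK)
  finally have "slash (c - cscale (- \<rho> / 2) std_form) (uU U V) \<in> translation_span" by (rule translation_span_slash_uU[OF _ UV])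
  then have K: "slash c (uU U V) - cscale (- \<rho> / 2) std_form \<in> translation_span"
    unfolding slash_diff slash_scale slash_std_form_Gamma[OF uU_Gamma[OF UV]] .
  have d: "slash std_form (w ** (jJ j ** tS S ** uU U V)) = slash c (uU U V)"
    by (simp add: c_def a_def matrix_mul_assoc slash_mult Sp6_mult w sp)
  define q where "q = quartic_act w Q_one"
  have q: "q \<in> spaceW'" unfolding q_def by (intro quartic_act_W' w W'_basis)
  define x where "x = quartic_act (jJ j) q"
  have x: "x \<in> spaceW'" unfolding x_def by (intro quartic_act_W' sp q)
  have "x = quartic_act w (quartic_act (jJ j) Q_one)"
    unfolding x_def q_def using cJ quartic_act_mult[OF w sp(1) W'_basis(1)] quartic_act_mult[OF sp(1) w W'_basis(1)] by simp
  moreover have "quartic_act (tS (Em j j 1)) x = quartic_act w (quartic_act (jJ j ** tS (Em j j 1)) Q_one)"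
    unfolding x_def q_def using comm w sp W'_basis(1)
    by (simp flip: quartic_act_mult add: Sp6_mult quartic_act_W') (simp add: matrix_mul_assoc)
  ultimately have "x + quartic_act (tS (Em j j 1)) x = quartic_act w (cscale (-1) Q_one)"
    using Q_one_relation[of j] quartic_act_add[OF w, of "quartic_act (jJ j) Q_one" "quartic_act (jJ j ** tS (Em j j 1)) Q_one"]
    by (simp add: quartic_act_W' Sp6_mult sp W'_basis)
  also have "\<dots> = cscale (-1) q" unfolding q_def by (rule quartic_act_scale[OF w W'_basis(1)])
  finally have "(x + quartic_act (tS (Em j j 1)) x) (ind {0}) = cscale (-1) q (ind {0})" by simp
  \<comment> \<open>Translations do not change values at \<open>ind {0}\<close>, so the two summands
    have the same value there.\<close>
  then have "2 * x (ind {0}) = - \<rho>"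
    using wQ quartic_act_tS_zero_point[OF _ x, of "Em j j 1"] by (simp add: q_def cscale_def)
  then have x0: "x (ind {0}) = - \<rho> / 2" by (simp add: field_simps)
  have "quartic_act (w ** (jJ j ** tS S ** uU U V)) Q_one = quartic_act (uU U V) (quartic_act (tS S) x)"
    by (simp add: x_def q_def matrix_mul_assoc quartic_act_mult Sp6_mult w sp W'_basis)
  then have "quartic_act (w ** (jJ j ** tS S ** uU U V)) Q_one (ind {0}) = - \<rho> / 2"
    using x0 by (simp add: quartic_act_uU_zero_point[OF UV] quartic_act_tS_zero_point quartic_act_W' sp x S(1))
  moreover have "slash c (uU U V) \<in> spaceW" by (rule spaceW_slash(1)[OF cW UV])
  ultimately show ?thesis
    unfolding good_word_def d using K lam w sp by (auto intro!: Sp6_mult)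
qed

section \<open>Commutation of blocks in different coordinates\<close>

lemma matrix_mult_Em:
  "(A ** Em i j 1) $ r $ k = (if k = j then A $ r $ i else 0)"
  "(Em i j 1 ** A) $ r $ k = (if r = i then A $ j $ k else 0)"
  using exhaust_3[of i] exhaust_3[of j] by (auto simp: matrix_matrix_mult_def sum_3 Em_def)

definition commutes :: "3 \<Rightarrow> int^(3 + 3)^(3 + 3) \<Rightarrow> bool"
  where "commutes i w \<longleftrightarrow> w ** jJ i = jJ i ** w \<and> w ** tS (Em i i 1) = tS (Em i i 1) ** w"

lemma commutes_mult: "commutes i v \<Longrightarrow> commutes i w \<Longrightarrow> commutes i (v ** w)"
  unfolding commutes_def using comm_mult by blast

lemma commutes_one: "commutes i (mat 1)"
  by (simp add: commutes_def)

lemma commutes_jJ: "i \<noteq> j \<Longrightarrow> commutes i (jJ j)"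
  by (simp add: commutes_def jJ_def tS_def mk_mult mk_eq_iff mat_distribs Em_mult algebra_simps)

lemma commutes_tS:
  assumes "\<And>k. S $ i $ k = 0 \<and> S $ k $ i = 0" shows "commutes i (tS S)"
proof -
  have "S ** Em i i 1 = 0" "Em i i 1 ** S = 0"
    using assms by (simp_all add: vec_eq_iff matrix_mult_Em)
  then show ?thesis by (simp add: commutes_def jJ_def tS_def mk_mult mk_eq_iff mat_distribs)
qed

lemma commutes_uU:
  assumes "\<And>k. U $ i $ k = mat 1 $ i $ k \<and> U $ k $ i = mat 1 $ k $ i"
    "\<And>k. V $ i $ k = mat 1 $ i $ k \<and> V $ k $ i = mat 1 $ k $ i"
  shows "commutes i (uU U V)"
proof -
  have "M ** Em i i 1 = Em i i 1" "Em i i 1 ** M = Em i i 1"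
    if "\<And>k. M $ i $ k = mat 1 $ i $ k \<and> M $ k $ i = mat 1 $ k $ i" for M
  proof -
    have E: "Em i i 1 $ r $ k = (if r = i \<and> k = i then 1 else 0)" for r k by (simp add: Em_def)
    show "M ** Em i i 1 = Em i i 1" "Em i i 1 ** M = Em i i 1"
      using that by (auto simp: vec_eq_iff matrix_mult_Em E mat_def)
  qed
  from this[of U] this[of "transpose V"] assms
  have "U ** Em i i 1 = Em i i 1" "Em i i 1 ** U = Em i i 1"
    "transpose V ** Em i i 1 = Em i i 1" "Em i i 1 ** transpose V = Em i i 1"
    by (auto simp: transpose_def mat_def)
  then show ?thesis by (simp add: commutes_def jJ_def tS_def uU_def mk_mult mk_eq_iff mat_distribs)
qed

text \<open>Reading the bottom rows modulo 2 as characteristics makes right multiplication by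
  generators act through \<open>linU\<close>, \<open>linT\<close> and \<open>linJ\<close>; column
  \<open>i\<close> of \<open>C\<close> is even exactly when all upper entries at \<open>i\<close>
  vanish.\<close>

definition bottom_row :: "int^(3 + 3)^(3 + 3) \<Rightarrow> 3 \<Rightarrow> bit^(3 + 3)"
  where "bottom_row \<gamma> k = char_pair (red (blockC \<gamma> $ k)) (red (blockD \<gamma> $ k))"

lemma row_mult_matrix: "(A ** B) $ k = transpose B *v (A $ k :: int^3)"
  by (simp add: vec_eq_iff matrix_matrix_mult_def matrix_vector_mult_def transpose_def mult.commute del: transpose_matrix_vector)

lemma bottom_row_uU: "bottom_row (\<gamma> ** uU U V) k = linU U V (bottom_row \<gamma> k)"
  by (simp add: bottom_row_def linU_def blockC_mult blockD_mult row_mult_matrix red_mv redm_transpose del: transpose_matrix_vector)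
     (simp add: uU_def row_mult_matrix red_mv redm_transpose del: transpose_matrix_vector)

lemma bottom_row_tS:
  assumes "transpose S = S" shows "bottom_row (\<gamma> ** tS S) k = linT S (bottom_row \<gamma> k)"
  using assms
  by (simp add: bottom_row_def linT_def blockC_mult blockD_mult)
     (simp add: tS_def row_mult_matrix red_mv red_add add.commute del: transpose_matrix_vector)

lemma bottom_row_jJ: "bottom_row (\<gamma> ** jJ j) k = linJ j (bottom_row \<gamma> k)"
proof -
  have C: "blockC (\<gamma> ** jJ j) $ k = (\<chi> l. if l = j then blockD \<gamma> $ k $ l else blockC \<gamma> $ k $ l)"
    by (auto simp: blockC_mult jJ_def mat_distribs matrix_mult_Em vec_eq_iff)
  have D: "blockD (\<gamma> ** jJ j) $ k = (\<chi> l. if l = j then - (blockC \<gamma> $ k $ l) else blockD \<gamma> $ k $ l)"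
    by (auto simp: blockD_mult jJ_def mat_distribs matrix_mult_Em vec_eq_iff)
  have "red (\<chi> l. if l = j then y $ l else x $ l) = swapj j (red x) (red y)"
    "red (\<chi> l. if l = j then - (y $ l) else x $ l) = swapj j (red x) (red y)" for x y
    by (simp_all add: red_def swapj_def vec_eq_iff)
  then show ?thesis unfolding bottom_row_def linJ_def C D by simp
qed

lemma bottom_row_flip: "bottom_row (\<gamma> ** flip j) k = bottom_row \<gamma> k"
proof -
  have "redm (Fm j) = mat 1" by (auto simp: redm_def Fm_def mat_def vec_eq_iff)
  then show ?thesis unfolding flip_uU bottom_row_uU by (simp add: linU_def char_pair_eta transpose_mat del: transpose_matrix_vector)
qed

lemma bottom_row_isotropic:
  assumes "\<gamma> \<in> Sp6" shows "pairing (bottom_row \<gamma> k) (bottom_row \<gamma> l) = 0"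
proof -
  have "blockC (\<gamma> ** sp_inv \<gamma>) = blockC (mk (mat 1) 0 0 (mat 1))"
    using sp_inv_right[OF assms] by (metis mat_mk)
  then have "blockC \<gamma> ** transpose (blockD \<gamma>) - blockD \<gamma> ** transpose (blockC \<gamma>) = 0"
    by (simp add: blockC_mult) (simp add: sp_inv_def mat_distribs)
  then have "(blockC \<gamma> ** transpose (blockD \<gamma>)) $ k $ l = (blockD \<gamma> ** transpose (blockC \<gamma>)) $ k $ l" by simp
  then have "sp (blockC \<gamma> $ k) (blockD \<gamma> $ l) = sp (blockD \<gamma> $ k) (blockC \<gamma> $ l)"
    by (simp add: scalar_product_def matrix_matrix_mult_def transpose_def)
  then show ?thesis by (simp add: pairing_def bottom_row_def red_sp)
qed

lemma upper_bottom_row: "upper (bottom_row \<gamma> k) $ i = 0 \<longleftrightarrow> even (blockC \<gamma> $ k $ i)"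
  by (simp add: bottom_row_def red_def)

text \<open>\<open>tower_step\<close> applied to the bottom rows splits off one block on the right,
  and what is left has even columns of \<open>C\<close> at \<open>j\<close> as well. If column
  \<open>j\<close> is even already, the block is the identity.\<close>

lemma row_split:
  assumes g: "\<gamma> \<in> Sp6" and I: "\<And>k i. i \<in> I \<Longrightarrow> even (blockC \<gamma> $ k $ i)" and j: "j \<notin> I"
  obtains \<gamma>' w where "\<gamma>' \<in> Sp6" "\<gamma> = \<gamma>' ** w" "\<And>k i. i \<in> insert j I \<Longrightarrow> even (blockC \<gamma>' $ k $ i)"
    "\<And>i. i \<in> I \<Longrightarrow> commutes i w" "\<And>v \<rho>. good_word v \<rho> \<Longrightarrow> commutes j v \<Longrightarrow> \<exists>\<mu>. good_word (v ** w) \<mu>"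
proof (cases "\<forall>k. even (blockC \<gamma> $ k $ j)")
  case True
  show ?thesis by (rule that[of \<gamma> "mat 1"]) (use g I True commutes_one in auto)
next
  case False
  then obtain k0 where "upper (bottom_row \<gamma> k0) $ j \<noteq> 0" by (auto simp: upper_bottom_row)
  then have k0: "upper (bottom_row \<gamma> k0) $ j = 1" using bit_cases01 by metis
  obtain U V S where UV: "U ** V = mat 1" and S: "transpose S = S" "\<And>i. i \<noteq> j \<Longrightarrow> S $ i $ i = 0"
    "S $ j $ j = (if sp (upper (bottom_row \<gamma> k0)) (lower (bottom_row \<gamma> k0)) = 0 then 0 else 1)"
    and c: "\<And>i k. i \<in> I \<Longrightarrow> U $ i $ k = mat 1 $ i $ k \<and> U $ k $ i = mat 1 $ k $ i"
      "\<And>i k. i \<in> I \<Longrightarrow> V $ i $ k = mat 1 $ i $ k \<and> V $ k $ i = mat 1 $ k $ i"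
      "\<And>i k. i \<in> I \<Longrightarrow> S $ i $ k = 0 \<and> S $ k $ i = 0"
    and z: "\<And>m i. m \<in> range (bottom_row \<gamma>) \<Longrightarrow> i \<in> insert j I \<Longrightarrow> upper (linJ j (linT S (linU U V m))) $ i = 0"
    by (rule tower_step[of "range (bottom_row \<gamma>)" I j "bottom_row \<gamma> k0"])
       (use bottom_row_isotropic[OF g] I j k0 upper_bottom_row in auto)
  \<comment> \<open>\<open>jJ j ** flip j\<close> inverts \<open>jJ j\<close>. Modulo 2 neither the
    flip nor the sign of \<open>S\<close> is visible, so the rows change exactly as in
    \<open>tower_step\<close>.\<close>
  define \<gamma>' where "\<gamma>' = \<gamma> ** uU U V ** tS (- S) ** jJ j ** flip j"
  define w where "w = jJ j ** tS S ** uU V U"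
  have VU: "V ** U = mat 1" using UV by (rule int_matrix_left_right_inverse)
  have mS: "transpose (- S) = - S" "redm (- S) = redm S"
    using S(1) by (auto simp: transpose_minus redm_def vec_eq_iff)
  show ?thesis
  proof (rule that[of \<gamma>' w])
    show "\<gamma>' \<in> Sp6" unfolding \<gamma>'_def by (intro Sp6_mult g uU_Sp6 UV tS_Sp6 mS jJ_Sp6 flip_Sp6)
    have "jJ j ** flip j ** jJ j = mat 1"
      unfolding jJ_square[of j, symmetric] by (metis flip_square jJ_square matrix_mul_assoc)
    then have "\<gamma>' ** w = \<gamma> ** uU U V ** (tS (- S) ** tS S) ** uU V U"
      unfolding \<gamma>'_def w_def by (metis (no_types, lifting) matrix_mul_assoc matrix_mul_rid)
    also have "\<dots> = \<gamma> ** (uU U V ** uU V U)" by (simp add: tS_add tS_zero matrix_mul_assoc)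
    also have "uU U V ** uU V U = mat 1"
    proof -
      have "transpose V ** transpose U = mat 1" using UV by (rule transpose_inverse)
      then show ?thesis by (simp add: uU_def mk_mult UV mat_mk)
    qed
    finally show "\<gamma> = \<gamma>' ** w" by simp
    have "bottom_row \<gamma>' k = linJ j (linT S (linU U V (bottom_row \<gamma> k)))" for k
      unfolding \<gamma>'_def bottom_row_flip bottom_row_jJ bottom_row_tS[OF mS(1)] bottom_row_uU by (simp add: linT_def mS(2))
    then show "even (blockC \<gamma>' $ k $ i)" if "i \<in> insert j I" for k i
      using z[OF _ that, of "bottom_row \<gamma> k"] by (simp flip: upper_bottom_row)
    show "commutes i w" if "i \<in> I" for i
      unfolding w_def using c that j by (intro commutes_mult commutes_jJ commutes_tS commutes_uU) auto
    show "\<exists>\<mu>. good_word (v ** w) \<mu>" if "good_word v \<rho>" "commutes j v" for v \<rho>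
    proof -
      have "good_word (v ** w) (- \<rho> / 2)"
        unfolding w_def by (rule good_word_step[OF that(1) _ _ VU S(1)]) (use that S in \<open>auto simp: commutes_def\<close>)
      then show ?thesis ..
    qed
  qed
qed

lemma std_form_orbit:
  assumes "\<gamma> \<in> Sp6"
  obtains \<rho> where "\<rho> \<in> \<real>" "slash std_form \<gamma> \<in> spaceW" "slash std_form \<gamma> - cscale \<rho> std_form \<in> translation_span"
    "quartic_act \<gamma> Q_one (ind {0}) = \<rho>"
proof -
  obtain \<gamma>1 w1 where 1: "\<gamma>1 \<in> Sp6" "\<gamma> = \<gamma>1 ** w1" "\<And>k i. i \<in> {1} \<Longrightarrow> even (blockC \<gamma>1 $ k $ i)"
    "\<And>v \<rho>. good_word v \<rho> \<Longrightarrow> commutes 1 v \<Longrightarrow> \<exists>\<mu>. good_word (v ** w1) \<mu>"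
    by (rule row_split[OF assms, of "{}" 1]) auto
  obtain \<gamma>2 w2 where 2: "\<gamma>2 \<in> Sp6" "\<gamma>1 = \<gamma>2 ** w2" "\<And>k i. i \<in> {2, 1} \<Longrightarrow> even (blockC \<gamma>2 $ k $ i)"
    "\<And>i. i \<in> {1} \<Longrightarrow> commutes i w2"
    "\<And>v \<rho>. good_word v \<rho> \<Longrightarrow> commutes 2 v \<Longrightarrow> \<exists>\<mu>. good_word (v ** w2) \<mu>"
    by (rule row_split[OF 1(1), of "{1}" 2]) (use 1(3) in auto)
  obtain \<gamma>3 w3 where 3: "\<gamma>3 \<in> Sp6" "\<gamma>2 = \<gamma>3 ** w3" "\<And>k i. i \<in> {3, 2, 1} \<Longrightarrow> even (blockC \<gamma>3 $ k $ i)"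
    "\<And>i. i \<in> {2, 1} \<Longrightarrow> commutes i w3"
    "\<And>v \<rho>. good_word v \<rho> \<Longrightarrow> commutes 3 v \<Longrightarrow> \<exists>\<mu>. good_word (v ** w3) \<mu>"
    by (rule row_split[OF 2(1), of "{2, 1}" 3]) (use 2(3) in auto)
  have "even (blockC \<gamma>3 $ k $ i)" for k i using 3(3)[of i k] exhaust_3[of i] by auto
  then have G: "\<gamma>3 \<in> Gamma30_2" using 3(1) by (simp add: Gamma30_2_def)
  \<comment> \<open>The blocks are appended in the order \<open>w3\<close>, \<open>w2\<close>,
    \<open>w1\<close>. The word built so far commutes with the inversion of the next coordinate,
    because the stages that produced it left that coordinate alone.\<close>
  obtain \<mu>3 where "good_word w3 \<mu>3" using 3(5)[OF good_word_one commutes_one] by auto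
  then obtain \<mu>2 where "good_word (w3 ** w2) \<mu>2" using 2(5) 3(4)[of 2] by auto
  moreover have "commutes 1 (w3 ** w2)" using 3(4)[of 1] 2(4)[of 1] by (intro commutes_mult) auto
  ultimately obtain \<mu> where N: "good_word (w3 ** w2 ** w1) \<mu>" using 1(4) by blast
  define w where "w = w3 ** w2 ** w1"
  have g: "\<gamma> = \<gamma>3 ** w" by (simp add: w_def 1(2) 2(2) 3(2) matrix_mul_assoc)
  have w: "w \<in> Sp6" using N by (simp add: good_word_def w_def)
  have "slash std_form \<gamma> = slash std_form w" unfolding g slash_mult[OF 3(1) w] slash_std_form_Gamma[OF G] ..
  moreover have "quartic_act \<gamma> Q_one = quartic_act w Q_one"
    unfolding g quartic_act_mult[OF 3(1) w W'_basis(1)] Q_one_Gamma[OF G] ..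
  ultimately show ?thesis using N that[of \<mu>] by (simp add: good_word_def w_def)
qed

section \<open>Averaging over translations\<close>

text \<open>The matrix is congruent to the identity modulo 2 and stays so under conjugation, hence
  its lower left block is even.\<close>

lemma tS_double_conj:
  assumes g: "\<gamma> \<in> Sp6" and S: "transpose S = S"
  shows "\<gamma> ** tS (S + S) ** sp_inv \<gamma> \<in> Gamma30_2"
proof -
  have SS: "transpose (S + S) = S + S" by (simp only: transpose_add S)
  define N where "N = mk 0 S 0 (0 :: int^3^3)"
  define M where "M = \<gamma> ** N ** sp_inv \<gamma>"
  have "tS (S + S) = mat 1 + (N + N)"
    by (simp add: tS_def mat_mk[where 'a = int] N_def) (simp add: mk_def vec_eq_iff all33)
  then have "\<gamma> ** tS (S + S) ** sp_inv \<gamma> = \<gamma> ** sp_inv \<gamma> + (M + M)"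
    by (simp only: matrix_add_ldistrib matrix_add_rdistrib' M_def matrix_mul_rid)
  also have "\<gamma> ** sp_inv \<gamma> = mat 1" using g by (rule sp_inv_right)
  finally have e: "\<gamma> ** tS (S + S) ** sp_inv \<gamma> = mat 1 + (M + M)" .
  have "even (blockC (mat 1 + (M + M)) $ i $ j)" for i j
    by (simp add: blockC_def) (simp add: mat_def)
  moreover have "\<gamma> ** tS (S + S) ** sp_inv \<gamma> \<in> Sp6" using g SS by (intro Sp6_mult tS_Sp6 sp_inv_Sp6)
  ultimately show ?thesis unfolding e by (simp add: Gamma30_2_def)
qed

lemma orbit_span_induct [consumes 1, case_names base add scale zero]:
  assumes "h \<in> orbit_span" "\<And>\<gamma>. \<gamma> \<in> Sp6 \<Longrightarrow> P (slash std_form \<gamma>)" "\<And>h k. P h \<Longrightarrow> P k \<Longrightarrow> P (h + k)"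
    "\<And>c h. P h \<Longrightarrow> P (cscale c h)" "P 0"
  shows "P h"
proof (rule cfun.span_induct[OF assms(1)[unfolded orbit_span_def], of P])
  show "cfun.subspace {h. P h}" unfolding cfun.subspace_def using assms by auto
  fix x assume "x \<in> {slash std_form \<gamma> |\<gamma>. \<gamma> \<in> Sp6}"
  then show "P x" using assms(2) by auto
qed

lemma orbit_span_double: "h \<in> orbit_span \<Longrightarrow> transpose S = S \<Longrightarrow> slash h (tS (S + S)) = h"
proof (induction rule: orbit_span_induct)
  case (base \<gamma>)
  then have SS: "tS (S + S) \<in> Sp6" by (intro tS_Sp6) (simp only: transpose_add)
  have d: "\<gamma> ** tS (S + S) ** sp_inv \<gamma> \<in> Gamma30_2" using base by (rule tS_double_conj)
  have "\<gamma> ** tS (S + S) = (\<gamma> ** tS (S + S) ** sp_inv \<gamma>) ** \<gamma>"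
    using sp_inv_left[OF base(1)] by (simp flip: matrix_mul_assoc)
  then have "slash (slash std_form \<gamma>) (tS (S + S)) = slash (slash std_form (\<gamma> ** tS (S + S) ** sp_inv \<gamma>)) \<gamma>"
    using slash_mult[OF base(1) SS, of std_form] slash_mult[OF Gamma_Sp6[OF d] base(1), of std_form] by simp
  then show ?case using slash_std_form_Gamma[OF d] by simp
qed (auto simp: slash_add slash_scale slash_zero)

definition liftm :: "bit^3^3 \<Rightarrow> int^3^3" where "liftm \<beta> = (\<chi> i. lift (\<beta> $ i))"

lemma redm_liftm: "redm (liftm \<beta>) = \<beta>"
  using red_lift by (simp add: redm_def liftm_def red_def vec_eq_iff)

lemma redm_add: "redm (S + S') = redm S + redm S'"
  by (auto simp: redm_def vec_eq_iff)

lemma liftm_sym: "transpose \<beta> = \<beta> \<Longrightarrow> transpose (liftm \<beta>) = liftm \<beta>"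
proof -
  assume "transpose \<beta> = \<beta>"
  then have "\<beta> $ k $ l = \<beta> $ l $ k" for k l by (metis (no_types, lifting) transpose_def vec_lambda_beta)
  then show ?thesis by (simp add: liftm_def transpose_def lift_def vec_eq_iff)
qed

text \<open>Translation by a symmetric matrix over \<open>F_2\<close> is thereby well defined on the
  orbit span, and averaging over all translations becomes a finite sum.\<close>

lemma orbit_span_mod2:
  assumes h: "h \<in> orbit_span" and S: "transpose S = S"
  shows "slash h (tS S) = slash h (tS (liftm (redm S)))"
proof -
  define L where "L = liftm (redm S)"
  define S' where "S' = (\<chi> i j. (S $ i $ j) div 2)"
  have sym: "S $ k $ l = S $ l $ k" for k l using S by (metis (no_types, lifting) transpose_def vec_lambda_beta)
  have S': "transpose S' = S'"
    unfolding S'_def transpose_def vec_eq_iff vec_lambda_beta using sym by simp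
  have L: "transpose L = L" unfolding L_def using S by (intro liftm_sym) (simp flip: redm_transpose)
  have "L $ i $ j = S $ i $ j mod 2" for i j
    by (simp add: L_def liftm_def lift_def redm_def odd_iff_mod_2_eq_one even_iff_mod_2_eq_zero)
  then have "S $ i $ j = L $ i $ j + (S' + S') $ i $ j" for i j
    using mult_div_mod_eq[of 2 "S $ i $ j"] by (simp add: S'_def)
  then have "S = (S' + S') + L" by (simp add: vec_eq_iff)
  then have e: "tS S = tS (S' + S') ** tS L" by (simp add: tS_add)
  have "slash h (tS S) = slash (slash h (tS (S' + S'))) (tS L)"
    unfolding e using L S' by (intro slash_mult tS_Sp6) (simp_all only: transpose_add)
  then show ?thesis using orbit_span_double[OF h S'] by (simp add: L_def)
qed

definition sym_bits :: "(bit^3^3) set" where "sym_bits = {\<beta>. transpose \<beta> = \<beta>}"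

definition translation_sum :: "(complex^3^3 \<Rightarrow> complex) \<Rightarrow> complex^3^3 \<Rightarrow> complex"
  where "translation_sum h = (\<lambda>\<tau>. \<Sum>\<beta>\<in>sym_bits. slash h (tS (liftm \<beta>)) \<tau>)"

lemma translation_sum_add: "translation_sum (h + k) = translation_sum h + translation_sum k" and translation_sum_scale: "translation_sum (cscale c h) = cscale c (translation_sum h)"
  and translation_sum_zero: "translation_sum 0 = 0"
  by (auto simp: translation_sum_def slash_add slash_scale slash_zero sum.distrib fun_eq_iff) (auto simp: cscale_def sum_distrib_left)

lemma translation_sum_diff: "translation_sum (h - k) = translation_sum h - translation_sum k"
  by (auto simp: translation_sum_def slash_diff sum_subtractf fun_eq_iff)

lemma translation_sum_slash:
  assumes h: "h \<in> orbit_span" and S: "transpose S = S"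
  shows "translation_sum (slash h (tS S)) = translation_sum h"
proof
  fix \<tau>
  have rS: "transpose (redm S) = redm S" using S by (simp flip: redm_transpose)
  have inv: "redm S + (redm S + \<beta>) = \<beta>" for \<beta> by (simp add: vec_eq_iff flip: add.assoc)
  have "slash (slash h (tS S)) (tS (liftm \<beta>)) = slash h (tS (liftm (redm S + \<beta>)))" if "\<beta> \<in> sym_bits" for \<beta>
  proof -
    have b: "transpose (liftm \<beta>) = liftm \<beta>" using that by (intro liftm_sym) (simp add: sym_bits_def)
    have "slash (slash h (tS S)) (tS (liftm \<beta>)) = slash h (tS (S + liftm \<beta>))"
      using S b by (simp add: slash_mult[symmetric] tS_Sp6 tS_add)
    also have "\<dots> = slash h (tS (liftm (redm S + \<beta>)))"
      using orbit_span_mod2[OF h, of "S + liftm \<beta>"] S b by (simp add: transpose_add redm_add redm_liftm)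
    finally show ?thesis .
  qed
  then have "translation_sum (slash h (tS S)) \<tau> = (\<Sum>\<beta>\<in>sym_bits. slash h (tS (liftm (redm S + \<beta>))) \<tau>)"
    by (simp add: translation_sum_def)
  also have "\<dots> = (\<Sum>\<beta>\<in>sym_bits. slash h (tS (liftm \<beta>)) \<tau>)"
    by (rule sum.reindex_bij_witness[where i = "\<lambda>\<beta>. redm S + \<beta>" and j = "\<lambda>\<beta>. redm S + \<beta>"])
       (auto simp: inv sym_bits_def transpose_add rS)
  finally show "translation_sum (slash h (tS S)) \<tau> = translation_sum h \<tau>" by (simp add: translation_sum_def)
qed

lemma translation_sum_translation_span: "h \<in> translation_span \<Longrightarrow> translation_sum h = 0"
proof -
  assume h: "h \<in> translation_span"
  show ?thesis
  proof (rule cfun.span_induct[OF h[unfolded translation_span_def], of "\<lambda>h. translation_sum h = 0"])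
    show "cfun.subspace {h. translation_sum h = 0}"
      unfolding cfun.subspace_def by (auto simp: translation_sum_add translation_sum_scale translation_sum_zero)
    fix x assume "x \<in> {slash h (tS S) - h | h S. h \<in> orbit_span \<and> transpose S = S}"
    then show "translation_sum x = 0" by (auto simp: translation_sum_diff translation_sum_slash)
  qed
qed

lemma translation_sum_invariant:
  assumes "\<And>S. transpose S = S \<Longrightarrow> slash h (tS S) = h"
  shows "translation_sum h = cscale (of_nat (card sym_bits)) h"
proof
  fix \<tau>
  have "slash h (tS (liftm \<beta>)) \<tau> = h \<tau>" if "\<beta> \<in> sym_bits" for \<beta>
    using assms[OF liftm_sym[of \<beta>]] that by (simp add: sym_bits_def)
  then show "translation_sum h \<tau> = cscale (of_nat (card sym_bits)) h \<tau>" by (simp add: translation_sum_def cscale_def)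
qed

lemma sym_bits_nonempty: "card sym_bits \<noteq> 0"
proof -
  have "0 \<in> sym_bits" by (simp add: sym_bits_def)
  then show ?thesis by (auto simp: card_eq_0_iff)
qed

lemma translation_sum_std_form: "translation_sum std_form = cscale (of_nat (card sym_bits)) std_form"
  by (rule translation_sum_invariant) (simp add: slash_std_form_Gamma tS_Gamma)

lemma orbit_span_mod_translation_span: "h \<in> orbit_span \<Longrightarrow> \<exists>c. h - cscale c std_form \<in> translation_span"
proof (induction rule: orbit_span_induct)
  case (base \<gamma>) then show ?case using std_form_orbit by metis
next
  case (add h k)
  then obtain c d where "h - cscale c std_form \<in> translation_span" "k - cscale d std_form \<in> translation_span" by blast
  then have "(h - cscale c std_form) + (k - cscale d std_form) \<in> translation_span" by (rule translation_span_add)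
  also have "(h - cscale c std_form) + (k - cscale d std_form) = (h + k) - cscale (c + d) std_form"
    by (simp add: cscale_def fun_eq_iff algebra_simps)
  finally show ?case by blast
next
  case (scale a h)
  then obtain c where "h - cscale c std_form \<in> translation_span" by blast
  then have "cscale a (h - cscale c std_form) \<in> translation_span" by (rule translation_span_scale)
  also have "cscale a (h - cscale c std_form) = cscale a h - cscale (a * c) std_form"
    by (simp add: cscale_def fun_eq_iff algebra_simps)
  finally show ?case by blast
next
  case zero
  have "0 - cscale 0 std_form = 0" by (simp add: cscale_def fun_eq_iff)
  then show ?case using translation_span_zero by metis
qed

text \<open>Modulo translation differences \<open>h\<close> is a multiple of
  \<open>std_form\<close>. Averaging removes the differences and multiplies both invariant forms by
  the same nonzero integer.\<close>

lemma invariant_multiple: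
  assumes h: "h \<in> orbit_span" and inv: "\<And>S. transpose S = S \<Longrightarrow> slash h (tS S) = h"
  obtains c where "h = cscale c std_form"
proof -
  obtain c where "h - cscale c std_form \<in> translation_span" using orbit_span_mod_translation_span[OF h] by blast
  then have "translation_sum h = cscale c (translation_sum std_form)" using translation_sum_translation_span[of "h - cscale c std_form"] by (simp add: translation_sum_diff translation_sum_scale)
  then have "cscale (of_nat (card sym_bits)) h = cscale c (cscale (of_nat (card sym_bits)) std_form)"
    by (simp add: translation_sum_invariant[OF inv] translation_sum_std_form)
  then have "h = cscale c std_form" using sym_bits_nonempty by (auto simp: cscale_def fun_eq_iff)
  then show ?thesis by (rule that)
qed

section \<open>The tensor product\<close>

text \<open>Reduces statements about tensors to the two factors: freezing tau gives access to
  \<open>quartic_act\<close>, freezing \<open>x\<close> to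
  \<open>invariant_multiple\<close>.\<close>

lemma WW'_slices:
  assumes "P \<in> spaceWW'"
  shows "(\<lambda>x. P (\<tau>, x)) \<in> spaceW'" "(\<lambda>\<tau>. P (\<tau>, x)) \<in> spaceW"
proof -
  have b: "(\<lambda>x. b (\<tau>, x)) \<in> spaceW' \<and> (\<lambda>\<tau>. b (\<tau>, x)) \<in> spaceW"
    if b: "b \<in> {tensor h q | h q. h \<in> spaceW \<and> q \<in> spaceW'}" for b
  proof -
    obtain h q where hq: "b = tensor h q" "h \<in> spaceW" "q \<in> spaceW'" using b by blast
    have "(\<lambda>x. b (\<tau>, x)) = cscale (h \<tau>) q" "(\<lambda>\<tau>. b (\<tau>, x)) = cscale (q x) h"
      by (auto simp: hq(1) tensor_def cscale_def)
    then show ?thesis using W'_scale[OF hq(3)] spaceW_scale[OF hq(2)] by simp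
  qed
  have sub: "cfun.subspace {P. (\<lambda>x. P (\<tau>, x)) \<in> spaceW' \<and> (\<lambda>\<tau>. P (\<tau>, x)) \<in> spaceW}"
    unfolding cfun.subspace_def
  proof (intro conjI ballI allI; clarsimp)
    show "(\<lambda>x. 0) \<in> spaceW' \<and> (\<lambda>\<tau>. 0) \<in> spaceW"
      using W'_zero cfun.span_zero[of "formH ` {F. fano F}"] by (simp add: zero_fun_def spaceW_def)
  next
    fix P Q assume "(\<lambda>x. P (\<tau>, x)) \<in> spaceW'" "(\<lambda>\<tau>. P (\<tau>, x)) \<in> spaceW" "(\<lambda>x. Q (\<tau>, x)) \<in> spaceW'" "(\<lambda>\<tau>. Q (\<tau>, x)) \<in> spaceW"
    then show "(\<lambda>x. P (\<tau>, x) + Q (\<tau>, x)) \<in> spaceW' \<and> (\<lambda>\<tau>. P (\<tau>, x) + Q (\<tau>, x)) \<in> spaceW"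
      using W'_add[of "\<lambda>x. P (\<tau>, x)" "\<lambda>x. Q (\<tau>, x)"] spaceW_add[of "\<lambda>\<tau>. P (\<tau>, x)" "\<lambda>\<tau>. Q (\<tau>, x)"] by (simp add: plus_fun_def)
  next
    fix c P assume "(\<lambda>x. P (\<tau>, x)) \<in> spaceW'" "(\<lambda>\<tau>. P (\<tau>, x)) \<in> spaceW"
    then show "(\<lambda>x. cscale c P (\<tau>, x)) \<in> spaceW' \<and> (\<lambda>\<tau>. cscale c P (\<tau>, x)) \<in> spaceW"
      using W'_scale[of "\<lambda>x. P (\<tau>, x)" c] spaceW_scale[of "\<lambda>\<tau>. P (\<tau>, x)" c] by (simp add: cscale_def)
  qed
  have "(\<lambda>x. P (\<tau>, x)) \<in> spaceW' \<and> (\<lambda>\<tau>. P (\<tau>, x)) \<in> spaceW"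
    by (rule cfun.span_induct[OF assms[unfolded spaceWW'_def], of "\<lambda>P. (\<lambda>x. P (\<tau>, x)) \<in> spaceW' \<and> (\<lambda>\<tau>. P (\<tau>, x)) \<in> spaceW", OF sub b])
  then show "(\<lambda>x. P (\<tau>, x)) \<in> spaceW'" "(\<lambda>\<tau>. P (\<tau>, x)) \<in> spaceW" by auto
qed

lemma WW'_off: "P \<in> spaceWW' \<Longrightarrow> \<tau> \<notin> siegel3 \<Longrightarrow> P (\<tau>, x) = 0"
  using orbit_span_off[OF spaceW_orbit_span[OF WW'_slices(2)], of P \<tau> x] by simp

lemma tensor_act_tensor:
  assumes "\<gamma> \<in> Sp6" "q \<in> spaceW'"
  shows "tensor_act \<gamma> (tensor h q) = tensor (slash h \<gamma>) (quartic_act \<gamma> q)"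
proof -
  have "(\<lambda>y. tensor h q (siegel_act \<gamma> \<tau>, y)) = cscale (h (siegel_act \<gamma> \<tau>)) q" for \<tau>
    by (simp add: tensor_def cscale_def)
  then have "quartic_act \<gamma> (\<lambda>y. tensor h q (siegel_act \<gamma> \<tau>, y)) = cscale (h (siegel_act \<gamma> \<tau>)) (quartic_act \<gamma> q)" for \<tau>
    using quartic_act_scale[OF assms] by simp
  then show ?thesis
    by (auto simp: tensor_act_def tensor_def slash_def cscale_def fun_eq_iff)
qed

lemma sum_fun_apply: "(\<Sum>t\<in>A. f t) x = (\<Sum>t\<in>A. f t x)"
  by (induction A rule: infinite_finite_induct) auto

lemma tensor_act_sum:
  assumes g: "\<gamma> \<in> Sp6" and P: "\<And>t \<tau>. t \<in> A \<Longrightarrow> (\<lambda>x. P t (\<tau>, x)) \<in> spaceW'" and "finite A"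
  shows "tensor_act \<gamma> (\<Sum>t\<in>A. P t) = (\<Sum>t\<in>A. tensor_act \<gamma> (P t))"
proof -
  have W: "(\<Sum>t\<in>A. (\<lambda>x. P t (\<tau>, x))) \<in> spaceW' \<and>
      quartic_act \<gamma> (\<Sum>t\<in>A. (\<lambda>x. P t (\<tau>, x))) = (\<Sum>t\<in>A. quartic_act \<gamma> (\<lambda>x. P t (\<tau>, x)))" for \<tau>
    using \<open>finite A\<close> P
    by (induction A rule: finite_induct) (auto simp: W'_zero quartic_act_zero[OF g] W'_add quartic_act_add[OF g])
  have s: "(\<lambda>y. \<Sum>t\<in>A. P t (\<tau>, y)) = (\<Sum>t\<in>A. (\<lambda>x. P t (\<tau>, x)))" for \<tau>
    by (simp add: fun_eq_iff sum_fun_apply)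
  show ?thesis
  proof
    fix p :: "(complex^3^3) \<times> (complex^(bit^3))"
    obtain \<tau> x where p: "p = (\<tau>, x)" by fastforce
    show "tensor_act \<gamma> (\<Sum>t\<in>A. P t) p = (\<Sum>t\<in>A. tensor_act \<gamma> (P t)) p"
      by (simp add: p tensor_act_def s W sum_fun_apply sum_distrib_left)
  qed
qed

lemma tensor_act_coble_R:
  assumes "\<gamma> \<in> Sp6"
  shows "tensor_act \<gamma> coble_R = tensor (slash std_form \<gamma>) (quartic_act \<gamma> Q_one)"
  unfolding coble_R_def by (rule tensor_act_tensor[OF assms W'_basis(1)])

lemma tensor_act_coble_R_mult:
  assumes "\<gamma> \<in> Sp6" "g \<in> Sp6"
  shows "tensor_act g (tensor_act \<gamma> coble_R) = tensor_act (\<gamma> ** g) coble_R"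
  using assms
  by (simp add: tensor_act_coble_R Sp6_mult tensor_act_tensor quartic_act_W' W'_basis slash_mult quartic_act_mult)

lemma tensor_act_coble_R_Gamma:
  assumes "\<gamma> \<in> Sp6" "\<delta> \<in> Gamma30_2"
  shows "tensor_act (\<delta> ** \<gamma>) coble_R = tensor_act \<gamma> coble_R"
  using assms Gamma_Sp6[OF assms(2)]
  by (simp add: tensor_act_coble_R Sp6_mult slash_mult quartic_act_mult W'_basis slash_std_form_Gamma Q_one_Gamma)

lemma tensor_act_coble_R_theta:
  assumes "\<gamma> \<in> Sp6" "\<tau> \<in> siegel3"
  shows "tensor_act \<gamma> coble_R (\<tau>, Theta2 \<tau> z) =
       det (cocycle \<gamma> \<tau>) powi (-16) * theta_exp_factor \<gamma> \<tau> z *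
       coble_R (siegel_act \<gamma> \<tau>, Theta2 (siegel_act \<gamma> \<tau>) (transform_z \<gamma> \<tau> z))"
proof -
  have "det (cocycle \<gamma> \<tau>) powi (-14) * det (cocycle \<gamma> \<tau>) powi (-2) = det (cocycle \<gamma> \<tau>) powi (-16)"
    using det_cocycle_nz[OF assms] by (simp flip: power_int_add)
  then show ?thesis
    using acts_as_quartic_act[OF assms(1) W'_basis(1)] assms(2)
    unfolding tensor_act_coble_R[OF assms(1)]
    by (simp add: acts_as_def tensor_def slash_def coble_R_def mult_ac)
qed

text \<open>Invariance ties the value at \<open>(tau, f x)\<close> to the value at
  \<open>(g^-1 tau, x)\<close> by nonzero factors. Because the point tau moves, vanishing at
  \<open>x\<close> is assumed for all tau at once.\<close>

lemma zero_transport: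
  assumes g: "g \<in> Sp6" and inv: "tensor_act g P = P" and off: "\<And>\<tau> x. \<tau> \<notin> siegel3 \<Longrightarrow> P (\<tau>, x) = 0"
    and W: "\<And>\<tau>. (\<lambda>x. P (\<tau>, x)) \<in> spaceW'"
    and act: "\<And>q. q \<in> spaceW' \<Longrightarrow> quartic_act g q = (\<lambda>y. c * q (f y))" "c \<noteq> 0"
    and x: "\<And>\<tau>. P (\<tau>, x) = 0"
  shows "P (\<tau>, f x) = 0"
proof (cases "\<tau> \<in> siegel3")
  case True
  define \<sigma> where "\<sigma> = siegel_act (sp_inv g) \<tau>"
  have s: "\<sigma> \<in> siegel3" unfolding \<sigma>_def using siegel_act_siegel3[OF sp_inv_Sp6[OF g] True] .
  have gs: "siegel_act g \<sigma> = \<tau>"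
    unfolding \<sigma>_def using siegel_act_compose(1)[OF g sp_inv_Sp6[OF g] True]
    by (simp add: sp_inv_right[OF g] siegel_act_one)
  have "0 = tensor_act g P (\<sigma>, x)" using x inv by simp
  also have "\<dots> = det (cocycle g \<sigma>) powi (-14) * (c * P (\<tau>, f x))"
    using s act(1)[OF W] by (simp add: tensor_act_def gs)
  finally show ?thesis using act(2) det_cocycle_nz[OF g s] by (simp add: power_int_eq_0_iff)
qed (rule off)

text \<open>The vectors at which \<open>P\<close> vanishes identically in tau satisfy the closure
  conditions of \<open>W'_separation\<close>.\<close>

lemma coble_zero:
  assumes W: "\<And>\<tau>. (\<lambda>x. P (\<tau>, x)) \<in> spaceW'" and off: "\<And>\<tau> x. \<tau> \<notin> siegel3 \<Longrightarrow> P (\<tau>, x) = 0"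
    and inv: "\<And>g. g \<in> Sp6 \<Longrightarrow> tensor_act g P = P" and z: "\<And>\<tau>. P (\<tau>, ind {0}) = 0"
  shows "P = 0"
proof
  fix p :: "(complex^3^3) \<times> (complex^(bit^3))"
  obtain \<tau> x where p: "p = (\<tau>, x)" by fastforce
  have "(\<lambda>x. P (\<tau>, x)) = 0"
  proof (rule W'_separation[OF W, of "{x. \<forall>\<tau>. P (\<tau>, x) = 0}"])
    fix x assume x: "x \<in> {x. \<forall>\<tau>. P (\<tau>, x) = 0}"
    show "actH j x \<in> {x. \<forall>\<tau>. P (\<tau>, x) = 0}" for j
    proof -
      have "P (\<tau>, actH j x) = 0" for \<tau>
        by (rule zero_transport[OF jJ_Sp6 inv[OF jJ_Sp6] off W quartic_act_J]) (use x in auto)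
      then show ?thesis by simp
    qed
    show "actU (shL i j) x \<in> {x. \<forall>\<tau>. P (\<tau>, x) = 0}" if "i \<noteq> j" for i j
    proof -
      note UV = shear_inverse[OF that, of 1]
      have "quartic_act (uU (mat 1 + Em i j 1) (mat 1 - Em i j 1)) q = (\<lambda>y. 1 * q (actU (shL i j) y))" if "q \<in> spaceW'" for q
        using quartic_act_U[OF UV that] by (simp add: shL_def)
      note act = this
      have "P (\<tau>, actU (shL i j) x) = 0" for \<tau>
        by (rule zero_transport[OF uU_Sp6[OF UV] inv[OF uU_Sp6[OF UV]] off W act]) (use x in auto)
      then show ?thesis by simp
    qed
  qed (use z in auto)
  then show "P p = 0 p" by (simp add: p fun_eq_iff)
qed

text \<open>Evaluation at \<open>ind {0}\<close> commutes with translations, so an invariant tensor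
  gives a translation invariant form.\<close>

lemma coble_zero_point:
  assumes P: "P \<in> spaceWW'" and inv: "\<And>g. g \<in> Sp6 \<Longrightarrow> tensor_act g P = P"
  obtains c where "(\<lambda>\<tau>. P (\<tau>, ind {0})) = cscale c std_form"
proof (rule invariant_multiple)
  show "(\<lambda>\<tau>. P (\<tau>, ind {0})) \<in> orbit_span" by (intro spaceW_orbit_span WW'_slices P)
  show "slash (\<lambda>\<tau>. P (\<tau>, ind {0})) (tS S) = (\<lambda>\<tau>. P (\<tau>, ind {0}))" if S: "transpose S = S" for S
  proof
    fix \<tau>
    show "slash (\<lambda>\<tau>. P (\<tau>, ind {0})) (tS S) \<tau> = P (\<tau>, ind {0})"
    proof (cases "\<tau> \<in> siegel3")
      case True
      have "P (\<tau>, ind {0}) = tensor_act (tS S) P (\<tau>, ind {0})" using inv[OF tS_Sp6[OF S]] by simp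
      then show ?thesis
        using True quartic_act_tS_zero_point[OF S WW'_slices(1)[OF P]] by (simp add: tensor_act_def slash_def)
    qed (simp add: slash_def WW'_off[OF P])
  qed
qed (rule that)

section \<open>The sum over the cosets\<close>

text \<open>A sum over an infinite set would be 0 by convention. Elements congruent modulo 2 differ
  by a left factor in the principal congruence subgroup and so lie in the same coset; reduction
  modulo 2 is therefore injective on \<open>T\<close>.\<close>

lemma transversal_finite:
  assumes "right_transversal Gamma30_2 Sp6 T" shows "finite T"
proof -
  define f :: "int^(3 + 3)^(3 + 3) \<Rightarrow> bit^(3 + 3)^(3 + 3)" where "f = (\<lambda>g. \<chi> i j. if odd (g $ i $ j) then 1 else 0)"
  have T: "T \<subseteq> Sp6" "\<And>\<gamma>. \<gamma> \<in> Sp6 \<Longrightarrow> \<exists>!t. t \<in> T \<and> (\<exists>\<delta>\<in>Gamma30_2. \<gamma> = \<delta> ** t)"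
    using assms by (auto simp: right_transversal_def)
  have "inj_on f T"
  proof (rule inj_onI)
    fix s t assume st: "s \<in> T" "t \<in> T" "f s = f t"
    have sp: "s \<in> Sp6" "t \<in> Sp6" using st T(1) by auto
    have "even (s $ i $ j - t $ i $ j)" for i j
      using st(3) by (auto simp: f_def vec_eq_iff split: if_splits)
    define N where "N = (\<chi> i j. (s $ i $ j - t $ i $ j) div 2)"
    define M where "M = N ** sp_inv t"
    have "s = t + (N + N)"
      unfolding N_def using \<open>\<And>i j. even (s $ i $ j - t $ i $ j)\<close> by (simp add: vec_eq_iff)
    then have "s ** sp_inv t = (t + (N + N)) ** sp_inv t" by (rule arg_cong)
    then have "s ** sp_inv t = t ** sp_inv t + (M + M)"
      by (simp only: M_def matrix_add_rdistrib')
    then have e: "s ** sp_inv t = mat 1 + (M + M)" by (simp add: sp_inv_right sp)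
    have "even (blockC (mat 1 + (M + M)) $ i $ j)" for i j
      by (simp add: blockC_def) (simp add: mat_def)
    then have d: "s ** sp_inv t \<in> Gamma30_2"
      using Sp6_mult[OF sp(1) sp_inv_Sp6[OF sp(2)]] by (simp add: Gamma30_2_def e)
    have "s = s ** sp_inv t ** t" using sp_inv_left[OF sp(2)] by (simp flip: matrix_mul_assoc)
    moreover have "s = mat 1 ** s" by simp
    ultimately show "s = t" using T(2)[OF sp(1)] st d Gamma_one by metis
  qed
  then show ?thesis using finite_imageD[of f T] by simp
qed

text \<open>Right multiplication by \<open>g\<close> permutes the cosets, and returning to the
  chosen representatives by \<open>rep\<close> does not change the summands.\<close>

lemma coset_sum_invariant:
  assumes T: "right_transversal Gamma30_2 Sp6 T" and g: "g \<in> Sp6"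
  shows "(\<Sum>t\<in>T. tensor_act (t ** g) coble_R) = (\<Sum>t\<in>T. tensor_act t coble_R)"
proof -
  have TS: "T \<subseteq> Sp6" and ex1: "\<And>\<gamma>. \<gamma> \<in> Sp6 \<Longrightarrow> \<exists>!t. t \<in> T \<and> (\<exists>\<delta>\<in>Gamma30_2. \<gamma> = \<delta> ** t)"
    using T by (auto simp: right_transversal_def)
  define rep where "rep = (\<lambda>\<gamma>. THE t. t \<in> T \<and> (\<exists>\<delta>\<in>Gamma30_2. \<gamma> = \<delta> ** t))"
  have rep: "rep \<gamma> \<in> T \<and> (\<exists>\<delta>\<in>Gamma30_2. \<gamma> = \<delta> ** rep \<gamma>)" if "\<gamma> \<in> Sp6" for \<gamma>
    unfolding rep_def by (rule theI'[OF ex1[OF that]])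
  have rep_eq: "rep (\<delta> ** t) = t" if "\<delta> \<in> Gamma30_2" "t \<in> T" for \<delta> t
    unfolding rep_def using that TS Gamma_Sp6 Sp6_mult by (intro the1_equality[OF ex1]) auto
  have recover: "rep (rep (t ** k) ** sp_inv k) = t" if "t \<in> T" "k \<in> Sp6" for t k
  proof -
    have "t ** k \<in> Sp6" using that TS by (auto intro: Sp6_mult)
    then obtain \<delta> where d: "\<delta> \<in> Gamma30_2" "t ** k = \<delta> ** rep (t ** k)" "rep (t ** k) \<in> T" using rep by blast
    have "rep (t ** k) = sp_inv \<delta> ** (\<delta> ** rep (t ** k))"
      using sp_inv_left[OF Gamma_Sp6[OF d(1)]] by (simp add: matrix_mul_assoc)
    also have "\<dots> = sp_inv \<delta> ** (t ** k)" using d(2) by simp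
    finally have "rep (t ** k) ** sp_inv k = sp_inv \<delta> ** t ** (k ** sp_inv k)" by (simp only: matrix_mul_assoc)
    then have "rep (t ** k) ** sp_inv k = sp_inv \<delta> ** t" by (simp add: sp_inv_right[OF that(2)])
    then show ?thesis using rep_eq[OF Gamma_inv[OF d(1)] that(1)] by simp
  qed
  have gi: "sp_inv g \<in> Sp6" by (rule sp_inv_Sp6[OF g])
  have gii: "sp_inv (sp_inv g) = g"
    using sp_inv_unique[OF gi sp_inv_left[OF g]] by simp
  show ?thesis
  proof (rule sum.reindex_bij_witness[where i = "\<lambda>t. rep (t ** sp_inv g)" and j = "\<lambda>t. rep (t ** g)"])
    fix t assume t: "t \<in> T"
    have sp: "t ** g \<in> Sp6" "t ** sp_inv g \<in> Sp6" using t TS g gi by (auto intro: Sp6_mult)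
    show "rep (rep (t ** g) ** sp_inv g) = t" by (rule recover[OF t g])
    show "rep (rep (t ** sp_inv g) ** g) = t" using recover[OF t gi] by (simp add: gii)
    show "rep (t ** g) \<in> T" "rep (t ** sp_inv g) \<in> T" using rep sp by auto
    obtain \<delta> where "\<delta> \<in> Gamma30_2" "t ** g = \<delta> ** rep (t ** g)" "rep (t ** g) \<in> Sp6" using rep[OF sp(1)] TS by blast
    then show "tensor_act (rep (t ** g)) coble_R = tensor_act (t ** g) coble_R"
      using tensor_act_coble_R_Gamma by metis
  qed
qed

text \<open>The transversal is arbitrary, and the third clause shows that a summand depends only on
  its coset. As the action on quartics is specified through theta vectors, the last clause ties the
  summands to the displayed formula exactly there. Existence and uniqueness up to scalars are part
  of the conclusion.\<close>

theorem theorem14: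
  fixes T :: "(int^(3 + 3)^(3 + 3)) set"
  assumes "right_transversal Gamma30_2 Sp6 T"
  shows "is_coble_quartic (\<Sum>\<gamma>\<in>T. tensor_act \<gamma> coble_R) \<and>
    (\<forall>P. is_coble_quartic P \<longrightarrow>
       (\<exists>c. c \<noteq> 0 \<and> P = cscale c (\<Sum>\<gamma>\<in>T. tensor_act \<gamma> coble_R))) \<and>
    (\<forall>\<gamma>\<in>Sp6. \<forall>\<delta>\<in>Gamma30_2. tensor_act (\<delta> ** \<gamma>) coble_R = tensor_act \<gamma> coble_R) \<and>
    (\<forall>\<gamma>\<in>Sp6. \<forall>\<tau>\<in>siegel3. \<forall>z.
       tensor_act \<gamma> coble_R (\<tau>, Theta2 \<tau> z) =
       det (cocycle \<gamma> \<tau>) powi (-16) * theta_exp_factor \<gamma> \<tau> z *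
       coble_R (siegel_act \<gamma> \<tau>, Theta2 (siegel_act \<gamma> \<tau>) (transform_z \<gamma> \<tau> z)))"
proof -
  have TS: "T \<subseteq> Sp6" and ex1: "\<And>\<gamma>. \<gamma> \<in> Sp6 \<Longrightarrow> \<exists>!t. t \<in> T \<and> (\<exists>\<delta>\<in>Gamma30_2. \<gamma> = \<delta> ** t)"
    using assms by (auto simp: right_transversal_def)
  have fin: "finite T" using assms by (rule transversal_finite)
  define P0 where "P0 = (\<Sum>\<gamma>\<in>T. tensor_act \<gamma> coble_R)"
  have RW: "tensor_act t coble_R \<in> spaceWW'" if "t \<in> T" for t
  proof -
    have t: "t \<in> Sp6" using that TS by auto
    have "slash std_form t \<in> spaceW" "quartic_act t Q_one \<in> spaceW'"
      using std_form_orbit[OF t] quartic_act_W'[OF t W'_basis(1)] by blast+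
    then show ?thesis unfolding tensor_act_coble_R[OF t] spaceWW'_def by (intro cfun.span_base) blast
  qed
  then have P0W: "P0 \<in> spaceWW'" unfolding P0_def spaceWW'_def by (intro cfun.span_sum)
  have P0inv: "tensor_act g P0 = P0" if g: "g \<in> Sp6" for g
  proof -
    have "tensor_act g P0 = (\<Sum>t\<in>T. tensor_act g (tensor_act t coble_R))"
      unfolding P0_def using WW'_slices(1)[OF RW] by (intro tensor_act_sum g fin) auto
    also have "\<dots> = (\<Sum>t\<in>T. tensor_act (t ** g) coble_R)"
      using tensor_act_coble_R_mult[OF _ g] TS by (intro sum.cong) auto
    finally show ?thesis unfolding P0_def coset_sum_invariant[OF assms g] .
  qed
  obtain c0 where c0: "(\<lambda>\<tau>. P0 (\<tau>, ind {0})) = cscale c0 std_form" using coble_zero_point[OF P0W P0inv] by blast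
  \<comment> \<open>Otherwise averaging the value at \<open>ind {0}\<close> would make the sum of
    the squares of the real numbers \<open>r t\<close> vanish, although the trivial coset has
    \<open>r t = 1\<close>.\<close>
  have "c0 \<noteq> 0"
  proof
    assume "c0 = 0"
    have "\<forall>t\<in>T. \<exists>r::real. slash std_form t - cscale (of_real r) std_form \<in> translation_span \<and> quartic_act t Q_one (ind {0}) = of_real r"
    proof
      fix t assume "t \<in> T"
      then have t: "t \<in> Sp6" using TS by auto
      obtain \<rho> where "\<rho> \<in> \<real>" "slash std_form t - cscale \<rho> std_form \<in> translation_span" "quartic_act t Q_one (ind {0}) = \<rho>"
        using std_form_orbit[OF t] by blast
      then show "\<exists>r::real. slash std_form t - cscale (of_real r) std_form \<in> translation_span \<and> quartic_act t Q_one (ind {0}) = of_real r"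
        by (auto elim!: Reals_cases)
    qed
    then obtain r where r: "\<And>t. t \<in> T \<Longrightarrow> slash std_form t - cscale (of_real (r t)) std_form \<in> translation_span"
      "\<And>t. t \<in> T \<Longrightarrow> quartic_act t Q_one (ind {0}) = of_real (r t)" by metis
    have P0e: "(\<lambda>\<tau>. P0 (\<tau>, ind {0})) = (\<Sum>t\<in>T. cscale (of_real (r t)) (slash std_form t))"
    proof
      fix \<tau>
      have "tensor_act t coble_R (\<tau>, ind {0}) = cscale (of_real (r t)) (slash std_form t) \<tau>" if "t \<in> T" for t
        using that TS r(2)[OF that] by (subst tensor_act_coble_R) (auto simp: tensor_def cscale_def)
      then show "P0 (\<tau>, ind {0}) = (\<Sum>t\<in>T. cscale (of_real (r t)) (slash std_form t)) \<tau>"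
        by (simp add: P0_def sum_fun_apply)
    qed
    \<comment> \<open>Averaging removes the translation differences, so \<open>r t\<close> appears
      once from the form and once from the quartic.\<close>
    have Avt: "translation_sum (slash std_form t) = cscale (of_real (r t)) (translation_sum std_form)" if "t \<in> T" for t
      using translation_sum_translation_span[OF r(1)[OF that]] by (simp add: translation_sum_diff translation_sum_scale)
    have "translation_sum (\<Sum>t\<in>A. cscale (of_real (r t)) (slash std_form t)) = cscale (of_real (\<Sum>t\<in>A. (r t)\<^sup>2)) (translation_sum std_form)"
      if "A \<subseteq> T" for A
      using finite_subset[OF that fin] that
    proof (induction A rule: finite_induct)
      case empty show ?case by (simp only: sum.empty translation_sum_zero of_real_0 cfun.scale_zero_left)
    next
      case (insert t A)
      then have t: "t \<in> T" and A: "A \<subseteq> T" by auto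
      have "translation_sum (\<Sum>t\<in>insert t A. cscale (of_real (r t)) (slash std_form t)) =
          cscale (of_real (r t)) (cscale (of_real (r t)) (translation_sum std_form)) + cscale (of_real (\<Sum>t\<in>A. (r t)\<^sup>2)) (translation_sum std_form)"
        unfolding sum.insert[OF insert.hyps] translation_sum_add translation_sum_scale Avt[OF t] insert.IH[OF A] ..
      also have "\<dots> = cscale (of_real (\<Sum>t\<in>insert t A. (r t)\<^sup>2)) (translation_sum std_form)"
        unfolding sum.insert[OF insert.hyps] by (simp add: cscale_def fun_eq_iff power2_eq_square algebra_simps)
      finally show ?case .
    qed
    from this[of T] have "cscale (of_real (\<Sum>t\<in>T. (r t)\<^sup>2)) (translation_sum std_form) = translation_sum (cscale c0 std_form)"
      using P0e c0 by simp
    then have "cscale (of_real (\<Sum>t\<in>T. (r t)\<^sup>2)) (cscale (of_nat (card sym_bits)) std_form) = 0"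
      by (simp only: \<open>c0 = 0\<close> translation_sum_scale translation_sum_std_form cfun.scale_zero_left translation_sum_zero)
    then have "of_real (\<Sum>t\<in>T. (r t)\<^sup>2) * (of_nat (card sym_bits) * std_form \<tau>) = 0" for \<tau>
      by (simp only: cscale_def fun_eq_iff zero_fun_apply)
    then have sq: "(\<Sum>t\<in>T. (r t)\<^sup>2) = 0"
      using std_form_nonzero sym_bits_nonempty by (metis mult_eq_0_iff of_nat_eq_0_iff of_real_eq_0_iff)
    \<comment> \<open>The representative of the trivial coset need not be the identity, but it acts
      on \<open>Q_one\<close> as the identity does.\<close>
    obtain t \<delta> where t: "t \<in> T" "\<delta> \<in> Gamma30_2" "mat 1 = \<delta> ** t" using ex1[OF Sp6_one] by blast
    have "quartic_act (mat 1) Q_one = quartic_act t Q_one"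
      unfolding t(3) using t TS by (subst quartic_act_mult) (auto simp: Gamma_Sp6 W'_basis Q_one_Gamma)
    then have "quartic_act t Q_one = Q_one" by (simp add: quartic_act_one W'_basis)
    moreover have "Q_one (ind {0}) = 1" by (simp add: Q_one_explicit ind_def bv_zero)
    ultimately have "r t = 1" using r(2)[OF t(1)] by simp
    moreover have "(r t)\<^sup>2 = 0" using sq t(1) fin by (simp add: sum_nonneg_eq_0_iff)
    ultimately show False by simp
  qed
  obtain \<tau>0 where \<tau>0: "std_form \<tau>0 \<noteq> 0" using std_form_nonzero by blast
  have P0: "is_coble_quartic P0"
  proof -
    have "P0 (\<tau>0, ind {0}) \<noteq> 0" using fun_cong[OF c0, of \<tau>0] \<tau>0 \<open>c0 \<noteq> 0\<close> by (simp add: cscale_def)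
    then have "P0 \<noteq> 0" by auto
    then show ?thesis using P0W P0inv by (simp add: is_coble_quartic_def)
  qed
  have unique: "\<exists>c. c \<noteq> 0 \<and> P = cscale c P0" if P: "is_coble_quartic P" for P
  proof -
    have PW: "P \<in> spaceWW'" and Pinv: "\<And>g. g \<in> Sp6 \<Longrightarrow> tensor_act g P = P" and Pnz: "P \<noteq> 0"
      using P by (auto simp: is_coble_quartic_def)
    obtain c where c: "(\<lambda>\<tau>. P (\<tau>, ind {0})) = cscale c std_form" using coble_zero_point[OF PW Pinv] by blast
    \<comment> \<open>The combination whose value at \<open>ind {0}\<close> is zero for every tau;
      \<open>coble_zero\<close> then makes it vanish altogether.\<close>
    define D where "D = P - cscale (c / c0) P0"
    have DW: "D \<in> spaceWW'"
      using PW P0W unfolding D_def spaceWW'_def by (intro cfun.span_diff cfun.span_scale)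
    have "tensor_act g D = D" if g: "g \<in> Sp6" for g
    proof -
      have sl: "(\<lambda>y. D (\<sigma>, y)) = (\<lambda>y. P (\<sigma>, y)) + cscale (- (c / c0)) (\<lambda>y. P0 (\<sigma>, y))" for \<sigma>
        by (simp add: D_def cscale_def fun_eq_iff)
      have "quartic_act g (\<lambda>y. D (\<sigma>, y)) = quartic_act g (\<lambda>y. P (\<sigma>, y)) + cscale (- (c / c0)) (quartic_act g (\<lambda>y. P0 (\<sigma>, y)))" for \<sigma>
        unfolding sl using WW'_slices(1)[OF PW] WW'_slices(1)[OF P0W]
        by (simp only: quartic_act_add[OF g] quartic_act_scale[OF g] W'_scale)
      then have e: "quartic_act g (\<lambda>y. D (\<sigma>, y)) x = quartic_act g (\<lambda>y. P (\<sigma>, y)) x - c / c0 * quartic_act g (\<lambda>y. P0 (\<sigma>, y)) x" for \<sigma> x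
        by (simp add: cscale_def)
      have "tensor_act g D = tensor_act g P - cscale (c / c0) (tensor_act g P0)"
        by (simp add: tensor_act_def fun_eq_iff e right_diff_distrib) (simp add: cscale_def)
      then show ?thesis using Pinv[OF g] P0inv[OF g] by (simp add: D_def)
    qed
    moreover have "D (\<tau>, ind {0}) = 0" for \<tau>
      using fun_cong[OF c, of \<tau>] fun_cong[OF c0, of \<tau>] \<open>c0 \<noteq> 0\<close> by (simp add: D_def cscale_def)
    ultimately have "D = 0" using WW'_slices(1)[OF DW] WW'_off[OF DW] by (intro coble_zero) auto
    then have "P = cscale (c / c0) P0" by (simp add: D_def)
    moreover have "c / c0 \<noteq> 0"
    proof
      assume "c / c0 = 0"
      with \<open>P = cscale (c / c0) P0\<close> have "P = 0" by (simp only: cfun.scale_zero_left)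
      then show False using Pnz by simp
    qed
    ultimately show ?thesis by blast
  qed
  show ?thesis
    using P0 unique tensor_act_coble_R_Gamma tensor_act_coble_R_theta unfolding P0_def by blast
qed

end
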